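(* Let $d\in\mathbb{N}$, $\Omega=(0,+\infty)\times\mathbb{R}^{d-1}$, $\bullet\in\{D,N\}$, let $S\subset\mathbb{R}^d$ be $(\gamma,a)$-thick with $\gamma\in(0,1]$ and $a=(a_1,\dots,a_d)\in(0,+\infty)^d$, and let $\omega=\Omega\cap S$. Then the system $$\partial_tu(t)-\Delta^\bullet_\Omega u(t)=\chi_\omega v(t)\quad(0<t<T),\qquad u(0)=u_0\in L^2(\Omega),$$ is null-controllable in any time $T>0$ with control cost $$C_T\le\frac{1}{\sqrt T}\left(\frac{2K^d}{\gamma}\right)^{Kd/2}\exp\left(\frac{K(2a_1+a_2+\dots+a_d)^2\ln^2(2K^d/\gamma)}{2T}\right),$$ where $K>0$ is the universal constant described in the context.
   Context: Thick sets: a measurable set $S\subset\mathbb{R}^d$ is $(\gamma,a)$-thick, with $\gamma\in(0,1]$ and $a\in(0,+\infty)^d$, if $|S\cap(x+[0,a_1]\times\dots\times[0,a_d])|\ge\gamma\prod_{j=1}^da_j$ for all $x\in\mathbb{R}^d$, where $|\cdot|$ is Lebesgue measure. $\Delta_\Omega^D$ and $\Delta_\Omega^N$ are the Dirichlet and Neumann Laplacians on $L^2(\Omega)$: $-\Delta_\Omega^\bullet$ is the self-adjoint operator associated with the form $\int_\Omega\langle\nabla f,\nabla g\rangle_{\mathbb{C}^d}\,dx$ with form domain $H_0^1(\Omega)$ (for $D$) or $H^1(\Omega)$ (for $N$). The system $\partial_tu-\Delta_\Omega^\bullet u=\chi_\omega v$, $u(0)=u_0$, is null-controllable in time $T>0$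 if for every $u_0\in L^2(\Omega)$ there is $v\in L^2((0,T),L^2(\Omega))$ with $(\ast)$ $e^{T\Delta_\Omega^\bullet}u_0+\int_0^Te^{(T-s)\Delta_\Omega^\bullet}\chi_\omega v(s)\,ds=0$. Its control cost is $C_T=\sup_{\|u_0\|_{L^2(\Omega)}=1}\inf\{\|v\|_{L^2((0,T),L^2(\omega))}\colon v\text{ satisfies }(\ast)\}$. The constant $K$: $K>0$ is a universal constant with the following property (such a constant is known to exist from earlier work). For every $d\in\mathbb{N}$, every $L>0$, every $\tilde\Omega\in\{\mathbb{R}^d,(0,L)^d\}$, every $\bullet\in\{D,N\}$, every $(\gamma,a)$-thick set $S\subset\mathbb{R}^d$ (with $a_j\le L$ for all $j$ if $\tilde\Omega=(0,L)^d$), the system $\partial_tu-\Delta_{\tilde\Omega}^\bullet u=\chi_{\tilde\Omega\cap S}v$ is null-controllable in any time $T>0$ with control cost $$C_T\le\frac1{\sqrt T}\left(\frac{K^d}{\gamma}\right)^{Kd/2}\exp\left(\frac{K\|a\|_1^2\ln^2(K^d/\gamma)}{2T}\right),\qquad\|a\|_1=a_1+\dots+a_d.$$ *)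

theory Defs
  imports "HOL-Analysis.Analysis"
begin

text \<open>
  The property that determines the constant \<open>K\<close> ranges over all dimensions, so the dimension has to be
  a number rather than a type. Points of d-dimensional space are the extensional functions on
  \<open>{..<d}\<close>, with coordinates \<open>0, \<dots>, d - 1\<close>; the topology is that of pointwise convergence
  and Lebesgue measure is the completed product measure.
\<close>

type_synonym point = "nat \<Rightarrow> real"

definition Rd :: "nat \<Rightarrow> point set" where
  "Rd d = {..<d} \<rightarrow>\<^sub>E UNIV"

definition lebesgue_Rd :: "nat \<Rightarrow> point measure" where
  "lebesgue_Rd d = completion (Pi\<^sub>M {..<d} (\<lambda>_. lborel))"

definition leb :: "nat \<Rightarrow> point set \<Rightarrow> point measure" where
  "leb d \<Omega> = restrict_space (lebesgue_Rd d) \<Omega>"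

definition half_space :: "nat \<Rightarrow> point set" where
  "half_space d = {x \<in> Rd d. x 0 > 0}"

definition open_cube :: "nat \<Rightarrow> real \<Rightarrow> point set" where
  "open_cube d L = {..<d} \<rightarrow>\<^sub>E {0<..<L}"

definition thick :: "nat \<Rightarrow> real \<Rightarrow> (nat \<Rightarrow> real) \<Rightarrow> point set \<Rightarrow> bool" where
  "thick d \<gamma> a S \<longleftrightarrow>
     0 < \<gamma> \<and> \<gamma> \<le> 1 \<and> (\<forall>j<d. 0 < a j) \<and> S \<in> sets (lebesgue_Rd d) \<and>
     (\<forall>x\<in>Rd d. measure (lebesgue_Rd d) (S \<inter> (\<Pi>\<^sub>E j\<in>{..<d}. {x j .. x j + a j})) \<ge> \<gamma> * (\<Prod>j<d. a j))"


section \<open>Square-integrable functions\<close>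

text \<open>
  Elements of \<open>L\<^sup>2(M)\<close> are represented by functions. All notions below are invariant under
  changing the representatives on null sets.
\<close>

definition L2 :: "'a measure \<Rightarrow> ('a \<Rightarrow> complex) set" where
  "L2 M = {f \<in> borel_measurable M. integrable M (\<lambda>x. (cmod (f x))\<^sup>2)}"

definition L2_norm :: "'a measure \<Rightarrow> ('a \<Rightarrow> complex) \<Rightarrow> real" where
  "L2_norm M f = sqrt (LINT x|M. (cmod (f x))\<^sup>2)"

definition L2_inner :: "'a measure \<Rightarrow> ('a \<Rightarrow> complex) \<Rightarrow> ('a \<Rightarrow> complex) \<Rightarrow> complex" where
  "L2_inner M f g = (LINT x|M. f x * cnj (g x))"


section \<open>Bochner integration of functions with values in \<open>L\<^sup>2(M)\<close>\<close>

text \<open>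
  The Bochner integral of the library needs a Banach space type as range. The notions below repeat
  its definition (approximation by simple functions) for the seminormed spaces \<open>L\<^sup>2(M)\<close>.
\<close>

definition L2_simple :: "'t measure \<Rightarrow> 'a measure \<Rightarrow> ('t \<Rightarrow> 'a \<Rightarrow> complex) \<Rightarrow> bool" where
  "L2_simple N M s \<longleftrightarrow> simple_function N s \<and> s \<in> space N \<rightarrow> L2 M"

definition L2_strongly_measurable :: "'t measure \<Rightarrow> 'a measure \<Rightarrow> ('t \<Rightarrow> 'a \<Rightarrow> complex) \<Rightarrow> bool" where
  "L2_strongly_measurable N M v \<longleftrightarrow>
     v \<in> space N \<rightarrow> L2 M \<and>
     (\<exists>s. (\<forall>n. L2_simple N M (s n)) \<and>
          (AE t in N. (\<lambda>n. L2_norm M (\<lambda>x. v t x - s n t x)) \<longlonglongrightarrow> 0))"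

text \<open>Only used for finite measures \<open>N\<close>, so all simple functions are integrable.\<close>

definition L2_simple_integral :: "'t measure \<Rightarrow> ('t \<Rightarrow> 'a \<Rightarrow> complex) \<Rightarrow> 'a \<Rightarrow> complex" where
  "L2_simple_integral N s x =
     (\<Sum>y\<in>s ` space N. of_real (measure N (s -` {y} \<inter> space N)) * y x)"

definition has_L2_integral ::
    "'t measure \<Rightarrow> 'a measure \<Rightarrow> ('t \<Rightarrow> 'a \<Rightarrow> complex) \<Rightarrow> ('a \<Rightarrow> complex) \<Rightarrow> bool" where
  "has_L2_integral N M w I \<longleftrightarrow>
     L2_strongly_measurable N M w \<and> I \<in> L2 M \<and>
     (\<exists>s. (\<forall>n. L2_simple N M (s n)) \<and>
          (\<lambda>n. \<integral>\<^sup>+ t. ennreal (L2_norm M (\<lambda>x. w t x - s n t x)) \<partial>N) \<longlonglongrightarrow> 0 \<and>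
          (\<lambda>n. L2_norm M (\<lambda>x. L2_simple_integral N (s n) x - I x)) \<longlonglongrightarrow> 0)"

definition L2_L2 :: "'t measure \<Rightarrow> 'a measure \<Rightarrow> ('t \<Rightarrow> 'a \<Rightarrow> complex) set" where
  "L2_L2 N M = {v. L2_strongly_measurable N M v \<and> integrable N (\<lambda>t. (L2_norm M (v t))\<^sup>2)}"

definition L2_L2_norm :: "'t measure \<Rightarrow> 'a measure \<Rightarrow> ('t \<Rightarrow> 'a \<Rightarrow> complex) \<Rightarrow> real" where
  "L2_L2_norm N M v = sqrt (LINT t|N. (L2_norm M (v t))\<^sup>2)"


section \<open>Sobolev spaces\<close>

definition partial :: "nat \<Rightarrow> (point \<Rightarrow> complex) \<Rightarrow> point \<Rightarrow> complex" where
  "partial i \<phi> x = vector_derivative (\<lambda>t. \<phi> (x(i := t))) (at (x i))"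

definition smooth :: "nat \<Rightarrow> (point \<Rightarrow> complex) \<Rightarrow> bool" where
  "smooth d \<phi> \<longleftrightarrow>
     (\<forall>ks. set ks \<subseteq> {..<d} \<longrightarrow>
        continuous_on (Rd d) (foldr partial ks \<phi>) \<and>
        (\<forall>i<d. \<forall>x\<in>Rd d. (\<lambda>t. foldr partial ks \<phi> (x(i := t))) differentiable (at (x i))))"

definition test_functions :: "nat \<Rightarrow> point set \<Rightarrow> (point \<Rightarrow> complex) set" where
  "test_functions d \<Omega> =
     {\<phi>. smooth d \<phi> \<and> (\<exists>C. compact C \<and> C \<subseteq> \<Omega> \<and> (\<forall>x\<in>Rd d - C. \<phi> x = 0))}"

definition has_weak_partial ::
    "nat \<Rightarrow> point set \<Rightarrow> nat \<Rightarrow> (point \<Rightarrow> complex) \<Rightarrow> (point \<Rightarrow> complex) \<Rightarrow> bool" where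
  "has_weak_partial d \<Omega> i f g \<longleftrightarrow>
     g \<in> L2 (leb d \<Omega>) \<and>
     (\<forall>\<phi>\<in>test_functions d \<Omega>.
        (LINT x|leb d \<Omega>. f x * partial i \<phi> x) = - (LINT x|leb d \<Omega>. g x * \<phi> x))"

text \<open>Unique up to null sets whenever it exists.\<close>

definition weak_partial :: "nat \<Rightarrow> point set \<Rightarrow> nat \<Rightarrow> (point \<Rightarrow> complex) \<Rightarrow> point \<Rightarrow> complex" where
  "weak_partial d \<Omega> i f = (SOME g. has_weak_partial d \<Omega> i f g)"

definition H1 :: "nat \<Rightarrow> point set \<Rightarrow> (point \<Rightarrow> complex) set" where
  "H1 d \<Omega> = {f \<in> L2 (leb d \<Omega>). \<forall>i<d. \<exists>g. has_weak_partial d \<Omega> i f g}"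

definition H1_0 :: "nat \<Rightarrow> point set \<Rightarrow> (point \<Rightarrow> complex) set" where
  "H1_0 d \<Omega> =
     {f \<in> H1 d \<Omega>. \<exists>\<phi>. (\<forall>n. \<phi> n \<in> test_functions d \<Omega>) \<and>
        (\<lambda>n. L2_norm (leb d \<Omega>) (\<lambda>x. \<phi> n x - f x)) \<longlonglongrightarrow> 0 \<and>
        (\<forall>i<d. (\<lambda>n. L2_norm (leb d \<Omega>) (\<lambda>x. partial i (\<phi> n) x - weak_partial d \<Omega> i f x)) \<longlonglongrightarrow> 0)}"


section \<open>Laplacians and their semigroups\<close>

text \<open>Operators on \<open>L\<^sup>2(M)\<close> are given by their graphs.\<close>

definition form_operator ::
    "'a measure \<Rightarrow> ('a \<Rightarrow> complex) set \<Rightarrow> (('a \<Rightarrow> complex) \<Rightarrow> ('a \<Rightarrow> complex) \<Rightarrow> complex) \<Rightarrow>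
     (('a \<Rightarrow> complex) \<times> ('a \<Rightarrow> complex)) set" where
  "form_operator M V q = {(f, g). f \<in> V \<and> g \<in> L2 M \<and> (\<forall>h\<in>V. q f h = L2_inner M g h)}"

definition gradient_form ::
    "nat \<Rightarrow> point set \<Rightarrow> (point \<Rightarrow> complex) \<Rightarrow> (point \<Rightarrow> complex) \<Rightarrow> complex" where
  "gradient_form d \<Omega> f g =
     (LINT x|leb d \<Omega>. (\<Sum>i<d. weak_partial d \<Omega> i f x * cnj (weak_partial d \<Omega> i g x)))"

datatype boundary_condition = Dirichlet | Neumann

definition form_domain :: "boundary_condition \<Rightarrow> nat \<Rightarrow> point set \<Rightarrow> (point \<Rightarrow> complex) set" where
  "form_domain b d \<Omega> = (case b of Dirichlet \<Rightarrow> H1_0 d \<Omega> | Neumann \<Rightarrow> H1 d \<Omega>)"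

definition laplacian ::
    "boundary_condition \<Rightarrow> nat \<Rightarrow> point set \<Rightarrow> ((point \<Rightarrow> complex) \<times> (point \<Rightarrow> complex)) set" where
  "laplacian b d \<Omega> =
     {(f, g). (f, \<lambda>x. - g x) \<in> form_operator (leb d \<Omega>) (form_domain b d \<Omega>) (gradient_form d \<Omega>)}"

definition C0_semigroup :: "'a measure \<Rightarrow> (real \<Rightarrow> ('a \<Rightarrow> complex) \<Rightarrow> 'a \<Rightarrow> complex) \<Rightarrow> bool" where
  "C0_semigroup M P \<longleftrightarrow>
     (\<forall>t\<ge>0. \<forall>f\<in>L2 M. P t f \<in> L2 M) \<and>
     (\<forall>t\<ge>0. \<forall>f\<in>L2 M. \<forall>g\<in>L2 M. \<forall>c. AE x in M. P t (\<lambda>x. c * f x + g x) x = c * P t f x + P t g x) \<and>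
     (\<forall>t\<ge>0. \<exists>B. \<forall>f\<in>L2 M. L2_norm M (P t f) \<le> B * L2_norm M f) \<and>
     (\<forall>f\<in>L2 M. AE x in M. P 0 f x = f x) \<and>
     (\<forall>s\<ge>0. \<forall>t\<ge>0. \<forall>f\<in>L2 M. AE x in M. P (s + t) f x = P s (P t f) x) \<and>
     (\<forall>f\<in>L2 M. ((\<lambda>t. L2_norm M (\<lambda>x. P t f x - f x)) \<longlongrightarrow> 0) (at_right 0))"

definition generator ::
    "'a measure \<Rightarrow> (real \<Rightarrow> ('a \<Rightarrow> complex) \<Rightarrow> 'a \<Rightarrow> complex) \<Rightarrow> (('a \<Rightarrow> complex) \<times> ('a \<Rightarrow> complex)) set" where
  "generator M P =
     {(f, g). f \<in> L2 M \<and> g \<in> L2 M \<and>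
        ((\<lambda>h. L2_norm M (\<lambda>x. (P h f x - f x) / of_real h - g x)) \<longlongrightarrow> 0) (at_right 0)}"

text \<open>
  A strongly continuous semigroup is determined by its generator, so the choice only concerns
  representatives of the elements of \<open>L\<^sup>2(\<Omega>)\<close>.
\<close>

definition heat_semigroup ::
    "boundary_condition \<Rightarrow> nat \<Rightarrow> point set \<Rightarrow> real \<Rightarrow> (point \<Rightarrow> complex) \<Rightarrow> point \<Rightarrow> complex" where
  "heat_semigroup b d \<Omega> =
     (SOME P. C0_semigroup (leb d \<Omega>) P \<and> generator (leb d \<Omega>) P = laplacian b d \<Omega>)"


section \<open>Null-controllability\<close>

definition null_controls ::
    "boundary_condition \<Rightarrow> nat \<Rightarrow> point set \<Rightarrow> point set \<Rightarrow> real \<Rightarrow> (point \<Rightarrow> complex) \<Rightarrow>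
     (real \<Rightarrow> point \<Rightarrow> complex) set" where
  "null_controls b d \<Omega> \<omega> T u0 =
     {v \<in> L2_L2 (lebesgue_on {0<..<T}) (leb d \<Omega>).
        \<exists>I. has_L2_integral (lebesgue_on {0<..<T}) (leb d \<Omega>)
              (\<lambda>s. heat_semigroup b d \<Omega> (T - s) (\<lambda>x. indicator \<omega> x * v s x)) I \<and>
            (AE x in leb d \<Omega>. heat_semigroup b d \<Omega> T u0 x + I x = 0)}"

definition null_controllable ::
    "boundary_condition \<Rightarrow> nat \<Rightarrow> point set \<Rightarrow> point set \<Rightarrow> real \<Rightarrow> bool" where
  "null_controllable b d \<Omega> \<omega> T \<longleftrightarrow> (\<forall>u0\<in>L2 (leb d \<Omega>). null_controls b d \<Omega> \<omega> T u0 \<noteq> {})"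

definition control_cost ::
    "boundary_condition \<Rightarrow> nat \<Rightarrow> point set \<Rightarrow> point set \<Rightarrow> real \<Rightarrow> ennreal" where
  "control_cost b d \<Omega> \<omega> T =
     (SUP u0\<in>{u0 \<in> L2 (leb d \<Omega>). L2_norm (leb d \<Omega>) u0 = 1}.
        INF v\<in>null_controls b d \<Omega> \<omega> T u0.
          ennreal (L2_L2_norm (lebesgue_on {0<..<T}) (leb d \<omega>) v))"

definition universal_cost_constant :: "real \<Rightarrow> bool" where
  "universal_cost_constant K \<longleftrightarrow> K > 0 \<and>
     (\<forall>d\<ge>1. \<forall>L>0. \<forall>\<Omega>\<in>{Rd d, open_cube d L}. \<forall>b \<gamma> a S.
        thick d \<gamma> a S \<longrightarrow> (\<Omega> = open_cube d L \<longrightarrow> (\<forall>j<d. a j \<le> L)) \<longrightarrow>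
        (\<forall>T>0. null_controllable b d \<Omega> (\<Omega> \<inter> S) T \<and>
           control_cost b d \<Omega> (\<Omega> \<inter> S) T \<le>
             ennreal (1 / sqrt T * (K ^ d / \<gamma>) powr (K * real d / 2) *
               exp (K * (\<Sum>j<d. a j)\<^sup>2 * (ln (K ^ d / \<gamma>))\<^sup>2 / (2 * T)))))"

end

theory Submission
  imports Defs "HOL-Library.Function_Algebras"
begin

text \<open>
  Reflection at the hyperplane \<open>x\<^sub>0 = 0\<close>: the odd (Dirichlet) or even (Neumann) extension of \<open>u\<^sub>0\<close> to
  the whole space is steered to \<open>0\<close> by a control \<open>v\<close> supported in the symmetrisation of \<open>\<omega>\<close>, which is
  thick with \<open>\<gamma> / 2\<close> in place of \<open>\<gamma>\<close> and \<open>2 a\<^sub>0\<close> in place of \<open>a\<^sub>0\<close>. Taking the odd (even) part and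
  restricting to the half-space maps the Laplacian of the whole space into the one of the half-space, hence
  intertwines the heat semigroups and turns \<open>v\<close> into a control for \<open>u\<^sub>0\<close>. With the normalisation
  \<open>1 / sqrt 2\<close> the extension is isometric and the restriction is a contraction, so the cost does not grow.

  As \<open>heat_semigroup\<close> is a choice among the semigroups generated by the Laplacian, existence and uniqueness of
  the semigroup generated by the operator of a closed form are needed. They follow from the convergence of the
  Euler approximations \<open>(1 - (t / 2\<^sup>k) A)\<close> to the power \<open>- 2\<^sup>k\<close>.
\<close>

subsection \<open>Semi-inner product spaces\<close>

text \<open>The chosen \<open>heat_semigroup\<close> occurs both in the hypothesis on the whole
  space and in the conclusion, and \<open>C0_semigroup\<close> bounds it only at each time
  separately. So the Euler formula is proved for an arbitrary semigroup with the given generator,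
  which requires a bound uniform for small times.

  The analytic obstacle is the boundary: \<open>sym\<close> has to map the form domain of the whole
  space into that of the half-space, and its adjoint \<open>ext\<close> has to map back. An odd test
  function vanishes on the hyperplane, but not near it, and an even one need not vanish there at
  all. Multiplying by a cutoff repairs this, but its normal derivative grows like \<open>k\<close>,
  which only a function vanishing on the hyperplane absorbs. In the Neumann case the normal
  derivative exchanges even and odd, so that exactly there the function to be cut off is odd.

  The factor 2: a box of doubled length in direction 0 contains a box of the original size that
  lies, possibly after reflection, in the closed half-space. A share \<open>\<gamma>\<close> of the
  small box is a share \<open>\<gamma> / 2\<close> of the large one.

  The abstract theory uses real scalars; complex linearity returns as commutation with
  multiplication by \<open>\<i>\<close>.\<close>

text \<open>Elements of \<open>L\<^sup>2\<close> are represented by functions, so the inner product is only positive semidefinite and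
  equality of elements reads \<open>nrm (x - y) = 0\<close>.\<close>

locale semi_inner =
  fixes X :: "'v::real_vector set" and ip :: "'v \<Rightarrow> 'v \<Rightarrow> real"
  assumes subspace_X: "subspace X"
    and ip_sym: "x \<in> X \<Longrightarrow> y \<in> X \<Longrightarrow> ip x y = ip y x"
    and ip_add_left: "x \<in> X \<Longrightarrow> y \<in> X \<Longrightarrow> z \<in> X \<Longrightarrow> ip (x + y) z = ip x z + ip y z"
    and ip_scale_left: "x \<in> X \<Longrightarrow> y \<in> X \<Longrightarrow> ip (c *\<^sub>R x) y = c * ip x y"
    and ip_nonneg: "x \<in> X \<Longrightarrow> 0 \<le> ip x x"
begin

definition nrm :: "'v \<Rightarrow> real" where
  "nrm x = sqrt (ip x x)"

lemma X_closed [simp]: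
  "0 \<in> X" "x \<in> X \<Longrightarrow> y \<in> X \<Longrightarrow> x + y \<in> X" "x \<in> X \<Longrightarrow> y \<in> X \<Longrightarrow> x - y \<in> X"
  "x \<in> X \<Longrightarrow> c *\<^sub>R x \<in> X" "x \<in> X \<Longrightarrow> - x \<in> X"
  using subspace_X
  by (auto simp: subspace_0 subspace_add subspace_diff subspace_scale subspace_neg)

lemma ip_add_right: "x \<in> X \<Longrightarrow> y \<in> X \<Longrightarrow> z \<in> X \<Longrightarrow> ip x (y + z) = ip x y + ip x z"
  by (metis ip_add_left ip_sym X_closed(2))

lemma ip_scale_right: "x \<in> X \<Longrightarrow> y \<in> X \<Longrightarrow> ip x (c *\<^sub>R y) = c * ip x y"
  by (metis ip_scale_left ip_sym X_closed(4))

lemma ip_minus_left: "x \<in> X \<Longrightarrow> y \<in> X \<Longrightarrow> ip (- x) y = - ip x y"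
  using ip_scale_left[of x y "-1"] by simp

lemma ip_minus_right: "x \<in> X \<Longrightarrow> y \<in> X \<Longrightarrow> ip x (- y) = - ip x y"
  using ip_scale_right[of x y "-1"] by simp

lemma ip_diff_left: "x \<in> X \<Longrightarrow> y \<in> X \<Longrightarrow> z \<in> X \<Longrightarrow> ip (x - y) z = ip x z - ip y z"
  using ip_add_left[of x "- y" z] by (simp add: ip_minus_left)

lemma ip_diff_right: "x \<in> X \<Longrightarrow> y \<in> X \<Longrightarrow> z \<in> X \<Longrightarrow> ip x (y - z) = ip x y - ip x z"
  using ip_add_right[of x y "- z"] by (simp add: ip_minus_right)

lemmas ip_linear = ip_add_left ip_add_right ip_scale_left ip_scale_right
  ip_minus_left ip_minus_right ip_diff_left ip_diff_right

lemma nrm_nonneg [simp]: "x \<in> X \<Longrightarrow> 0 \<le> nrm x"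
  by (simp add: nrm_def ip_nonneg)

lemma nrm_sq: "x \<in> X \<Longrightarrow> (nrm x)\<^sup>2 = ip x x"
  by (simp add: nrm_def ip_nonneg)

lemma nrm_scale: "x \<in> X \<Longrightarrow> nrm (c *\<^sub>R x) = \<bar>c\<bar> * nrm x"
  by (simp add: nrm_def ip_linear real_sqrt_mult flip: mult.assoc)

lemma nrm_0 [simp]: "nrm 0 = 0"
  using nrm_scale[of 0 0] by simp

lemma nrm_minus [simp]: "x \<in> X \<Longrightarrow> nrm (- x) = nrm x"
  using nrm_scale[of x "-1"] by simp

lemma nrm_commute: "x \<in> X \<Longrightarrow> y \<in> X \<Longrightarrow> nrm (x - y) = nrm (y - x)"
  using nrm_minus[of "x - y"] by simp

lemma Cauchy_Schwarz:
  assumes x: "x \<in> X" and y: "y \<in> X"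
  shows "\<bar>ip x y\<bar> \<le> nrm x * nrm y"
proof -
  have q: "0 \<le> ip x x + 2 * t * ip x y + t\<^sup>2 * ip y y" for t
    using ip_nonneg[of "x + t *\<^sub>R y"] x y
    by (simp add: ip_linear ip_sym[of y x] power2_eq_square algebra_simps)
  have "(ip x y)\<^sup>2 \<le> ip x x * ip y y"
  proof (cases "ip y y = 0")
    case True
    have "ip x y = 0"
    proof (rule ccontr)
      assume n: "ip x y \<noteq> 0"
      \<comment> \<open>With \<open>ip y y = 0\<close> the quadratic is affine in \<open>t\<close>;
        at this \<open>t\<close> its value is -1.\<close>
      from q[of "- (ip x x + 1) / (2 * ip x y)"] n True show False by (simp add: field_simps)
    qed
    then show ?thesis using True by simp
  next
    case False
    then have p: "ip y y > 0" using ip_nonneg[OF y] by simp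
    from q[of "- ip x y / ip y y"] p show ?thesis
      by (simp add: power2_eq_square field_simps)
  qed
  also have "\<dots> = (nrm x * nrm y)\<^sup>2"
    using x y by (simp add: power_mult_distrib nrm_sq)
  finally show ?thesis
    using x y by (metis abs_le_square_iff abs_of_nonneg mult_nonneg_nonneg nrm_nonneg)
qed

lemma nrm_triangle:
  assumes x: "x \<in> X" and y: "y \<in> X"
  shows "nrm (x + y) \<le> nrm x + nrm y"
proof -
  have "(nrm (x + y))\<^sup>2 = (nrm x)\<^sup>2 + 2 * ip x y + (nrm y)\<^sup>2"
    using x y by (simp add: nrm_sq ip_linear ip_sym[of y x])
  also have "\<dots> \<le> (nrm x + nrm y)\<^sup>2"
    using Cauchy_Schwarz[OF x y] by (simp add: power2_sum)
  finally show ?thesis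
    using x y by (meson add_nonneg_nonneg nrm_nonneg power2_le_imp_le)
qed

lemma nrm_triangle_diff:
  assumes "x \<in> X" "y \<in> X" "z \<in> X"
  shows "nrm (x - z) \<le> nrm (x - y) + nrm (y - z)"
  using nrm_triangle[of "x - y" "y - z"] assms by simp

lemma nrm_le_add_diff:
  assumes "x \<in> X" "y \<in> X"
  shows "nrm x \<le> nrm y + nrm (x - y)"
  using nrm_triangle[of y "x - y"] assms by simp

lemma nrm_diff_triangle:
  assumes "x \<in> X" "y \<in> X"
  shows "nrm (x - y) \<le> nrm x + nrm y"
  using nrm_triangle[of x "- y"] assms by simp

lemma nrm_add4:
  assumes "x \<in> X" "y \<in> X" "x' \<in> X" "y' \<in> X"
  shows "nrm ((x + y) - (x' + y')) \<le> nrm (x - x') + nrm (y - y')"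
proof -
  have "(x + y) - (x' + y') = (x - x') + (y - y')" by simp
  then show ?thesis using nrm_triangle[of "x - x'" "y - y'"] assms by (metis X_closed(3))
qed

lemma ip_cong_right:
  assumes "x \<in> X" "y \<in> X" "z \<in> X" "nrm (y - z) = 0"
  shows "ip x y = ip x z"
  using Cauchy_Schwarz[of x "y - z"] assms by (simp add: ip_linear)

lemma limit_unique:
  assumes s: "\<And>n. s n \<in> X" and x: "x \<in> X" and y: "y \<in> X"
    and 1: "(\<lambda>n. nrm (s n - x)) \<longlonglongrightarrow> 0" and 2: "(\<lambda>n. nrm (s n - y)) \<longlonglongrightarrow> 0"
  shows "nrm (x - y) = 0"
proof -
  have "(\<lambda>n. nrm (s n - x) + nrm (s n - y)) \<longlonglongrightarrow> 0"
    using tendsto_add[OF 1 2] by simp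
  moreover have "nrm (x - y) \<le> nrm (s n - x) + nrm (s n - y)" for n
    using nrm_triangle_diff[of x "s n" y] s x y by (simp add: nrm_commute[of x "s n"])
  ultimately have "nrm (x - y) \<le> 0"
    by (meson LIMSEQ_le_const)
  moreover have "0 \<le> nrm (x - y)" by (rule nrm_nonneg) (use x y in simp)
  ultimately show ?thesis by simp
qed

end

locale semi_hilbert = semi_inner +
  assumes complete:
    "(\<And>n. s n \<in> X) \<Longrightarrow> (\<And>e. e > 0 \<Longrightarrow> \<exists>N. \<forall>m\<ge>N. \<forall>n\<ge>N. nrm (s m - s n) < e) \<Longrightarrow>
     \<exists>x\<in>X. (\<lambda>n. nrm (s n - x)) \<longlonglongrightarrow> 0"
begin

text \<open>The representing element minimises \<open>J u = ip u u - 2 * l u\<close>, which is the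
  squared distance to it up to a constant. The parallelogram identity makes minimising sequences
  Cauchy, and the first variation vanishes at their limit.\<close>

lemma riesz:
  assumes add: "\<And>x y. x \<in> X \<Longrightarrow> y \<in> X \<Longrightarrow> l (x + y) = l x + l y"
    and scale: "\<And>c x. x \<in> X \<Longrightarrow> l (c *\<^sub>R x) = c * l x"
    and bound: "\<And>x. x \<in> X \<Longrightarrow> \<bar>l x\<bar> \<le> C * nrm x"
  shows "\<exists>u\<in>X. \<forall>h\<in>X. ip u h = (l h :: real)"
proof -
  define J where "J u = ip u u - 2 * l u" for u
  have lower: "J u \<ge> - C\<^sup>2" if "u \<in> X" for u
  proof -
    have "0 \<le> (nrm u - C)\<^sup>2" by simp
    then have "(nrm u)\<^sup>2 - 2 * (C * nrm u) \<ge> - C\<^sup>2" by (simp add: power2_diff algebra_simps)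
    then show ?thesis using bound[OF that] nrm_sq[OF that] by (simp add: J_def abs_le_iff)
  qed
  define m where "m = Inf (J ` X)"
  have bdd: "bdd_below (J ` X)" by (rule bdd_belowI2) (rule lower)
  have m_le: "m \<le> J u" if "u \<in> X" for u
    unfolding m_def using bdd that by (simp add: cINF_lower)
  have "\<exists>u\<in>X. J u < m + 1 / real (Suc n)" for n
  proof -
    have "J ` X \<noteq> {}" using X_closed(1) by blast
    moreover have "Inf (J ` X) < m + 1 / real (Suc n)" by (simp add: m_def)
    ultimately have "\<exists>y\<in>J ` X. y < m + 1 / real (Suc n)" by (rule cInf_lessD)
    then show ?thesis by blast
  qed
  then obtain s where s: "\<And>n. s n \<in> X" "\<And>n. J (s n) < m + 1 / real (Suc n)" by metis
  have l_half: "l ((1/2) *\<^sub>R (x + y)) = (l x + l y) / 2" if "x \<in> X" "y \<in> X" for x y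
    using that by (simp add: scale add)
  \<comment> \<open>Parallelogram identity for \<open>J\<close>: both values are close to
    \<open>m\<close>, and the value at the midpoint is at least \<open>m\<close>.\<close>
  have par: "(nrm (s i - s j))\<^sup>2 \<le> 2 * (1 / real (Suc i) + 1 / real (Suc j))" for i j
  proof -
    have "J (s i) + J (s j) = 2 * J ((1/2) *\<^sub>R (s i + s j)) + (nrm (s i - s j))\<^sup>2 / 2"
      using s(1)[of i] s(1)[of j]
      by (simp add: J_def nrm_sq ip_linear l_half add ip_sym[of "s j" "s i"] field_simps)
        (simp add: algebra_simps add scale)
    then show ?thesis
      using s(2)[of i] s(2)[of j] m_le[of "(1/2) *\<^sub>R (s i + s j)"] s(1)[of i] s(1)[of j] by simp
  qed
  have "\<exists>x\<in>X. (\<lambda>n. nrm (s n - x)) \<longlonglongrightarrow> 0"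
  proof (rule complete)
    fix e :: real assume e: "e > 0"
    obtain N where N: "4 / e\<^sup>2 < real N" using reals_Archimedean2 by blast
    have "nrm (s i - s j) < e" if "i \<ge> N" "j \<ge> N" for i j
    proof -
      have "real N > 0" using N e by (smt (verit) divide_pos_pos zero_less_power)
      have "1 / real (Suc i) \<le> 1 / real (Suc N)" "1 / real (Suc j) \<le> 1 / real (Suc N)"
        using that by (auto simp: field_simps)
      then have "(nrm (s i - s j))\<^sup>2 \<le> 4 / real (Suc N)" using par[of i j] by simp
      also have "\<dots> < e\<^sup>2" using N e \<open>real N > 0\<close> by (simp add: field_simps) (smt (verit) mult_pos_pos zero_less_power)
      finally show ?thesis using e by (meson less_eq_real_def power2_less_imp_less)
    qed
    then show "\<exists>N. \<forall>m\<ge>N. \<forall>n\<ge>N. nrm (s m - s n) < e" by blast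
  qed (rule s)
  then obtain u where u: "u \<in> X" "(\<lambda>n. nrm (s n - u)) \<longlonglongrightarrow> 0" by blast
  have "ip u h = l h" if h: "h \<in> X" for h
  proof -
    have lim: "(\<lambda>n. ip (s n) h) \<longlonglongrightarrow> ip u h"
    proof (rule LIM_zero_cancel, rule Lim_null_comparison)
      show "\<forall>\<^sub>F n in sequentially. norm (ip (s n) h - ip u h) \<le> nrm (s n - u) * nrm h"
        using Cauchy_Schwarz[of "s _ - u" h] s(1) u(1) h by (simp add: ip_linear)
      show "(\<lambda>n. nrm (s n - u) * nrm h) \<longlonglongrightarrow> 0"
        using tendsto_mult_left_zero[OF u(2)] .
    qed
    \<comment> \<open>Moving from \<open>s n\<close> to \<open>s n + t *\<^sub>R h\<close> lowers
      \<open>J\<close> by less than \<open>1 / Suc n\<close>. In this inequality only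
      \<open>ip (s n) h\<close> has to be passed to the limit.\<close>
    have key: "0 \<le> t\<^sup>2 * ip h h + 2 * t * (ip u h - l h)" for t
    proof (rule LIMSEQ_le_const)
      have "(\<lambda>n. t\<^sup>2 * ip h h + 2 * t * (ip (s n) h - l h) + 1 / real (Suc n))
        \<longlonglongrightarrow> t\<^sup>2 * ip h h + 2 * t * (ip u h - l h) + 0"
        by (intro tendsto_intros lim LIMSEQ_Suc lim_1_over_n)
      then show "(\<lambda>n. t\<^sup>2 * ip h h + 2 * t * (ip (s n) h - l h) + 1 / real (Suc n))
        \<longlonglongrightarrow> t\<^sup>2 * ip h h + 2 * t * (ip u h - l h)" by simp
      have "0 \<le> t\<^sup>2 * ip h h + 2 * t * (ip (s n) h - l h) + 1 / real (Suc n)" for n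
      proof -
        have "J (s n + t *\<^sub>R h) = J (s n) + t\<^sup>2 * ip h h + 2 * t * (ip (s n) h - l h)"
          using s(1)[of n] h
          by (simp add: J_def ip_linear add scale ip_sym[of h "s n"] power2_eq_square algebra_simps)
        then show ?thesis using s(2)[of n] m_le[of "s n + t *\<^sub>R h"] s(1)[of n] h by simp
      qed
      then show "\<exists>N. \<forall>n\<ge>N. 0 \<le> t\<^sup>2 * ip h h + 2 * t * (ip (s n) h - l h) + 1 / real (Suc n)"
        by blast
    qed
    define D where "D = ip u h - l h"
    have "D = 0"
    proof (rule ccontr)
      assume D: "D \<noteq> 0"
      \<comment> \<open>Almost the minimiser of the quadratic in \<open>key\<close>; the added 1
        keeps the denominator positive when \<open>h\<close> has norm zero.\<close>
      define t where "t = - D / (ip h h + 1)"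
      have p: "ip h h + 1 > 0" using ip_nonneg[OF h] by simp
      have "t\<^sup>2 * ip h h + 2 * t * D = - (D\<^sup>2 * (ip h h + 2)) / (ip h h + 1)\<^sup>2"
        using p by (simp add: t_def power2_eq_square divide_simps) (simp add: algebra_simps)
      moreover have "D\<^sup>2 * (ip h h + 2) / (ip h h + 1)\<^sup>2 > 0"
        using D ip_nonneg[OF h] by (intro divide_pos_pos mult_pos_pos) auto
      ultimately show False using key[of t] by (simp add: D_def)
    qed
    then show ?thesis by (simp add: D_def)
  qed
  then show ?thesis using u(1) by blast
qed

end

subsection \<open>Semigroups of dissipative operators\<close>

lemma tendsto_at_right_0_iff:
  fixes F :: "real \<Rightarrow> real"
  assumes "\<And>h. h > 0 \<Longrightarrow> 0 \<le> F h"
  shows "(F \<longlongrightarrow> 0) (at_right 0) \<longleftrightarrow> (\<forall>e>0. \<exists>\<delta>>0. \<forall>h. 0 < h \<and> h < \<delta> \<longrightarrow> F h < e)"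
proof -
  have "(F \<longlongrightarrow> 0) (at_right 0) \<longleftrightarrow> (\<forall>e>0. \<exists>\<delta>>0. \<forall>h>0. h < \<delta> \<longrightarrow> \<bar>F h\<bar> < e)"
    by (simp add: tendsto_iff eventually_at_right_field dist_real_def)
  then show ?thesis using assms by (auto simp: abs_of_nonneg) (metis abs_of_nonneg)+
qed

context semi_inner
begin

lemma nrm_le_imp0: "nrm x \<le> 0 \<Longrightarrow> x \<in> X \<Longrightarrow> nrm x = 0"
  using nrm_nonneg[of x] by linarith

lemma nrm0_trans:
  assumes "nrm (x - y) = 0" "nrm (y - z) = 0" "x \<in> X" "y \<in> X" "z \<in> X"
  shows "nrm (x - z) = 0"
  by (rule nrm_le_imp0) (use nrm_triangle_diff[of x y z] assms in auto)

lemma nrm0_sym: "nrm (x - y) = 0 \<Longrightarrow> x \<in> X \<Longrightarrow> y \<in> X \<Longrightarrow> nrm (y - x) = 0"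
  by (simp add: nrm_commute)

text \<open>The counterpart of \<open>C0_semigroup\<close> with real scalars and with equality up to
  elements of norm zero.\<close>

definition c0 :: "(real \<Rightarrow> 'v \<Rightarrow> 'v) \<Rightarrow> bool" where
  "c0 P \<longleftrightarrow>
     (\<forall>t\<ge>0. \<forall>f\<in>X. P t f \<in> X) \<and>
     (\<forall>t\<ge>0. \<forall>f\<in>X. \<forall>g\<in>X. \<forall>c. nrm (P t (c *\<^sub>R f + g) - (c *\<^sub>R P t f + P t g)) = 0) \<and>
     (\<forall>t\<ge>0. \<exists>B. \<forall>f\<in>X. nrm (P t f) \<le> B * nrm f) \<and>
     (\<forall>f\<in>X. nrm (P 0 f - f) = 0) \<and>
     (\<forall>s\<ge>0. \<forall>t\<ge>0. \<forall>f\<in>X. nrm (P (s + t) f - P s (P t f)) = 0) \<and>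
     (\<forall>f\<in>X. ((\<lambda>t. nrm (P t f - f)) \<longlongrightarrow> 0) (at_right 0))"

definition gen :: "(real \<Rightarrow> 'v \<Rightarrow> 'v) \<Rightarrow> ('v \<times> 'v) set" where
  "gen P = {(f, g). f \<in> X \<and> g \<in> X \<and>
     ((\<lambda>h. nrm ((1 / h) *\<^sub>R (P h f - f) - g)) \<longlongrightarrow> 0) (at_right 0)}"

text \<open>The steps sum geometrically. Keeping the subtracted term \<open>2 * K / 2 ^ n\<close>
  makes the bound reproduce itself exactly in the induction.\<close>

lemma dyadic_Cauchy:
  assumes s: "\<And>n. s n \<in> X" and step: "\<And>k. nrm (s k - s (Suc k)) \<le> K / 2 ^ k"
  shows "m \<le> n \<Longrightarrow> nrm (s m - s n) \<le> 2 * K / 2 ^ m - 2 * K / 2 ^ n"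
proof (induction n rule: nat_induct_at_least)
  case base
  then show ?case by simp
next
  case (Suc n)
  have "nrm (s m - s (Suc n)) \<le> nrm (s m - s n) + nrm (s n - s (Suc n))"
    by (rule nrm_triangle_diff) (rule s)+
  then show ?case using Suc.IH step[of n] by simp
qed

text \<open>The factors are exchanged one at a time, and nonexpansiveness of \<open>S\<close>
  carries each defect to the end without growth. The defect is measured only along the orbit of
  \<open>f\<close> under \<open>T\<close>, so an invariant set of regular elements such as
  \<open>D2 c\<close> can be used.\<close>

lemma funpow_compare:
  assumes S: "\<And>x. x \<in> X \<Longrightarrow> S x \<in> X" and T: "\<And>x. x \<in> X \<Longrightarrow> T x \<in> X"
    and ne: "\<And>x y. x \<in> X \<Longrightarrow> y \<in> X \<Longrightarrow> nrm (S x - S y) \<le> nrm (x - y)"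
    and f: "f \<in> X" and step: "\<And>j. j < n \<Longrightarrow> nrm (S ((T ^^ j) f) - T ((T ^^ j) f)) \<le> \<delta>"
  shows "nrm ((S ^^ n) f - (T ^^ n) f) \<le> real n * \<delta>"
  using step
proof (induction n)
  case 0
  then show ?case by simp
next
  case (Suc n)
  have mem: "(S ^^ n) f \<in> X" "(T ^^ n) f \<in> X"
    using S T f by (induction n) auto
  have "nrm ((S ^^ Suc n) f - (T ^^ Suc n) f)
      \<le> nrm (S ((S ^^ n) f) - S ((T ^^ n) f)) + nrm (S ((T ^^ n) f) - T ((T ^^ n) f))"
    using nrm_triangle_diff[of "S ((S ^^ n) f)" "S ((T ^^ n) f)" "T ((T ^^ n) f)"] mem S T by simp
  also have "\<dots> \<le> nrm ((S ^^ n) f - (T ^^ n) f) + \<delta>"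
    using ne[OF mem] Suc.prems[of n] by simp
  also have "\<dots> \<le> real n * \<delta> + \<delta>" using Suc by simp
  finally show ?case by (simp add: algebra_simps)
qed

end

text \<open>Membership of \<open>(u, (1 / \<mu>) *\<^sub>R (u - f))\<close> expresses
  \<open>u - \<mu> A u = f\<close>, so \<open>A_range\<close> is solvability of the resolvent
  equation. \<open>A_cong\<close> makes the graph independent of representatives, which turns
  identities up to norm zero into membership.\<close>

locale m_dissipative = semi_hilbert X ip for X :: "'v::real_vector set" and ip +
  fixes A :: "('v \<times> 'v) set"
  assumes A_X: "(f, g) \<in> A \<Longrightarrow> f \<in> X \<and> g \<in> X"
    and A_add: "(f, g) \<in> A \<Longrightarrow> (f', g') \<in> A \<Longrightarrow> (f + f', g + g') \<in> A"
    and A_scale: "(f, g) \<in> A \<Longrightarrow> (c *\<^sub>R f, c *\<^sub>R g) \<in> A"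
    and A_cong: "(f, g) \<in> A \<Longrightarrow> f' \<in> X \<Longrightarrow> g' \<in> X \<Longrightarrow> nrm (f - f') = 0 \<Longrightarrow> nrm (g - g') = 0 \<Longrightarrow> (f', g') \<in> A"
    and A_diss: "(f, g) \<in> A \<Longrightarrow> ip g f \<le> 0"
    and A_range: "f \<in> X \<Longrightarrow> \<mu> > 0 \<Longrightarrow> \<exists>u. (u, (1 / \<mu>) *\<^sub>R (u - f)) \<in> A"
    and A_dense: "f \<in> X \<Longrightarrow> e > 0 \<Longrightarrow> \<exists>u w. (u, w) \<in> A \<and> nrm (f - u) < e"
begin

lemma A_diff: "(f, g) \<in> A \<Longrightarrow> (f', g') \<in> A \<Longrightarrow> (f - f', g - g') \<in> A"
  using A_add[of f g "-1 *\<^sub>R f'" "-1 *\<^sub>R g'"] A_scale[of f' g' "-1"] by simp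

text \<open>The resolvent \<open>(1 - \<mu> A)\<^sup>-\<^sup>1\<close>.\<close>

definition R :: "real \<Rightarrow> 'v \<Rightarrow> 'v" where
  "R \<mu> f = (SOME u. (u, (1 / \<mu>) *\<^sub>R (u - f)) \<in> A)"

lemma R_A: "f \<in> X \<Longrightarrow> \<mu> > 0 \<Longrightarrow> (R \<mu> f, (1 / \<mu>) *\<^sub>R (R \<mu> f - f)) \<in> A"
  unfolding R_def by (rule someI_ex) (rule A_range)

lemma R_X [simp]: "f \<in> X \<Longrightarrow> \<mu> > 0 \<Longrightarrow> R \<mu> f \<in> X"
  using R_A A_X by blast

text \<open>With \<open>(d, e)\<close> the difference of the two pairs, dissipativity gives
  \<open>(nrm d)\<^sup>2 \<le> ip (d - \<mu> *\<^sub>R e) d\<close>; Cauchy-Schwarz and division by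
  \<open>nrm d\<close> do the rest.\<close>

lemma A_expand:
  assumes "(u, w) \<in> A" "(u', w') \<in> A" "\<mu> \<ge> 0"
  shows "nrm (u - u') \<le> nrm ((u - \<mu> *\<^sub>R w) - (u' - \<mu> *\<^sub>R w'))"
proof -
  define d e where "d = u - u'" and "e = w - w'"
  have de: "(d, e) \<in> A" using A_diff assms d_def e_def by blast
  then have X: "d \<in> X" "e \<in> X" using A_X by auto
  have eq: "(u - \<mu> *\<^sub>R w) - (u' - \<mu> *\<^sub>R w') = d - \<mu> *\<^sub>R e"
    by (simp add: d_def e_def algebra_simps)
  have "(nrm d)\<^sup>2 \<le> ip (d - \<mu> *\<^sub>R e) d"
    using A_diss[OF de] assms(3) X by (simp add: nrm_sq ip_linear mult_nonneg_nonpos)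
  also have "\<dots> \<le> nrm (d - \<mu> *\<^sub>R e) * nrm d"
    using Cauchy_Schwarz[of "d - \<mu> *\<^sub>R e" d] X by simp
  finally have *: "nrm d * nrm d \<le> nrm (d - \<mu> *\<^sub>R e) * nrm d" by (simp add: power2_eq_square)
  have "nrm d \<le> nrm (d - \<mu> *\<^sub>R e)"
  proof (cases "nrm d = 0")
    case True
    then show ?thesis using X by simp
  next
    case False
    then have "nrm d > 0" using nrm_nonneg[of d] X by linarith
    then show ?thesis using * by simp
  qed
  then show ?thesis unfolding eq by (simp add: d_def)
qed

text \<open>The source of the resolvent identities below: it suffices to exhibit a pair in
  \<open>A\<close> that solves the resolvent equation up to a small or null error.\<close>

lemma R_near:
  assumes "(u, w) \<in> A" "f \<in> X" "\<mu> > 0"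
  shows "nrm (R \<mu> f - u) \<le> nrm (f - (u - \<mu> *\<^sub>R w))"
  using A_expand[OF R_A[OF assms(2,3)] assms(1), of \<mu>] assms by simp

lemma R_nonexpansive:
  assumes "f \<in> X" "g \<in> X" "\<mu> > 0"
  shows "nrm (R \<mu> f - R \<mu> g) \<le> nrm (f - g)"
  using R_near[OF R_A[OF assms(2,3)] assms(1,3)] assms by simp

lemma R_linear:
  assumes "f \<in> X" "g \<in> X" "\<mu> > 0"
  shows "nrm (R \<mu> (c *\<^sub>R f + g) - (c *\<^sub>R R \<mu> f + R \<mu> g)) = 0"
proof -
  have "(c *\<^sub>R R \<mu> f + R \<mu> g, c *\<^sub>R ((1 / \<mu>) *\<^sub>R (R \<mu> f - f)) + (1 / \<mu>) *\<^sub>R (R \<mu> g - g)) \<in> A"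
    using R_A assms by (intro A_add A_scale) auto
  from R_near[OF this, of "c *\<^sub>R f + g" \<mu>]
  have "nrm (R \<mu> (c *\<^sub>R f + g) - (c *\<^sub>R R \<mu> f + R \<mu> g)) \<le> 0"
    using assms by (simp add: algebra_simps)
  then show ?thesis using assms by (intro nrm_le_imp0) auto
qed

text \<open>Since \<open>(1 / \<mu>) *\<^sub>R (R \<mu> f - f)\<close> is the image of
  \<open>R \<mu> f\<close> under \<open>A\<close>, this says that the resolvent commutes with
  \<open>A\<close> on its domain.\<close>

lemma R_quotient:
  assumes fg: "(f, g) \<in> A" and m: "\<mu> > 0"
  shows "nrm (R \<mu> g - (1 / \<mu>) *\<^sub>R (R \<mu> f - f)) = 0"
proof -
  have X: "f \<in> X" "g \<in> X" using A_X fg by auto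
  define w where "w = (1 / \<mu>) *\<^sub>R (R \<mu> f - f)"
  have "(w, (1 / \<mu>) *\<^sub>R (w - g)) \<in> A"
    using A_scale[OF A_diff[OF R_A[OF X(1) m] fg], of "1 / \<mu>"] by (simp add: w_def)
  from R_near[OF this X(2) m] have "nrm (R \<mu> g - w) \<le> 0" using m by simp
  then show ?thesis using X m by (intro nrm_le_imp0) (auto simp: w_def)
qed

lemma R_comm:
  assumes fg: "(f, g) \<in> A" and m: "\<mu> > 0"
  shows "(R \<mu> f, R \<mu> g) \<in> A"
proof -
  have X: "f \<in> X" "g \<in> X" using A_X fg by auto
  show ?thesis
    by (rule A_cong[OF R_A[OF X(1) m]])
      (use X m R_quotient[OF fg m] in \<open>auto simp: nrm_commute[of "R \<mu> g"]\<close>)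
qed

lemma A_0: "(0, 0) \<in> A"
  using A_scale[OF R_A[OF X_closed(1), of 1], of 0] by simp

lemma R_norm_le: "f \<in> X \<Longrightarrow> \<mu> > 0 \<Longrightarrow> nrm (R \<mu> f) \<le> nrm f"
  using R_near[OF A_0, of f \<mu>] by simp

lemma Rn_X [simp]: "f \<in> X \<Longrightarrow> \<mu> > 0 \<Longrightarrow> (R \<mu> ^^ n) f \<in> X"
  by (induction n) auto

lemma Rn_nonexpansive:
  "f \<in> X \<Longrightarrow> g \<in> X \<Longrightarrow> \<mu> > 0 \<Longrightarrow> nrm ((R \<mu> ^^ n) f - (R \<mu> ^^ n) g) \<le> nrm (f - g)"
proof (induction n)
  case (Suc n)
  then show ?case using R_nonexpansive[of "(R \<mu> ^^ n) f" "(R \<mu> ^^ n) g" \<mu>] by simp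
qed simp

lemma Rn_A: "(f, g) \<in> A \<Longrightarrow> \<mu> > 0 \<Longrightarrow> ((R \<mu> ^^ n) f, (R \<mu> ^^ n) g) \<in> A"
  by (induction n) (auto intro: R_comm)

lemma Rn_linear:
  assumes "f \<in> X" "g \<in> X" "\<mu> > 0"
  shows "nrm ((R \<mu> ^^ n) (c *\<^sub>R f + g) - (c *\<^sub>R (R \<mu> ^^ n) f + (R \<mu> ^^ n) g)) = 0"
proof (induction n)
  case (Suc n)
  let ?F = "(R \<mu> ^^ n) f" and ?G = "(R \<mu> ^^ n) g" and ?H = "(R \<mu> ^^ n) (c *\<^sub>R f + g)"
  have "nrm (R \<mu> ?H - R \<mu> (c *\<^sub>R ?F + ?G)) \<le> 0"
    using R_nonexpansive[of ?H "c *\<^sub>R ?F + ?G" \<mu>] Suc assms by simp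
  then have "nrm (R \<mu> ?H - R \<mu> (c *\<^sub>R ?F + ?G)) = 0" using assms by (intro nrm_le_imp0) auto
  moreover have "nrm (R \<mu> (c *\<^sub>R ?F + ?G) - (c *\<^sub>R R \<mu> ?F + R \<mu> ?G)) = 0"
    using assms by (intro R_linear) auto
  ultimately have "nrm (R \<mu> ?H - (c *\<^sub>R R \<mu> ?F + R \<mu> ?G)) = 0"
    by (rule nrm0_trans) (use assms in auto)
  then show ?case by simp
qed simp

text \<open>On the domain each application of the resolvent moves by at most
  \<open>\<mu> * nrm w\<close>. The bound depends only on the total time
  \<open>real n * \<mu>\<close>, so it survives refinement and yields strong continuity at time
  0.\<close>

lemma Rn_near_id:
  assumes uw: "(u, w) \<in> A" and m: "\<mu> > 0" and f: "f \<in> X"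
  shows "nrm ((R \<mu> ^^ n) f - f) \<le> 2 * nrm (f - u) + real n * \<mu> * nrm w"
proof -
  have X: "u \<in> X" "w \<in> X" using A_X uw by auto
  have u: "nrm ((R \<mu> ^^ n) u - u) \<le> real n * \<mu> * nrm w"
  proof (induction n)
    case (Suc n)
    have "nrm (R \<mu> u - u) = \<mu> * nrm ((1 / \<mu>) *\<^sub>R (R \<mu> u - u))"
      using X m by (simp add: nrm_scale)
    also have "nrm ((1 / \<mu>) *\<^sub>R (R \<mu> u - u)) \<le> nrm (R \<mu> w)"
      using nrm_triangle_diff[of "(1 / \<mu>) *\<^sub>R (R \<mu> u - u)" "R \<mu> w" 0]
        R_quotient[OF uw m] X m by (simp add: nrm_commute[of "R \<mu> w"])
    also have "nrm (R \<mu> w) \<le> nrm w" using R_norm_le X m by simp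
    finally have 1: "nrm (R \<mu> u - u) \<le> \<mu> * nrm w" using m by simp
    have "nrm ((R \<mu> ^^ Suc n) u - u) \<le> nrm (R \<mu> ((R \<mu> ^^ n) u) - R \<mu> u) + nrm (R \<mu> u - u)"
      using nrm_triangle_diff[of "R \<mu> ((R \<mu> ^^ n) u)" "R \<mu> u" u] X m by simp
    also have "\<dots> \<le> nrm ((R \<mu> ^^ n) u - u) + \<mu> * nrm w"
      using R_nonexpansive[of "(R \<mu> ^^ n) u" u \<mu>] X m 1 by simp
    finally show ?case using Suc by (simp add: algebra_simps)
  qed simp
  have "nrm ((R \<mu> ^^ n) f - f) \<le> nrm ((R \<mu> ^^ n) f - (R \<mu> ^^ n) u) + nrm ((R \<mu> ^^ n) u - f)"
    using X f m by (intro nrm_triangle_diff) auto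
  also have "\<dots> \<le> nrm (f - u) + (nrm ((R \<mu> ^^ n) u - u) + nrm (u - f))"
    using Rn_nonexpansive[OF f X(1) m, of n] nrm_triangle_diff[of "(R \<mu> ^^ n) u" u f] X f m by simp
  finally show ?thesis using u nrm_commute[of u f] X f by simp
qed

text \<open>The domain of the square of \<open>A\<close>, graded by a bound on the second image.
  Resolvents preserve the bound, so one constant serves a whole orbit.\<close>

definition D2 :: "real \<Rightarrow> 'v set" where
  "D2 c = {f. \<exists>g h. (f, g) \<in> A \<and> (g, h) \<in> A \<and> nrm h \<le> c}"

lemma D2_X: "f \<in> D2 c \<Longrightarrow> f \<in> X"
  using A_X by (auto simp: D2_def)

lemma D2_R: "f \<in> D2 c \<Longrightarrow> \<mu> > 0 \<Longrightarrow> R \<mu> f \<in> D2 c"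
  unfolding D2_def by clarify (meson R_comm R_norm_le A_X order_trans)

text \<open>For \<open>v = R a (R b f)\<close> the equation \<open>(1 - b A) (1 - a A) v = f\<close>
  reads \<open>v - (a + b) A v = f - a b A\<^sup>2 v\<close>. Thus \<open>v\<close> solves the
  resolvent equation for the step \<open>a + b\<close> up to an error of norm at most
  \<open>a * b * c\<close>.\<close>

lemma R_Euler_step:
  assumes f: "f \<in> D2 c" and a: "a > 0" and b: "b > 0"
  shows "nrm (R (a + b) f - R a (R b f)) \<le> a * b * c"
proof -
  obtain g h where gh: "(f, g) \<in> A" "(g, h) \<in> A" "nrm h \<le> c" using f by (auto simp: D2_def)
  have X: "f \<in> X" "g \<in> X" "h \<in> X" using gh A_X by auto
  define u where "u = R b f"
  define v where "v = R a u"
  have uX: "u \<in> X" "v \<in> X" using X a b by (auto simp: u_def v_def)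
  have vA: "(v, (1 / a) *\<^sub>R (v - u)) \<in> A" unfolding v_def by (rule R_A[OF uX(1) a])
  define z1 z2 where "z1 = R a (R b g)" and "z2 = R a (R b h)"
  have zX: "z1 \<in> X" "z2 \<in> X" using X a b by (auto simp: z1_def z2_def)
  have vz: "(v, z1) \<in> A" "(z1, z2) \<in> A"
    using gh a b by (auto simp: v_def u_def z1_def z2_def intro!: R_comm)
  have ug: "(u, R b g) \<in> A" using gh b by (auto simp: u_def intro!: R_comm)
  have e1: "nrm (z1 - (1 / a) *\<^sub>R (v - u)) = 0"
    unfolding z1_def v_def by (rule R_quotient[OF ug a])
  have e2: "nrm (R b g - (1 / b) *\<^sub>R (u - f)) = 0"
    unfolding u_def by (rule R_quotient[OF gh(1) b])
  have e3: "nrm (z2 - (1 / a) *\<^sub>R (z1 - R b g)) = 0"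
    unfolding z2_def z1_def by (rule R_quotient[OF R_comm[OF gh(2) b] a])
  \<comment> \<open>The three bracketed differences are null by \<open>e1\<close>, \<open>e2\<close>
    and \<open>e3\<close>, so only \<open>(a * b) *\<^sub>R z2\<close> contributes to the
    norm.\<close>
  have "f - (v - (a + b) *\<^sub>R z1) =
     a *\<^sub>R (z1 - (1 / a) *\<^sub>R (v - u)) + (b *\<^sub>R (R b g - (1 / b) *\<^sub>R (u - f)) +
     ((- (a * b)) *\<^sub>R (z2 - (1 / a) *\<^sub>R (z1 - R b g)) + (a * b) *\<^sub>R z2))"
    using a b by (simp add: algebra_simps)
  also have "nrm \<dots> \<le> nrm (a *\<^sub>R (z1 - (1 / a) *\<^sub>R (v - u))) + (nrm (b *\<^sub>R (R b g - (1 / b) *\<^sub>R (u - f))) +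
     (nrm ((- (a * b)) *\<^sub>R (z2 - (1 / a) *\<^sub>R (z1 - R b g))) + nrm ((a * b) *\<^sub>R z2)))"
    using X uX zX a b
    by (intro order_trans[OF nrm_triangle] add_left_mono order_refl) auto
  also have "\<dots> = a * b * nrm z2"
    using X uX zX a b by (simp only: nrm_scale X_closed R_X e1 e2 e3) simp
  also have "nrm z2 \<le> c"
    unfolding z2_def using R_norm_le[of "R b h" a] R_norm_le[of h b] X a b gh(3) by simp
  finally have 1: "nrm (f - (v - (a + b) *\<^sub>R z1)) \<le> a * b * c" using a b by simp
  have "nrm (R (a + b) f - v) \<le> nrm (f - (v - (a + b) *\<^sub>R z1))"
    using R_near[OF vz(1) X(1), of "a + b"] a b by simp
  then show ?thesis using 1 by (simp add: v_def u_def)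
qed

text \<open>Applying the resolvent to an element of the domain lands in the domain of the square,
  and for small \<open>\<mu>\<close> it moves the element only a little.\<close>

lemma D2_dense:
  assumes f: "f \<in> X" and e: "e > 0"
  shows "\<exists>c. \<exists>u\<in>D2 c. nrm (f - u) < e"
proof -
  obtain u w where uw: "(u, w) \<in> A" "nrm (f - u) < e / 2" using A_dense[OF f, of "e / 2"] e by auto
  have X: "u \<in> X" "w \<in> X" using uw A_X by auto
  define \<mu> where "\<mu> = e / (2 * (nrm w + 1))"
  have m: "\<mu> > 0" using e nrm_nonneg[OF X(2)] by (simp add: \<mu>_def add_nonneg_pos)
  have D: "R \<mu> u \<in> D2 (nrm ((1 / \<mu>) *\<^sub>R (R \<mu> w - w)))"
    unfolding D2_def using R_comm[OF uw(1) m] R_A[OF X(2) m] by blast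
  have "nrm (R \<mu> u - u) \<le> \<mu> * nrm w"
    using Rn_near_id[OF uw(1) m X(1), of 1] by simp
  moreover have "\<mu> * nrm w \<le> e / 2"
  proof -
    have "\<mu> * nrm w = e / 2 * (nrm w / (nrm w + 1))" by (simp add: \<mu>_def)
    also have "\<dots> \<le> e / 2 * 1"
      using nrm_nonneg[OF X(2)] e by (intro mult_left_mono) (auto simp: divide_simps)
    finally show ?thesis by simp
  qed
  ultimately have near: "nrm (R \<mu> u - u) \<le> e / 2" by linarith
  then have "nrm (f - R \<mu> u) < e"
    using near
    using nrm_triangle_diff[of f u "R \<mu> u"] uw(2) f X m by (simp add: nrm_commute[of u "R \<mu> u"])
  then show ?thesis using D by blast
qed

text \<open>Dyadic subdivision lets consecutive approximations be compared step by step: one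
  resolvent of step \<open>h + h\<close> against two of step \<open>h\<close>.\<close>

definition E :: "real \<Rightarrow> nat \<Rightarrow> 'v \<Rightarrow> 'v" where
  "E t k = R (t / 2 ^ k) ^^ (2 ^ k)"

lemma E_X [simp]: "f \<in> X \<Longrightarrow> t > 0 \<Longrightarrow> E t k f \<in> X"
  by (simp add: E_def)

lemma E_nonexpansive: "f \<in> X \<Longrightarrow> g \<in> X \<Longrightarrow> t > 0 \<Longrightarrow> nrm (E t k f - E t k g) \<le> nrm (f - g)"
  by (simp add: E_def Rn_nonexpansive)

end

context m_dissipative
begin

lemma E_linear:
  assumes "f \<in> X" "g \<in> X" "t > 0"
  shows "nrm (E t k (c *\<^sub>R f + g) - (c *\<^sub>R E t k f + E t k g)) = 0"
  unfolding E_def by (rule Rn_linear) (use assms in auto)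

text \<open>Each of the \<open>2 ^ k\<close> comparisons costs \<open>h\<^sup>2 * c\<close> with
  \<open>h = t / 2 ^ Suc k\<close>; their total is the stated bound, which is summable in
  \<open>k\<close>.\<close>

lemma E_step:
  assumes f: "f \<in> D2 c" and t: "t > 0"
  shows "nrm (E t k f - E t (Suc k) f) \<le> t\<^sup>2 * c / 4 / 2 ^ k"
proof -
  define h where "h = t / 2 ^ Suc k"
  have h: "h > 0" using t by (simp add: h_def)
  have hh: "t / 2 ^ k = h + h" by (simp add: h_def)
  let ?S = "R (h + h)" and ?T = "R h \<circ> R h"
  have TD: "(?T ^^ j) f \<in> D2 c" for j
    using f h by (induction j) (auto intro: D2_R)
  have "nrm ((?S ^^ 2 ^ k) f - (?T ^^ 2 ^ k) f) \<le> real (2 ^ k) * (h * h * c)"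
  proof (rule funpow_compare)
    fix j
    show "nrm (?S ((?T ^^ j) f) - ?T ((?T ^^ j) f)) \<le> h * h * c"
      using R_Euler_step[OF TD[of j] h h] by simp
  qed (use h D2_X[OF f] in \<open>auto intro: R_nonexpansive\<close>)
  moreover have "?T ^^ n = R h ^^ (2 * n)" for n
    by (induction n) (auto simp: fun_eq_iff)
  ultimately have "nrm (E t k f - E t (Suc k) f) \<le> 2 ^ k * (h * h * c)"
    by (simp add: E_def hh) (simp add: h_def)
  also have "\<dots> = t\<^sup>2 * c / 4 / 2 ^ k"
    by (simp add: h_def power2_eq_square field_simps)
  finally show ?thesis .
qed

text \<open>On \<open>D2 c\<close> the increments decay geometrically. Density and nonexpansiveness
  extend the Cauchy property to all of \<open>X\<close>.\<close>

lemma E_limit: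
  assumes f: "f \<in> X" and t: "t > 0"
  shows "\<exists>u\<in>X. (\<lambda>k. nrm (E t k f - u)) \<longlonglongrightarrow> 0"
proof (rule complete)
  fix e :: real assume e: "e > 0"
  obtain c u where u: "u \<in> D2 c" "nrm (f - u) < e / 3" using D2_dense[OF f, of "e / 3"] e by auto
  have uX: "u \<in> X" using u D2_X by blast
  define K where "K = 2 * (t\<^sup>2 * c / 4)"
  obtain g h where gh: "(g, h) \<in> A" "nrm h \<le> c" using u(1) by (auto simp: D2_def)
  then have "h \<in> X" using A_X by blast
  from order_trans[OF nrm_nonneg[OF this] gh(2)] have c: "c \<ge> 0" .
  then have K: "K \<ge> 0" by (simp add: K_def)
  have est: "nrm (E t m u - E t n u) \<le> K / 2 ^ m" if "m \<le> n" for m n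
  proof -
    have "nrm (E t m u - E t n u) \<le> K / 2 ^ m - K / 2 ^ n"
      unfolding K_def by (rule dyadic_Cauchy[OF _ E_step[OF u(1) t] that]) (use uX t in simp)
    moreover have "0 \<le> K / 2 ^ n" using K by simp
    ultimately show ?thesis by linarith
  qed
  have "(\<lambda>m. K / 2 ^ m) \<longlonglongrightarrow> 0"
    using tendsto_mult[OF tendsto_const[of K] LIMSEQ_power_zero[of "1/2::real"]]
    by (simp add: power_one_over)
  from LIMSEQ_D[OF this, of "e / 3"] obtain N where "\<forall>m\<ge>N. norm (K / 2 ^ m - 0) < e / 3" using e by auto
  then have N: "K / 2 ^ m < e / 3" if "m \<ge> N" for m using that K by simp
  have main: "nrm (E t m f - E t n f) < e" if "m \<ge> N" "m \<le> n" for m n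
  proof -
    have "nrm (E t m f - E t n f) \<le> nrm (E t m f - E t m u) + nrm (E t m u - E t n f)"
      using f uX t by (intro nrm_triangle_diff) auto
    also have "nrm (E t m u - E t n f) \<le> nrm (E t m u - E t n u) + nrm (E t n u - E t n f)"
      using f uX t by (intro nrm_triangle_diff) auto
    finally show ?thesis
      using E_nonexpansive[OF f uX t, of m] E_nonexpansive[OF uX f t, of n]
        nrm_commute[OF uX f] u(2) est[OF that(2)] N[OF that(1)] by linarith
  qed
  have "nrm (E t m f - E t n f) < e" if "m \<ge> N" "n \<ge> N" for m n
    using main[of m n] main[of n m] that nrm_commute[of "E t m f" "E t n f"] f t
    by (cases "m \<le> n") auto
  then show "\<exists>N. \<forall>m\<ge>N. \<forall>n\<ge>N. nrm (E t m f - E t n f) < e" by blast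
qed (use assms in simp)

text \<open>Time 0 is separate because the resolvent is characterised only for positive step
  lengths.\<close>

definition S :: "real \<Rightarrow> 'v \<Rightarrow> 'v" where
  "S t f = (if t = 0 then f else SOME u. u \<in> X \<and> (\<lambda>k. nrm (E t k f - u)) \<longlonglongrightarrow> 0)"

lemma S_0 [simp]: "S 0 f = f"
  by (simp add: S_def)

lemma S_props:
  assumes "f \<in> X" "t > 0"
  shows "S t f \<in> X" "(\<lambda>k. nrm (E t k f - S t f)) \<longlonglongrightarrow> 0"
proof -
  have "\<exists>u. u \<in> X \<and> (\<lambda>k. nrm (E t k f - u)) \<longlonglongrightarrow> 0" using E_limit[OF assms] by blast
  from someI_ex[OF this] show "S t f \<in> X" "(\<lambda>k. nrm (E t k f - S t f)) \<longlonglongrightarrow> 0"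
    using assms by (auto simp: S_def)
qed

lemma S_X [simp]: "f \<in> X \<Longrightarrow> t \<ge> 0 \<Longrightarrow> S t f \<in> X"
  using S_props[of f t] by (cases "t = 0") auto

lemma nrm_lim:
  assumes s: "\<And>n. s n \<in> X" and x: "x \<in> X" and lim: "(\<lambda>n. nrm (s n - x)) \<longlonglongrightarrow> 0"
    and b: "\<And>n. nrm (s n) \<le> B"
  shows "nrm x \<le> B"
proof (rule LIMSEQ_le_const)
  show "(\<lambda>n. nrm (s n - x) + B) \<longlonglongrightarrow> B" using tendsto_add[OF lim tendsto_const[of B]] by simp
  have "nrm x \<le> nrm (s n - x) + B" for n
    using nrm_le_add_diff[OF x s[of n]] b[of n] nrm_commute[OF s[of n] x] by linarith
  then show "\<exists>N. \<forall>n\<ge>N. nrm x \<le> nrm (s n - x) + B" by blast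
qed

lemma lim_diff:
  assumes "\<And>n. s n \<in> X" "\<And>n. s' n \<in> X" "x \<in> X" "x' \<in> X"
    and "(\<lambda>n. nrm (s n - x)) \<longlonglongrightarrow> 0" "(\<lambda>n. nrm (s' n - x')) \<longlonglongrightarrow> 0"
  shows "(\<lambda>n. nrm ((s n - s' n) - (x - x'))) \<longlonglongrightarrow> 0"
proof (rule Lim_null_comparison)
  show "(\<lambda>n. nrm (s n - x) + nrm (s' n - x')) \<longlonglongrightarrow> 0" using tendsto_add[OF assms(5,6)] by simp
  have "nrm ((s n - s' n) - (x - x')) \<le> nrm (s n - x) + nrm (s' n - x')" for n
    using nrm_diff_triangle[of "s n - x" "s' n - x'"] assms(1-4)
    by (simp add: algebra_simps)
  then show "\<forall>\<^sub>F n in sequentially. norm (nrm ((s n - s' n) - (x - x'))) \<le> nrm (s n - x) + nrm (s' n - x')"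
    using assms by (simp add: abs_of_nonneg)
qed

lemma S_nonexpansive:
  assumes "f \<in> X" "g \<in> X" "t \<ge> 0"
  shows "nrm (S t f - S t g) \<le> nrm (f - g)"
proof (cases "t = 0")
  case False
  then have t: "t > 0" using assms by simp
  show ?thesis
  proof (rule nrm_lim)
    show "(\<lambda>n. nrm ((E t n f - E t n g) - (S t f - S t g))) \<longlonglongrightarrow> 0"
      using assms t by (intro lim_diff S_props) auto
    show "nrm (E t n f - E t n g) \<le> nrm (f - g)" for n using E_nonexpansive assms t by blast
  qed (use assms t in auto)
qed simp

lemma S_linear:
  assumes f: "f \<in> X" and g: "g \<in> X" and "t \<ge> 0"
  shows "nrm (S t (c *\<^sub>R f + g) - (c *\<^sub>R S t f + S t g)) = 0"
proof (cases "t = 0")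
  case False
  then have t: "t > 0" using assms by simp
  have sg: "c *\<^sub>R f + g \<in> X" using f g by simp
  show ?thesis
  proof (rule limit_unique)
    show "(\<lambda>k. nrm (E t k (c *\<^sub>R f + g) - S t (c *\<^sub>R f + g))) \<longlonglongrightarrow> 0"
      by (rule S_props[OF sg t])
    show "(\<lambda>k. nrm (E t k (c *\<^sub>R f + g) - (c *\<^sub>R S t f + S t g))) \<longlonglongrightarrow> 0"
    proof (rule Lim_null_comparison)
      show "(\<lambda>k. \<bar>c\<bar> * nrm (E t k f - S t f) + nrm (E t k g - S t g)) \<longlonglongrightarrow> 0"
        using tendsto_add[OF tendsto_mult_right_zero[OF S_props(2)[OF f t], of "\<bar>c\<bar>"] S_props(2)[OF g t]] by simp
      have "nrm (E t k (c *\<^sub>R f + g) - (c *\<^sub>R S t f + S t g)) \<le> \<bar>c\<bar> * nrm (E t k f - S t f) + nrm (E t k g - S t g)" for k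
      proof -
        have "nrm (E t k (c *\<^sub>R f + g) - (c *\<^sub>R S t f + S t g)) \<le>
          nrm (E t k (c *\<^sub>R f + g) - (c *\<^sub>R E t k f + E t k g)) + nrm ((c *\<^sub>R E t k f + E t k g) - (c *\<^sub>R S t f + S t g))"
          using f g t by (intro nrm_triangle_diff) auto
        also have "nrm ((c *\<^sub>R E t k f + E t k g) - (c *\<^sub>R S t f + S t g)) \<le>
          nrm (c *\<^sub>R E t k f - c *\<^sub>R S t f) + nrm (E t k g - S t g)"
          using f g t by (intro nrm_add4) auto
        also have "nrm (c *\<^sub>R E t k f - c *\<^sub>R S t f) = \<bar>c\<bar> * nrm (E t k f - S t f)"
          using f g t by (simp add: nrm_scale flip: scaleR_diff_right)
        finally show ?thesis using E_linear[OF f g t] by simp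
      qed
      then show "\<forall>\<^sub>F k in sequentially. norm (nrm (E t k (c *\<^sub>R f + g) - (c *\<^sub>R S t f + S t g)))
        \<le> \<bar>c\<bar> * nrm (E t k f - S t f) + nrm (E t k g - S t g)"
        using f g t by (simp add: abs_of_nonneg)
    qed
  qed (use f g t in auto)
qed simp

text \<open>The pair \<open>(R b (R a f), R b w)\<close>, where \<open>w\<close> is the image of
  \<open>R a f\<close> under \<open>A\<close>, lies in \<open>A\<close> by \<open>R_comm\<close> and
  solves the resolvent equation for \<open>R b f\<close> with step \<open>a\<close>.\<close>

lemma Rn_commute:
  assumes f: "f \<in> X" and a: "a > 0" and b: "b > 0"
  shows "nrm (R a ((R b ^^ n) f) - (R b ^^ n) (R a f)) = 0"
proof -
  have comm1: "nrm (R a (R b f) - R b (R a f)) = 0" if f: "f \<in> X" for f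
  proof -
    let ?u = "R a f"
    have u: "(?u, (1 / a) *\<^sub>R (?u - f)) \<in> A" using R_A f a by blast
    have "nrm (R a (R b f) - R b ?u) \<le> nrm (R b f - (R b ?u - a *\<^sub>R R b ((1 / a) *\<^sub>R (?u - f))))"
      by (rule R_near[OF R_comm[OF u b]]) (use f a b in auto)
    \<comment> \<open>The first bracket is zero and the second is null by linearity, since
      \<open>a *\<^sub>R ((1 / a) *\<^sub>R (?u - f)) + f\<close> is \<open>?u\<close>.\<close>
    also have "R b f - (R b ?u - a *\<^sub>R R b ((1 / a) *\<^sub>R (?u - f))) =
      (R b f - R b (a *\<^sub>R 0 + f)) + (a *\<^sub>R R b ((1 / a) *\<^sub>R (?u - f)) + R b f - R b (a *\<^sub>R ((1 / a) *\<^sub>R (?u - f)) + f))"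
      using a by simp
    also have "nrm \<dots> \<le> nrm (R b f - R b (a *\<^sub>R 0 + f)) + nrm (a *\<^sub>R R b ((1 / a) *\<^sub>R (?u - f)) + R b f - R b (a *\<^sub>R ((1 / a) *\<^sub>R (?u - f)) + f))"
      using f a b by (intro nrm_triangle) auto
    also have "\<dots> = 0"
      using R_linear[of "(1 / a) *\<^sub>R (?u - f)" f b a] f a b
      by (simp add: nrm_commute[of "a *\<^sub>R R b ((1 / a) *\<^sub>R (?u - f)) + R b f"])
    finally show ?thesis using f a b by (intro nrm_le_imp0) auto
  qed
  show ?thesis using f
  proof (induction n arbitrary: f)
    case (Suc n)
    have "nrm (R a (R b ((R b ^^ n) f)) - R b (R a ((R b ^^ n) f))) = 0" using comm1 Suc b by simp
    moreover have "nrm (R b (R a ((R b ^^ n) f)) - R b ((R b ^^ n) (R a f))) \<le> 0"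
      using R_nonexpansive[of "R a ((R b ^^ n) f)" "(R b ^^ n) (R a f)" b] Suc a b by simp
    then have "nrm (R b (R a ((R b ^^ n) f)) - R b ((R b ^^ n) (R a f))) = 0"
      by (rule nrm_le_imp0) (use Suc a b in auto)
    ultimately have "nrm (R a (R b ((R b ^^ n) f)) - R b ((R b ^^ n) (R a f))) = 0"
      by (rule nrm0_trans) (use Suc a b in auto)
    then show ?case by simp
  qed simp
qed

lemma Rn_product:
  assumes f: "f \<in> X" and a: "a > 0" and b: "b > 0"
  shows "nrm (((R a \<circ> R b) ^^ n) f - (R a ^^ n) ((R b ^^ n) f)) = 0"
proof (induction n)
  case (Suc n)
  let ?x = "((R a \<circ> R b) ^^ n) f" and ?y = "(R a ^^ n) ((R b ^^ n) f)"
  have X: "?x \<in> X" using f a b by (induction n) auto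
  have "nrm (R a (R b ?x) - R a (R b ?y)) \<le> nrm (?x - ?y)"
    using R_nonexpansive[of "R b ?x" "R b ?y" a] R_nonexpansive[of ?x ?y b] X f a b by simp
  then have 1: "nrm (R a (R b ?x) - R a (R b ?y)) = 0"
    by (intro nrm_le_imp0) (use Suc X f a b in auto)
  have "nrm (R a (R b ?y) - R a ((R a ^^ n) (R b ((R b ^^ n) f)))) \<le> 0"
    using R_nonexpansive[of "R b ?y" "(R a ^^ n) (R b ((R b ^^ n) f))" a]
      Rn_commute[of "(R b ^^ n) f" b a n] X f a b by simp
  then have 2: "nrm (R a (R b ?y) - R a ((R a ^^ n) (R b ((R b ^^ n) f)))) = 0"
    by (intro nrm_le_imp0) (use X f a b in auto)
  from nrm0_trans[OF 1 2] show ?case using X f a b by (simp add: comp_def)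
qed simp

text \<open>Both times are cut into the same number \<open>2 ^ k\<close> of steps, of lengths
  \<open>a\<close> and \<open>b\<close>, so no rational relation between \<open>s\<close> and
  \<open>t\<close> is involved. Replacing \<open>R (a + b)\<close> by \<open>R a \<circ> R b\<close>
  in every step costs \<open>2 ^ k * a * b * c = s * t * c / 2 ^ k\<close> on \<open>D2 c\<close>,
  and density does the rest.\<close>

lemma S_semigroup_pos:
  assumes f: "f \<in> X" and s: "s > 0" and t: "t > 0"
  shows "nrm (S (s + t) f - S s (S t f)) = 0"
proof -
  have st: "s + t > 0" using s t by simp
  have D: "nrm (S (s + t) u - S s (S t u)) = 0" if u: "u \<in> D2 c" for u c
  proof (rule limit_unique)
    have uX: "u \<in> X" using u D2_X by blast
    show "(\<lambda>k. nrm (E (s + t) k u - S (s + t) u)) \<longlonglongrightarrow> 0" by (rule S_props[OF uX st])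
    have est: "nrm (E (s + t) k u - E s k (E t k u)) \<le> s * t * c / 2 ^ k" for k
    proof -
      define a b where "a = s / 2 ^ k" and "b = t / 2 ^ k"
      have ab: "a > 0" "b > 0" using s t by (auto simp: a_def b_def)
      have TD: "((R a \<circ> R b) ^^ j) u \<in> D2 c" for j
        using u ab by (induction j) (auto intro: D2_R)
      have "nrm ((R (a + b) ^^ 2 ^ k) u - ((R a \<circ> R b) ^^ 2 ^ k) u) \<le> real (2 ^ k) * (a * b * c)"
      proof (rule funpow_compare)
        show "nrm (R (a + b) (((R a \<circ> R b) ^^ j) u) - (R a \<circ> R b) (((R a \<circ> R b) ^^ j) u)) \<le> a * b * c" for j
          using R_Euler_step[OF TD[of j] ab] by simp
      qed (use ab uX in \<open>auto intro: R_nonexpansive\<close>)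
      moreover have "nrm ((R (a + b) ^^ 2 ^ k) u - (R a ^^ 2 ^ k) ((R b ^^ 2 ^ k) u)) \<le>
          nrm ((R (a + b) ^^ 2 ^ k) u - ((R a \<circ> R b) ^^ 2 ^ k) u) +
          nrm (((R a \<circ> R b) ^^ 2 ^ k) u - (R a ^^ 2 ^ k) ((R b ^^ 2 ^ k) u))"
        using uX ab D2_X[OF TD] by (intro nrm_triangle_diff) auto
      ultimately have "nrm ((R (a + b) ^^ 2 ^ k) u - (R a ^^ 2 ^ k) ((R b ^^ 2 ^ k) u)) \<le> real (2 ^ k) * (a * b * c)"
        using Rn_product[OF uX ab, of "2 ^ k"] by linarith
      also have "\<dots> = s * t * c / 2 ^ k" by (simp add: a_def b_def field_simps)
      finally show ?thesis by (simp add: E_def a_def b_def add_divide_distrib)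
    qed
    show "(\<lambda>k. nrm (E (s + t) k u - S s (S t u))) \<longlonglongrightarrow> 0"
    proof (rule Lim_null_comparison)
      have "(\<lambda>k. s * t * c * (1 / 2) ^ k) \<longlonglongrightarrow> 0"
        by (intro tendsto_mult_right_zero LIMSEQ_power_zero) simp
      from tendsto_add[OF tendsto_add[OF this S_props(2)[OF uX t]] S_props(2)[OF S_props(1)[OF uX t] s]]
      show "(\<lambda>k. s * t * c / 2 ^ k + nrm (E t k u - S t u) + nrm (E s k (S t u) - S s (S t u))) \<longlonglongrightarrow> 0"
        by (simp add: power_one_over)
      have "nrm (E (s + t) k u - S s (S t u)) \<le>
        s * t * c / 2 ^ k + nrm (E t k u - S t u) + nrm (E s k (S t u) - S s (S t u))" for k
      proof -
        have "nrm (E (s + t) k u - S s (S t u)) \<le>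
          nrm (E (s + t) k u - E s k (E t k u)) + nrm (E s k (E t k u) - S s (S t u))"
          using uX s t st by (intro nrm_triangle_diff) auto
        also have "nrm (E s k (E t k u) - S s (S t u)) \<le>
          nrm (E s k (E t k u) - E s k (S t u)) + nrm (E s k (S t u) - S s (S t u))"
          using uX s t st by (intro nrm_triangle_diff) auto
        also have "nrm (E s k (E t k u) - E s k (S t u)) \<le> nrm (E t k u - S t u)"
          using uX s t by (intro E_nonexpansive) auto
        finally show ?thesis using est[of k] by simp
      qed
      then show "\<forall>\<^sub>F k in sequentially. norm (nrm (E (s + t) k u - S s (S t u))) \<le>
        s * t * c / 2 ^ k + nrm (E t k u - S t u) + nrm (E s k (S t u) - S s (S t u))"
        using uX s t st by (simp add: abs_of_nonneg)
    qed
  qed (use s t st D2_X[OF u] in auto)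
  have "nrm (S (s + t) f - S s (S t f)) \<le> 0 + e" if e: "e > 0" for e
  proof -
    obtain c u where u: "u \<in> D2 c" "nrm (f - u) < e / 2" using D2_dense[OF f, of "e / 2"] e by auto
    have uX: "u \<in> X" using u D2_X by blast
    have "nrm (S (s + t) f - S s (S t f)) \<le> nrm (S (s + t) f - S (s + t) u) + nrm (S (s + t) u - S s (S t f))"
      using f uX s t by (intro nrm_triangle_diff) auto
    also have "nrm (S (s + t) u - S s (S t f)) \<le> nrm (S (s + t) u - S s (S t u)) + nrm (S s (S t u) - S s (S t f))"
      using f uX s t by (intro nrm_triangle_diff) auto
    also have "nrm (S s (S t u) - S s (S t f)) \<le> nrm (u - f)"
      using S_nonexpansive[of "S t u" "S t f" s] S_nonexpansive[of u f t] f uX s t by simp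
    also have "nrm (S (s + t) f - S (s + t) u) \<le> nrm (f - u)" using S_nonexpansive f uX s t by simp
    finally show ?thesis using u(2) D[OF u(1)] nrm_commute[OF f uX] by simp
  qed
  then have "nrm (S (s + t) f - S s (S t f)) \<le> 0" by (rule field_le_epsilon)
  then show ?thesis by (rule nrm_le_imp0) (use f s t in auto)
qed

lemma S_near_id:
  assumes uw: "(u, w) \<in> A" and t: "t > 0" and f: "f \<in> X"
  shows "nrm (S t f - f) \<le> 2 * nrm (f - u) + t * nrm w"
proof (rule nrm_lim)
  have "(\<lambda>k. nrm ((E t k f - f) - (S t f - f))) \<longlonglongrightarrow> 0" using S_props(2)[OF f t] by simp
  then show "(\<lambda>k. nrm ((E t k f - f) - (S t f - f))) \<longlonglongrightarrow> 0" .
  show "nrm (E t k f - f) \<le> 2 * nrm (f - u) + t * nrm w" for k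
    using Rn_near_id[OF uw _ f, of "t / 2 ^ k" "2 ^ k"] t by (simp add: E_def)
qed (use f t in auto)

text \<open>Up to null elements \<open>(R \<mu> ^^ n) f - f\<close> is \<open>\<mu>\<close> times
  the sum of \<open>(R \<mu> ^^ j) g\<close> for \<open>j = 1, ..., n\<close>; the hypothesis bounds
  the distance of each summand from \<open>g\<close>.\<close>

lemma Rn_quotient:
  assumes fg: "(f, g) \<in> A" and m: "\<mu> > 0" and d: "\<And>j. nrm ((R \<mu> ^^ j) g - g) \<le> b + real j * c" and c: "c \<ge> 0"
  shows "nrm ((R \<mu> ^^ n) f - f - (real n * \<mu>) *\<^sub>R g) \<le> real n * \<mu> * (b + real n * c)"
proof (induction n)
  case (Suc n)
  have X: "f \<in> X" "g \<in> X" using A_X fg by auto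
  let ?y = "(R \<mu> ^^ n) f" and ?z = "(R \<mu> ^^ Suc n) g"
  have q: "nrm (?z - (1 / \<mu>) *\<^sub>R (R \<mu> ?y - ?y)) = 0"
    using R_quotient[OF Rn_A[OF fg m, of n] m] by simp
  have eq: "(R \<mu> ^^ Suc n) f - f - (real (Suc n) * \<mu>) *\<^sub>R g =
    (?y - f - (real n * \<mu>) *\<^sub>R g) + ((- \<mu>) *\<^sub>R (?z - (1 / \<mu>) *\<^sub>R (R \<mu> ?y - ?y)) + \<mu> *\<^sub>R (?z - g))"
    using m by (simp add: algebra_simps)
  have "nrm ((R \<mu> ^^ Suc n) f - f - (real (Suc n) * \<mu>) *\<^sub>R g) \<le> nrm (?y - f - (real n * \<mu>) *\<^sub>R g) +
     (nrm ((- \<mu>) *\<^sub>R (?z - (1 / \<mu>) *\<^sub>R (R \<mu> ?y - ?y))) + nrm (\<mu> *\<^sub>R (?z - g)))"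
    unfolding eq using X m by (intro order_trans[OF nrm_triangle] add_left_mono order_refl nrm_triangle) auto
  also have "nrm ((- \<mu>) *\<^sub>R (?z - (1 / \<mu>) *\<^sub>R (R \<mu> ?y - ?y))) = 0"
    using X m q by (subst nrm_scale) auto
  also have "nrm (\<mu> *\<^sub>R (?z - g)) = \<mu> * nrm (?z - g)"
    using X m by (subst nrm_scale) auto
  also have "\<dots> \<le> \<mu> * (b + real (Suc n) * c)"
    using d[of "Suc n"] m by (intro mult_left_mono) auto
  also have "nrm (?y - f - (real n * \<mu>) *\<^sub>R g) \<le> real n * \<mu> * (b + real (Suc n) * c)"
    using Suc m c by (smt (verit) mult_left_mono mult_right_mono of_nat_mono le_SucI order_refl mult_nonneg_nonneg of_nat_0_le_iff)
  finally show ?case by (simp add: algebra_simps)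
qed simp

lemma S_quotient:
  assumes fg: "(f, g) \<in> A" and uw: "(u, w) \<in> A" and t: "t > 0"
  shows "nrm ((1 / t) *\<^sub>R (S t f - f) - g) \<le> 2 * nrm (g - u) + t * nrm w"
proof -
  have X: "f \<in> X" "g \<in> X" "u \<in> X" "w \<in> X" using A_X fg uw by auto
  have "nrm (S t f - f - t *\<^sub>R g) \<le> t * (2 * nrm (g - u) + t * nrm w)"
  proof (rule nrm_lim)
    show "(\<lambda>k. nrm ((E t k f - f - t *\<^sub>R g) - (S t f - f - t *\<^sub>R g))) \<longlonglongrightarrow> 0"
      using S_props(2)[OF X(1) t] by simp
    show "nrm (E t k f - f - t *\<^sub>R g) \<le> t * (2 * nrm (g - u) + t * nrm w)" for k
      using Rn_quotient[OF fg, of "t / 2 ^ k" "2 * nrm (g - u)" "t / 2 ^ k * nrm w" "2 ^ k"]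
        Rn_near_id[OF uw _ X(2), of "t / 2 ^ k"] t X by (simp add: E_def mult.assoc)
  qed (use X t in auto)
  moreover have "nrm ((1 / t) *\<^sub>R (S t f - f) - g) = (1 / t) * nrm (S t f - f - t *\<^sub>R g)"
  proof -
    have "(1 / t) *\<^sub>R (S t f - f) - g = (1 / t) *\<^sub>R (S t f - f - t *\<^sub>R g)"
      using t by (simp add: algebra_simps)
    then show ?thesis using X t by (simp only:) (subst nrm_scale, auto)
  qed
  ultimately show ?thesis using t by (simp add: divide_le_eq mult.commute)
qed

text \<open>Density makes the first term small uniformly in \<open>h\<close>; the approximant, and
  with it \<open>nrm w\<close>, is then fixed before \<open>h\<close> tends to 0.\<close>

lemma near_dense_tendsto:
  assumes g: "g \<in> X" and nn: "\<And>h. h > 0 \<Longrightarrow> 0 \<le> F h"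
    and F: "\<And>u w h. (u, w) \<in> A \<Longrightarrow> h > 0 \<Longrightarrow> F h \<le> 2 * nrm (g - u) + h * nrm w"
  shows "(F \<longlongrightarrow> 0) (at_right (0::real))"
proof (subst tendsto_at_right_0_iff[OF nn]; clarify?)
  fix e :: real assume e: "e > 0"
  obtain u w where uw: "(u, w) \<in> A" "nrm (g - u) < e / 4" using A_dense[OF g, of "e / 4"] e by auto
  have w: "nrm w \<ge> 0" using uw A_X by auto
  have "F h < e" if "0 < h" "h < e / (2 * (nrm w + 1))" for h
  proof -
    have "h * (nrm w + 1) < e / 2" using that w by (simp add: field_simps)
    then have "h * nrm w < e / 2" using that by (simp add: algebra_simps)
    then show ?thesis using F[OF uw(1) that(1)] uw(2) by simp
  qed
  then show "\<exists>\<delta>>0. \<forall>h. 0 < h \<and> h < \<delta> \<longrightarrow> F h < e"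
    using e w by (intro exI[of _ "e / (2 * (nrm w + 1))"]) auto
qed

lemma c0_S: "c0 S"
proof -
  have "nrm (S t f) \<le> 1 * nrm f" if "f \<in> X" "t \<ge> 0" for t f
  proof -
    have "nrm (S t 0) = 0" using S_linear[of 0 0 t "-1"] that by (simp add: nrm_scale) 
    moreover have "nrm (S t f) \<le> nrm (S t 0) + nrm (S t f - S t 0)"
      using that by (intro nrm_le_add_diff) auto
    ultimately show ?thesis using S_nonexpansive[of f 0 t] that by simp
  qed
  moreover have "nrm (S (s + t) f - S s (S t f)) = 0" if "s \<ge> 0" "t \<ge> 0" "f \<in> X" for s t f
    using S_semigroup_pos[of f s t] that by (cases "s = 0"; cases "t = 0") auto
  moreover have "((\<lambda>t. nrm (S t f - f)) \<longlongrightarrow> 0) (at_right 0)" if f: "f \<in> X" for f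
    using f S_near_id[OF _ _ f] by (intro near_dense_tendsto[OF f]) auto
  ultimately show ?thesis
    unfolding c0_def using S_linear S_X by (intro conjI allI impI ballI exI[of _ "1::real"]) auto
qed

text \<open>That \<open>A\<close> is contained in the generator is the quotient estimate.
  Conversely, for \<open>(f, g)\<close> in the generator solve \<open>u - w = f - g\<close> with
  \<open>(u, w)\<close> in \<open>A\<close>. Then \<open>d = f - u\<close> equals
  \<open>g - w\<close>, and because \<open>S\<close> is nonexpansive the difference quotients of
  \<open>d\<close> have nonpositive product with \<open>d\<close>, which forces
  \<open>ip d d \<le> 0\<close>.\<close>

lemma gen_S: "gen S = A"
proof (rule antisym; rule subrelI)
  have sup: "(f, g) \<in> gen S" if fg: "(f, g) \<in> A" for f g
  proof -
    have X: "f \<in> X" "g \<in> X" using A_X fg by auto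
    have "((\<lambda>h. nrm ((1 / h) *\<^sub>R (S h f - f) - g)) \<longlongrightarrow> 0) (at_right 0)"
      using X S_quotient[OF fg] by (intro near_dense_tendsto[OF X(2)]) auto
    then show ?thesis using X by (simp add: gen_def)
  qed
  then show "(f, g) \<in> gen S" if "(f, g) \<in> A" for f g using that .
  fix f g assume fg: "(f, g) \<in> gen S"
  then have X: "f \<in> X" "g \<in> X" and lim: "((\<lambda>h. nrm ((1 / h) *\<^sub>R (S h f - f) - g)) \<longlongrightarrow> 0) (at_right 0)"
    by (auto simp: gen_def)
  define u w where "u = R 1 (f - g)" and "w = u - (f - g)"
  have uw: "(u, w) \<in> A" using R_A[of "f - g" 1] X by (simp add: u_def w_def)
  then have uX: "u \<in> X" "w \<in> X" using A_X by auto
  have limu: "((\<lambda>h. nrm ((1 / h) *\<^sub>R (S h u - u) - w)) \<longlongrightarrow> 0) (at_right 0)"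
    using sup[OF uw] by (simp add: gen_def)
  define d where "d = f - u"
  have dX: "d \<in> X" using X uX by (simp add: d_def)
  have gw: "g - w = d" by (simp add: d_def w_def)
  have bound: "ip d d \<le> (nrm ((1 / h) *\<^sub>R (S h f - f) - g) + nrm ((1 / h) *\<^sub>R (S h u - u) - w)) * nrm d" if h: "h > 0" for h
  proof -
    let ?q = "(1 / h) *\<^sub>R ((S h f - S h u) - d)"
    have qX: "?q \<in> X" using h X uX dX by simp
    have "ip (S h f - S h u) d \<le> nrm (S h f - S h u) * nrm d"
      using Cauchy_Schwarz[of "S h f - S h u" d] h X uX dX by simp
    also have "\<dots> \<le> nrm d * nrm d"
      using S_nonexpansive[of f u h] h X uX dX by (intro mult_right_mono) (auto simp: d_def)
    also have "\<dots> = ip d d" using nrm_sq[OF dX] by (simp add: power2_eq_square)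
    finally have "ip ?q d \<le> 0" using h X uX dX by (simp add: ip_linear divide_nonpos_pos)
    then have "ip d d \<le> ip (d - ?q) d" using qX dX by (simp only: ip_diff_left)
    also have "\<dots> \<le> nrm (d - ?q) * nrm d" using Cauchy_Schwarz[of "d - ?q" d] qX dX by simp
    also have "nrm (d - ?q) = nrm (?q - d)" using qX dX by (intro nrm_commute) auto
    also have "?q - d = ((1 / h) *\<^sub>R (S h f - f) - g) - ((1 / h) *\<^sub>R (S h u - u) - w)"
    proof -
      have "?q - d = (1 / h) *\<^sub>R ((S h f - S h u) - (f - u)) - (g - w)" by (simp add: gw) (simp add: d_def)
      then show ?thesis by (simp add: algebra_simps)
    qed
    also have "nrm \<dots> \<le> nrm ((1 / h) *\<^sub>R (S h f - f) - g) + nrm ((1 / h) *\<^sub>R (S h u - u) - w)"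
      using X uX h by (intro nrm_diff_triangle) auto
    finally show ?thesis using dX by (simp add: mult_right_mono)
  qed
  have "((\<lambda>h. (nrm ((1 / h) *\<^sub>R (S h f - f) - g) + nrm ((1 / h) *\<^sub>R (S h u - u) - w)) * nrm d) \<longlongrightarrow> (0 + 0) * nrm d) (at_right 0)"
    by (intro tendsto_intros lim limu)
  moreover have "\<forall>\<^sub>F h in at_right 0. ip d d \<le> (nrm ((1 / h) *\<^sub>R (S h f - f) - g) + nrm ((1 / h) *\<^sub>R (S h u - u) - w)) * nrm d"
    using bound by (intro eventually_at_rightI[of 0 1]) auto
  ultimately have "ip d d \<le> (0 + 0) * nrm d"
    by (intro tendsto_le[OF _ _ tendsto_const]) auto
  then have "nrm d = 0" using ip_nonneg[OF dX] by (simp add: nrm_def)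
  then show "(f, g) \<in> A"
    by (intro A_cong[OF uw X]) (use X uX gw in \<open>auto simp: d_def nrm_commute[of u f] nrm_commute[of w g]\<close>)
qed

end

section \<open>Uniform boundedness and bounds for semigroups near time 0\<close>

context semi_hilbert
begin

lemma nrm_diff_add_diff:
  assumes "a \<in> X" "b \<in> X" "c \<in> X" "d \<in> X"
  shows "nrm (a - (b + (c - d))) \<le> nrm a + (nrm b + (nrm c + nrm d))"
  using nrm_diff_triangle[of a "b + (c - d)"] nrm_triangle[of b "c - d"] nrm_diff_triangle[of c d] assms
  by auto

lemma c0D:
  assumes "c0 P"
  shows "\<And>t f. t \<ge> 0 \<Longrightarrow> f \<in> X \<Longrightarrow> P t f \<in> X"
    and "\<And>t f g c. t \<ge> 0 \<Longrightarrow> f \<in> X \<Longrightarrow> g \<in> X \<Longrightarrow> nrm (P t (c *\<^sub>R f + g) - (c *\<^sub>R P t f + P t g)) = 0"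
    and "\<And>t. t \<ge> 0 \<Longrightarrow> \<exists>B. \<forall>f\<in>X. nrm (P t f) \<le> B * nrm f"
    and "\<And>f. f \<in> X \<Longrightarrow> nrm (P 0 f - f) = 0"
    and "\<And>s t f. s \<ge> 0 \<Longrightarrow> t \<ge> 0 \<Longrightarrow> f \<in> X \<Longrightarrow> nrm (P (s + t) f - P s (P t f)) = 0"
    and "\<And>f. f \<in> X \<Longrightarrow> ((\<lambda>t. nrm (P t f - f)) \<longlongrightarrow> 0) (at_right 0)"
  using assms unfolding c0_def by auto

text \<open>Sokal's proof: each \<open>T n\<close> gains at least \<open>r \<parallel>T n\<parallel>\<close> when passing to one of the two points
  \<open>x \<plusminus> r e\<close>, and the radii \<open>3\<^sup>-\<^sup>n\<close> keep the limit close to all earlier choices.\<close>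

lemma uniform_boundedness_geometric:
  fixes T :: "nat \<Rightarrow> 'a \<Rightarrow> 'a"
  assumes TX: "\<And>n f. f \<in> X \<Longrightarrow> T n f \<in> X"
    and lin: "\<And>n f g c. f \<in> X \<Longrightarrow> g \<in> X \<Longrightarrow> nrm (T n (c *\<^sub>R f + g) - (c *\<^sub>R T n f + T n g)) = 0"
    and bdd: "\<And>n. \<exists>B. \<forall>f\<in>X. nrm (T n f) \<le> B * nrm f"
    and pointwise: "\<And>f. f \<in> X \<Longrightarrow> \<exists>C. \<forall>n. nrm (T n f) \<le> C"
  shows "\<exists>n. \<forall>f\<in>X. nrm (T n f) \<le> 4 ^ n * nrm f"
proof (rule ccontr)
  assume "\<not> ?thesis"
  then have large: "\<exists>f\<in>X. nrm (T n f) > 4 ^ n * nrm f" for n by (meson not_le)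
  define U where "U = {e \<in> X. nrm e \<le> 1}"
  define b where "b n = (SUP e\<in>U. nrm (T n e))" for n
  obtain B where B: "\<And>n f. f \<in> X \<Longrightarrow> nrm (T n f) \<le> B n * nrm f" using bdd by metis
  have Blow: "nrm (T n e) \<le> \<bar>B n\<bar>" if "e \<in> U" for n e
  proof -
    have "nrm (T n e) \<le> B n * nrm e" using B that by (simp add: U_def)
    also have "\<dots> \<le> \<bar>B n\<bar> * nrm e" using that by (intro mult_right_mono) (auto simp: U_def)
    also have "\<dots> \<le> \<bar>B n\<bar> * 1" using that by (intro mult_left_mono) (auto simp: U_def)
    finally show ?thesis by simp
  qed
  have bddU: "bdd_above ((\<lambda>e. nrm (T n e)) ` U)" for n
    by (rule bdd_aboveI2) (rule Blow)
  have b_upper: "nrm (T n e) \<le> b n" if "e \<in> U" for n e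
    unfolding b_def by (rule cSUP_upper[OF that bddU])
  have scale: "nrm (T n (c *\<^sub>R f)) = \<bar>c\<bar> * nrm (T n f)" if f: "f \<in> X" for n c f
  proof -
    have "nrm (T n 0) \<le> B n * nrm 0" using B[of 0 n] by simp
    then have z: "nrm (T n 0) = 0" using TX by (intro nrm_le_imp0) auto
    have "nrm (T n (c *\<^sub>R f) - c *\<^sub>R T n f) \<le> nrm (T n (c *\<^sub>R f + 0) - (c *\<^sub>R T n f + T n 0)) + nrm (T n 0)"
      using nrm_triangle[of "T n (c *\<^sub>R f + 0) - (c *\<^sub>R T n f + T n 0)" "T n 0"] TX f by simp
    then have "nrm (T n (c *\<^sub>R f) - c *\<^sub>R T n f) \<le> 0" using lin[of f 0 n c] f z by simp
    then have "nrm (T n (c *\<^sub>R f) - c *\<^sub>R T n f) = 0" using TX f by (intro nrm_le_imp0) auto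
    then have "nrm (T n (c *\<^sub>R f)) = nrm (c *\<^sub>R T n f)"
      using nrm_le_add_diff[of "T n (c *\<^sub>R f)" "c *\<^sub>R T n f"] nrm_le_add_diff[of "c *\<^sub>R T n f" "T n (c *\<^sub>R f)"]
        nrm_commute[of "T n (c *\<^sub>R f)" "c *\<^sub>R T n f"] TX f by simp
    then show ?thesis using TX f by (simp add: nrm_scale)
  qed
  have op: "nrm (T n f) \<le> b n * nrm f" if f: "f \<in> X" for n f
  proof (cases "nrm f = 0")
    case True
    then show ?thesis using B[OF f, of n] by simp
  next
    case False
    then have p: "nrm f > 0" using nrm_nonneg[OF f] by linarith
    have "(1 / nrm f) *\<^sub>R f \<in> U" using f p by (simp add: U_def nrm_scale)
    from b_upper[OF this, of n] show ?thesis using f p by (simp add: scale field_simps)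
  qed
  have bn: "b n > 4 ^ n" for n
  proof -
    obtain f where f: "f \<in> X" "nrm (T n f) > 4 ^ n * nrm f" using large by blast
    have "4 ^ n * nrm f < b n * nrm f" using op[OF f(1), of n] f(2) by simp
    then show ?thesis using nrm_nonneg[OF f(1)] by (metis less_eq_real_def mult_less_cancel_right not_less)
  qed
  have U0: "U \<noteq> {}" by (auto simp: U_def intro: exI[of _ 0])
  have "\<exists>e\<in>U. nrm (T n e) > 2 / 3 * b n" for n
  proof -
    have "b n > 0" using bn[of n] by (smt (verit) zero_less_power)
    then have "2 / 3 * b n < b n" by simp
    then show ?thesis unfolding b_def using less_cSUP_iff[OF U0 bddU] by (metis b_def)
  qed
  then obtain e where e: "\<And>n. e n \<in> U" "\<And>n. nrm (T n (e n)) > 2 / 3 * b n" by metis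
  have eX: "e n \<in> X" "nrm (e n) \<le> 1" for n using e(1)[of n] by (auto simp: U_def)
  define nxt where "nxt n x = (if nrm (T n (x + (1/3) ^ n *\<^sub>R e n)) \<ge> nrm (T n (x - (1/3) ^ n *\<^sub>R e n))
     then x + (1/3) ^ n *\<^sub>R e n else x - (1/3) ^ n *\<^sub>R e n)" for n x
  define x where "x = rec_nat 0 nxt"
  have x0: "x 0 = 0" and xS: "x (Suc n) = nxt n (x n)" for n by (auto simp: x_def)
  have xX: "x n \<in> X" for n by (induction n) (auto simp: x0 xS nxt_def eX)
  have gain: "nrm (T n (nxt n z)) \<ge> (1/3) ^ n * (2 / 3 * b n)" if z: "z \<in> X" for n z
  proof -
    let ?r = "(1/3) ^ n :: real"
    let ?p = "z + ?r *\<^sub>R e n" and ?m = "z - ?r *\<^sub>R e n"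
    have X: "?p \<in> X" "?m \<in> X" using z eX by auto
    have "2 * ?r * nrm (T n (e n)) = nrm (T n ((2 * ?r) *\<^sub>R e n))" using scale[OF eX(1)] by simp
    also have "(2 * ?r) *\<^sub>R e n = (-1) *\<^sub>R ?m + ?p" by (simp add: algebra_simps flip: scaleR_2)
    also have "nrm (T n ((-1) *\<^sub>R ?m + ?p)) \<le> nrm ((-1) *\<^sub>R T n ?m + T n ?p) +
        nrm (T n ((-1) *\<^sub>R ?m + ?p) - ((-1) *\<^sub>R T n ?m + T n ?p))"
      using X TX[OF X(1), of n] TX[OF X(2), of n] TX[of "(-1) *\<^sub>R ?m + ?p" n] by (intro nrm_le_add_diff) (metis X_closed)+
    also have "\<dots> = nrm ((-1) *\<^sub>R T n ?m + T n ?p)"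
      using lin[OF X(2,1), of n "-1"] by simp
    also have "\<dots> \<le> nrm (T n ?m) + nrm (T n ?p)"
      using nrm_triangle[of "(-1) *\<^sub>R T n ?m" "T n ?p"] TX[OF X(1), of n] TX[OF X(2), of n] by simp
    also have "\<dots> \<le> 2 * nrm (T n (nxt n z))" by (auto simp: nxt_def)
    finally have "?r * nrm (T n (e n)) \<le> nrm (T n (nxt n z))" by simp
    moreover have "?r * (2 / 3 * b n) \<le> ?r * nrm (T n (e n))"
      using e(2)[of n] by (intro mult_left_mono) auto
    ultimately show ?thesis by linarith
  qed
  have stp: "nrm (x (Suc n) - x n) \<le> (1/3) ^ n" for n
  proof -
    have "x (Suc n) - x n = (1/3) ^ n *\<^sub>R e n \<or> x (Suc n) - x n = (- ((1/3) ^ n)) *\<^sub>R e n"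
      by (simp add: xS nxt_def)
    moreover have "(1/3) ^ n * nrm (e n) \<le> (1/3) ^ n * 1"
      using eX(2)[of n] by (intro mult_left_mono) auto
    ultimately show ?thesis using eX[of n] by (auto simp: nrm_scale simp del: scaleR_minus_left)
  qed
  have far: "nrm (x m - x n) \<le> (3/2) * ((1/3) ^ m - (1/3) ^ n)" if "m \<le> n" for m n
    using that
  proof (induction n rule: nat_induct_at_least)
    case (Suc n)
    have "nrm (x m - x (Suc n)) \<le> nrm (x m - x n) + nrm (x n - x (Suc n))"
      by (rule nrm_triangle_diff) (rule xX)+
    then show ?case using Suc.IH stp[of n] nrm_commute[OF xX[of n] xX[of "Suc n"]] by simp
  qed simp
  have far': "nrm (x m - x n) \<le> (3/2) * (1/3) ^ m" if "m \<le> n" for m n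
  proof -
    have "0 \<le> (1/3::real) ^ n" by simp
    then show ?thesis using far[OF that] unfolding right_diff_distrib by linarith
  qed
  have "\<exists>y\<in>X. (\<lambda>n. nrm (x n - y)) \<longlonglongrightarrow> 0"
  proof (rule complete[OF xX])
    fix \<epsilon> :: real assume "\<epsilon> > 0"
    then obtain N where N: "(1/3) ^ N < \<epsilon> / 3" using real_arch_pow_inv[of "\<epsilon> / 3" "1/3"] by auto
    have "nrm (x m - x n) < \<epsilon>" if "m \<ge> N" "n \<ge> N" for m n
    proof -
      have "nrm (x m - x n) \<le> nrm (x m - x N) + nrm (x N - x n)" by (rule nrm_triangle_diff) (rule xX)+
      then show ?thesis using far'[OF that(1)] far'[OF that(2)] nrm_commute[OF xX[of m] xX[of N]] N by simp
    qed
    then show "\<exists>N. \<forall>m\<ge>N. \<forall>n\<ge>N. nrm (x m - x n) < \<epsilon>" by blast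
  qed
  then obtain y where y: "y \<in> X" "(\<lambda>n. nrm (x n - y)) \<longlonglongrightarrow> 0" by blast
  have ynear: "nrm (y - x m) \<le> (3/2) * (1/3) ^ m" for m
  proof (rule LIMSEQ_le_const)
    show "(\<lambda>n. nrm (x n - y) + (3/2) * (1/3) ^ m) \<longlonglongrightarrow> (3/2) * (1/3) ^ m"
      using tendsto_add[OF y(2) tendsto_const] by simp
    have "nrm (y - x m) \<le> nrm (x n - y) + (3/2) * (1/3) ^ m" if "n \<ge> m" for n
      using nrm_triangle_diff[OF y(1) xX[of n] xX[of m]] far'[OF that]
        nrm_commute[OF xX[of n] y(1)] nrm_commute[OF xX[of n] xX[of m]] by linarith
    then show "\<exists>N. \<forall>n\<ge>N. nrm (y - x m) \<le> nrm (x n - y) + (3/2) * (1/3) ^ m" by blast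
  qed
  \<comment> \<open>The gain \<open>2 / 3\<close> exceeds the loss \<open>1 / 2\<close> caused by
    passing from \<open>x (Suc n)\<close> to \<open>y\<close>, because
    \<open>(3/2) * (1/3) ^ Suc n\<close> is \<open>(1/3) ^ n / 2\<close>; the difference is the
    factor \<open>1 / 6\<close>. Growth remains because \<open>4 ^ n\<close> beats
    \<open>3 ^ n\<close>.\<close>
  have low: "(4/3) ^ n / 6 \<le> nrm (T n y)" for n
  proof -
    have 1: "nrm (T n (x (Suc n))) \<ge> (1/3) ^ n * (2 / 3 * b n)" using gain[OF xX] by (simp add: xS)
    let ?d = "x (Suc n) - y"
    have dX: "?d \<in> X" using xX y by simp
    have "nrm (T n ?d) \<le> b n * nrm ?d" by (rule op[OF dX])
    also have "\<dots> \<le> b n * ((1/3) ^ n / 2)"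
      using ynear[of "Suc n"] nrm_commute[OF xX[of "Suc n"] y(1)] bn[of n]
      by (intro mult_left_mono) (auto intro!: less_imp_le[OF less_trans[of 0 "4 ^ n"]])
    finally have 2: "nrm (T n ?d) \<le> b n * ((1/3) ^ n / 2)" .
    have "nrm (T n (1 *\<^sub>R ?d + y)) \<le> nrm (1 *\<^sub>R T n ?d + T n y) + nrm (T n (1 *\<^sub>R ?d + y) - (1 *\<^sub>R T n ?d + T n y))"
      using dX y TX[OF dX, of n] TX[OF y(1), of n] TX[OF xX[of "Suc n"], of n] by (intro nrm_le_add_diff) auto
    then have "nrm (T n (x (Suc n))) \<le> nrm (T n ?d + T n y)"
      using lin[OF dX y(1), of n 1] by simp
    also have "\<dots> \<le> nrm (T n ?d) + nrm (T n y)" using TX dX y by (intro nrm_triangle) auto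
    finally have "nrm (T n y) \<ge> (1/3) ^ n * b n / 6" using 1 2 by (simp add: algebra_simps)
    moreover have "(1/3) ^ n * b n \<ge> (1/3) ^ n * 4 ^ n" using bn[of n] by (intro mult_left_mono) auto
    moreover have "(1/3) ^ n * 4 ^ n = (4/3 :: real) ^ n" by (simp flip: power_mult_distrib)
    ultimately show ?thesis by linarith
  qed
  obtain C where C: "\<And>n. nrm (T n y) \<le> C" using pointwise[OF y(1)] by blast
  obtain n where "(4/3 :: real) ^ n > 6 * C" using real_arch_pow[of "4/3" "6 * C"] by auto
  then show False using low[of n] C[of n] by simp
qed

text \<open>Otherwise there are times \<open>t n\<close> tending to 0 at which the operator violates
  the bound \<open>4 ^ n\<close>, while strong continuity keeps every orbit \<open>P (t n) f\<close>
  bounded, against uniform boundedness. The times are positive since \<open>P 0\<close> is the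
  identity up to null elements.\<close>

lemma c0_locally_bounded:
  assumes P: "c0 P"
  shows "\<exists>\<delta>>0. \<exists>C. \<forall>t. 0 \<le> t \<and> t \<le> \<delta> \<longrightarrow> (\<forall>f\<in>X. nrm (P t f) \<le> C * nrm f)"
proof (rule ccontr)
  note P' = c0D[OF P]
  assume neg: "\<not> ?thesis"
  have "\<exists>t. 0 \<le> t \<and> t \<le> 1 / real (Suc n) \<and> \<not> (\<forall>f\<in>X. nrm (P t f) \<le> 4 ^ n * nrm f)" for n
    using neg by (metis divide_pos_pos of_nat_0_less_iff zero_less_Suc zero_less_one)
  then obtain t where t: "\<And>n. 0 \<le> t n" "\<And>n. t n \<le> 1 / real (Suc n)"
    "\<And>n. \<not> (\<forall>f\<in>X. nrm (P (t n) f) \<le> 4 ^ n * nrm f)" by metis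
  have t0: "t n > 0" for n
  proof (rule ccontr)
    assume "\<not> t n > 0"
    then have "t n = 0" using t(1)[of n] by simp
    have "nrm (P (t n) f) \<le> 4 ^ n * nrm f" if f: "f \<in> X" for f
    proof -
      have "nrm (P 0 f) \<le> nrm f" using nrm_le_add_diff[of "P 0 f" f] P'(1)[of 0 f] P'(4)[OF f] f by simp
      also have "\<dots> = 1 * nrm f" by simp
      also have "\<dots> \<le> 4 ^ n * nrm f" using f by (intro mult_right_mono) auto
      finally show ?thesis using \<open>t n = 0\<close> by simp
    qed
    then show False using t(3) by blast
  qed
  have "\<exists>n. \<forall>f\<in>X. nrm (P (t n) f) \<le> 4 ^ n * nrm f"
  proof (rule uniform_boundedness_geometric)
    fix f assume f: "f \<in> X"
    have "filterlim t (at_right 0) sequentially"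
      unfolding filterlim_at
    proof (intro conjI always_eventually allI)
      show "t \<longlonglongrightarrow> 0"
        by (rule tendsto_sandwich[OF _ _ tendsto_const LIMSEQ_Suc[OF lim_1_over_n]]) (use t in auto)
    qed (use t0 in \<open>auto simp: less_imp_neq[symmetric]\<close>)
    from filterlim_compose[OF P'(6)[OF f] this]
    have "(\<lambda>n. nrm (P (t n) f - f)) \<longlonglongrightarrow> 0" .
    then have "Bseq (\<lambda>n. nrm (P (t n) f - f))" using convergentI convergent_imp_Bseq by blast
    then obtain K where K: "\<And>n. \<bar>nrm (P (t n) f - f)\<bar> \<le> K" by (auto simp: Bseq_def)
    have "nrm (P (t n) f) \<le> nrm f + K" for n
      using nrm_le_add_diff[of "P (t n) f" f] P'(1)[OF t(1) f, of n] K[of n] f by simp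
    then show "\<exists>C. \<forall>n. nrm (P (t n) f) \<le> C" by blast
  qed (use P' t in auto)
  then show False using t(3) by blast
qed

end

section \<open>Uniqueness: each semigroup generated by the operator is the Euler limit\<close>

context m_dissipative
begin

text \<open>On the domain one Euler step and one step of \<open>P\<close> differ by
  \<open>o(h)\<close>. Summing \<open>2 ^ k\<close> such defects along the orbit needs two facts:
  \<open>P\<close> commutes with the resolvent, so that the defect at time \<open>j h\<close> is the
  initial defect transported by \<open>P (j h)\<close>, and \<open>P\<close> is bounded uniformly on
  the interval up to \<open>t\<close>.\<close>

theorem Euler_formula:
  assumes P: "c0 P" and gP: "gen P = A" and f: "f \<in> X" and t: "t > 0"
  shows "(\<lambda>k. nrm (E t k f - P t f)) \<longlonglongrightarrow> 0"
proof -
  note P' = c0D[OF P]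
  have Pdiff: "nrm (P s (x - y) - (P s x - P s y)) = 0" if "x \<in> X" "y \<in> X" "s \<ge> 0" for x y s
    using P'(2)[of s y x "-1"] that by simp
  have Pcong: "nrm (P s x - P s y) = 0" if xy: "nrm (x - y) = 0" "x \<in> X" "y \<in> X" "s \<ge> 0" for x y s
  proof -
    obtain B where B: "\<And>f. f \<in> X \<Longrightarrow> nrm (P s f) \<le> B * nrm f" using P'(3)[OF xy(4)] by blast
    have "nrm (P s (x - y)) \<le> 0" using B[of "x - y"] xy by simp
    moreover have "nrm (P s x - P s y) \<le> nrm (P s (x - y)) + nrm ((P s x - P s y) - P s (x - y))"
      using P'(1) xy by (intro nrm_le_add_diff) auto
    ultimately have "nrm (P s x - P s y) \<le> 0"
      using Pdiff[OF xy(2-4)] nrm_commute[of "P s x - P s y" "P s (x - y)"] P'(1) xy by simp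
    then show ?thesis using P'(1) xy by (intro nrm_le_imp0) auto
  qed
  obtain \<delta> C0 where \<delta>: "\<delta> > 0" and C0: "\<And>s f. 0 \<le> s \<Longrightarrow> s \<le> \<delta> \<Longrightarrow> f \<in> X \<Longrightarrow> nrm (P s f) \<le> C0 * nrm f"
    using c0_locally_bounded[OF P] by blast
  define C1 where "C1 = max C0 1"
  have C1: "C1 \<ge> 1" "\<And>s f. 0 \<le> s \<Longrightarrow> s \<le> \<delta> \<Longrightarrow> f \<in> X \<Longrightarrow> nrm (P s f) \<le> C1 * nrm f"
    by (simp add: C1_def) (rule order_trans[OF C0], auto simp: C1_def intro!: mult_right_mono)
  have multi: "nrm (P (real n * s) f) \<le> C1 ^ n * nrm f" if "0 \<le> s" "s \<le> \<delta>" "f \<in> X" for n s f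
    using that
  proof (induction n)
    case 0
    then show ?case using nrm_le_add_diff[of "P 0 f" f] P'(1)[of 0 f] P'(4)[of f] by simp
  next
    case (Suc n)
    let ?y = "P (real n * s) f"
    have y: "?y \<in> X" "P s ?y \<in> X" using P'(1) Suc.prems by auto
    have "nrm (P (real (Suc n) * s) f) \<le> nrm (P s ?y) + nrm (P (real (Suc n) * s) f - P s ?y)"
      using y P'(1) Suc.prems by (intro nrm_le_add_diff) auto
    also have "nrm (P (real (Suc n) * s) f - P s ?y) = 0"
      using P'(5)[of s "real n * s" f] Suc.prems by (simp add: algebra_simps)
    also have "nrm (P s ?y) \<le> C1 * nrm ?y" using C1(2) y Suc.prems by simp
    also have "\<dots> \<le> C1 * (C1 ^ n * nrm f)" using Suc C1(1) by (intro mult_left_mono) auto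
    finally show ?case by (simp add: mult.assoc)
  qed
  \<comment> \<open>Every time up to \<open>t\<close> is reached by \<open>N\<close> equal steps of
    length at most \<open>\<delta>\<close>, so a single constant \<open>C\<close> bounds
    \<open>P\<close> there.\<close>
  obtain N where N: "t / \<delta> \<le> real N" using real_arch_simple by blast
  define C where "C = C1 ^ N"
  have C: "C \<ge> 1" using C1 by (simp add: C_def)
  have N0: "real N > 0" using N t \<delta> by (smt (verit) divide_pos_pos)
  have bound: "nrm (P s f) \<le> C * nrm f" if "0 \<le> s" "s \<le> t" "f \<in> X" for s f
  proof -
    have "s \<le> real N * \<delta>" using that N \<delta> by (simp add: field_simps)
    then have "s / real N \<le> \<delta>" using N0 by (simp add: field_simps)
    from multi[OF _ this that(3), of N] show ?thesis using that N0 by (simp add: C_def)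
  qed
  \<comment> \<open>\<open>P s\<close> commutes with \<open>P h\<close>, hence carries the
    difference quotients at \<open>x\<close> to those at \<open>P s x\<close>, and so preserves the
    generator.\<close>
  have PA: "(P s x, P s y) \<in> A" if xy: "(x, y) \<in> A" and s: "s \<ge> 0" for s x y
  proof -
    have X: "x \<in> X" "y \<in> X" using A_X xy by auto
    have lim: "((\<lambda>h. nrm ((1 / h) *\<^sub>R (P h x - x) - y)) \<longlongrightarrow> 0) (at_right 0)"
      using xy gP by (auto simp: gen_def)
    obtain B where B: "\<And>f. f \<in> X \<Longrightarrow> nrm (P s f) \<le> B * nrm f" using P'(3)[OF s] by blast
    have "((\<lambda>h. nrm ((1 / h) *\<^sub>R (P h (P s x) - P s x) - P s y)) \<longlongrightarrow> 0) (at_right 0)"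
    proof (rule Lim_null_comparison)
      show "((\<lambda>h. B * nrm ((1 / h) *\<^sub>R (P h x - x) - y)) \<longlongrightarrow> 0) (at_right 0)"
        using tendsto_mult_right_zero[OF lim] .
      have "nrm ((1 / h) *\<^sub>R (P h (P s x) - P s x) - P s y) \<le> B * nrm ((1 / h) *\<^sub>R (P h x - x) - y)" if h: "h > 0" for h
      proof -
        let ?z = "(1 / h) *\<^sub>R (P h x - x) - y"
        have PX: "P h x \<in> X" "P s x \<in> X" "P s y \<in> X" "P h (P s x) \<in> X" "P s (P h x) \<in> X" "?z \<in> X"
          "P s (P h x - x) \<in> X" "P s ?z \<in> X" "P (h + s) x \<in> X"
          using P'(1) X s h by auto
        have 1: "nrm (P s ?z - ((1 / h) *\<^sub>R P s (P h x - x) - P s y)) = 0"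
        proof -
          have "nrm (P s ?z - (P s ((1 / h) *\<^sub>R (P h x - x)) - P s y)) = 0"
            using Pdiff[of "(1 / h) *\<^sub>R (P h x - x)" y s] PX X s by simp
          moreover have "nrm (P s ((1 / h) *\<^sub>R (P h x - x) + 0) - ((1 / h) *\<^sub>R P s (P h x - x) + P s 0)) = 0"
            using P'(2)[of s "P h x - x" 0 "1 / h"] PX X s by simp
          moreover have "nrm (P s 0) = 0" using bound B[of 0] P'(1)[of s 0] s by (intro nrm_le_imp0) auto
          then have "nrm (((1 / h) *\<^sub>R P s (P h x - x) + P s 0) - (1 / h) *\<^sub>R P s (P h x - x)) = 0" by simp
          ultimately have "nrm (P s ((1 / h) *\<^sub>R (P h x - x)) - (1 / h) *\<^sub>R P s (P h x - x)) = 0"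
            using nrm0_trans[of "P s ((1 / h) *\<^sub>R (P h x - x))" "(1 / h) *\<^sub>R P s (P h x - x) + P s 0" "(1 / h) *\<^sub>R P s (P h x - x)"]
              P'(1) PX X s by simp
          then have "nrm ((P s ((1 / h) *\<^sub>R (P h x - x)) - P s y) - ((1 / h) *\<^sub>R P s (P h x - x) - P s y)) = 0" by simp
          from nrm0_trans[OF \<open>nrm (P s ?z - (P s ((1 / h) *\<^sub>R (P h x - x)) - P s y)) = 0\<close> this]
          show ?thesis using P'(1) PX X s by simp
        qed
        have 2: "nrm (P s (P h x - x) - (P s (P h x) - P s x)) = 0" using Pdiff PX X s by simp
        have 3: "nrm (P s (P h x) - P h (P s x)) = 0"
          using nrm0_trans[OF nrm0_sym[OF P'(5)[of s h x]] P'(5)[of h s x, unfolded add.commute[of h s]]] PX X s h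
          by (simp add: add.commute)
        \<comment> \<open>All terms subtracted from \<open>P s ?z\<close> are null; they account for
          linearity and commutation holding only up to norm zero.\<close>
        have eq: "(1 / h) *\<^sub>R (P h (P s x) - P s x) - P s y = P s ?z -
          ((P s ?z - ((1 / h) *\<^sub>R P s (P h x - x) - P s y)) + ((1 / h) *\<^sub>R (P s (P h x - x) - (P s (P h x) - P s x)) +
           (1 / h) *\<^sub>R (P s (P h x) - P h (P s x))))"
          by (simp add: algebra_simps)
        have "nrm ((1 / h) *\<^sub>R (P h (P s x) - P s x) - P s y) \<le> nrm (P s ?z) +
          (nrm (P s ?z - ((1 / h) *\<^sub>R P s (P h x - x) - P s y)) + (nrm ((1 / h) *\<^sub>R (P s (P h x - x) - (P s (P h x) - P s x))) +
           nrm ((1 / h) *\<^sub>R (P s (P h x) - P h (P s x)))))"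
          unfolding eq using PX X
          by (intro order_trans[OF nrm_diff_triangle] add_left_mono order_trans[OF nrm_triangle] order_refl) auto
        also have "\<dots> = nrm (P s ?z)"
          using 1 2 3 PX by (simp add: nrm_scale)
        also have "\<dots> \<le> B * nrm ?z" using B PX by blast
        finally show ?thesis .
      qed
      then show "\<forall>\<^sub>F h in at_right 0. norm (nrm ((1 / h) *\<^sub>R (P h (P s x) - P s x) - P s y))
        \<le> B * nrm ((1 / h) *\<^sub>R (P h x - x) - y)"
        using P'(1) X s by (intro eventually_at_rightI[of 0 1]) (auto simp: abs_of_nonneg)
    qed
    then have "(P s x, P s y) \<in> gen P" using P'(1) X s by (simp add: gen_def)
    then show ?thesis using gP by simp
  qed
  \<comment> \<open>By \<open>PA\<close>, \<open>P s (R h x)\<close> together with the image of the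
    other component solves the resolvent equation for \<open>P s x\<close>.\<close>
  have PR: "nrm (R h (P s x) - P s (R h x)) = 0" if x: "x \<in> X" and h: "h > 0" and s: "s \<ge> 0" for x h s
  proof -
    let ?u = "R h x" and ?w = "(1 / h) *\<^sub>R (R h x - x)"
    have uw: "(P s ?u, P s ?w) \<in> A" using PA R_A x h s by blast
    have X: "?u \<in> X" "?w \<in> X" "P s ?u \<in> X" "P s ?w \<in> X" "P s x \<in> X" using x h s P'(1) by auto
    have "nrm (R h (P s x) - P s ?u) \<le> nrm (P s x - (P s ?u - h *\<^sub>R P s ?w))"
      by (rule R_near[OF uw]) (use X h in auto)
    also have "P s x - (P s ?u - h *\<^sub>R P s ?w) = (h *\<^sub>R P s ?w + P s x) - P s (h *\<^sub>R ?w + x)"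
      using h by simp
    also have "nrm \<dots> = 0"
      using nrm0_sym[OF P'(2)[of s ?w x h]] X x h s P'(1) by simp
    finally show ?thesis using X h by (intro nrm_le_imp0) auto
  qed
  have tend: "(\<lambda>k. nrm (E t k u - P t u)) \<longlonglongrightarrow> 0" if ug: "(u, g) \<in> A" for u g
  proof (rule Lim_null_comparison)
    have X: "u \<in> X" "g \<in> X" using A_X ug by auto
    \<comment> \<open>\<open>h * F h\<close> bounds the one-step error at \<open>u\<close>: the
      difference quotients of \<open>P\<close> and of the resolvent both tend to
      \<open>g\<close>.\<close>
    define F where "F h = nrm ((1 / h) *\<^sub>R (P h u - u) - g) + nrm (R h g - g)" for h
    have "((\<lambda>h. nrm (R h g - g)) \<longlongrightarrow> 0) (at_right 0)"
      using X Rn_near_id[OF _ _ X(2), of _ _ _ 1] by (intro near_dense_tendsto[OF X(2)]) auto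
    moreover have "((\<lambda>h. nrm ((1 / h) *\<^sub>R (P h u - u) - g)) \<longlongrightarrow> 0) (at_right 0)"
      using ug gP by (auto simp: gen_def)
    ultimately have F: "(F \<longlongrightarrow> 0) (at_right 0)" unfolding F_def by (auto intro: tendsto_add_zero)
    have "filterlim (\<lambda>k. t / 2 ^ k) (at_right 0) sequentially"
      unfolding filterlim_at
    proof (intro conjI always_eventually allI)
      show "(\<lambda>k. t / 2 ^ k) \<longlonglongrightarrow> 0"
        using tendsto_mult_right_zero[OF LIMSEQ_power_zero[of "1/2::real"], of t] by (simp add: power_one_over)
    qed (use t in auto)
    from filterlim_compose[OF F this] have "(\<lambda>k. F (t / 2 ^ k)) \<longlonglongrightarrow> 0" .
    then show "(\<lambda>k. t * C * F (t / 2 ^ k)) \<longlonglongrightarrow> 0" by (rule tendsto_mult_right_zero)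
    have "nrm (E t k u - P t u) \<le> t * C * F (t / 2 ^ k)" for k
    proof -
      define h where "h = t / 2 ^ k"
      have h: "h > 0" using t by (simp add: h_def)
      have d: "nrm (R h u - P h u) \<le> h * F h"
      proof -
        have PhX: "P h u \<in> X" using P'(1) X h by auto
        have "R h u - P h u = (- h) *\<^sub>R (R h g - (1 / h) *\<^sub>R (R h u - u)) + (h *\<^sub>R (R h g - g) + (- h) *\<^sub>R ((1 / h) *\<^sub>R (P h u - u) - g))"
          using h by (simp add: algebra_simps)
        also have "nrm \<dots> \<le> nrm ((- h) *\<^sub>R (R h g - (1 / h) *\<^sub>R (R h u - u))) + (nrm (h *\<^sub>R (R h g - g)) + nrm ((- h) *\<^sub>R ((1 / h) *\<^sub>R (P h u - u) - g)))"
          using X h PhX by (intro order_trans[OF nrm_triangle] add_left_mono order_refl nrm_triangle) auto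
        also have "nrm ((- h) *\<^sub>R (R h g - (1 / h) *\<^sub>R (R h u - u))) = 0"
          using R_quotient[OF ug h] X h by (subst nrm_scale) auto
        also have "nrm (h *\<^sub>R (R h g - g)) = h * nrm (R h g - g)" using X h by (subst nrm_scale) auto
        also have "nrm ((- h) *\<^sub>R ((1 / h) *\<^sub>R (P h u - u) - g)) = h * nrm ((1 / h) *\<^sub>R (P h u - u) - g)"
          using X h PhX by (subst nrm_scale) auto
        finally show ?thesis by (simp add: F_def algebra_simps)
      qed
      \<comment> \<open>Iterates of \<open>P h\<close> agree with \<open>P (real j * h)\<close> only
        up to null elements, and \<open>funpow_compare\<close> speaks of true iterates.\<close>
      have iter: "(P h ^^ j) u \<in> X \<and> nrm ((P h ^^ j) u - P (real j * h) u) = 0" for j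
      proof (induction j)
        case 0
        then show ?case using P'(4)[OF X(1)] P'(1)[of 0 u] X by (simp add: nrm_commute)
      next
        case (Suc j)
        have jX: "(P h ^^ j) u \<in> X" "P (real j * h) u \<in> X" using Suc P'(1) X h by auto
        have "nrm (P h ((P h ^^ j) u) - P h (P (real j * h) u)) = 0"
          using Pcong[OF conjunct2[OF Suc]] jX h by simp
        moreover have "nrm (P h (P (real j * h) u) - P (h + real j * h) u) = 0"
          using nrm0_sym[OF P'(5)[of h "real j * h" u]] P'(1) jX X h by simp
        ultimately have "nrm (P h ((P h ^^ j) u) - P (h + real j * h) u) = 0"
          by (rule nrm0_trans) (use P'(1) jX X h in auto)
        then show ?case using P'(1) jX h by (simp add: algebra_simps)
      qed
      have "nrm ((R h ^^ 2 ^ k) u - (P h ^^ 2 ^ k) u) \<le> real (2 ^ k) * (C * (h * F h))"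
      proof (rule funpow_compare)
        fix j :: nat assume j: "j < 2 ^ k"
        let ?x = "(P h ^^ j) u" and ?s = "real j * h"
        have sX: "?x \<in> X" "P ?s u \<in> X" "R h u \<in> X" "P h u \<in> X" "P ?s (R h u) \<in> X" "P ?s (P h u) \<in> X"
          "R h ?x \<in> X" "P h ?x \<in> X" "R h (P ?s u) \<in> X" "P h (P ?s u) \<in> X"
          using iter[of j] P'(1) X h by auto
        have "real j < 2 ^ k" using j by (metis of_nat_less_iff of_nat_numeral of_nat_power)
        then have st: "?s \<le> t" using t h by (simp add: h_def field_simps)
        have s0: "?s \<ge> 0" using h by simp
        have x: "nrm (?x - P ?s u) = 0" using iter by blast
        have "nrm (R h ?x - R h (P ?s u)) \<le> 0" using R_nonexpansive[of ?x "P ?s u" h] x sX h by simp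
        then have "nrm (R h ?x - R h (P ?s u)) = 0" by (intro nrm_le_imp0) (use sX in auto)
        from nrm0_trans[OF this PR[OF X(1) h s0]] have 1: "nrm (R h ?x - P ?s (R h u)) = 0"
          using sX by simp
        have "nrm (P h ?x - P h (P ?s u)) = 0" using Pcong[OF x] sX h by simp
        moreover have "nrm (P h (P ?s u) - P (h + ?s) u) = 0"
          using nrm0_sym[OF P'(5)[of h ?s u]] sX X P'(1) h by simp
        ultimately have "nrm (P h ?x - P (h + ?s) u) = 0"
          by (rule nrm0_trans) (use sX X P'(1) h in auto)
        moreover have "nrm (P (h + ?s) u - P ?s (P h u)) = 0"
          using P'(5)[of ?s h u] X h by (simp add: add.commute)
        ultimately have 2: "nrm (P h ?x - P ?s (P h u)) = 0"
          by (rule nrm0_trans) (use sX X P'(1) h in auto)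
        have 3: "nrm (P ?s (R h u - P h u) - (P ?s (R h u) - P ?s (P h u))) = 0"
          using Pdiff sX s0 by simp
        have rX: "P ?s (R h u - P h u) \<in> X" using P'(1) sX s0 by simp
        \<comment> \<open>The defect at time \<open>?s\<close> is \<open>P ?s\<close> applied to the
          defect at time 0; the other terms are null by \<open>1\<close>, \<open>2\<close> and
          \<open>3\<close>.\<close>
        have eq: "R h ?x - P h ?x = P ?s (R h u - P h u) - ((P ?s (R h u - P h u) - (P ?s (R h u) - P ?s (P h u))) +
            ((P h ?x - P ?s (P h u)) - (R h ?x - P ?s (R h u))))" by simp
        have "nrm (R h ?x - P h ?x) \<le> nrm (P ?s (R h u - P h u)) + (nrm (P ?s (R h u - P h u) - (P ?s (R h u) - P ?s (P h u))) +
            (nrm (P h ?x - P ?s (P h u)) + nrm (R h ?x - P ?s (R h u))))"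
          unfolding eq
          using sX rX by (intro nrm_diff_add_diff) auto
        also have "\<dots> = nrm (P ?s (R h u - P h u))" by (simp only: 1 2 3)
        also have "\<dots> \<le> C * nrm (R h u - P h u)"
          by (rule bound[OF s0 st]) (use sX in simp)
        also have "\<dots> \<le> C * (h * F h)"
          by (rule mult_left_mono[OF d]) (use C in simp)
        finally show "nrm (R h ?x - P h ?x) \<le> C * (h * F h)" .
      next
        show "nrm (R h x - R h y) \<le> nrm (x - y)" if "x \<in> X" "y \<in> X" for x y
          by (rule R_nonexpansive[OF that h])
        show "P h x \<in> X" if "x \<in> X" for x by (rule P'(1)) (use that h in auto)
      qed (use X h in auto)
      also have "real (2 ^ k) * (C * (h * F h)) = t * C * F h" by (simp add: h_def)
      finally have 1: "nrm ((R h ^^ 2 ^ k) u - (P h ^^ 2 ^ k) u) \<le> t * C * F h" .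
      have "real (2 ^ k) * h = t" by (simp add: h_def)
      then have 2: "nrm ((P h ^^ 2 ^ k) u - P t u) = 0" "(P h ^^ 2 ^ k) u \<in> X" using iter[of "2 ^ k"] by auto
      have "nrm ((R h ^^ 2 ^ k) u - P t u) \<le> t * C * F h"
        using nrm_triangle_diff[of "(R h ^^ 2 ^ k) u" "(P h ^^ 2 ^ k) u" "P t u"] 1 2 X h t P'(1) by simp
      then show ?thesis by (simp add: E_def h_def)
    qed
    then show "\<forall>\<^sub>F k in sequentially. norm (nrm (E t k u - P t u)) \<le> t * C * F (t / 2 ^ k)"
      using X t P'(1) by (simp add: abs_of_nonneg)
  qed
  show ?thesis
  proof (rule LIMSEQ_I)
    fix r :: real assume r: "r > 0"
    \<comment> \<open>The error of replacing \<open>f\<close> by \<open>u\<close> enters once with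
      factor 1 and once with factor \<open>C\<close>; as \<open>C \<ge> 1\<close>, both together
      stay below \<open>r / 2\<close>.\<close>
    obtain u g where ug: "(u, g) \<in> A" "nrm (f - u) < r / (4 * C)" using A_dense[OF f, of "r / (4 * C)"] r C by auto
    have uX: "u \<in> X" using A_X ug by auto
    obtain k0 where k0: "\<And>k. k \<ge> k0 \<Longrightarrow> nrm (E t k u - P t u) < r / 2"
      using LIMSEQ_D[OF tend[OF ug(1)], of "r / 2"] r by (metis abs_less_iff diff_zero half_gt_zero real_norm_def)
    have "C * nrm (f - u) < r / 4" using ug(2) C by (simp add: field_simps)
    moreover have "1 * nrm (f - u) \<le> C * nrm (f - u)" using C f uX by (intro mult_right_mono) auto
    ultimately have small: "nrm (f - u) + C * nrm (f - u) < r / 2" by linarith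
    have "nrm (E t k f - P t f) < r" if k: "k \<ge> k0" for k
    proof -
      have PX: "P t u \<in> X" "P t f \<in> X" using P'(1) uX f t by auto
      have 1: "nrm (E t k f - P t f) \<le> nrm (E t k f - E t k u) + nrm (E t k u - P t f)"
        using f uX t PX by (intro nrm_triangle_diff) auto
      have 2: "nrm (E t k u - P t f) \<le> nrm (E t k u - P t u) + nrm (P t u - P t f)"
        using f uX t PX by (intro nrm_triangle_diff) auto
      have 3: "nrm (P t u - P t f) \<le> nrm (P t (u - f)) + nrm ((P t u - P t f) - P t (u - f))"
        using f uX t PX P'(1) by (intro nrm_le_add_diff) auto
      have 4: "nrm ((P t u - P t f) - P t (u - f)) = 0"
        by (rule nrm0_sym[OF Pdiff[OF uX f]]) (use t PX P'(1) uX f in auto)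
      have 5: "nrm (P t (u - f)) \<le> C * nrm (f - u)"
        using bound[of t "u - f"] nrm_commute[OF uX f] f uX t by simp
      have 6: "nrm (E t k f - E t k u) \<le> nrm (f - u)" by (rule E_nonexpansive[OF f uX t])
      show ?thesis using 1 2 3 4 5 6 k0[OF k] small by linarith
    qed
    then show "\<exists>k0. \<forall>k\<ge>k0. norm (nrm (E t k f - P t f) - 0) < r"
      using f t P'(1) by (auto simp: abs_of_nonneg)
  qed
qed

end

section \<open>Bounded operators that intertwine two semigroups\<close>

locale intertwined = P: m_dissipative X ip A + Q: m_dissipative Y iq B
  for X :: "'v::real_vector set" and ip A and Y :: "'w::real_vector set" and iq B +
  fixes U :: "'v \<Rightarrow> 'w" and K :: real
  assumes U_Y: "x \<in> X \<Longrightarrow> U x \<in> Y"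
    and U_linear: "x \<in> X \<Longrightarrow> y \<in> X \<Longrightarrow> U (c *\<^sub>R x + y) = c *\<^sub>R U x + U y"
    and U_bound: "x \<in> X \<Longrightarrow> Q.nrm (U x) \<le> K * P.nrm x"
    and U_A: "(x, y) \<in> A \<Longrightarrow> (U x, U y) \<in> B"
begin

lemma U_diff: "x \<in> X \<Longrightarrow> y \<in> X \<Longrightarrow> U (x - y) = U x - U y"
  using U_linear[of y x "-1"] by simp

text \<open>The image under \<open>U\<close> of the resolvent equation for \<open>f\<close> is the
  resolvent equation for \<open>U f\<close>, whose solution is unique up to null elements. Hence
  inclusion of the graph of \<open>A\<close> in that of \<open>B\<close> under \<open>U\<close> is
  all that enters.\<close>

lemma U_R:
  assumes f: "f \<in> X" and m: "\<mu> > 0"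
  shows "Q.nrm (U (P.R \<mu> f) - Q.R \<mu> (U f)) = 0"
proof -
  have uw: "(U (P.R \<mu> f), U ((1 / \<mu>) *\<^sub>R (P.R \<mu> f - f))) \<in> B" by (rule U_A[OF P.R_A[OF f m]])
  define w where "w = (1 / \<mu>) *\<^sub>R (P.R \<mu> f - f)"
  have w: "w \<in> X" "P.R \<mu> f = \<mu> *\<^sub>R w + f" using f m by (auto simp: w_def)
  have "U (\<mu> *\<^sub>R w + f) = \<mu> *\<^sub>R U w + U f" by (rule U_linear[OF w(1) f])
  then have z: "U f - (U (P.R \<mu> f) - \<mu> *\<^sub>R U w) = 0" unfolding w(2) by simp
  have "Q.nrm (Q.R \<mu> (U f) - U (P.R \<mu> f)) \<le> 0"
    using Q.R_near[OF uw[folded w_def] U_Y[OF f] m] unfolding z by simp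
  then have "Q.nrm (Q.R \<mu> (U f) - U (P.R \<mu> f)) = 0" using U_Y f m by (intro Q.nrm_le_imp0) auto
  then show ?thesis by (rule Q.nrm0_sym) (use U_Y f m in auto)
qed

lemma U_Rn:
  assumes f: "f \<in> X" and m: "\<mu> > 0"
  shows "Q.nrm (U ((P.R \<mu> ^^ n) f) - (Q.R \<mu> ^^ n) (U f)) = 0"
proof (induction n)
  case 0
  then show ?case by simp
next
  case (Suc n)
  let ?x = "(P.R \<mu> ^^ n) f" and ?y = "(Q.R \<mu> ^^ n) (U f)"
  have X: "?x \<in> X" "?y \<in> Y" "U ?x \<in> Y" using U_Y f m by auto
  have "Q.nrm (Q.R \<mu> (U ?x) - Q.R \<mu> ?y) \<le> 0"
    using Q.R_nonexpansive[of "U ?x" ?y \<mu>] Suc X m by simp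
  then have "Q.nrm (Q.R \<mu> (U ?x) - Q.R \<mu> ?y) = 0" using X m by (intro Q.nrm_le_imp0) auto
  from Q.nrm0_trans[OF U_R[OF X(1) m] this] show ?case using X U_Y m by simp
qed

text \<open>\<open>U\<close> intertwines the Euler approximations up to null elements and is
  continuous, so the two Euler limits are intertwined as well.\<close>

theorem U_semigroup:
  assumes S: "P.c0 S" "P.gen S = A" and T: "Q.c0 T" "Q.gen T = B" and f: "f \<in> X" and t: "t \<ge> 0"
  shows "Q.nrm (U (S t f) - T t (U f)) = 0"
proof (cases "t = 0")
  case True
  have X: "S 0 f \<in> X" "T 0 (U f) \<in> Y" "U (S 0 f) \<in> Y" "U f \<in> Y"
    by (rule P.c0D(1)[OF S(1)] Q.c0D(1)[OF T(1)] f U_Y order_refl)+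
  have "Q.nrm (U (S 0 f) - U f) \<le> 0"
    using U_bound[OF P.X_closed(3)[OF X(1) f]] unfolding U_diff[OF X(1) f] P.c0D(4)[OF S(1) f] by simp
  then have "Q.nrm (U (S 0 f) - U f) = 0" using X by (intro Q.nrm_le_imp0) auto
  moreover have "Q.nrm (U f - T 0 (U f)) = 0"
    using Q.nrm0_sym[OF Q.c0D(4)[OF T(1) X(4)] X(2,4)] .
  ultimately have "Q.nrm (U (S 0 f) - T 0 (U f)) = 0" by (rule Q.nrm0_trans) (fact X)+
  then show ?thesis using True by simp
next
  case False
  then have t: "t > 0" using t by simp
  have X: "S t f \<in> X" "T t (U f) \<in> Y" "U (S t f) \<in> Y" "U f \<in> Y"
    by (rule P.c0D(1)[OF S(1)] Q.c0D(1)[OF T(1)] f U_Y less_imp_le[OF t])+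
  show ?thesis
  proof (rule Q.limit_unique)
    show "(\<lambda>k. Q.nrm (U (P.E t k f) - U (S t f))) \<longlonglongrightarrow> 0"
    proof (rule Lim_null_comparison)
      show "(\<lambda>k. K * P.nrm (P.E t k f - S t f)) \<longlonglongrightarrow> 0"
        using tendsto_mult_right_zero[OF P.Euler_formula[OF S f t]] .
      have "norm (Q.nrm (U (P.E t k f) - U (S t f))) \<le> K * P.nrm (P.E t k f - S t f)" for k
        using U_bound[of "P.E t k f - S t f"] f t X U_Y by (simp add: U_diff)
      then show "\<forall>\<^sub>F k in sequentially. norm (Q.nrm (U (P.E t k f) - U (S t f))) \<le> K * P.nrm (P.E t k f - S t f)"
        by simp
    qed
    have "Q.nrm (U (P.E t k f) - T t (U f)) = Q.nrm (Q.E t k (U f) - T t (U f))" for k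
    proof -
      have z: "Q.nrm (U (P.E t k f) - Q.E t k (U f)) = 0"
        unfolding P.E_def Q.E_def using U_Rn f t by simp
      have "U (P.E t k f) \<in> Y" "Q.E t k (U f) \<in> Y" using f t U_Y by auto
      then show ?thesis
        using Q.nrm_triangle_diff[of "U (P.E t k f)" "Q.E t k (U f)" "T t (U f)"]
          Q.nrm_triangle_diff[of "Q.E t k (U f)" "U (P.E t k f)" "T t (U f)"]
          Q.nrm0_sym[OF z] z X by simp
    qed
    then show "(\<lambda>k. Q.nrm (U (P.E t k f) - T t (U f))) \<longlonglongrightarrow> 0"
      using Q.Euler_formula[OF T X(4) t] by simp
  qed (use X f t U_Y in auto)
qed

end

text \<open>Lets sets of complex-valued functions serve as the spaces \<open>X\<close> and
  \<open>Y\<close> of the abstract theory.\<close>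

instantiation "fun" :: (type, real_vector) real_vector
begin

definition scaleR_fun_def: "c *\<^sub>R f = (\<lambda>x. c *\<^sub>R f x)"

instance
  by standard (simp_all add: scaleR_fun_def fun_eq_iff scaleR_add_left scaleR_add_right)

end

lemma scaleR_fun_apply [simp]: "(c *\<^sub>R f) x = c *\<^sub>R f x"
  by (simp add: scaleR_fun_def)

subsection \<open>The Hilbert space of square-integrable functions\<close>

lemma L2D: "f \<in> L2 M \<Longrightarrow> f \<in> borel_measurable M" "f \<in> L2 M \<Longrightarrow> integrable M (\<lambda>x. (cmod (f x))\<^sup>2)"
  by (auto simp: L2_def)

lemma L2_mult_integrable:
  assumes f: "f \<in> L2 M" and g: "g \<in> L2 M"
  shows "integrable M (\<lambda>x. f x * g x)"
proof (rule Bochner_Integration.integrable_bound)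
  show "integrable M (\<lambda>x. (cmod (f x))\<^sup>2 + (cmod (g x))\<^sup>2)" using L2D(2)[OF f] L2D(2)[OF g] by simp
  show "(\<lambda>x. f x * g x) \<in> borel_measurable M" using L2D(1)[OF f] L2D(1)[OF g] by measurable
  have "a * b \<le> a\<^sup>2 + b\<^sup>2" for a b :: real
    using sum_squares_bound[of a b] zero_le_power2[of a] zero_le_power2[of b] by linarith
  then show "AE x in M. norm (f x * g x) \<le> norm ((cmod (f x))\<^sup>2 + (cmod (g x))\<^sup>2)"
    by (auto simp: norm_mult)
qed

lemma L2_cnj: "f \<in> L2 M \<Longrightarrow> (\<lambda>x. cnj (f x)) \<in> L2 M"
  by (auto simp: L2_def intro!: borel_measurable_continuous_on[where f = cnj] continuous_intros)

lemma L2_inner_integrable: "f \<in> L2 M \<Longrightarrow> g \<in> L2 M \<Longrightarrow> integrable M (\<lambda>x. f x * cnj (g x))"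
  by (rule L2_mult_integrable) (auto intro: L2_cnj)

lemma L2_scale: 
  assumes "f \<in> L2 M" 
  shows "(\<lambda>x. c * f x) \<in> L2 M"
  using assms by (auto simp: L2_def norm_mult power_mult_distrib)

lemma L2_add:
  assumes f: "f \<in> L2 M" and g: "g \<in> L2 M"
  shows "(\<lambda>x. f x + g x) \<in> L2 M"
proof -
  have "integrable M (\<lambda>x. (cmod (f x + g x))\<^sup>2)"
  proof (rule Bochner_Integration.integrable_bound)
    show "integrable M (\<lambda>x. 2 * (cmod (f x))\<^sup>2 + 2 * (cmod (g x))\<^sup>2)" using L2D(2)[OF f] L2D(2)[OF g] by simp
    show "(\<lambda>x. (cmod (f x + g x))\<^sup>2) \<in> borel_measurable M" using L2D(1)[OF f] L2D(1)[OF g] by measurable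
    have "(cmod (a + b))\<^sup>2 \<le> 2 * (cmod a)\<^sup>2 + 2 * (cmod b)\<^sup>2" for a b
    proof -
      have "(cmod (a + b))\<^sup>2 \<le> (cmod a + cmod b)\<^sup>2" by (intro power_mono norm_triangle_ineq) auto
      also have "\<dots> \<le> 2 * (cmod a)\<^sup>2 + 2 * (cmod b)\<^sup>2"
        using sum_squares_bound[of "cmod a" "cmod b"] by (simp add: power2_sum)
      finally show ?thesis .
    qed
    then show "AE x in M. norm ((cmod (f x + g x))\<^sup>2) \<le> norm (2 * (cmod (f x))\<^sup>2 + 2 * (cmod (g x))\<^sup>2)"
      by auto
  qed
  then show ?thesis using L2D(1)[OF f] L2D(1)[OF g] by (auto simp: L2_def)
qed

lemma L2_diff: "f \<in> L2 M \<Longrightarrow> g \<in> L2 M \<Longrightarrow> (\<lambda>x. f x - g x) \<in> L2 M"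
  using L2_add[of f M "\<lambda>x. -1 * g x"] L2_scale[of g M "-1"] by simp

lemma L2_zero: "(\<lambda>x. 0) \<in> L2 M"
  by (simp add: L2_def)

lemma L2_minus: "f \<in> L2 M \<Longrightarrow> (\<lambda>x. - f x) \<in> L2 M"
  using L2_scale[of f M "-1"] by simp

lemma L2_of_real_norm: "f \<in> L2 M \<Longrightarrow> (\<lambda>x. of_real (cmod (f x))) \<in> L2 M"
  by (auto simp: L2_def)

lemma L2_sum: "(\<And>i. i \<in> I \<Longrightarrow> f i \<in> L2 M) \<Longrightarrow> (\<lambda>x. \<Sum>i\<in>I. f i x) \<in> L2 M"
  by (induction I rule: infinite_finite_induct) (auto intro: L2_add L2_zero)

lemma L2_nn_iff:
  "f \<in> L2 M \<longleftrightarrow> f \<in> borel_measurable M \<and> (\<integral>\<^sup>+ x. ennreal ((cmod (f x))\<^sup>2) \<partial>M) < \<infinity>"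
  by (auto simp: L2_def integrable_iff_bounded)

lemma L2_nn_norm:
  "f \<in> L2 M \<Longrightarrow> (\<integral>\<^sup>+ x. ennreal ((cmod (f x))\<^sup>2) \<partial>M) = ennreal ((L2_norm M f)\<^sup>2)"
  by (simp add: L2_def L2_norm_def nn_integral_eq_integral)

text \<open>A real semi-inner product with the same norm. The complex inner product is recovered
  from it by testing with both \<open>g\<close> and \<open>\<i> g\<close>.\<close>

definition rip :: "'a measure \<Rightarrow> ('a \<Rightarrow> complex) \<Rightarrow> ('a \<Rightarrow> complex) \<Rightarrow> real" where
  "rip M f g = Re (L2_inner M f g)"

lemma rip_self: "rip M f f = (L2_norm M f)\<^sup>2"
proof -
  have "L2_inner M f f = (LINT x|M. complex_of_real ((cmod (f x))\<^sup>2))"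
    by (simp add: L2_inner_def complex_norm_square[symmetric] flip: of_real_power)
  then show ?thesis by (simp add: rip_def L2_norm_def del: of_real_power)
qed

lemma L2_inner_add_left:
  "f \<in> L2 M \<Longrightarrow> g \<in> L2 M \<Longrightarrow> h \<in> L2 M \<Longrightarrow>
    L2_inner M (\<lambda>x. f x + g x) h = L2_inner M f h + L2_inner M g h"
  by (simp add: L2_inner_def distrib_right L2_inner_integrable)

lemma L2_inner_scale_left: "L2_inner M (\<lambda>x. c * f x) h = c * L2_inner M f h"
  by (simp add: L2_inner_def mult.assoc)

lemma L2_inner_scale_right: "L2_inner M f (\<lambda>x. c * h x) = cnj c * L2_inner M f h"
  by (simp add: L2_inner_def mult.left_commute)

lemma L2_inner_cnj: "L2_inner M g f = cnj (L2_inner M f g)"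
  using Bochner_Integration.integral_cnj[of M "\<lambda>x. f x * cnj (g x)"] by (simp add: L2_inner_def mult.commute)

lemma L2_norm_nonneg [simp]: "0 \<le> L2_norm M f"
  by (simp add: L2_norm_def)

interpretation L2: semi_inner "L2 M" "rip M" for M :: "'a measure"
proof
  show "subspace (L2 M)"
    unfolding subspace_def plus_fun_def zero_fun_def scaleR_fun_def scaleR_conv_of_real
    by (auto intro: L2_add L2_scale L2_zero)
  fix f g h :: "'a \<Rightarrow> complex" and c :: real
  assume f: "f \<in> L2 M"
  show "0 \<le> rip M f f" by (simp add: rip_self)
  assume g: "g \<in> L2 M"
  show "rip M f g = rip M g f"
    unfolding rip_def by (subst L2_inner_cnj) simp
  show "rip M (c *\<^sub>R f) g = c * rip M f g"
    unfolding rip_def scaleR_fun_def scaleR_conv_of_real L2_inner_scale_left by simp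
  assume h: "h \<in> L2 M"
  show "rip M (f + g) h = rip M f h + rip M g h"
    unfolding rip_def plus_fun_def using L2_inner_add_left[OF f g h] by simp
qed

lemma L2_nrm: "L2.nrm M f = L2_norm M f"
  by (simp add: L2.nrm_def rip_self)

lemma L2_nrm_diff: "L2.nrm M (f - g) = L2_norm M (\<lambda>x. f x - g x)"
  by (simp add: L2_nrm fun_diff_def)

lemma L2_norm_eq_0_iff: "f \<in> L2 M \<Longrightarrow> L2_norm M f = 0 \<longleftrightarrow> (AE x in M. f x = 0)"
  by (simp add: L2_norm_def L2D integral_nonneg_eq_0_iff_AE)

lemma L2_nrm_eq_iff: "f \<in> L2 M \<Longrightarrow> g \<in> L2 M \<Longrightarrow> L2.nrm M (f - g) = 0 \<longleftrightarrow> (AE x in M. f x = g x)"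
  by (simp add: L2_nrm_diff L2_norm_eq_0_iff L2_diff)

lemma L2_norm_triangle:
  "f \<in> L2 M \<Longrightarrow> g \<in> L2 M \<Longrightarrow> L2_norm M (\<lambda>x. f x + g x) \<le> L2_norm M f + L2_norm M g"
  using L2.nrm_triangle[of f M g] by (simp add: L2_nrm L2_add plus_fun_def)

lemma L2_norm_scale: "L2_norm M (\<lambda>x. c * f x) = cmod c * L2_norm M f"
  by (simp add: L2_norm_def norm_mult power_mult_distrib real_sqrt_mult)

lemma L2_norm_of_real_norm: "L2_norm M (\<lambda>x. of_real (cmod (f x))) = L2_norm M f"
  by (simp add: L2_norm_def)

lemma L2_norm_sum_le:
  "finite I \<Longrightarrow> (\<And>i. i \<in> I \<Longrightarrow> f i \<in> L2 M) \<Longrightarrow> L2_norm M (\<lambda>x. \<Sum>i\<in>I. f i x) \<le> (\<Sum>i\<in>I. L2_norm M (f i))"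
proof (induction I rule: finite_induct)
  case empty
  then show ?case by (simp add: L2_norm_def)
next
  case (insert i I)
  have "L2_norm M (\<lambda>x. f i x + (\<Sum>j\<in>I. f j x)) \<le> L2_norm M (f i) + L2_norm M (\<lambda>x. \<Sum>j\<in>I. f j x)"
    using insert.prems by (intro L2_norm_triangle L2_sum) auto
  then show ?case using insert by fastforce
qed

text \<open>Multiplying \<open>f\<close> by a unimodular constant makes the inner product real and
  nonnegative, so that Cauchy-Schwarz for \<open>rip\<close> applies.\<close>

lemma L2_inner_le:
  assumes "f \<in> L2 M" "g \<in> L2 M"
  shows "cmod (L2_inner M f g) \<le> L2_norm M f * L2_norm M g"
proof -
  obtain c where c: "cmod c = 1" "c * L2_inner M f g = of_real (cmod (L2_inner M f g))"
  proof (cases "L2_inner M f g = 0")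
    case False
    show ?thesis
    proof (rule that)
      let ?z = "L2_inner M f g"
      show "cmod (cnj ?z / of_real (cmod ?z)) = 1" using False by (simp add: norm_divide)
      show "cnj ?z / of_real (cmod ?z) * ?z = of_real (cmod ?z)"
        using False complex_norm_square[of ?z] by (simp add: field_simps power2_eq_square)
    qed
  qed (auto intro: that[of 1])
  have "cmod (L2_inner M f g) = rip M (\<lambda>x. c * f x) g"
    by (simp add: rip_def L2_inner_scale_left c(2))
  also have "\<dots> \<le> L2.nrm M (\<lambda>x. c * f x) * L2.nrm M g"
    by (rule order_trans[OF abs_ge_self L2.Cauchy_Schwarz[OF L2_scale[OF assms(1)] assms(2)]])
  also have "\<dots> = L2_norm M f * L2_norm M g"
    using assms by (simp add: L2_nrm L2_scale L2_norm_scale c(1))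
  finally show ?thesis .
qed

lemma L2_norm_integral_le:
  assumes "f \<in> L2 M" "g \<in> L2 M"
  shows "cmod (LINT x|M. f x * g x) \<le> L2_norm M f * L2_norm M g"
  using L2_inner_le[OF assms(1) L2_cnj[OF assms(2)]] by (simp add: L2_inner_def L2_norm_def)

text \<open>Riesz-Fischer. The partial sums \<open>G n\<close> of the absolute increments have norm
  at most 2; by monotone convergence the increments are almost everywhere absolutely summable, which
  gives a pointwise limit.\<close>

lemma L2_complete_fast:
  fixes g :: "nat \<Rightarrow> 'a \<Rightarrow> complex"
  assumes g: "\<And>n. g n \<in> L2 M"
    and fast: "\<And>k. L2_norm M (\<lambda>x. g (Suc k) x - g k x) \<le> (1/2) ^ k"
  shows "\<exists>f \<in> L2 M. (\<lambda>n. L2_norm M (\<lambda>x. g n x - f x)) \<longlonglongrightarrow> 0"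
proof -
  have gm [measurable]: "g n \<in> borel_measurable M" for n by (rule L2D(1)[OF g])
  define d where "d k x = cmod (g (Suc k) x - g k x)" for k x
  have dm [measurable]: "d k \<in> borel_measurable M" for k unfolding d_def by measurable
  define G where "G n x = (\<Sum>k<n. d k x)" for n x
  have G0: "0 \<le> G n x" for n x by (simp add: G_def d_def sum_nonneg)
  have GL: "(\<lambda>x. of_real (G n x)) \<in> L2 M" for n
    unfolding G_def d_def of_real_sum using g by (intro L2_sum L2_of_real_norm L2_diff) auto
  have "L2_norm M (\<lambda>x. of_real (G n x)) \<le> 2" for n
  proof -
    have "L2_norm M (\<lambda>x. of_real (G n x)) \<le> (\<Sum>k<n. L2_norm M (\<lambda>x. of_real (cmod (g (Suc k) x - g k x))))"
      unfolding G_def d_def of_real_sum using g by (intro L2_norm_sum_le L2_of_real_norm L2_diff) auto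
    also have "\<dots> \<le> (\<Sum>k<n. (1/2) ^ k)" unfolding L2_norm_of_real_norm by (intro sum_mono fast)
    also have "\<dots> \<le> 2" by (simp add: geometric_sum)
    finally show ?thesis .
  qed
  then have "(L2_norm M (\<lambda>x. of_real (G n x)))\<^sup>2 \<le> 2\<^sup>2" for n by (intro power_mono) auto
  then have Gint: "(\<integral>\<^sup>+ x. ennreal ((G n x)\<^sup>2) \<partial>M) \<le> 4" for n
    using L2_nn_norm[OF GL, of n] by (simp add: ennreal_leI[of _ 4, simplified])
  have Gm [measurable]: "G n \<in> borel_measurable M" for n unfolding G_def by measurable
  have inc: "incseq (\<lambda>n x. ennreal ((G n x)\<^sup>2))"
    unfolding incseq_def le_fun_def using G0
    by (intro allI impI ennreal_leI power_mono) (auto simp: G_def d_def intro!: sum_mono2)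
  have "(\<integral>\<^sup>+ x. (SUP n. ennreal ((G n x)\<^sup>2)) \<partial>M) = (SUP n. \<integral>\<^sup>+ x. ennreal ((G n x)\<^sup>2) \<partial>M)"
    by (intro nn_integral_monotone_convergence_SUP inc) measurable
  also have "\<dots> \<le> 4" by (intro SUP_least Gint)
  finally have "(\<integral>\<^sup>+ x. (SUP n. ennreal ((G n x)\<^sup>2)) \<partial>M) < \<infinity>"
    by (rule le_less_trans) (simp add: ennreal_numeral[symmetric] del: ennreal_numeral)
  then have "(\<integral>\<^sup>+ x. (SUP n. ennreal ((G n x)\<^sup>2)) \<partial>M) \<noteq> \<infinity>" by simp
  then have "AE x in M. (SUP n. ennreal ((G n x)\<^sup>2)) \<noteq> \<infinity>"
    by (intro nn_integral_PInf_AE) measurable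
  then have conv: "AE x in M. convergent (\<lambda>n. g n x)"
  proof eventually_elim
    case (elim x)
    obtain B where B: "(SUP n. ennreal ((G n x)\<^sup>2)) = ennreal B" "B \<ge> 0"
      using elim by (cases "SUP n. ennreal ((G n x)\<^sup>2)") auto
    have "(G n x)\<^sup>2 \<le> B" for n
      using SUP_upper[of n UNIV "\<lambda>n. ennreal ((G n x)\<^sup>2)"] B by simp
    then have "G n x \<le> sqrt B" for n by (simp add: real_le_rsqrt)
    then have "summable (\<lambda>k. d k x)"
      by (intro bounded_imp_summable[where B = "sqrt B"])
        (auto simp: G_def d_def lessThan_Suc_atMost[symmetric] simp del: sum.lessThan_Suc)
    then have "summable (\<lambda>k. g (Suc k) x - g k x)" unfolding d_def by (rule summable_norm_cancel)
    then have "convergent (\<lambda>n. \<Sum>k<n. g (Suc k) x - g k x)" by (simp add: summable_iff_convergent)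
    then have "convergent (\<lambda>n. g n x - g 0 x)"
      by (simp only: sum_lessThan_telescope[of "\<lambda>k. g k x"])
    then have "convergent (\<lambda>n. (g n x - g 0 x) + g 0 x)"
      by (intro convergent_add convergent_const)
    then show ?case by simp
  qed
  define f where "f x = lim (\<lambda>n. g n x)" for x
  have fm [measurable]: "f \<in> borel_measurable M" unfolding f_def by measurable
  have far: "L2_norm M (\<lambda>x. g (m + j) x - g m x) \<le> 2 * (1/2) ^ m" for m j
  proof -
    have "L2_norm M (\<lambda>x. g (m + j) x - g m x) = L2_norm M (\<lambda>x. \<Sum>k<j. g (m + Suc k) x - g (m + k) x)"
    proof (rule arg_cong[where f = "L2_norm M"], rule ext)
      fix x
      show "g (m + j) x - g m x = (\<Sum>k<j. g (m + Suc k) x - g (m + k) x)"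
        using sum_lessThan_telescope[of "\<lambda>k. g (m + k) x" j] by simp
    qed
    also have "\<dots> \<le> (\<Sum>k<j. L2_norm M (\<lambda>x. g (m + Suc k) x - g (m + k) x))"
      using g by (intro L2_norm_sum_le L2_diff) auto
    also have "\<dots> \<le> (\<Sum>k<j. (1/2) ^ m * (1/2) ^ k)"
    proof (rule sum_mono)
      show "L2_norm M (\<lambda>x. g (m + Suc k) x - g (m + k) x) \<le> (1/2) ^ m * (1/2) ^ k" for k
        using fast[of "m + k"] by (simp add: power_add)
    qed
    also have "\<dots> = (1/2) ^ m * (\<Sum>k<j. (1/2) ^ k)" by (simp add: sum_distrib_left)
    also have "\<dots> \<le> (1/2) ^ m * 2" by (intro mult_left_mono) (auto simp: geometric_sum)
    finally show ?thesis by simp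
  qed
  have lim: "AE x in M. (\<lambda>n. g n x) \<longlonglongrightarrow> f x"
    using conv by eventually_elim (simp add: f_def convergent_LIMSEQ_iff)
  \<comment> \<open>Fatou's lemma along \<open>g (m + j)\<close> turns the uniform distance
    \<open>far\<close> into the distance of the limit from \<open>g m\<close>.\<close>
  have fat: "(\<integral>\<^sup>+ x. ennreal ((cmod (f x - g m x))\<^sup>2) \<partial>M) \<le> ennreal ((2 * (1/2) ^ m)\<^sup>2)" for m
  proof -
    have "(\<integral>\<^sup>+ x. ennreal ((cmod (f x - g m x))\<^sup>2) \<partial>M) =
      (\<integral>\<^sup>+ x. liminf (\<lambda>j. ennreal ((cmod (g (m + j) x - g m x))\<^sup>2)) \<partial>M)"
    proof (rule nn_integral_cong_AE)
      show "AE x in M. ennreal ((cmod (f x - g m x))\<^sup>2) = liminf (\<lambda>j. ennreal ((cmod (g (m + j) x - g m x))\<^sup>2))"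
        using lim
      proof eventually_elim
        case (elim x)
        have "(\<lambda>j. g (m + j) x) \<longlonglongrightarrow> f x" using LIMSEQ_ignore_initial_segment[OF elim, of m] by (simp add: add.commute)
        then have "(\<lambda>j. ennreal ((cmod (g (m + j) x - g m x))\<^sup>2)) \<longlonglongrightarrow> ennreal ((cmod (f x - g m x))\<^sup>2)"
          by (intro tendsto_ennrealI tendsto_intros)
        from lim_imp_Liminf[OF trivial_limit_sequentially this] show ?case by (rule sym)
      qed
    qed
    also have "\<dots> \<le> liminf (\<lambda>j. \<integral>\<^sup>+ x. ennreal ((cmod (g (m + j) x - g m x))\<^sup>2) \<partial>M)"
      by (rule nn_integral_liminf) measurable
    also have "\<dots> \<le> liminf (\<lambda>j. ennreal ((2 * (1/2) ^ m)\<^sup>2))"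
    proof (intro Liminf_mono always_eventually allI)
      fix j
      have "(L2_norm M (\<lambda>x. g (m + j) x - g m x))\<^sup>2 \<le> (2 * (1/2) ^ m)\<^sup>2"
        by (intro power_mono far) simp
      then show "(\<integral>\<^sup>+ x. ennreal ((cmod (g (m + j) x - g m x))\<^sup>2) \<partial>M) \<le> ennreal ((2 * (1/2) ^ m)\<^sup>2)"
        using L2_nn_norm[OF L2_diff[OF g[of "m + j"] g[of m]]] by (simp add: ennreal_leI)
    qed
    finally show ?thesis by (simp add: Liminf_const)
  qed
  have fgL: "(\<lambda>x. f x - g m x) \<in> L2 M" for m
    unfolding L2_nn_iff by (intro conjI le_less_trans[OF fat]) auto
  have "(\<lambda>x. (f x - g 0 x) + g 0 x) \<in> L2 M" using fgL g by (intro L2_add) auto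
  then have fL: "f \<in> L2 M" by simp
  have "L2_norm M (\<lambda>x. g m x - f x) \<le> 2 * (1/2) ^ m" for m
  proof -
    have "(L2_norm M (\<lambda>x. f x - g m x))\<^sup>2 \<le> (2 * (1/2) ^ m)\<^sup>2"
      using fat[of m] unfolding L2_nn_norm[OF fgL] by simp
    then have "L2_norm M (\<lambda>x. f x - g m x) \<le> 2 * (1/2) ^ m" by (rule power2_le_imp_le) simp
    then show ?thesis by (simp add: L2_norm_def norm_minus_commute)
  qed
  note le = this
  have "(\<lambda>m. 2 * (1/2) ^ m) \<longlonglongrightarrow> (0::real)"
    by (intro tendsto_mult_right_zero LIMSEQ_power_zero) simp
  then have "(\<lambda>m. L2_norm M (\<lambda>x. g m x - f x)) \<longlonglongrightarrow> 0"
    by (rule Lim_null_comparison[rotated]) (simp add: le)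
  then show ?thesis using fL by blast
qed

interpretation L2: semi_hilbert "L2 M" "rip M" for M :: "'a measure"
proof
  fix s :: "nat \<Rightarrow> 'a \<Rightarrow> complex"
  assume s: "\<And>n. s n \<in> L2 M"
    and C: "\<And>e. e > 0 \<Longrightarrow> \<exists>N. \<forall>m\<ge>N. \<forall>n\<ge>N. L2.nrm M (s m - s n) < e"
  have "\<exists>N. \<forall>m\<ge>N. \<forall>n\<ge>N. L2.nrm M (s m - s n) < (1/2) ^ k" for k :: nat using C by simp
  then obtain N where N: "\<And>k m n. m \<ge> N k \<Longrightarrow> n \<ge> N k \<Longrightarrow> L2.nrm M (s m - s n) < (1/2) ^ k" by metis
  \<comment> \<open>Summing the thresholds makes the index monotone, so that \<open>r k\<close> and
    \<open>r (Suc k)\<close> both exceed \<open>N k\<close>.\<close>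
  define r where "r k = (\<Sum>i\<le>k. N i)" for k
  have r: "r k \<ge> N k" "r (Suc k) \<ge> N k" for k
    using member_le_sum[of k "{..k}" N] by (auto simp: r_def intro: trans_le_add1)
  have "\<exists>f\<in>L2 M. (\<lambda>k. L2_norm M (\<lambda>x. s (r k) x - f x)) \<longlonglongrightarrow> 0"
  proof (rule L2_complete_fast)
    show "L2_norm M (\<lambda>x. s (r (Suc k)) x - s (r k) x) \<le> (1/2) ^ k" for k
      using N[OF r(2) r(1), of k] s by (simp add: L2_nrm_diff)
  qed (rule s)
  then obtain f where f: "f \<in> L2 M" "(\<lambda>k. L2.nrm M (s (r k) - f)) \<longlonglongrightarrow> 0"
    using s by (auto simp: L2_nrm_diff)
  have "(\<lambda>n. L2.nrm M (s n - f)) \<longlonglongrightarrow> 0"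
  proof (rule LIMSEQ_I)
    fix e :: real assume e: "e > 0"
    obtain k0 where k0: "\<forall>k\<ge>k0. norm (L2.nrm M (s (r k) - f) - 0) < e / 2"
      using LIMSEQ_D[OF f(2), of "e / 2"] e by auto
    obtain k1 where k1: "(1/2) ^ k1 < e / 2" using real_arch_pow_inv[of "e / 2" "1/2"] e by auto
    define k where "k = max k0 k1"
    have k: "k \<ge> k0" "k \<ge> k1" by (auto simp: k_def)
    have "L2.nrm M (s n - f) < e" if n: "n \<ge> N k" for n
    proof -
      have "L2.nrm M (s n - f) \<le> L2.nrm M (s n - s (r k)) + L2.nrm M (s (r k) - f)"
        using s f by (intro L2.nrm_triangle_diff) auto
      moreover have "L2.nrm M (s n - s (r k)) < (1/2) ^ k" using N[OF n r(1)] .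
      moreover have "(1/2::real) ^ k \<le> (1/2) ^ k1" using k by (intro power_decreasing) auto
      moreover have "L2.nrm M (s (r k) - f) < e / 2" using k0 k(1) by (auto simp: abs_less_iff)
      ultimately show ?thesis using k1 by linarith
    qed
    then show "\<exists>n0. \<forall>n\<ge>n0. norm (L2.nrm M (s n - f) - 0) < e"
      using s f(1) by auto
  qed
  then show "\<exists>x\<in>L2 M. (\<lambda>n. L2.nrm M (s n - x)) \<longlonglongrightarrow> 0" using f(1) by blast
qed

subsection \<open>Semigroups on the space of square-integrable functions\<close>

lemma generator_eq_gen: "generator M P = L2.gen M P"
proof -
  have eq: "(\<lambda>x. (P h f x - f x) / of_real h - g x) = (1 / h) *\<^sub>R (P h f - f) - g" for h f g
    by (simp add: fun_eq_iff scaleR_conv_of_real)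
  show ?thesis unfolding generator_def L2.gen_def L2_nrm eq by simp
qed

lemma C0_semigroup_imp_c0:
  assumes P: "C0_semigroup M P"
  shows "L2.c0 M P"
proof -
  note P' = P[unfolded C0_semigroup_def]
  have mem: "P t f \<in> L2 M" if "t \<ge> 0" "f \<in> L2 M" for t f using P' that by blast
  show ?thesis
    unfolding L2.c0_def
  proof (intro conjI allI impI ballI)
    fix t :: real and f g c assume t: "t \<ge> 0" and f: "f \<in> L2 M" and g: "g \<in> L2 M"
    have "c *\<^sub>R f + g = (\<lambda>x. of_real c * f x + g x)"
      by (simp add: fun_eq_iff scaleR_conv_of_real)
    moreover have "AE x in M. P t (\<lambda>x. of_real c * f x + g x) x = of_real c * P t f x + P t g x"
      using P' t f g by blast
    ultimately show "L2.nrm M (P t (c *\<^sub>R f + g) - (c *\<^sub>R P t f + P t g)) = 0"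
      using mem t f g L2.X_closed(2)[OF L2.X_closed(4)[OF f] g, of c]
      by (subst L2_nrm_eq_iff) (auto simp: scaleR_conv_of_real)
  next
    fix s t :: real and f assume "s \<ge> 0" "t \<ge> 0" "f \<in> L2 M"
    then show "L2.nrm M (P (s + t) f - P s (P t f)) = 0"
      using P' mem by (subst L2_nrm_eq_iff) auto
  next
    fix f assume "f \<in> L2 M"
    then show "L2.nrm M (P 0 f - f) = 0" "((\<lambda>t. L2.nrm M (P t f - f)) \<longlongrightarrow> 0) (at_right 0)"
      using P' mem by (auto simp: L2_nrm_eq_iff) (simp add: L2_nrm_diff)
  qed (use P' in \<open>auto simp: L2_nrm\<close>)
qed

text \<open>Splitting a complex scalar into real and imaginary part reduces complex linearity to
  real linearity and commutation with multiplication by \<open>\<i>\<close>.\<close>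

lemma c0_imp_C0_semigroup:
  assumes P: "L2.c0 M P"
    and i: "\<And>t f. t \<ge> 0 \<Longrightarrow> f \<in> L2 M \<Longrightarrow> AE x in M. P t (\<lambda>x. \<i> * f x) x = \<i> * P t f x"
  shows "C0_semigroup M P"
proof -
  note P' = L2.c0D[OF P]
  have lin: "AE x in M. P t (\<lambda>x. of_real c * f x + g x) x = of_real c * P t f x + P t g x"
    if "t \<ge> 0" "f \<in> L2 M" "g \<in> L2 M" for t f g c
  proof -
    have "c *\<^sub>R f + g = (\<lambda>x. of_real c * f x + g x)"
      by (simp add: fun_eq_iff scaleR_conv_of_real)
    then show ?thesis
      using P'(2)[OF that, of c] P'(1) that L2.X_closed(2)[OF L2.X_closed(4)[OF that(2)] that(3), of c]
      by (subst (asm) L2_nrm_eq_iff) (auto simp: scaleR_conv_of_real)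
  qed
  show ?thesis
    unfolding C0_semigroup_def
  proof (intro conjI allI impI ballI)
    fix t :: real and f g and c :: complex assume t: "t \<ge> 0" and f: "f \<in> L2 M" and g: "g \<in> L2 M"
    have eq: "(\<lambda>x. c * f x + g x) = (\<lambda>x. of_real (Re c) * f x + (of_real (Im c) * (\<i> * f x) + g x))"
      by (subst complex_eq[of c]) (simp add: algebra_simps)
    have fi: "(\<lambda>x. \<i> * f x) \<in> L2 M" "(\<lambda>x. of_real (Im c) * (\<i> * f x) + g x) \<in> L2 M"
      using f g by (intro L2_scale L2_add; simp)+
    show "AE x in M. P t (\<lambda>x. c * f x + g x) x = c * P t f x + P t g x"
      unfolding eq using lin[OF t f fi(2), of "Re c"] lin[OF t fi(1) g, of "Im c"] i[OF t f]
    proof eventually_elim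
      case (elim x)
      then show ?case by (subst complex_eq[of c]) (simp add: algebra_simps)
    qed
  next
    fix s t :: real and f assume st: "s \<ge> 0" "t \<ge> 0" "f \<in> L2 M"
    from P'(5)[OF this] show "AE x in M. P (s + t) f x = P s (P t f) x"
      using st P'(1) by (subst (asm) L2_nrm_eq_iff) auto
  next
    fix f assume f: "f \<in> L2 M"
    from P'(4)[OF f] show "AE x in M. P 0 f x = f x"
      using f P'(1)[of 0 f] by (subst (asm) L2_nrm_eq_iff) auto
    from P'(6)[OF f] show "((\<lambda>t. L2_norm M (\<lambda>x. P t f x - f x)) \<longlongrightarrow> 0) (at_right 0)"
      by (simp add: L2_nrm_diff)
  qed (use P'(1,3) in \<open>auto simp: L2_nrm\<close>)
qed

section \<open>Closed symmetric forms and their operators\<close>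

locale closed_form = semi_hilbert X ip for X :: "'v::real_vector set" and ip +
  fixes V :: "'v set" and q :: "'v \<Rightarrow> 'v \<Rightarrow> real"
  assumes V_X: "V \<subseteq> X" and V_subspace: "subspace V"
    and q_sym: "f \<in> V \<Longrightarrow> g \<in> V \<Longrightarrow> q f g = q g f"
    and q_add: "f \<in> V \<Longrightarrow> g \<in> V \<Longrightarrow> h \<in> V \<Longrightarrow> q (f + g) h = q f h + q g h"
    and q_scale: "f \<in> V \<Longrightarrow> h \<in> V \<Longrightarrow> q (c *\<^sub>R f) h = c * q f h"
    and q_nonneg: "f \<in> V \<Longrightarrow> 0 \<le> q f f"
    and V_complete: "(\<And>n. s n \<in> V) \<Longrightarrow>
       (\<And>e. e > 0 \<Longrightarrow> \<exists>N. \<forall>m\<ge>N. \<forall>n\<ge>N. ip (s m - s n) (s m - s n) + q (s m - s n) (s m - s n) < e) \<Longrightarrow>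
       \<exists>x\<in>V. (\<lambda>n. ip (s n - x) (s n - x) + q (s n - x) (s n - x)) \<longlonglongrightarrow> 0"
    and V_cong: "f \<in> V \<Longrightarrow> f' \<in> X \<Longrightarrow> nrm (f - f') = 0 \<Longrightarrow> f' \<in> V \<and> (\<forall>h\<in>V. q f' h = q f h)"
    and V_orthogonal: "f \<in> X \<Longrightarrow> (\<And>h. h \<in> V \<Longrightarrow> ip f h = 0) \<Longrightarrow> nrm f = 0"
begin

sublocale V: semi_inner V q
  by standard (use V_subspace q_sym q_add q_scale q_nonneg in auto)

lemma V_imp_X: "f \<in> V \<Longrightarrow> f \<in> X"
  using V_X by blast

text \<open>The minus sign makes this the negative of the operator associated with the form: the
  form of the gradient yields the Laplacian itself, which is dissipative.\<close>

definition form_graph :: "('v \<times> 'v) set" where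
  "form_graph = {(f, g). f \<in> V \<and> g \<in> X \<and> (\<forall>h\<in>V. q f h = - ip g h)}"

lemma form_semi_inner: "\<mu> \<ge> 0 \<Longrightarrow> semi_inner V (\<lambda>f g. ip f g + \<mu> * q f g)"
  by standard
    (use V_imp_X V_subspace in \<open>auto simp: ip_linear V.ip_linear algebra_simps ip_nonneg q_nonneg ip_sym q_sym\<close>)

text \<open>The form norms for different weights \<open>\<mu>\<close> are equivalent, so
  completeness for weight 1, which is \<open>V_complete\<close>, transfers to every positive
  weight.\<close>

lemma form_hilbert:
  assumes m: "\<mu> > 0"
  shows "semi_hilbert V (\<lambda>f g. ip f g + \<mu> * q f g)"
proof -
  interpret M: semi_inner V "\<lambda>f g. ip f g + \<mu> * q f g" using form_semi_inner m by simp
  have le: "ip x x + q x x \<le> max 1 (1 / \<mu>) * (M.nrm x)\<^sup>2" if x: "x \<in> V" for x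
  proof -
    have "q x x = 1 / \<mu> * (\<mu> * q x x)" using m by simp
    also have "\<dots> \<le> max 1 (1 / \<mu>) * (\<mu> * q x x)" using m q_nonneg[OF x] by (intro mult_right_mono) auto
    finally have "q x x \<le> max 1 (1 / \<mu>) * (\<mu> * q x x)" .
    moreover have "1 * ip x x \<le> max 1 (1 / \<mu>) * ip x x"
      using ip_nonneg[OF V_imp_X[OF x]] by (intro mult_right_mono) auto
    ultimately show ?thesis by (simp add: M.nrm_sq[OF x] distrib_left)
  qed
  have ge: "(M.nrm x)\<^sup>2 \<le> max 1 \<mu> * (ip x x + q x x)" if x: "x \<in> V" for x
  proof -
    have "1 * ip x x \<le> max 1 \<mu> * ip x x"
      by (rule mult_right_mono) (use ip_nonneg[OF V_imp_X[OF x]] in auto)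
    moreover have "\<mu> * q x x \<le> max 1 \<mu> * q x x"
      by (rule mult_right_mono) (use q_nonneg[OF x] in auto)
    ultimately show ?thesis by (simp add: M.nrm_sq[OF x] distrib_left)
  qed
  show ?thesis
  proof
    fix s :: "nat \<Rightarrow> 'v"
    assume s: "\<And>n. s n \<in> V" and C: "\<And>e. e > 0 \<Longrightarrow> \<exists>N. \<forall>m\<ge>N. \<forall>n\<ge>N. M.nrm (s m - s n) < e"
    have "\<exists>x\<in>V. (\<lambda>n. ip (s n - x) (s n - x) + q (s n - x) (s n - x)) \<longlonglongrightarrow> 0"
    proof (rule V_complete[OF s])
      fix e :: real assume e: "e > 0"
      define c where "c = max 1 (1 / \<mu>)"
      have c: "c > 0" by (simp add: c_def)
      obtain N where N: "\<forall>m\<ge>N. \<forall>n\<ge>N. M.nrm (s m - s n) < sqrt (e / c)" using C[of "sqrt (e / c)"] e c by auto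
      have "ip (s m - s n) (s m - s n) + q (s m - s n) (s m - s n) < e" if "m \<ge> N" "n \<ge> N" for m n
      proof -
        have d: "s m - s n \<in> V" using s by simp
        have "(M.nrm (s m - s n))\<^sup>2 < (sqrt (e / c))\<^sup>2"
          using N that M.nrm_nonneg[OF d] by (intro power_strict_mono) auto
        then have "c * (M.nrm (s m - s n))\<^sup>2 < e" using e c by (simp add: field_simps)
        then show ?thesis using le[OF d] by (simp add: c_def)
      qed
      then show "\<exists>N. \<forall>m\<ge>N. \<forall>n\<ge>N. ip (s m - s n) (s m - s n) + q (s m - s n) (s m - s n) < e" by blast
    qed
    then obtain x where x: "x \<in> V" and lim: "(\<lambda>n. ip (s n - x) (s n - x) + q (s n - x) (s n - x)) \<longlonglongrightarrow> 0" by blast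
    have "(\<lambda>n. (M.nrm (s n - x))\<^sup>2) \<longlonglongrightarrow> 0"
    proof (rule tendsto_sandwich[OF _ _ tendsto_const tendsto_mult_right_zero[OF lim, of "max 1 \<mu>"]])
      show "\<forall>\<^sub>F n in sequentially. (M.nrm (s n - x))\<^sup>2 \<le> max 1 \<mu> * (ip (s n - x) (s n - x) + q (s n - x) (s n - x))"
        using ge s x by simp
    qed simp
    from tendsto_real_sqrt[OF this] have "(\<lambda>n. M.nrm (s n - x)) \<longlonglongrightarrow> 0" using s x by simp
    then show "\<exists>x\<in>V. (\<lambda>n. M.nrm (s n - x)) \<longlonglongrightarrow> 0" using x by blast
  qed
qed

text \<open>The weak form of the resolvent equation, solved by Riesz representation in
  \<open>V\<close> with the form norm, for which \<open>ip f\<close> is a bounded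
  functional.\<close>

lemma resolvent_exists:
  assumes f: "f \<in> X" and m: "\<mu> > 0"
  shows "\<exists>u\<in>V. \<forall>h\<in>V. ip u h + \<mu> * q u h = ip f h"
proof -
  interpret M: semi_hilbert V "\<lambda>f g. ip f g + \<mu> * q f g" using form_hilbert[OF m] .
  show ?thesis
  proof (rule M.riesz)
    fix x assume x: "x \<in> V"
    have "\<bar>ip f x\<bar> \<le> nrm f * nrm x" by (rule Cauchy_Schwarz[OF f V_imp_X[OF x]])
    also have "nrm x \<le> M.nrm x"
      using m q_nonneg[OF x] by (simp add: nrm_def M.nrm_def)
    finally show "\<bar>ip f x\<bar> \<le> nrm f * M.nrm x" using f by (simp add: mult_left_mono)
  qed (use f V_imp_X in \<open>auto simp: ip_linear\<close>)
qed

text \<open>\<open>V_orthogonal\<close> states density through the orthogonal complement. The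
  closure \<open>W\<close> of \<open>V\<close> is itself complete; Riesz representation in
  \<open>W\<close> gives the projection \<open>p\<close> of \<open>f\<close>, and
  \<open>f - p\<close> is orthogonal to \<open>V\<close>, hence null.\<close>

lemma V_dense:
  assumes f: "f \<in> X" and e: "e > 0"
  shows "\<exists>v\<in>V. nrm (f - v) < e"
proof -
  define W where "W = {x \<in> X. \<forall>e>0. \<exists>v\<in>V. nrm (x - v) < e}"
  have WX: "W \<subseteq> X" by (auto simp: W_def)
  have VW: "V \<subseteq> W"
  proof
    fix x assume x: "x \<in> V"
    have "\<exists>v\<in>V. nrm (x - v) < e" if "e > 0" for e using that by (intro bexI[OF _ x]) simp
    then show "x \<in> W" using V_imp_X[OF x] by (simp add: W_def)
  qed
  have sub: "subspace W"
    unfolding subspace_def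
  proof (intro conjI ballI allI)
    show "0 \<in> W" using VW by auto
    fix x assume x: "x \<in> W"
    show "c *\<^sub>R x \<in> W" for c
      unfolding W_def
    proof (safe)
      show "c *\<^sub>R x \<in> X" using x by (simp add: W_def)
      fix e :: real assume e: "e > 0"
      then have "e / (\<bar>c\<bar> + 1) > 0" by simp
      then obtain v where v: "v \<in> V" "nrm (x - v) < e / (\<bar>c\<bar> + 1)" using x unfolding W_def by blast
      have X: "x \<in> X" "v \<in> X" using x v V_imp_X by (auto simp: W_def)
      have "nrm (c *\<^sub>R x - c *\<^sub>R v) = \<bar>c\<bar> * nrm (x - v)"
        using nrm_scale[of "x - v" c] X by (simp add: scaleR_diff_right)
      also have "\<dots> \<le> (\<bar>c\<bar> + 1) * nrm (x - v)" using X by (simp add: distrib_right)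
      also have "\<dots> < e" using v(2) by (simp add: field_simps)
      finally show "\<exists>v\<in>V. nrm (c *\<^sub>R x - v) < e" using v(1) V.X_closed(4) by blast
    qed
    fix y assume y: "y \<in> W"
    show "x + y \<in> W"
      unfolding W_def
    proof safe
      show "x + y \<in> X" using x y by (simp add: W_def)
      fix e :: real assume e: "e > 0"
      then have e2: "e / 2 > 0" by simp
      obtain v where v: "v \<in> V" "nrm (x - v) < e / 2" using x e2 unfolding W_def by blast
      obtain w where w: "w \<in> V" "nrm (y - w) < e / 2" using y e2 unfolding W_def by blast
      have "nrm ((x + y) - (v + w)) \<le> nrm (x - v) + nrm (y - w)"
        using x y v w V_imp_X by (intro nrm_add4) (auto simp: W_def)
      then have "nrm ((x + y) - (v + w)) < e" using v w by simp
      then show "\<exists>v\<in>V. nrm (x + y - v) < e" using v(1) w(1) V.X_closed(2) by blast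
    qed
  qed
  interpret W: semi_inner W ip
  proof
    show "ip x y = ip y x" if "x \<in> W" "y \<in> W" for x y
      by (rule ip_sym) (use that WX in auto)
  qed (use WX sub in \<open>auto simp: subset_iff ip_linear ip_nonneg\<close>)
  interpret W: semi_hilbert W ip
  proof
    fix s :: "nat \<Rightarrow> 'v"
    assume s: "\<And>n. s n \<in> W" and C: "\<And>e. e > 0 \<Longrightarrow> \<exists>N. \<forall>m\<ge>N. \<forall>n\<ge>N. nrm (s m - s n) < e"
    have sX: "s n \<in> X" for n using s WX by blast
    obtain x where x: "x \<in> X" "(\<lambda>n. nrm (s n - x)) \<longlonglongrightarrow> 0"
      using complete[of s, OF sX C] by blast
    have "\<exists>v\<in>V. nrm (x - v) < e" if e: "e > 0" for e
    proof -
      obtain n where n: "nrm (s n - x) < e / 2" using LIMSEQ_D[OF x(2), of "e / 2"] e sX x(1) by auto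
      have "e / 2 > 0" using e by simp
      then obtain v where v: "v \<in> V" "nrm (s n - v) < e / 2" using s[of n] unfolding W_def by blast
      have "nrm (x - v) \<le> nrm (x - s n) + nrm (s n - v)" using x(1) sX v V_imp_X by (intro nrm_triangle_diff) auto
      then have "nrm (x - v) < e" using n v(2) nrm_commute[OF sX[of n] x(1)] by simp
      then show ?thesis using v(1) by blast
    qed
    then have "x \<in> W" using x(1) by (simp add: W_def)
    then show "\<exists>x\<in>W. (\<lambda>n. nrm (s n - x)) \<longlonglongrightarrow> 0" using x(2) by blast
  qed
  have "\<exists>p\<in>W. \<forall>h\<in>W. ip p h = ip f h"
    using WX f by (intro W.riesz[where C = "nrm f"]) (auto simp: subset_iff ip_linear intro: Cauchy_Schwarz)
  then obtain p where p: "p \<in> W" "\<And>h. h \<in> W \<Longrightarrow> ip p h = ip f h" by blast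
  have pX: "p \<in> X" using p WX by blast
  have 0: "nrm (f - p) = 0"
  proof (rule V_orthogonal)
    fix h assume h: "h \<in> V"
    then show "ip (f - p) h = 0" using p(2)[of h] VW f pX V_imp_X by (auto simp: ip_linear)
  qed (use f pX in simp)
  obtain v where v: "v \<in> V" "nrm (p - v) < e" using p(1) e by (auto simp: W_def)
  have "nrm (f - v) \<le> nrm (f - p) + nrm (p - v)" using f pX v V_imp_X by (intro nrm_triangle_diff) auto
  then have "nrm (f - v) < e" using 0 v by simp
  then show ?thesis using v(1) by blast
qed

theorem m_dissipative: "m_dissipative X ip form_graph"
proof
  show "f \<in> X \<and> g \<in> X" if "(f, g) \<in> form_graph" for f g using that V_imp_X by (auto simp: form_graph_def)
  show "(f + f', g + g') \<in> form_graph" if "(f, g) \<in> form_graph" "(f', g') \<in> form_graph" for f g f' g'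
    using that by (clarsimp simp: form_graph_def) (simp add: ip_linear V.ip_linear V_imp_X)
  show "(c *\<^sub>R f, c *\<^sub>R g) \<in> form_graph" if "(f, g) \<in> form_graph" for f g c
    using that by (clarsimp simp: form_graph_def) (simp add: ip_linear V.ip_linear V_imp_X)
  show "(f', g') \<in> form_graph" if fg: "(f, g) \<in> form_graph" and X: "f' \<in> X" "g' \<in> X"
    and z: "nrm (f - f') = 0" "nrm (g - g') = 0" for f g f' g'
  proof -
    have f: "f \<in> V" "g \<in> X" "\<And>h. h \<in> V \<Longrightarrow> q f h = - ip g h" using fg by (auto simp: form_graph_def)
    have f': "f' \<in> V" "\<And>h. h \<in> V \<Longrightarrow> q f' h = q f h" using V_cong[OF f(1) X(1) z(1)] by auto
    have "ip g h = ip g' h" if h: "h \<in> V" for h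
      using ip_cong_right[of h g g'] f(2) X(2) z(2) V_imp_X[OF h] by (simp add: ip_sym)
    then show ?thesis using f f' X by (auto simp: form_graph_def)
  qed
  show "ip g f \<le> 0" if fg: "(f, g) \<in> form_graph" for f g
  proof -
    have f: "f \<in> V" "g \<in> X" "\<And>h. h \<in> V \<Longrightarrow> q f h = - ip g h" using fg by (auto simp: form_graph_def)
    show ?thesis using f(3)[OF f(1)] q_nonneg[OF f(1)] by simp
  qed
  show range: "\<exists>u. (u, (1 / \<mu>) *\<^sub>R (u - f)) \<in> form_graph" if f: "f \<in> X" and m: "\<mu> > 0" for f \<mu>
  proof -
    obtain u where u: "u \<in> V" "\<And>h. h \<in> V \<Longrightarrow> ip u h + \<mu> * q u h = ip f h" using resolvent_exists[OF f m] by blast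
    have "q u h = - ip ((1 / \<mu>) *\<^sub>R (u - f)) h" if h: "h \<in> V" for h
      using u(2)[OF h] f V_imp_X[OF u(1)] V_imp_X[OF h] m by (simp add: ip_linear field_simps)
    then have "(u, (1 / \<mu>) *\<^sub>R (u - f)) \<in> form_graph" using u f V_imp_X by (simp add: form_graph_def)
    then show ?thesis by blast
  qed
  show "\<exists>u w. (u, w) \<in> form_graph \<and> nrm (f - u) < e" if f: "f \<in> X" and e: "e > 0" for f e
  proof -
    have "e / 2 > 0" using e by simp
    then obtain v where v: "v \<in> V" "nrm (f - v) < e / 2" using V_dense[OF f] by blast
    \<comment> \<open>The resolvent of \<open>v\<close> lies in the domain and its squared distance
      from \<open>v\<close> is at most \<open>\<mu> * q v v / 4\<close>; this choice makes that at
      most \<open>(e / 4)\<^sup>2\<close>.\<close>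
    define \<mu> where "\<mu> = e\<^sup>2 / (4 * (q v v + 1))"
    have p: "q v v + 1 > 0" using q_nonneg[OF v(1)] by simp
    have m: "\<mu> > 0" using e p by (simp add: \<mu>_def)
    obtain u where u: "u \<in> V" "\<And>h. h \<in> V \<Longrightarrow> ip u h + \<mu> * q u h = ip v h"
      using resolvent_exists[OF V_imp_X[OF v(1)] m] by blast
    let ?d = "u - v"
    have dV: "?d \<in> V" using u v by simp
    have X: "u \<in> X" "v \<in> X" "?d \<in> X" using u v dV V_imp_X by auto
    \<comment> \<open>Completing the square: \<open>q u ?d = q ?d ?d + q v ?d\<close> is at least
      \<open>- q v v / 4\<close>, whatever the size of \<open>?d\<close>.\<close>
    have 1: "0 \<le> q (?d + (1/2) *\<^sub>R v) (?d + (1/2) *\<^sub>R v)" using dV v by (intro q_nonneg) auto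
    have hv: "(1/2) *\<^sub>R v \<in> V" using v by simp
    have 2: "q (?d + (1/2) *\<^sub>R v) (?d + (1/2) *\<^sub>R v) = q ?d ?d + q v ?d + q v v / 4"
      using V.ip_add_left[OF dV hv V.X_closed(2)[OF dV hv]] V.ip_add_right[OF dV dV hv] V.ip_add_right[OF hv dV hv]
        V.ip_scale_left[OF v(1) dV, of "1/2"] V.ip_scale_right[OF dV v(1), of "1/2"]
        V.ip_scale_left[OF v(1) hv, of "1/2"] V.ip_scale_right[OF v(1,1), of "1/2"] V.ip_sym[OF dV v(1)]
      by linarith
    have 3: "q ?d ?d = q u ?d - q v ?d" by (rule V.ip_diff_left[OF u(1) v(1) dV])
    have "- q u ?d \<le> q v v / 4" using 1 2 3 by linarith
    moreover have "ip ?d ?d = - \<mu> * q u ?d" using u(2)[OF dV] ip_diff_left[OF X(1,2,3)] by linarith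
    ultimately have "ip ?d ?d \<le> \<mu> * (q v v / 4)"
      using mult_left_mono[of "- q u ?d" "q v v / 4" \<mu>] m by simp
    also have "\<dots> = (e / 4)\<^sup>2 * (q v v / (q v v + 1))" by (simp add: \<mu>_def power2_eq_square)
    also have "\<dots> \<le> (e / 4)\<^sup>2 * 1" using q_nonneg[OF v(1)] by (intro mult_left_mono) auto
    finally have "(nrm ?d)\<^sup>2 \<le> (e / 4)\<^sup>2" using X by (simp add: nrm_sq)
    then have "nrm ?d \<le> e / 4" by (rule power2_le_imp_le) (use e in simp)
    moreover have "nrm (f - u) \<le> nrm (f - v) + nrm (v - u)" using f X by (intro nrm_triangle_diff) auto
    ultimately have "nrm (f - u) < e" using v(2) nrm_commute[OF X(1,2)] e by simp
    moreover have "(u, (1 / \<mu>) *\<^sub>R (u - v)) \<in> form_graph"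
    proof -
      have "q u h = - ip ((1 / \<mu>) *\<^sub>R (u - v)) h" if h: "h \<in> V" for h
        using u(2)[OF h] X V_imp_X[OF h] m by (simp add: ip_linear field_simps)
      then show ?thesis using u X by (simp add: form_graph_def)
    qed
    ultimately show ?thesis by blast
  qed
qed

end

subsection \<open>Smooth functions\<close>

lemma Rd_iff: "x \<in> Rd d \<longleftrightarrow> (\<forall>i\<ge>d. x i = undefined)"
  by (auto simp: Rd_def PiE_iff extensional_def)

lemma Rd_upd [simp]: "x \<in> Rd d \<Longrightarrow> i < d \<Longrightarrow> x(i := t) \<in> Rd d"
  by (auto simp: Rd_iff)

definition coord_diff :: "nat \<Rightarrow> (point \<Rightarrow> complex) \<Rightarrow> bool" where
  "coord_diff d f \<longleftrightarrow> (\<forall>i<d. \<forall>x\<in>Rd d. (\<lambda>t. f (x(i := t))) differentiable (at (x i)))"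

lemma coord_diffD:
  assumes "coord_diff d f" "i < d" "x \<in> Rd d"
  shows "((\<lambda>t. f (x(i := t))) has_vector_derivative partial i f x) (at (x i))"
  using assms unfolding partial_def coord_diff_def by (simp add: vector_derivative_works[symmetric])

lemma coord_diffD':
  assumes "coord_diff d f" "i < d" "x \<in> Rd d"
  shows "((\<lambda>t. f (x(i := t))) has_vector_derivative partial i f (x(i := s))) (at s)"
  using coord_diffD[OF assms(1,2) Rd_upd[OF assms(3,2)], of s] by simp

lemma coord_diffI:
  assumes "\<And>i x. i < d \<Longrightarrow> x \<in> Rd d \<Longrightarrow> ((\<lambda>t. f (x(i := t))) has_vector_derivative D i x) (at (x i))"
  shows "coord_diff d f"
  unfolding coord_diff_def using assms differentiableI_vector by blast

lemma partialI: "((\<lambda>t. f (x(i := t))) has_vector_derivative D) (at (x i)) \<Longrightarrow> partial i f x = D"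
  by (simp add: partial_def vector_derivative_at)

lemma Rd_cong_fun:
  assumes "\<And>y. y \<in> Rd d \<Longrightarrow> f y = g y" "x \<in> Rd d" "i < d"
  shows "(\<lambda>t. f (x(i := t))) = (\<lambda>t. g (x(i := t)))"
  using assms by (intro ext) simp

lemma partial_cong:
  assumes "\<And>y. y \<in> Rd d \<Longrightarrow> f y = g y" "x \<in> Rd d" "i < d"
  shows "partial i f x = partial i g x"
  by (simp only: partial_def Rd_cong_fun[of d f g x i, OF assms])

text \<open>Smoothness by coinduction: it suffices to place the function in a class closed under
  partial derivatives. Closure is required up to agreement on \<open>Rd d\<close>, because the
  computed derivatives are known only there.\<close>

lemma smooth_coinduct:
  assumes "\<phi> \<in> F" and cont: "\<And>f. f \<in> F \<Longrightarrow> continuous_on (Rd d) f"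
    and diff: "\<And>f. f \<in> F \<Longrightarrow> coord_diff d f"
    and part: "\<And>f i. f \<in> F \<Longrightarrow> i < d \<Longrightarrow> \<exists>g\<in>F. \<forall>x\<in>Rd d. partial i f x = g x"
  shows "smooth d \<phi>"
proof -
  have *: "\<exists>g\<in>F. \<forall>x\<in>Rd d. foldr partial ks \<phi> x = g x" if "set ks \<subseteq> {..<d}" for ks
    using that
  proof (induction ks)
    case Nil
    then show ?case using assms(1) by auto
  next
    case (Cons i ks)
    then obtain g where g: "g \<in> F" "\<And>x. x \<in> Rd d \<Longrightarrow> foldr partial ks \<phi> x = g x" by auto
    obtain h where h: "h \<in> F" "\<And>x. x \<in> Rd d \<Longrightarrow> partial i g x = h x" using part[OF g(1), of i] Cons.prems by auto
    have "foldr partial (i # ks) \<phi> x = h x" if "x \<in> Rd d" for x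
      using partial_cong[of d "foldr partial ks \<phi>" g x i, OF g(2) that] h(2)[OF that] Cons.prems by simp
    then show ?case using h(1) by blast
  qed
  show ?thesis
    unfolding smooth_def
  proof (intro allI impI conjI ballI)
    fix ks assume ks: "set ks \<subseteq> {..<d}"
    obtain g where g: "g \<in> F" "\<And>x. x \<in> Rd d \<Longrightarrow> foldr partial ks \<phi> x = g x" using *[OF ks] by blast
    show "continuous_on (Rd d) (foldr partial ks \<phi>)"
      using cont[OF g(1)] g(2) continuous_on_cong[of "Rd d" "Rd d" "foldr partial ks \<phi>" g] by simp
    fix i x assume "i < d" "x \<in> Rd d"
    then show "(\<lambda>t. foldr partial ks \<phi> (x(i := t))) differentiable (at (x i))"
      using diff[OF g(1)] Rd_cong_fun[of d "foldr partial ks \<phi>" g x i, OF g(2)]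
      unfolding coord_diff_def by metis
  qed
qed

lemma smooth_continuous: "smooth d f \<Longrightarrow> continuous_on (Rd d) f"
  unfolding smooth_def by (drule spec[of _ "[]"]) simp

lemma smooth_coord_diff: "smooth d f \<Longrightarrow> coord_diff d f"
  unfolding smooth_def coord_diff_def by (drule spec[of _ "[]"]) simp

lemma smooth_partial: "smooth d f \<Longrightarrow> i < d \<Longrightarrow> smooth d (partial i f)"
proof -
  assume s: "smooth d f" and i: "i < d"
  show ?thesis
    unfolding smooth_def
  proof (intro allI impI)
    fix ks assume "set ks \<subseteq> {..<d}"
    then have "set (ks @ [i]) \<subseteq> {..<d}" using i by simp
    have eq: "foldr partial ks (partial i f) = foldr partial (ks @ [i]) f" by simp
    show "continuous_on (Rd d) (foldr partial ks (partial i f)) \<and>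
      (\<forall>j<d. \<forall>x\<in>Rd d. (\<lambda>t. foldr partial ks (partial i f) (x(j := t))) differentiable at (x j))"
      unfolding eq by (rule s[unfolded smooth_def, THEN spec, THEN mp]) fact
  qed
qed

lemma partial_add:
  assumes "coord_diff d f" "coord_diff d g" "i < d" "x \<in> Rd d"
  shows "((\<lambda>t. f (x(i := t)) + g (x(i := t))) has_vector_derivative partial i f x + partial i g x) (at (x i))"
  by (intro has_vector_derivative_add coord_diffD[OF assms(1,3,4)] coord_diffD[OF assms(2-4)])

lemma partial_mult:
  assumes "coord_diff d f" "coord_diff d g" "i < d" "x \<in> Rd d"
  shows "((\<lambda>t. f (x(i := t)) * g (x(i := t))) has_vector_derivative f x * partial i g x + partial i f x * g x) (at (x i))"
  using has_vector_derivative_mult[OF coord_diffD[OF assms(1,3,4)] coord_diffD[OF assms(2,3,4)]] by simp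

lemma smooth_add:
  assumes "smooth d f" "smooth d g"
  shows "smooth d (\<lambda>x. f x + g x)"
proof (rule smooth_coinduct)
  let ?F = "{(\<lambda>x. f x + g x) | f g. smooth d f \<and> smooth d g}"
  show "(\<lambda>x. f x + g x) \<in> ?F" using assms by blast
  fix h assume "h \<in> ?F"
  then obtain f g where h: "h = (\<lambda>x. f x + g x)" and fg: "smooth d f" "smooth d g" by blast
  show "continuous_on (Rd d) h" unfolding h by (intro continuous_intros smooth_continuous fg)
  show "coord_diff d h"
    unfolding h by (rule coord_diffI) (rule partial_add[OF fg[THEN smooth_coord_diff]])
  fix i assume i: "i < d"
  show "\<exists>g\<in>?F. \<forall>x\<in>Rd d. partial i h x = g x"
  proof (intro bexI ballI)
    show "(\<lambda>x. partial i f x + partial i g x) \<in> ?F" using fg smooth_partial i by blast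
    show "partial i h x = partial i f x + partial i g x" if "x \<in> Rd d" for x
      unfolding h by (rule partialI) (rule partial_add[OF fg[THEN smooth_coord_diff] i that])
  qed
qed

text \<open>A class for the coinduction: by the product rule a derivative of a product is a sum of
  products of smooth functions.\<close>

inductive_set mult_span :: "nat \<Rightarrow> (point \<Rightarrow> complex) set" for d where
  base: "smooth d f \<Longrightarrow> smooth d g \<Longrightarrow> (\<lambda>x. f x * g x) \<in> mult_span d"
| add: "h \<in> mult_span d \<Longrightarrow> k \<in> mult_span d \<Longrightarrow> (\<lambda>x. h x + k x) \<in> mult_span d"

lemma mult_span_props:
  assumes "h \<in> mult_span d"
  shows "continuous_on (Rd d) h \<and> coord_diff d h \<and> (\<forall>i<d. \<exists>g\<in>mult_span d. \<forall>x\<in>Rd d. partial i h x = g x)"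
  using assms
proof induction
  case (base f g)
  note fg = this[THEN smooth_coord_diff]
  have "\<exists>k\<in>mult_span d. \<forall>x\<in>Rd d. partial i (\<lambda>x. f x * g x) x = k x" if i: "i < d" for i
  proof (intro bexI ballI)
    show "partial i (\<lambda>x. f x * g x) x = f x * partial i g x + partial i f x * g x" if "x \<in> Rd d" for x
      by (rule partialI) (rule partial_mult[OF fg i that])
    show "(\<lambda>x. f x * partial i g x + partial i f x * g x) \<in> mult_span d"
      by (intro mult_span.intros smooth_partial i base)
  qed
  moreover have "coord_diff d (\<lambda>x. f x * g x)"
    by (rule coord_diffI) (rule partial_mult[OF fg])
  moreover have "continuous_on (Rd d) (\<lambda>x. f x * g x)"
    by (rule continuous_on_mult[OF base[THEN smooth_continuous]])
  ultimately show ?case by blast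
next
  case (add h k)
  have "\<exists>l\<in>mult_span d. \<forall>x\<in>Rd d. partial i (\<lambda>x. h x + k x) x = l x" if i: "i < d" for i
  proof -
    note IH = add.IH(1)[THEN conjunct2, THEN conjunct2, THEN spec, THEN mp, OF i]
      add.IH(2)[THEN conjunct2, THEN conjunct2, THEN spec, THEN mp, OF i]
    from IH(1) obtain h' where h': "h' \<in> mult_span d" "\<forall>x\<in>Rd d. partial i h x = h' x" ..
    from IH(2) obtain k' where k': "k' \<in> mult_span d" "\<forall>x\<in>Rd d. partial i k x = k' x" ..
    have "coord_diff d h" "coord_diff d k"
      using add.IH(1)[THEN conjunct2, THEN conjunct1] add.IH(2)[THEN conjunct2, THEN conjunct1] .
    note p = partialI[OF partial_add[OF this i]]
    show ?thesis
    proof (rule bexI[OF _ mult_span.add[OF h'(1) k'(1)]], rule ballI)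
      show "partial i (\<lambda>x. h x + k x) x = h' x + k' x" if x: "x \<in> Rd d" for x
        using p[OF x] h'(2)[rule_format, OF x] k'(2)[rule_format, OF x] by simp
    qed
  qed
  moreover have "coord_diff d (\<lambda>x. h x + k x)"
    by (rule coord_diffI)
      (rule partial_add[OF add.IH(1)[THEN conjunct2, THEN conjunct1] add.IH(2)[THEN conjunct2, THEN conjunct1]])
  moreover have "continuous_on (Rd d) (\<lambda>x. h x + k x)"
    by (rule continuous_on_add[OF add.IH(1)[THEN conjunct1] add.IH(2)[THEN conjunct1]])
  ultimately show ?case by blast
qed

lemma smooth_mult:
  assumes "smooth d f" "smooth d g"
  shows "smooth d (\<lambda>x. f x * g x)"
proof (rule smooth_coinduct[of _ "mult_span d"])
  show "(\<lambda>x. f x * g x) \<in> mult_span d" by (rule mult_span.base[OF assms])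
qed (blast dest: mult_span_props)+

lemma smooth_const: "smooth d (\<lambda>x. c)"
proof (rule smooth_coinduct)
  show "(\<lambda>x. c) \<in> range (\<lambda>c x. c)" by blast
  fix f :: "point \<Rightarrow> complex" assume "f \<in> range (\<lambda>c x. c)"
  then obtain c where f: "f = (\<lambda>x. c)" by blast
  show "continuous_on (Rd d) f" unfolding f by simp
  show "coord_diff d f" unfolding f by (rule coord_diffI) (rule has_vector_derivative_const)
  show "\<exists>g\<in>range (\<lambda>c x. c). \<forall>x\<in>Rd d. partial i f x = g x" for i
  proof (rule bexI[of _ "\<lambda>x. 0"], rule ballI)
    show "partial i f x = 0" for x
      unfolding f by (rule partialI) (rule has_vector_derivative_const)
  qed (rule rangeI)
qed

lemma smooth_scale: "smooth d f \<Longrightarrow> smooth d (\<lambda>x. c * f x)"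
  by (rule smooth_mult[OF smooth_const])

lemma smooth_prod: "(\<And>i. i \<in> I \<Longrightarrow> smooth d (f i)) \<Longrightarrow> smooth d (\<lambda>x. \<Prod>i\<in>I. f i x)"
proof (induction I rule: infinite_finite_induct)
  case (insert i I)
  have "smooth d (\<lambda>x. f i x * (\<Prod>j\<in>I. f j x))" using insert by (intro smooth_mult) auto
  then show ?case using insert.hyps by simp
qed (simp_all add: smooth_const)

text \<open>The functions \<open>p(1/t) exp(-1/t)\<close>, extended by \<open>0\<close> to \<open>t \<le> 0\<close>, are closed under differentiation.\<close>

definition eta :: "real poly \<Rightarrow> real \<Rightarrow> real" where
  "eta p t = (if t > 0 then poly p (1 / t) * exp (- (1 / t)) else 0)"

lemma poly_exp_lim: "((\<lambda>s. poly p s * exp (- s)) \<longlongrightarrow> (0::real)) at_top"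
proof -
  have "((\<lambda>s. \<Sum>i\<le>degree p. coeff p i * (s ^ i / exp s)) \<longlongrightarrow> (\<Sum>i\<le>degree p. coeff p i * 0)) at_top"
    by (intro tendsto_sum tendsto_mult tendsto_const tendsto_power_div_exp_0)
  then show ?thesis by (simp add: poly_altdef sum_distrib_right exp_minus divide_inverse mult.assoc)
qed

lemma eta_lim: "((\<lambda>t. poly p (1 / t) * exp (- (1 / t))) \<longlongrightarrow> (0::real)) (at_right 0)"
  using filterlim_compose[OF poly_exp_lim filterlim_inverse_at_top_right] by (simp add: inverse_eq_divide)

text \<open>For \<open>t > 0\<close> the derivative is
  \<open>(1 / t)\<^sup>2 * (p - p') (1 / t) * exp (- (1 / t))\<close>; the polynomial
  \<open>[:0, 0, 1:]\<close> is the square of the variable. At 0 the right difference quotient is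
  again of this kind, with \<open>[:0, 1:] * p\<close> for \<open>p\<close>, and tends to 0.\<close>

lemma eta_deriv: "(eta p has_real_derivative eta ([:0, 0, 1:] * (p - pderiv p)) t) (at t)"
proof -
  consider "t > 0" | "t < 0" | "t = 0" by linarith
  then show ?thesis
  proof cases
    case 1
    have "((\<lambda>t. poly p (1 / t) * exp (- (1 / t))) has_real_derivative
        poly (pderiv p) (1 / t) * (- (1 / t\<^sup>2)) * exp (- (1 / t)) + poly p (1 / t) * (exp (- (1 / t)) * (1 / t\<^sup>2))) (at t)"
      using 1 by (auto intro!: derivative_eq_intros simp: power2_eq_square field_simps)
    then have "(eta p has_real_derivative
        poly (pderiv p) (1 / t) * (- (1 / t\<^sup>2)) * exp (- (1 / t)) + poly p (1 / t) * (exp (- (1 / t)) * (1 / t\<^sup>2))) (at t)"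
      by (rule has_field_derivative_transform_within_open[of _ _ _ "{0<..}"]) (use 1 in \<open>auto simp: eta_def\<close>)
    moreover have "poly (pderiv p) (1 / t) * (- (1 / t\<^sup>2)) * exp (- (1 / t)) + poly p (1 / t) * (exp (- (1 / t)) * (1 / t\<^sup>2)) =
        eta ([:0, 0, 1:] * (p - pderiv p)) t"
      using 1 by (simp add: eta_def power2_eq_square field_simps)
    ultimately show ?thesis by simp
  next
    case 2
    have "(eta p has_real_derivative 0) (at t)"
      by (rule has_field_derivative_transform_within_open[of "\<lambda>_. 0" _ _ "{..<0}"]) (use 2 in \<open>auto simp: eta_def\<close>)
    then show ?thesis using 2 by (simp add: eta_def)
  next
    case 3
    have "((\<lambda>h. (eta p h - eta p 0) / (h - 0)) \<longlongrightarrow> 0) (at 0)"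
      unfolding filterlim_at_split
    proof
      show "((\<lambda>h. (eta p h - eta p 0) / (h - 0)) \<longlongrightarrow> 0) (at_left 0)"
        by (rule tendsto_eventually) (auto simp: eventually_at_left_field eta_def intro!: exI[of _ "-1"])
      have "\<forall>\<^sub>F h in at_right 0. poly ([:0, 1:] * p) (1 / h) * exp (- (1 / h)) = (eta p h - eta p 0) / (h - 0)"
        by (auto simp: eventually_at_right_field eta_def intro!: exI[of _ 1])
      then show "((\<lambda>h. (eta p h - eta p 0) / (h - 0)) \<longlongrightarrow> 0) (at_right 0)"
        by (rule Lim_transform_eventually[OF eta_lim])
    qed
    then show ?thesis using 3 by (simp add: has_field_derivative_iff eta_def)
  qed
qed

lemma eta_continuous: "continuous_on A (eta p)"
  using eta_deriv DERIV_isCont continuous_at_imp_continuous_on by blast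

lemma eta_coord_deriv:
  assumes "i < d" "x \<in> Rd d"
  shows "((\<lambda>t. complex_of_real (eta p (\<alpha> * (x(i := t)) j + \<beta>))) has_vector_derivative
    of_real (if i = j then \<alpha> * eta ([:0, 0, 1:] * (p - pderiv p)) (\<alpha> * x j + \<beta>) else 0)) (at (x i))"
proof (cases "i = j")
  case True
  have "((\<lambda>t. eta p (\<alpha> * t + \<beta>)) has_real_derivative
      eta ([:0, 0, 1:] * (p - pderiv p)) (\<alpha> * x j + \<beta>) * (\<alpha> * 1 + 0)) (at (x j))"
    by (rule DERIV_chain2[OF eta_deriv]) (auto intro!: derivative_eq_intros)
  from has_vector_derivative_of_real[OF this, where 'a = complex]
  show ?thesis using True by (simp add: mult.commute)
qed auto

lemma partial_eta:
  assumes "i < d" "x \<in> Rd d"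
  shows "partial i (\<lambda>x. complex_of_real (eta p (\<alpha> * x j + \<beta>))) x =
    of_real (if i = j then \<alpha> * eta ([:0, 0, 1:] * (p - pderiv p)) (\<alpha> * x j + \<beta>) else 0)"
  by (rule partialI) (rule eta_coord_deriv[OF assms])

lemma smooth_eta: "smooth d (\<lambda>x. complex_of_real (eta p (\<alpha> * x j + \<beta>)))"
proof (rule smooth_coinduct)
  let ?F = "range (\<lambda>p x. complex_of_real (eta p (\<alpha> * x j + \<beta>)))"
  show "(\<lambda>x. complex_of_real (eta p (\<alpha> * x j + \<beta>))) \<in> ?F" by blast
  fix f :: "point \<Rightarrow> complex" assume "f \<in> ?F"
  then obtain p where f: "f = (\<lambda>x. complex_of_real (eta p (\<alpha> * x j + \<beta>)))" by blast
  have "continuous_on (Rd d) (\<lambda>x :: point. x j)"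
    using continuous_on_subset[OF continuous_on_product_coordinates subset_UNIV] .
  then show "continuous_on (Rd d) f"
    unfolding f by (intro continuous_on_of_real continuous_on_compose2[OF eta_continuous[of UNIV]] continuous_intros) auto
  show "coord_diff d f" unfolding f by (rule coord_diffI) (rule eta_coord_deriv)
  fix i assume i: "i < d"
  have z: "eta 0 t = 0" "\<alpha> * eta q t = eta (smult \<alpha> q) t" for t q by (auto simp: eta_def)
  show "\<exists>g\<in>?F. \<forall>x\<in>Rd d. partial i f x = g x"
  proof (intro bexI ballI)
    show "partial i f x = complex_of_real (eta (if i = j then smult \<alpha> ([:0, 0, 1:] * (p - pderiv p)) else 0) (\<alpha> * x j + \<beta>))"
      if "x \<in> Rd d" for x
      unfolding f partial_eta[OF i that] z by (simp add: z)
  qed blast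
qed

section \<open>The reflection and smooth functions\<close>

definition reflect :: "point \<Rightarrow> point" where
  "reflect x = x(0 := - x 0)"

lemma reflect_reflect [simp]: "reflect (reflect x) = x"
  by (auto simp: reflect_def)

lemma reflect_Rd [simp]: "d \<ge> 1 \<Longrightarrow> reflect x \<in> Rd d \<longleftrightarrow> x \<in> Rd d"
  by (auto simp: Rd_iff reflect_def)

lemma reflect_0 [simp]: "reflect x 0 = - x 0" and reflect_other [simp]: "i \<noteq> 0 \<Longrightarrow> reflect x i = x i"
  by (auto simp: reflect_def)

lemma continuous_on_reflect: "continuous_on A reflect"
proof (rule continuous_on_coordinatewise_then_product)
  fix i
  have "continuous_on A (\<lambda>x :: point. x i)" for i
    using continuous_on_subset[OF continuous_on_product_coordinates subset_UNIV] .
  then show "continuous_on A (\<lambda>x. reflect x i)"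
    by (cases "i = 0") (auto intro: continuous_on_minus)
qed

lemma reflect_coord_deriv:
  assumes f: "coord_diff d f" and d: "d \<ge> 1" and i: "i < d" and x: "x \<in> Rd d"
  shows "((\<lambda>t. f (reflect (x(i := t)))) has_vector_derivative
    (if i = 0 then - 1 else 1) * partial i f (reflect x)) (at (x i))"
proof (cases "i = 0")
  case True
  have "((\<lambda>t. f ((reflect x)(0 := t))) has_vector_derivative partial 0 f (reflect x)) (at (- x 0))"
    using coord_diffD[OF f, of 0 "reflect x"] d x by simp
  then have "((\<lambda>t. f ((reflect x)(0 := t))) \<circ> uminus has_vector_derivative (- 1) *\<^sub>R partial 0 f (reflect x)) (at (x 0))"
    by (intro vector_diff_chain_at) (auto intro!: derivative_eq_intros)
  moreover have "(\<lambda>t. f ((reflect x)(0 := t))) \<circ> uminus = (\<lambda>t. f (reflect (x(0 := t))))"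
    by (auto simp: reflect_def fun_eq_iff)
  ultimately show ?thesis using True by simp
next
  case False
  have "reflect (x(i := t)) = (reflect x)(i := t)" for t using False by (auto simp: reflect_def)
  then show ?thesis using coord_diffD[OF f i, of "reflect x"] d x False by simp
qed

lemma partial_reflect:
  assumes "coord_diff d f" "d \<ge> 1" "i < d" "x \<in> Rd d"
  shows "partial i (\<lambda>x. f (reflect x)) x = (if i = 0 then - 1 else 1) * partial i f (reflect x)"
  by (rule partialI) (rule reflect_coord_deriv[OF assms])

lemma smooth_reflect:
  assumes f: "smooth d f" and d: "d \<ge> 1"
  shows "smooth d (\<lambda>x. f (reflect x))"
proof (rule smooth_coinduct)
  let ?F = "{(\<lambda>x. f (reflect x)) | f. smooth d f}"
  show "(\<lambda>x. f (reflect x)) \<in> ?F" using f by blast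
  fix h assume "h \<in> ?F"
  then obtain f where h: "h = (\<lambda>x. f (reflect x))" and f: "smooth d f" by blast
  show "continuous_on (Rd d) h"
    unfolding h using d by (intro continuous_on_compose2[OF smooth_continuous[OF f]] continuous_on_reflect) auto
  show "coord_diff d h"
    unfolding h by (rule coord_diffI) (rule reflect_coord_deriv[OF smooth_coord_diff[OF f] d])
  fix i assume i: "i < d"
  let ?g = "\<lambda>y. (if i = 0 then - 1 else 1) * partial i f y"
  have "smooth d ?g" by (rule smooth_scale[OF smooth_partial[OF f i]])
  then show "\<exists>g\<in>?F. \<forall>x\<in>Rd d. partial i h x = g x"
    unfolding h using partial_reflect[OF smooth_coord_diff[OF f] d i] by (intro bexI[of _ "\<lambda>x. ?g (reflect x)"]) auto
qed

subsection \<open>Lebesgue measure and test functions\<close>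

abbreviation lborel_Rd :: "nat \<Rightarrow> point measure" where
  "lborel_Rd d \<equiv> Pi\<^sub>M {..<d} (\<lambda>_. lborel)"

interpretation lborel_product: product_sigma_finite "\<lambda>_ :: nat. lborel :: real measure"
  by standard

lemma space_lborel_Rd [simp]: "space (lborel_Rd d) = Rd d"
  by (simp add: space_PiM Rd_def)

lemma space_lebesgue_Rd [simp]: "space (lebesgue_Rd d) = Rd d"
  by (simp add: lebesgue_Rd_def)

lemma sets_lebesgue_RdI: "A \<in> sets (lborel_Rd d) \<Longrightarrow> A \<in> sets (lebesgue_Rd d)"
  by (simp add: lebesgue_Rd_def)

lemma Rd_sets [simp]: "Rd d \<in> sets (lebesgue_Rd d)"
  using sets.top[of "lebesgue_Rd d"] by simp

lemma half_space_sets [simp]: "d \<ge> 1 \<Longrightarrow> half_space d \<in> sets (lebesgue_Rd d)"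
proof (rule sets_lebesgue_RdI)
  assume d: "d \<ge> 1"
  have "(\<lambda>x. x 0) \<in> borel_measurable (lborel_Rd d)"
    using measurable_component_singleton[of 0 "{..<d}" "\<lambda>_. lborel"] d by simp
  then have "{x \<in> space (lborel_Rd d). 0 < x 0} \<in> sets (lborel_Rd d)" by measurable
  then show "half_space d \<in> sets (lborel_Rd d)" by (simp add: half_space_def)
qed

text \<open>Continuity refers to the topology on all functions, measurability to the product
  measure. The identity links the two: it is measurable coordinate by coordinate, the coordinates
  from \<open>d\<close> on being constantly \<open>undefined\<close>.\<close>

lemma borel_measurable_lborel_Rd:
  assumes "continuous_on (Rd d) f"
  shows "f \<in> borel_measurable (lborel_Rd d)"
proof -
  have "(\<lambda>x. x) \<in> borel_measurable (lborel_Rd d)"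
  proof (rule measurable_coordinatewise_then_product)
    fix i
    show "(\<lambda>x. x i) \<in> borel_measurable (lborel_Rd d)"
    proof (cases "i < d")
      case True
      then show ?thesis using measurable_component_singleton[of i "{..<d}" "\<lambda>_. lborel"] by simp
    next
      case False
      have "(\<lambda>x. undefined) \<in> borel_measurable (lborel_Rd d)" by simp
      then show ?thesis
        by (rule measurable_cong[THEN iffD2, rotated]) (use False in \<open>simp add: Rd_iff\<close>)
    qed
  qed
  then have "(\<lambda>x. x) \<in> lborel_Rd d \<rightarrow>\<^sub>M restrict_space borel (Rd d)"
    by (rule measurable_restrict_space2[rotated]) auto
  from measurable_compose[OF this borel_measurable_continuous_on_restrict[OF assms]] show ?thesis by simp
qed

definition cube :: "nat \<Rightarrow> real \<Rightarrow> point set" where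
  "cube d B = {..<d} \<rightarrow>\<^sub>E {- B .. B}"

lemma cube_sets: "cube d B \<in> sets (lborel_Rd d)"
  unfolding cube_def by (rule sets_PiM_I_finite) auto

lemma cube_emeasure: "emeasure (lborel_Rd d) (cube d B) < \<infinity>"
  unfolding cube_def by (subst lborel_product.emeasure_PiM) (auto simp: emeasure_lborel_Icc_eq power_less_top_ennreal)

lemma integrable_bounded_support:
  fixes f :: "point \<Rightarrow> 'b::{banach, second_countable_topology}"
  assumes f: "f \<in> borel_measurable (lborel_Rd d)"
    and b: "\<And>x. x \<in> Rd d \<Longrightarrow> norm (f x) \<le> C"
    and s: "\<And>x i. x \<in> Rd d \<Longrightarrow> f x \<noteq> 0 \<Longrightarrow> i < d \<Longrightarrow> \<bar>x i\<bar> \<le> B"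
  shows "integrable (lborel_Rd d) f"
proof (rule Bochner_Integration.integrable_bound[OF _ f])
  show "integrable (lborel_Rd d) (\<lambda>x. C * indicator (cube d B) x)"
    using cube_emeasure[of d B] cube_sets[of d B] by (intro integrable_mult_right integrable_real_indicator) auto
  show "AE x in lborel_Rd d. norm (f x) \<le> norm (C * indicator (cube d B) x)"
  proof (rule AE_I2)
    fix x assume x: "x \<in> space (lborel_Rd d)"
    show "norm (f x) \<le> norm (C * indicator (cube d B) x)"
    proof (cases "f x = 0")
      case False
      have "x \<in> cube d B" using s[of x, OF _ False] x by (auto simp: cube_def PiE_iff Rd_def abs_le_iff minus_le_iff)
      then show ?thesis using b[of x] x by simp
    qed simp
  qed
qed

lemma test_support_bounded:
  assumes "\<phi> \<in> test_functions d \<Omega>"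
  shows "\<exists>B>0. \<forall>x\<in>Rd d. \<phi> x \<noteq> 0 \<longrightarrow> (\<forall>i<d. \<bar>x i\<bar> < B)"
proof -
  obtain C where C: "compact C" "C \<subseteq> \<Omega>" "\<And>x. x \<in> Rd d - C \<Longrightarrow> \<phi> x = 0"
    using assms by (auto simp: test_functions_def)
  have "\<exists>b. \<forall>x\<in>C. \<bar>x i\<bar> \<le> b" for i
  proof -
    have "continuous_on C (\<lambda>x :: point. x i)"
      using continuous_on_subset[OF continuous_on_product_coordinates subset_UNIV] .
    then have "bounded ((\<lambda>x. x i) ` C)" using C(1) compact_continuous_image compact_imp_bounded by blast
    then show ?thesis by (auto simp: bounded_iff)
  qed
  then obtain b where b: "\<And>i x. x \<in> C \<Longrightarrow> \<bar>x i\<bar> \<le> b i" by metis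
  define B where "B = 1 + (\<Sum>i<d. \<bar>b i\<bar>)"
  show ?thesis
  proof (intro exI[of _ B] conjI ballI allI impI)
    show "B > 0" by (simp add: B_def add_pos_nonneg sum_nonneg)
    fix x i assume x: "x \<in> Rd d" "\<phi> x \<noteq> 0" and i: "i < d"
    have "x \<in> C" using C(3) x by blast
    then have "\<bar>x i\<bar> \<le> b i" by (rule b)
    also have "\<dots> \<le> \<bar>b i\<bar>" by simp
    also have "\<dots> \<le> (\<Sum>i<d. \<bar>b i\<bar>)" using i by (intro member_le_sum) auto
    finally show "\<bar>x i\<bar> < B" by (simp add: B_def)
  qed
qed

lemma test_smooth: "\<phi> \<in> test_functions d \<Omega> \<Longrightarrow> smooth d \<phi>"
  by (simp add: test_functions_def)

lemma test_bounded:
  assumes t: "\<phi> \<in> test_functions d \<Omega>" and \<Omega>: "\<Omega> \<subseteq> Rd d"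
  shows "\<exists>B. \<forall>x\<in>Rd d. cmod (\<phi> x) \<le> B"
proof -
  obtain C where C: "compact C" "C \<subseteq> \<Omega>" "\<And>x. x \<in> Rd d - C \<Longrightarrow> \<phi> x = 0"
    using t by (auto simp: test_functions_def)
  have "continuous_on C \<phi>"
    using smooth_continuous[OF test_smooth[OF t]] continuous_on_subset C(2) \<Omega> by blast
  then have "bounded (\<phi> ` C)" using C(1) compact_continuous_image compact_imp_bounded by blast
  then obtain B where B: "\<And>x. x \<in> C \<Longrightarrow> cmod (\<phi> x) \<le> B" by (auto simp: bounded_iff)
  show ?thesis
  proof (intro exI ballI)
    show "cmod (\<phi> x) \<le> \<bar>B\<bar>" if "x \<in> Rd d" for x
      using B[of x] C(3)[of x] that by (cases "x \<in> C") auto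
  qed
qed

lemma test_outside: "\<phi> \<in> test_functions d \<Omega> \<Longrightarrow> x \<in> Rd d \<Longrightarrow> x \<notin> \<Omega> \<Longrightarrow> \<phi> x = 0"
  by (auto simp: test_functions_def)

lemma test_mono: "\<Omega> \<subseteq> \<Omega>' \<Longrightarrow> \<phi> \<in> test_functions d \<Omega> \<Longrightarrow> \<phi> \<in> test_functions d \<Omega>'"
  by (auto simp: test_functions_def)

lemma test_functionsI:
  assumes "smooth d \<phi>" "compact C" "C \<subseteq> \<Omega>" "\<And>x. x \<in> Rd d \<Longrightarrow> x \<notin> C \<Longrightarrow> \<phi> x = 0"
  shows "\<phi> \<in> test_functions d \<Omega>"
  unfolding test_functions_def using assms by blast

lemma test_mult:
  assumes t: "\<phi> \<in> test_functions d \<Omega>" and f: "smooth d f"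
  shows "(\<lambda>x. f x * \<phi> x) \<in> test_functions d \<Omega>"
proof -
  obtain C where C: "compact C" "C \<subseteq> \<Omega>" "\<And>x. x \<in> Rd d - C \<Longrightarrow> \<phi> x = 0"
    using t by (auto simp: test_functions_def)
  show ?thesis
    by (rule test_functionsI[OF smooth_mult[OF f test_smooth[OF t]] C(1,2)]) (simp add: C(3))
qed

lemma test_scale: "\<phi> \<in> test_functions d \<Omega> \<Longrightarrow> (\<lambda>x. c * \<phi> x) \<in> test_functions d \<Omega>"
  by (rule test_mult[OF _ smooth_const])

lemma test_add:
  assumes t: "\<phi> \<in> test_functions d \<Omega>" "\<psi> \<in> test_functions d \<Omega>"
  shows "(\<lambda>x. \<phi> x + \<psi> x) \<in> test_functions d \<Omega>"
proof -
  obtain C where C: "compact C" "C \<subseteq> \<Omega>" "\<And>x. x \<in> Rd d - C \<Longrightarrow> \<phi> x = 0"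
    using t(1) by (auto simp: test_functions_def)
  obtain D where D: "compact D" "D \<subseteq> \<Omega>" "\<And>x. x \<in> Rd d - D \<Longrightarrow> \<psi> x = 0"
    using t(2) by (auto simp: test_functions_def)
  show ?thesis
    by (rule test_functionsI[OF smooth_add[OF t[THEN test_smooth]] compact_Un[OF C(1) D(1)]])
      (use C(2,3) D(2,3) in auto)
qed

lemma test_zero: "(\<lambda>x. 0) \<in> test_functions d \<Omega>"
  by (rule test_functionsI[OF smooth_const, of "{}"]) auto

lemma test_reflect:
  assumes t: "\<phi> \<in> test_functions d \<Omega>" and d: "d \<ge> 1"
  shows "(\<lambda>x. \<phi> (reflect x)) \<in> test_functions d (reflect ` \<Omega>)"
proof -
  obtain C where C: "compact C" "C \<subseteq> \<Omega>" "\<And>x. x \<in> Rd d - C \<Longrightarrow> \<phi> x = 0"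
    using t by (auto simp: test_functions_def)
  show ?thesis
  proof (rule test_functionsI[OF smooth_reflect[OF test_smooth[OF t] d]])
    show "compact (reflect ` C)" by (rule compact_continuous_image[OF continuous_on_reflect C(1)])
    show "reflect ` C \<subseteq> reflect ` \<Omega>" using C(2) by blast
    fix x assume x: "x \<in> Rd d" "x \<notin> reflect ` C"
    then have "reflect x \<notin> C" by (metis image_eqI reflect_reflect)
    then show "\<phi> (reflect x) = 0" using C(3) x(1) d by simp
  qed
qed

text \<open>Off the compact set \<open>C\<close> the function vanishes for nearby values of the
  \<open>i\<close>-th coordinate, since the complement of \<open>C\<close> is open along each
  coordinate line. So the derivative vanishes there too and \<open>C\<close> serves again.\<close>

lemma test_partial:
  assumes t: "\<phi> \<in> test_functions d \<Omega>" and i: "i < d"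
  shows "partial i \<phi> \<in> test_functions d \<Omega>"
proof -
  obtain C where C: "compact C" "C \<subseteq> \<Omega>" "\<And>x. x \<in> Rd d - C \<Longrightarrow> \<phi> x = 0"
    using t by (auto simp: test_functions_def)
  show ?thesis
  proof (rule test_functionsI[OF smooth_partial[OF test_smooth[OF t] i] C(1,2)])
    fix x assume x: "x \<in> Rd d" "x \<notin> C"
    have "continuous_on UNIV (\<lambda>t. x(i := t))"
    proof (rule continuous_on_coordinatewise_then_product)
      show "continuous_on UNIV (\<lambda>t. (x(i := t)) j)" for j by (cases "j = i") auto
    qed
    then have "open ((\<lambda>t. x(i := t)) -` (- C))"
      using C(1) by (intro open_vimage open_Compl compact_imp_closed) auto
    then have op: "open {t. x(i := t) \<notin> C}" by (simp add: vimage_def)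
    show "partial i \<phi> x = 0"
    proof (rule partialI)
      show "((\<lambda>t. \<phi> (x(i := t))) has_vector_derivative 0) (at (x i))"
        by (rule has_vector_derivative_transform_within_open[OF has_vector_derivative_const[of 0] op])
          (use x i C(3) in auto)
    qed
  qed
qed

lemma test_measurable: "\<phi> \<in> test_functions d \<Omega> \<Longrightarrow> \<phi> \<in> borel_measurable (lborel_Rd d)"
  by (intro borel_measurable_lborel_Rd smooth_continuous test_smooth)

lemma test_integrable_power:
  assumes t: "\<phi> \<in> test_functions d \<Omega>" and \<Omega>: "\<Omega> \<subseteq> Rd d"
  shows "integrable (lborel_Rd d) (\<lambda>x. (cmod (\<phi> x))\<^sup>2)" "integrable (lborel_Rd d) \<phi>"
proof -
  from test_support_bounded[OF t]
  obtain B where B: "\<forall>x\<in>Rd d. \<phi> x \<noteq> 0 \<longrightarrow> (\<forall>i<d. \<bar>x i\<bar> < B)" by blast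
  from test_bounded[OF t \<Omega>] obtain C where C: "\<forall>x\<in>Rd d. cmod (\<phi> x) \<le> C" ..
  note [measurable] = test_measurable[OF t]
  show "integrable (lborel_Rd d) (\<lambda>x. (cmod (\<phi> x))\<^sup>2)"
  proof (rule integrable_bounded_support[of _ _ "C\<^sup>2" B])
    show "norm ((cmod (\<phi> x))\<^sup>2) \<le> C\<^sup>2" if "x \<in> Rd d" for x
      using power_mono[OF C[rule_format, OF that]] by simp
    show "\<bar>x i\<bar> \<le> B" if "x \<in> Rd d" "(cmod (\<phi> x))\<^sup>2 \<noteq> 0" "i < d" for x i
      using B that by (auto intro: less_imp_le)
  qed simp
  show "integrable (lborel_Rd d) \<phi>"
  proof (rule integrable_bounded_support[of _ _ C B])
    show "\<bar>x i\<bar> \<le> B" if "x \<in> Rd d" "\<phi> x \<noteq> 0" "i < d" for x i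
      using B that by (auto intro: less_imp_le)
  qed (simp_all add: C)
qed

lemma leb_measurable:
  assumes "f \<in> borel_measurable (lborel_Rd d)"
  shows "f \<in> borel_measurable (leb d \<Omega>)"
  unfolding leb_def lebesgue_Rd_def by (intro measurable_restrict_space1 measurable_completion assms)

lemma integrable_leb:
  fixes f :: "point \<Rightarrow> 'b::{banach, second_countable_topology}"
  assumes "integrable (lebesgue_Rd d) f" "\<Omega> \<in> sets (lebesgue_Rd d)"
  shows "integrable (leb d \<Omega>) f"
  unfolding leb_def using assms sets.sets_into_space[OF assms(2)]
  by (subst integrable_restrict_space) (auto intro!: integrable_mult_indicator simp: Int_absorb2)

lemma integral_leb:
  fixes f :: "point \<Rightarrow> 'b::{banach, second_countable_topology}"
  assumes "\<Omega> \<in> sets (lebesgue_Rd d)"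
  shows "(LINT x|leb d \<Omega>. f x) = (LINT x|lebesgue_Rd d. indicator \<Omega> x *\<^sub>R f x)"
  unfolding leb_def using assms sets.sets_into_space[OF assms]
  by (subst integral_restrict_space) (auto simp: Int_absorb2)

lemma leb_Rd: "leb d (Rd d) = lebesgue_Rd d"
proof (rule measure_eqI)
  have "Rd d \<inter> A = A" if "A \<in> sets (lebesgue_Rd d)" for A
    using sets.sets_into_space[OF that] by auto
  then show sets: "sets (leb d (Rd d)) = sets (lebesgue_Rd d)"
    by (auto simp: leb_def sets_restrict_space)
  show "emeasure (leb d (Rd d)) A = emeasure (lebesgue_Rd d) A" if "A \<in> sets (leb d (Rd d))" for A
    using that sets.sets_into_space[OF that[unfolded sets]] unfolding leb_def
    by (subst emeasure_restrict_space) auto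
qed

lemma test_L2:
  assumes t: "\<phi> \<in> test_functions d \<Omega>'" "\<Omega>' \<subseteq> Rd d" and \<Omega>: "\<Omega> \<in> sets (lebesgue_Rd d)"
  shows "\<phi> \<in> L2 (leb d \<Omega>)"
  unfolding L2_def
proof (safe)
  show "\<phi> \<in> borel_measurable (leb d \<Omega>)" by (rule leb_measurable[OF test_measurable[OF t(1)]])
  show "integrable (leb d \<Omega>) (\<lambda>x. (cmod (\<phi> x))\<^sup>2)"
    using test_integrable_power(1)[OF t] test_measurable[OF t(1)]
    by (intro integrable_leb[OF _ \<Omega>]) (simp add: lebesgue_Rd_def integrable_completion)
qed

subsection \<open>Integration by parts\<close>

text \<open>Fubini isolates coordinate \<open>i\<close>, in which the fundamental theorem of
  calculus leaves only boundary values outside the support.\<close>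

lemma integral_partial_eq_0:
  assumes t: "\<phi> \<in> test_functions d \<Omega>" and \<Omega>: "\<Omega> \<subseteq> Rd d" and i: "i < d"
  shows "(LINT x|lborel_Rd d. partial i \<phi> x) = 0"
proof -
  from test_support_bounded[OF t]
  obtain B where B0: "B > 0" "\<forall>x\<in>Rd d. \<phi> x \<noteq> 0 \<longrightarrow> (\<forall>i<d. \<bar>x i\<bar> < B)" by blast
  from test_support_bounded[OF test_partial[OF t i]]
  obtain B' where B0': "B' > 0" "\<forall>x\<in>Rd d. partial i \<phi> x \<noteq> 0 \<longrightarrow> (\<forall>j<d. \<bar>x j\<bar> < B')" by blast
  have B: "B > 0" "\<And>x i. x \<in> Rd d \<Longrightarrow> \<phi> x \<noteq> 0 \<Longrightarrow> i < d \<Longrightarrow> \<bar>x i\<bar> < B"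
    and B': "B' > 0" "\<And>x j. x \<in> Rd d \<Longrightarrow> partial i \<phi> x \<noteq> 0 \<Longrightarrow> j < d \<Longrightarrow> \<bar>x j\<bar> < B'"
    using B0 B0' by simp_all
  \<comment> \<open>Beyond the support bounds of both \<open>\<phi>\<close> and its derivative, so
    that the boundary values vanish and the integral over the segment is the full one.\<close>
  define D where "D = B + B'"
  have D: "D > B" "D > B'" "D > 0" using B B' by (auto simp: D_def)
  have ins: "{..<d} = insert i ({..<d} - {i})" using i by auto
  have inner: "(LINT y|lborel. partial i \<phi> (x(i := y))) = 0" if x: "x \<in> space (Pi\<^sub>M ({..<d} - {i}) (\<lambda>_. lborel))" for x
  proof -
    have xR: "x(i := y) \<in> Rd d" for y using x i by (auto simp: space_PiM PiE_iff extensional_def Rd_iff)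
    have cd: "coord_diff d \<phi>" by (rule smooth_coord_diff[OF test_smooth[OF t]])
    have der: "((\<lambda>t. \<phi> (x(i := t))) has_vector_derivative partial i \<phi> (x(i := s))) (at s)" for s
      using coord_diffD[OF cd i xR[of s]] by simp
    have cont: "continuous_on UNIV (\<lambda>s. partial i \<phi> (x(i := s)))"
    proof (rule continuous_on_compose2[OF smooth_continuous[OF smooth_partial[OF test_smooth[OF t] i]]])
      show "continuous_on UNIV (\<lambda>s. x(i := s))"
      proof (rule continuous_on_coordinatewise_then_product)
        show "continuous_on UNIV (\<lambda>t. (x(i := t)) j)" for j by (cases "j = i") auto
      qed
    qed (use xR in auto)
    have "has_bochner_integral lborel (\<lambda>s. indicator {- D .. D} s *\<^sub>R partial i \<phi> (x(i := s)))
      (\<phi> (x(i := D)) - \<phi> (x(i := - D)))"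
      using D by (intro has_bochner_integral_FTC_Icc has_vector_derivative_at_within[OF der]
        continuous_on_subset[OF cont]) auto
    moreover have "\<phi> (x(i := D)) = 0" "\<phi> (x(i := - D)) = 0"
      using B(2)[OF xR _ i, of D] B(2)[OF xR _ i, of "- D"] D by auto
    moreover have "indicator {- D .. D} s *\<^sub>R partial i \<phi> (x(i := s)) = partial i \<phi> (x(i := s))" for s
      using B'(2)[OF xR[of s] _ i] D by (cases "partial i \<phi> (x(i := s)) = 0") (auto simp: indicator_def abs_less_iff)
    ultimately show ?thesis by (simp add: has_bochner_integral_iff)
  qed
  have "(LINT x|lborel_Rd d. partial i \<phi> x) =
    (LINT x|Pi\<^sub>M ({..<d} - {i}) (\<lambda>_. lborel). LINT y|lborel. partial i \<phi> (x(i := y)))"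
    using lborel_product.product_integral_insert[of "{..<d} - {i}" i "partial i \<phi>"]
      test_integrable_power(2)[OF test_partial[OF t i] \<Omega>] ins by simp
  also have "\<dots> = (LINT x|Pi\<^sub>M ({..<d} - {i}) (\<lambda>_. lborel :: real measure). 0)"
    by (rule Bochner_Integration.integral_cong[OF refl inner])
  finally show ?thesis by simp
qed

lemma integral_test_leb:
  assumes "\<phi> \<in> test_functions d \<Omega>" "\<Omega> \<in> sets (lebesgue_Rd d)"
  shows "(LINT x|leb d \<Omega>. f x * \<phi> x) = (LINT x|lebesgue_Rd d. f x * \<phi> x)"
  unfolding integral_leb[OF assms(2)]
  by (rule Bochner_Integration.integral_cong[OF refl]) (use test_outside[OF assms(1)] in \<open>auto simp: indicator_def\<close>)

lemma integration_by_parts: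
  assumes f: "\<phi> \<in> test_functions d \<Omega>" "\<psi> \<in> test_functions d \<Omega>" and \<Omega>: "\<Omega> \<subseteq> Rd d" and i: "i < d"
  shows "(LINT x|lborel_Rd d. \<phi> x * partial i \<psi> x) = - (LINT x|lborel_Rd d. partial i \<phi> x * \<psi> x)"
proof -
  have p: "partial i (\<lambda>x. \<phi> x * \<psi> x) x = \<phi> x * partial i \<psi> x + partial i \<phi> x * \<psi> x" if "x \<in> Rd d" for x
    by (rule partialI) (rule partial_mult[OF f[THEN test_smooth, THEN smooth_coord_diff] i that])
  have I: "integrable (lborel_Rd d) (\<lambda>x. \<phi> x * partial i \<psi> x)" "integrable (lborel_Rd d) (\<lambda>x. partial i \<phi> x * \<psi> x)"
    using test_integrable_power(2)[OF test_mult[OF test_partial[OF f(2) i] test_smooth[OF f(1)]] \<Omega>]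
      test_integrable_power(2)[OF test_mult[OF f(2) test_smooth[OF test_partial[OF f(1) i]]] \<Omega>] .
  have "0 = (LINT x|lborel_Rd d. partial i (\<lambda>x. \<phi> x * \<psi> x) x)"
    using integral_partial_eq_0[OF test_mult[OF f(2) test_smooth[OF f(1)]] \<Omega> i] by simp
  also have "\<dots> = (LINT x|lborel_Rd d. \<phi> x * partial i \<psi> x + partial i \<phi> x * \<psi> x)"
    by (rule Bochner_Integration.integral_cong[OF refl]) (simp add: p)
  also have "\<dots> = (LINT x|lborel_Rd d. \<phi> x * partial i \<psi> x) + (LINT x|lborel_Rd d. partial i \<phi> x * \<psi> x)"
    by (rule Bochner_Integration.integral_add[OF I])
  finally show ?thesis by (simp add: eq_neg_iff_add_eq_0)
qed

lemma test_has_weak_partial: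
  assumes t: "\<phi> \<in> test_functions d \<Omega>" and \<Omega>: "\<Omega> \<in> sets (lebesgue_Rd d)" and i: "i < d"
  shows "has_weak_partial d \<Omega> i \<phi> (partial i \<phi>)"
  unfolding has_weak_partial_def
proof (intro conjI ballI)
  have sub: "\<Omega> \<subseteq> Rd d" using sets.sets_into_space[OF \<Omega>] by simp
  show "partial i \<phi> \<in> L2 (leb d \<Omega>)" by (rule test_L2[OF test_partial[OF t i] sub \<Omega>])
  fix \<psi> assume p: "\<psi> \<in> test_functions d \<Omega>"
  have "(LINT x|leb d \<Omega>. \<phi> x * partial i \<psi> x) = (LINT x|lborel_Rd d. \<phi> x * partial i \<psi> x)"
    unfolding integral_test_leb[OF test_partial[OF p i] \<Omega>] lebesgue_Rd_def
    by (rule integral_completion[OF borel_measurable_times[OF test_measurable[OF t] test_measurable[OF test_partial[OF p i]]]])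
  also have "\<dots> = - (LINT x|lborel_Rd d. partial i \<phi> x * \<psi> x)" by (rule integration_by_parts[OF t p sub i])
  also have "(LINT x|lborel_Rd d. partial i \<phi> x * \<psi> x) = (LINT x|leb d \<Omega>. partial i \<phi> x * \<psi> x)"
    unfolding integral_test_leb[OF p \<Omega>] lebesgue_Rd_def
    by (rule integral_completion[OF borel_measurable_times[OF test_measurable[OF test_partial[OF t i]] test_measurable[OF p]], symmetric])
  finally show "(LINT x|leb d \<Omega>. \<phi> x * partial i \<psi> x) = - (LINT x|leb d \<Omega>. partial i \<phi> x * \<psi> x)" .
qed

subsection \<open>The fundamental lemma of the calculus of variations\<close>

definition open_box :: "nat \<Rightarrow> (nat \<Rightarrow> real) \<Rightarrow> (nat \<Rightarrow> real) \<Rightarrow> point set" where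
  "open_box d a b = {x \<in> Rd d. \<forall>i<d. a i < x i \<and> x i < b i}"

definition closed_box :: "nat \<Rightarrow> (nat \<Rightarrow> real) \<Rightarrow> (nat \<Rightarrow> real) \<Rightarrow> point set" where
  "closed_box d a b = {x \<in> Rd d. \<forall>i<d. a i \<le> x i \<and> x i \<le> b i}"

text \<open>Smooth functions supported in the closed box that tend pointwise to the indicator of the
  open box as \<open>n\<close> grows. The arguments are written as affine functions of
  \<open>x i\<close> to match \<open>smooth_eta\<close>.\<close>

definition bump :: "nat \<Rightarrow> (nat \<Rightarrow> real) \<Rightarrow> (nat \<Rightarrow> real) \<Rightarrow> nat \<Rightarrow> point \<Rightarrow> complex" where
  "bump d a b n x = (\<Prod>i<d. of_real (eta 1 (real n * x i + - (real n * a i))) *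
     of_real (eta 1 (- real n * x i + real n * b i)))"

text \<open>Tychonoff over all coordinates; those from \<open>d\<close> on contribute the singleton
  \<open>{undefined}\<close>.\<close>

lemma compact_closed_box: "compact (closed_box d a b)"
proof -
  let ?X = "\<lambda>i. if i < d then {a i .. b i} else {undefined}"
  have "compactin (product_topology (\<lambda>i. euclidean) UNIV) (PiE UNIV ?X)"
    by (subst compactin_PiE) (auto simp: compactin_euclidean_iff)
  then have "compact (PiE UNIV ?X)" by (simp add: euclidean_product_topology compactin_euclidean_iff)
  moreover have "closed_box d a b = PiE UNIV ?X"
  proof (intro set_eqI iffI)
    fix x assume x: "x \<in> PiE UNIV ?X"
    have X: "x i \<in> ?X i" for i using x by (auto simp: PiE_iff)
    have "x i = undefined" if "i \<ge> d" for i using X[of i] that by simp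
    moreover have "a i \<le> x i \<and> x i \<le> b i" if "i < d" for i using X[of i] that by simp
    ultimately show "x \<in> closed_box d a b" unfolding closed_box_def Rd_iff by blast
  qed (auto simp: closed_box_def Rd_iff)
  ultimately show ?thesis by simp
qed

lemma eta_1_bounds: "0 \<le> eta 1 t" "eta 1 t \<le> 1" "t \<le> 0 \<Longrightarrow> eta 1 t = 0"
  by (auto simp: eta_def)

lemma eta_1_tendsto: "t > 0 \<Longrightarrow> (\<lambda>n. eta 1 (real n * t)) \<longlonglongrightarrow> 1"
proof -
  assume t: "t > 0"
  have "(\<lambda>n. exp (- (1 / t) * (1 / real n))) \<longlonglongrightarrow> exp (- (1 / t) * 0)"
    by (intro tendsto_intros lim_1_over_n)
  moreover have "\<forall>\<^sub>F n in sequentially. exp (- (1 / t) * (1 / real n)) = eta 1 (real n * t)"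
    using eventually_gt_at_top[of 0] by eventually_elim (use t in \<open>auto simp: eta_def mult.commute\<close>)
  ultimately show ?thesis by (simp add: Lim_transform_eventually)
qed

lemma bump_test:
  assumes "closed_box d a b \<subseteq> \<Omega>"
  shows "bump d a b n \<in> test_functions d \<Omega>"
proof (rule test_functionsI[OF _ compact_closed_box assms])
  show "smooth d (bump d a b n)"
    unfolding bump_def by (intro smooth_prod smooth_mult smooth_eta)
  fix x assume x: "x \<in> Rd d" "x \<notin> closed_box d a b"
  then obtain i where i: "i < d" "x i < a i \<or> b i < x i" by (auto simp: closed_box_def not_le)
  have "eta 1 (real n * x i + - (real n * a i)) = 0 \<or> eta 1 (- real n * x i + real n * b i) = 0"
  proof (rule disjE[OF i(2)])
    assume "x i < a i"
    then have "real n * x i \<le> real n * a i" by (intro mult_left_mono) auto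
    then show ?thesis using eta_1_bounds(3) by simp
  next
    assume "b i < x i"
    then have "real n * b i \<le> real n * x i" by (intro mult_left_mono) auto
    then show ?thesis using eta_1_bounds(3) by simp
  qed
  then show "bump d a b n x = 0" unfolding bump_def using i(1) by (intro prod_zero) auto
qed

lemma bump_real: "cnj (bump d a b n x) = bump d a b n x"
  by (simp add: bump_def)

lemma bump_le_1: "cmod (bump d a b n x) \<le> 1"
proof -
  have "cmod (bump d a b n x) = (\<Prod>i<d. \<bar>eta 1 (real n * x i + - (real n * a i))\<bar> * \<bar>eta 1 (- real n * x i + real n * b i)\<bar>)"
    by (simp add: bump_def norm_mult flip: prod_norm)
  also have "\<dots> \<le> (\<Prod>i<d. 1 * 1)"
    using eta_1_bounds(1,2) by (intro prod_mono conjI mult_mono) (auto simp: abs_of_nonneg)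
  finally show ?thesis by simp
qed

lemma bump_tendsto: "x \<in> Rd d \<Longrightarrow> (\<lambda>n. bump d a b n x) \<longlonglongrightarrow> indicator (open_box d a b) x"
proof (cases "x \<in> open_box d a b")
  case True
  have "(\<lambda>n. bump d a b n x) \<longlonglongrightarrow> (\<Prod>i<d. of_real 1 * of_real 1)"
    unfolding bump_def
  proof (intro tendsto_prod tendsto_mult tendsto_of_real)
    fix i assume "i \<in> {..<d}"
    then have "x i - a i > 0" "b i - x i > 0" using True by (auto simp: open_box_def)
    moreover have "real n * x i + - (real n * a i) = real n * (x i - a i)"
      "- real n * x i + real n * b i = real n * (b i - x i)" for n
      by (simp_all add: algebra_simps)
    ultimately show "(\<lambda>n. eta 1 (real n * x i + - (real n * a i))) \<longlonglongrightarrow> 1"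
      "(\<lambda>n. eta 1 (- real n * x i + real n * b i)) \<longlonglongrightarrow> 1"
      by (simp_all only: eta_1_tendsto)
  qed
  then show ?thesis using True by simp
next
  case False
  assume x: "x \<in> Rd d"
  obtain i where i: "i < d" "x i \<le> a i \<or> b i \<le> x i" using False x by (auto simp: open_box_def not_less)
  have "bump d a b n x = 0" for n
  proof -
    have "eta 1 (real n * x i + - (real n * a i)) = 0 \<or> eta 1 (- real n * x i + real n * b i) = 0"
    proof (rule disjE[OF i(2)])
      assume "x i \<le> a i"
      then have "real n * x i \<le> real n * a i" by (intro mult_left_mono) auto
      then show ?thesis using eta_1_bounds(3) by simp
    next
      assume "b i \<le> x i"
      then have "real n * b i \<le> real n * x i" by (intro mult_left_mono) auto
      then show ?thesis using eta_1_bounds(3) by simp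
    qed
    then show ?thesis unfolding bump_def using i(1) by (intro prod_zero) auto
  qed
  then show ?thesis using False by simp
qed

lemma open_box_PiE: "open_box d a b = (\<Pi>\<^sub>E i\<in>{..<d}. {a i <..< b i})"
  unfolding open_box_def Rd_def PiE_iff by (rule set_eqI) (unfold mem_Collect_eq PiE_iff greaterThanLessThan_iff atLeastAtMost_iff, blast)

lemma closed_box_PiE: "closed_box d a b = (\<Pi>\<^sub>E i\<in>{..<d}. {a i .. b i})"
  unfolding closed_box_def Rd_def PiE_iff by (rule set_eqI) (unfold mem_Collect_eq PiE_iff greaterThanLessThan_iff atLeastAtMost_iff, blast)

lemma open_box_sets: "open_box d a b \<in> sets (lborel_Rd d)"
  unfolding open_box_PiE by (rule sets_PiM_I_finite) auto

lemma open_box_Int: "open_box d a b \<inter> open_box d a' b' = open_box d (\<lambda>i. max (a i) (a' i)) (\<lambda>i. min (b i) (b' i))"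
  by (auto simp: open_box_def)

text \<open>Open boxes form an intersection-stable generator, which allows an induction over Borel
  sets from vanishing integrals over boxes.\<close>

lemma sets_lborel_Rd:
  assumes d: "d \<ge> 1"
  shows "sets (lborel_Rd d) = sigma_sets (Rd d) (range (\<lambda>(a, b). open_box d a b))"
proof -
  let ?E = "range (\<lambda>(a, b). {a <..< b :: real})"
  have "sets (lborel_Rd d) = sets (Pi\<^sub>M {..<d} (\<lambda>_. sigma UNIV ?E))"
    by (rule sets_PiM_cong[OF refl]) (simp add: borel_eq_box[where 'a = real] box_real)
  also have "\<dots> = sets (sigma (\<Pi>\<^sub>E i\<in>{..<d}. UNIV) {{f\<in>(\<Pi>\<^sub>E i\<in>{..<d}. UNIV). \<forall>i\<in>j. f i \<in> A i} | A j. j \<in> {{..<d}} \<and> A \<in> Pi j (\<lambda>_. ?E)})"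
  proof (rule sets_PiM_sigma)
    fix i :: nat
    have "(UNIV :: real set) = \<Union> (range (\<lambda>n. {- real n <..< real n}))"
    proof (intro set_eqI iffI UNIV_I)
      fix x :: real
      obtain n where "\<bar>x\<bar> < real n" using reals_Archimedean2 by blast
      then show "x \<in> \<Union> (range (\<lambda>n. {- real n <..< real n}))" by (auto simp: abs_less_iff intro!: exI[of _ n])
    qed
    then show "\<exists>S\<subseteq>?E. countable S \<and> UNIV = \<Union> S"
      by (intro exI[of _ "range (\<lambda>n. {- real n <..< real n})"]) auto
  qed auto
  also have "{{f\<in>(\<Pi>\<^sub>E i\<in>{..<d}. UNIV). \<forall>i\<in>j. f i \<in> A i} | A j. j \<in> {{..<d}} \<and> A \<in> Pi j (\<lambda>_. ?E)} =
    range (\<lambda>(a, b). open_box d a b)" (is "?L = ?R")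
  proof (intro set_eqI iffI)
    fix Q assume "Q \<in> ?L"
    then obtain A where A: "A \<in> Pi {..<d} (\<lambda>_. ?E)" and Q: "Q = {f\<in>(\<Pi>\<^sub>E i\<in>{..<d}. UNIV). \<forall>i\<in>{..<d}. f i \<in> A i}" by auto
    have "\<forall>i. \<exists>u v. i < d \<longrightarrow> A i = {u <..< v}" using A by (fastforce simp: Pi_iff)
    then obtain u v where uv: "\<And>i. i < d \<Longrightarrow> A i = {u i <..< v i}" by metis
    have "Q = open_box d u v" unfolding Q open_box_def Rd_def using uv by auto
    then show "Q \<in> ?R" by auto
  next
    fix Q assume "Q \<in> ?R"
    then obtain u v where Q: "Q = open_box d u v" by auto
    show "Q \<in> ?L"
      unfolding Q open_box_def Rd_def
      by (rule CollectI, rule exI[of _ "\<lambda>i. {u i <..< v i}"], rule exI[of _ "{..<d}"]) auto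
  qed
  finally show ?thesis by (simp add: Rd_def open_box_def sets_measure_of_conv subset_eq PiE_iff)
qed

text \<open>The exhaustion provides countably many boxes on which bump functions are admissible and
  whose open versions cover the domain, so that almost-everywhere statements can be checked box by
  box.\<close>

locale domain =
  fixes d :: nat and \<Omega> :: "point set"
  assumes d: "d \<ge> 1" and \<Omega>_sets [simp]: "\<Omega> \<in> sets (lebesgue_Rd d)"
    and exhaustion: "\<exists>a b :: nat \<Rightarrow> nat \<Rightarrow> real. (\<forall>n. closed_box d (a n) (b n) \<subseteq> \<Omega>) \<and> \<Omega> \<subseteq> (\<Union>n. open_box d (a n) (b n))"
begin

lemma \<Omega>_Rd: "\<Omega> \<subseteq> Rd d"
  using sets.sets_into_space[OF \<Omega>_sets] by simp

lemma space_leb [simp]: "space (leb d \<Omega>) = \<Omega>"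
  using \<Omega>_Rd by (auto simp: leb_def space_restrict_space)

lemma leb_sets: "A \<in> sets (lborel_Rd d) \<Longrightarrow> A \<inter> \<Omega> \<in> sets (leb d \<Omega>)"
  unfolding leb_def sets_restrict_space using sets_lebesgue_RdI[of A d] by (auto simp: Int_commute)

lemma leb_indicator: "A \<in> sets (lborel_Rd d) \<Longrightarrow> (indicator A :: point \<Rightarrow> 'b::real_normed_algebra_1) \<in> borel_measurable (leb d \<Omega>)"
  by (rule leb_measurable) simp

lemma test_in_L2: "\<phi> \<in> test_functions d \<Omega> \<Longrightarrow> \<phi> \<in> L2 (leb d \<Omega>)"
  by (rule test_L2[OF _ \<Omega>_Rd \<Omega>_sets])

lemma closed_box_L2: "(\<lambda>x. indicator (closed_box d a b) x) \<in> L2 (leb d \<Omega>)"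
proof -
  have s: "closed_box d a b \<in> sets (lborel_Rd d)" unfolding closed_box_PiE by (rule sets_PiM_I_finite) auto
  have "emeasure (lborel_Rd d) (closed_box d a b) < \<infinity>"
    unfolding closed_box_PiE
    by (subst lborel_product.emeasure_PiM) (auto simp: emeasure_lborel_Icc_eq less_top[symmetric] ennreal_prod_eq_top)
  then have "integrable (lborel_Rd d) (indicator (closed_box d a b) :: point \<Rightarrow> real)"
    using s by (intro integrable_real_indicator) auto
  then have "integrable (leb d \<Omega>) (indicator (closed_box d a b) :: point \<Rightarrow> real)"
    by (intro integrable_leb \<Omega>_sets) (simp add: lebesgue_Rd_def integrable_completion)
  moreover have "(cmod (indicator (closed_box d a b) x))\<^sup>2 = indicator (closed_box d a b) x" for x
    by (auto simp: indicator_def)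
  ultimately show ?thesis using leb_indicator[OF s] by (simp add: L2_def)
qed

lemma integral_open_box_eq_0:
  assumes g: "g \<in> L2 (leb d \<Omega>)"
    and t: "\<And>a b n. closed_box d a b \<subseteq> \<Omega> \<Longrightarrow> (LINT x|leb d \<Omega>. g x * bump d a b n x) = 0"
    and box: "closed_box d a b \<subseteq> \<Omega>"
  shows "(LINT x|leb d \<Omega>. indicator (open_box d a b) x * g x) = 0"
proof -
  have gm [measurable]: "g \<in> borel_measurable (leb d \<Omega>)" by (rule L2D(1)[OF g])
  have "(\<lambda>n. LINT x|leb d \<Omega>. bump d a b n x * g x) \<longlonglongrightarrow> (LINT x|leb d \<Omega>. indicator (open_box d a b) x * g x)"
  proof (rule integral_dominated_convergence)
    show "(\<lambda>x. indicator (open_box d a b) x * g x) \<in> borel_measurable (leb d \<Omega>)"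
      by (intro borel_measurable_times leb_indicator open_box_sets gm)
    show "(\<lambda>x. bump d a b n x * g x) \<in> borel_measurable (leb d \<Omega>)" for n
      by (intro borel_measurable_times gm leb_measurable test_measurable[OF bump_test[OF box]])
    show "integrable (leb d \<Omega>) (\<lambda>x. cmod (indicator (closed_box d a b) x * g x))"
      by (intro integrable_norm L2_mult_integrable closed_box_L2 g)
    show "AE x in leb d \<Omega>. (\<lambda>n. bump d a b n x * g x) \<longlonglongrightarrow> indicator (open_box d a b) x * g x"
      by (rule AE_I2) (use \<Omega>_Rd in \<open>auto intro!: tendsto_mult bump_tendsto\<close>)
    show "AE x in leb d \<Omega>. norm (bump d a b n x * g x) \<le> cmod (indicator (closed_box d a b) x * g x)" for n
    proof (rule AE_I2)
      fix x assume "x \<in> space (leb d \<Omega>)"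
      then have x: "x \<in> Rd d" using \<Omega>_Rd by auto
      have "bump d a b n x = 0" if "x \<notin> closed_box d a b"
        using test_outside[OF bump_test[OF order_refl] x that] .
      then show "norm (bump d a b n x * g x) \<le> cmod (indicator (closed_box d a b) x * g x)"
        using mult_right_mono[OF bump_le_1[of d a b n x], of "cmod (g x)"]
        by (cases "x \<in> closed_box d a b") (auto simp: norm_mult)
    qed
  qed
  moreover have "(LINT x|leb d \<Omega>. bump d a b n x * g x) = 0" for n
    using t[OF box, of n] by (simp add: mult.commute)
  ultimately show ?thesis by (simp add: LIMSEQ_const_iff)
qed

text \<open>On one box of the exhaustion \<open>g\<close> is integrable. Its integrals over smaller
  boxes are limits of integrals against bumps, hence zero; by induction over the generated
  sigma-algebra they vanish over all Borel sets, and up to null sets over all measurable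
  sets.\<close>

theorem fundamental_lemma:
  assumes g: "g \<in> L2 (leb d \<Omega>)"
    and t: "\<And>a b n. closed_box d a b \<subseteq> \<Omega> \<Longrightarrow> (LINT x|leb d \<Omega>. g x * bump d a b n x) = 0"
  shows "AE x in leb d \<Omega>. g x = 0"
proof -
  obtain a b :: "nat \<Rightarrow> nat \<Rightarrow> real" where ab: "\<And>n. closed_box d (a n) (b n) \<subseteq> \<Omega>" "\<Omega> \<subseteq> (\<Union>n. open_box d (a n) (b n))"
    using exhaustion by blast
  have gm [measurable]: "g \<in> borel_measurable (leb d \<Omega>)" by (rule L2D(1)[OF g])
  have "AE x in leb d \<Omega>. indicator (open_box d (a n) (b n)) x * g x = 0" for n
  proof -
    define h where "h x = indicator (open_box d (a n) (b n)) x * g x" for x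
    have hm [measurable]: "h \<in> borel_measurable (leb d \<Omega>)"
      unfolding h_def by (intro borel_measurable_times leb_indicator open_box_sets gm)
    have hi: "integrable (leb d \<Omega>) h"
    proof (rule Bochner_Integration.integrable_bound[OF _ hm])
      show "integrable (leb d \<Omega>) (\<lambda>x. indicator (closed_box d (a n) (b n)) x * g x)"
        by (intro L2_mult_integrable closed_box_L2 g)
      have "open_box d (a n) (b n) \<subseteq> closed_box d (a n) (b n)" by (auto simp: open_box_def closed_box_def less_imp_le)
      then show "AE x in leb d \<Omega>. norm (h x) \<le> norm (indicator (closed_box d (a n) (b n)) x * g x)"
        by (auto simp: h_def norm_mult indicator_def)
    qed
    have hiA: "integrable (leb d \<Omega>) (\<lambda>x. indicator A x *\<^sub>R h x)" if "A \<in> sets (lborel_Rd d)" for A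
      by (rule Bochner_Integration.integrable_bound[OF hi])
        (auto simp: indicator_def intro!: borel_measurable_scaleR leb_indicator[OF that, unfolded indicator_def])
    have h_box: "(LINT x|leb d \<Omega>. indicator (open_box d u v) x *\<^sub>R h x) = 0" for u v
    proof -
      \<comment> \<open>Intersecting an arbitrary box with the \<open>n\<close>-th one gives a box
        whose closed version still lies in the domain.\<close>
      let ?u = "\<lambda>i. max (u i) (a n i)" and ?v = "\<lambda>i. min (v i) (b n i)"
      have "closed_box d ?u ?v \<subseteq> \<Omega>" using ab(1)[of n] by (auto simp: closed_box_def)
      from integral_open_box_eq_0[OF g t this] have "(LINT x|leb d \<Omega>. indicator (open_box d ?u ?v) x * g x) = 0" by simp
      moreover have "indicator (open_box d ?u ?v) x * g x = indicator (open_box d u v) x *\<^sub>R h x" for x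
        unfolding open_box_Int[symmetric] h_def by (auto simp: indicator_def)
      ultimately show ?thesis by simp
    qed
    have hA: "(LINT x|leb d \<Omega>. indicator A x *\<^sub>R h x) = 0" if A: "A \<in> sets (lborel_Rd d)" for A
    proof -
      have "Int_stable (range (\<lambda>(a, b). open_box d a b))"
        unfolding Int_stable_def by (auto simp: open_box_Int)
      moreover have sub: "range (\<lambda>(a, b). open_box d a b) \<subseteq> Pow (Rd d)" by (auto simp: open_box_def)
      moreover have "A \<in> sigma_sets (Rd d) (range (\<lambda>(a, b). open_box d a b))" using A sets_lborel_Rd[OF d] by simp
      ultimately show ?thesis
      proof (induction rule: sigma_sets_induct_disjoint)
        case (basic A)
        then show ?case using h_box by auto
      next
        case empty
        show ?case by simp
      next
        case (compl A)
        then have As: "A \<in> sets (lborel_Rd d)" using sets_lborel_Rd[OF d] by simp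
        have "(LINT x|leb d \<Omega>. indicator (Rd d - A) x *\<^sub>R h x) = (LINT x|leb d \<Omega>. h x - indicator A x *\<^sub>R h x)"
          by (rule Bochner_Integration.integral_cong[OF refl]) (use \<Omega>_Rd in \<open>auto simp: indicator_def\<close>)
        also have "\<dots> = (LINT x|leb d \<Omega>. h x) - (LINT x|leb d \<Omega>. indicator A x *\<^sub>R h x)"
          by (rule Bochner_Integration.integral_diff[OF hi hiA[OF As]])
        \<comment> \<open>\<open>h\<close> vanishes off its own box, so the integral over the whole
          domain is one over a box.\<close>
        also have "(LINT x|leb d \<Omega>. h x) = (LINT x|leb d \<Omega>. indicator (open_box d (a n) (b n)) x *\<^sub>R h x)"
          by (rule Bochner_Integration.integral_cong[OF refl]) (auto simp: h_def indicator_def)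
        finally show ?case using compl h_box by simp
      next
        case (union A)
        have As: "A i \<in> sets (lborel_Rd d)" for i using union sets_lborel_Rd[OF d] by auto
        have "set_lebesgue_integral (leb d \<Omega>) (\<Union>i. A i \<inter> \<Omega>) h = (\<Sum>i. set_lebesgue_integral (leb d \<Omega>) (A i \<inter> \<Omega>) h)"
        proof (rule lebesgue_integral_countable_add)
          show "A i \<inter> \<Omega> \<in> sets (leb d \<Omega>)" for i using leb_sets As by blast
          show "(A i \<inter> \<Omega>) \<inter> (A j \<inter> \<Omega>) = {}" if "i \<noteq> j" for i j
            using union(1) that by (auto simp: disjoint_family_on_def)
          have "(\<Union>i. A i \<inter> \<Omega>) \<in> sets (leb d \<Omega>)" using leb_sets As by blast
          then show "set_integrable (leb d \<Omega>) (\<Union>i. A i \<inter> \<Omega>) h"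
            unfolding set_integrable_def using hi by (intro integrable_mult_indicator)
        qed
        moreover have eq: "set_lebesgue_integral (leb d \<Omega>) (B \<inter> \<Omega>) h = (LINT x|leb d \<Omega>. indicator B x *\<^sub>R h x)" for B
          unfolding set_lebesgue_integral_def by (rule Bochner_Integration.integral_cong[OF refl]) (auto simp: indicator_def)
        moreover have "(\<Union>i. A i \<inter> \<Omega>) = (\<Union>i. A i) \<inter> \<Omega>" by auto
        ultimately show ?case using union by simp
      qed
    qed
    have h0: "set_lebesgue_integral (leb d \<Omega>) A h = 0" if "A \<in> sets (leb d \<Omega>)" for A
    proof -
      from that
      obtain B where B: "B \<in> sets (lebesgue_Rd d)" "A = \<Omega> \<inter> B" by (auto simp: leb_def sets_restrict_space)
      then have Bc: "B \<in> sets (completion (lborel_Rd d))" by (simp add: lebesgue_Rd_def)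
      \<comment> \<open>A set of the completed sigma-algebra differs from its Borel main part by a
        null set.\<close>
      let ?M = "main_part (lborel_Rd d) B"
      have M: "?M \<in> sets (lborel_Rd d)" using main_part_sets[OF Bc] .
      have "AE x in lebesgue_Rd d. x \<in> ?M \<longleftrightarrow> x \<in> B"
        unfolding lebesgue_Rd_def by (rule AE_completion[OF AE_in_main_part[OF Bc]])
      then have "AE x in leb d \<Omega>. x \<in> ?M \<longleftrightarrow> x \<in> B"
        unfolding leb_def using \<Omega>_Rd by (subst AE_restrict_space_iff) (auto simp: Int_absorb2)
      then have "AE x in leb d \<Omega>. indicator A x *\<^sub>R h x = indicator ?M x *\<^sub>R h x"
        using AE_space by eventually_elim (auto simp: B indicator_def)
      moreover have "(\<lambda>x. indicator A x *\<^sub>R h x) \<in> borel_measurable (leb d \<Omega>)"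
        using \<open>A \<in> sets (leb d \<Omega>)\<close> by measurable
      moreover have "(\<lambda>x. indicator ?M x *\<^sub>R h x) \<in> borel_measurable (leb d \<Omega>)"
        using hiA[OF M] by (rule borel_measurable_integrable)
      ultimately have "(LINT x|leb d \<Omega>. indicator A x *\<^sub>R h x) = (LINT x|leb d \<Omega>. indicator ?M x *\<^sub>R h x)"
        by (intro integral_cong_AE) auto
      then show ?thesis
        using hA[OF M] by (simp add: set_lebesgue_integral_def)
    qed
    have hs: "set_integrable (leb d \<Omega>) A h" if "A \<in> sets (leb d \<Omega>)" for A
      unfolding set_integrable_def by (rule integrable_mult_indicator[OF that hi])
    have "set_lebesgue_integral (leb d \<Omega>) A (\<lambda>x. Re (h x)) = 0"
      "set_lebesgue_integral (leb d \<Omega>) A (\<lambda>x. Im (h x)) = 0" if "A \<in> sets (leb d \<Omega>)" for A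
      using integral_Re[OF hs[OF that, unfolded set_integrable_def]]
        integral_Im[OF hs[OF that, unfolded set_integrable_def]] h0[OF that]
      by (simp_all add: set_lebesgue_integral_def)
    then have "AE x in leb d \<Omega>. Re (h x) = 0" "AE x in leb d \<Omega>. Im (h x) = 0"
      using hi by (auto intro!: density_unique_real[where f' = "\<lambda>_. 0"] integrable_Re integrable_Im
        simp: set_lebesgue_integral_def)
    then have "AE x in leb d \<Omega>. h x = 0" by eventually_elim (simp add: complex_eq_iff)
    then show ?thesis by (simp add: h_def)
  qed
  then have "AE x in leb d \<Omega>. \<forall>n. indicator (open_box d (a n) (b n)) x * g x = 0"
    unfolding AE_all_countable by (rule allI)
  then show ?thesis
    using AE_space
  proof eventually_elim
    case (elim x)
    then obtain n where "x \<in> open_box d (a n) (b n)" using ab(2) by auto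
    then show ?case using elim(1) by (auto dest: spec[of _ n])
  qed
qed

end

lemma domain_Rd: "d \<ge> 1 \<Longrightarrow> domain d (Rd d)"
proof
  have "x \<in> (\<Union>n. open_box d (\<lambda>_. - real n) (\<lambda>_. real n))" if x: "x \<in> Rd d" for x
  proof -
    obtain n where n: "(\<Sum>i<d. \<bar>x i\<bar>) < real n" using reals_Archimedean2 by blast
    have "\<bar>x i\<bar> < real n" if "i < d" for i
      using member_le_sum[of i "{..<d}" "\<lambda>i. \<bar>x i\<bar>"] that n by simp
    then have "x \<in> open_box d (\<lambda>_. - real n) (\<lambda>_. real n)" using x by (auto simp: open_box_def abs_less_iff minus_less_iff)
    then show ?thesis by blast
  qed
  then show "\<exists>a b :: nat \<Rightarrow> nat \<Rightarrow> real. (\<forall>n. closed_box d (a n) (b n) \<subseteq> Rd d) \<and> Rd d \<subseteq> (\<Union>n. open_box d (a n) (b n))"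
    by (intro exI[of _ "\<lambda>n _. - real n"] exI[of _ "\<lambda>n _. real n"]) (auto simp: closed_box_def)
qed auto

lemma domain_half_space: "d \<ge> 1 \<Longrightarrow> domain d (half_space d)"
proof
  assume d: "d \<ge> 1"
  \<comment> \<open>The lower bound \<open>1 / Suc n\<close> in direction 0 keeps the closed boxes
    away from the boundary while their union exhausts the half-space.\<close>
  let ?a = "\<lambda>n i. if i = 0 then 1 / real (Suc n) else - real n" and ?b = "\<lambda>(n::nat) (i::nat). real n"
  have "x \<in> (\<Union>n. open_box d (?a n) (?b n))" if x: "x \<in> half_space d" for x
  proof -
    have x0: "x 0 > 0" "x \<in> Rd d" using x by (auto simp: half_space_def)
    obtain n1 where n1: "(\<Sum>i<d. \<bar>x i\<bar>) < real n1" using reals_Archimedean2 by blast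
    obtain n2 where n2: "inverse (real (Suc n2)) < x 0" using reals_Archimedean[OF x0(1)] by blast
    define n where "n = max n1 n2"
    have "\<bar>x i\<bar> < real n" if "i < d" for i
      using member_le_sum[of i "{..<d}" "\<lambda>i. \<bar>x i\<bar>"] that n1 by (simp add: n_def)
    moreover have "1 / real (Suc n) < x 0"
    proof -
      have "1 / real (Suc n) \<le> 1 / real (Suc n2)" by (intro divide_left_mono) (auto simp: n_def)
      then show ?thesis using n2 by (simp add: inverse_eq_divide)
    qed
    ultimately have "x \<in> open_box d (?a n) (?b n)" using x0 by (auto simp: open_box_def abs_less_iff minus_less_iff)
    then show ?thesis by blast
  qed
  moreover have "closed_box d (?a n) (?b n) \<subseteq> half_space d" for n
  proof
    fix x assume x: "x \<in> closed_box d (?a n) (?b n)"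
    then have "1 / real (Suc n) \<le> x 0" using d by (auto simp: closed_box_def)
    moreover have "1 / real (Suc n) > 0" by simp
    ultimately have "x 0 > 0" by linarith
    then show "x \<in> half_space d" using x by (simp add: half_space_def closed_box_def)
  qed
  ultimately show "\<exists>a b :: nat \<Rightarrow> nat \<Rightarrow> real. (\<forall>n. closed_box d (a n) (b n) \<subseteq> half_space d) \<and> half_space d \<subseteq> (\<Union>n. open_box d (a n) (b n))"
    by (intro exI[of _ ?a] exI[of _ ?b]) auto
qed auto

subsection \<open>Sobolev spaces\<close>

lemma L2_norm_cong_AE:
  assumes "f \<in> L2 M" "g \<in> L2 M" "AE x in M. f x = g x"
  shows "L2_norm M f = L2_norm M g"
proof -
  have "(LINT x|M. (cmod (f x))\<^sup>2) = (LINT x|M. (cmod (g x))\<^sup>2)"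
  proof (rule integral_cong_AE)
    show "(\<lambda>x. (cmod (f x))\<^sup>2) \<in> borel_measurable M" "(\<lambda>x. (cmod (g x))\<^sup>2) \<in> borel_measurable M"
      using L2D(2)[OF assms(1)] L2D(2)[OF assms(2)] by (auto dest: borel_measurable_integrable)
    show "AE x in M. (cmod (f x))\<^sup>2 = (cmod (g x))\<^sup>2" using assms(3) by eventually_elim simp
  qed
  then show ?thesis by (simp add: L2_norm_def)
qed

lemma L2_inner_cong_AE:
  assumes "f \<in> L2 M" "g \<in> L2 M" "f' \<in> L2 M" "g' \<in> L2 M" "AE x in M. f x = f' x" "AE x in M. g x = g' x"
  shows "L2_inner M f g = L2_inner M f' g'"
  unfolding L2_inner_def
proof (rule integral_cong_AE)
  show "(\<lambda>x. f x * cnj (g x)) \<in> borel_measurable M" "(\<lambda>x. f' x * cnj (g' x)) \<in> borel_measurable M"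
    by (rule borel_measurable_integrable, rule L2_inner_integrable, fact+)+
  show "AE x in M. f x * cnj (g x) = f' x * cnj (g' x)" using assms(5,6) by eventually_elim simp
qed

lemma L2_integral_tendsto:
  assumes f: "\<And>n. f n \<in> L2 M" "f' \<in> L2 M" and h: "h \<in> L2 M"
    and lim: "(\<lambda>n. L2_norm M (\<lambda>x. f n x - f' x)) \<longlonglongrightarrow> 0"
  shows "(\<lambda>n. LINT x|M. f n x * h x) \<longlonglongrightarrow> (LINT x|M. f' x * h x)"
proof (rule LIM_zero_cancel, rule Lim_null_comparison)
  show "(\<lambda>n. L2_norm M (\<lambda>x. f n x - f' x) * L2_norm M h) \<longlonglongrightarrow> 0" by (rule tendsto_mult_left_zero[OF lim])
  have "(LINT x|M. f n x * h x) - (LINT x|M. f' x * h x) = (LINT x|M. (f n x - f' x) * h x)" for n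
    using L2_mult_integrable[OF f(1) h] L2_mult_integrable[OF f(2) h] by (simp add: left_diff_distrib)
  then show "\<forall>\<^sub>F n in sequentially. norm ((LINT x|M. f n x * h x) - (LINT x|M. f' x * h x))
      \<le> L2_norm M (\<lambda>x. f n x - f' x) * L2_norm M h"
    using L2_norm_integral_le[OF L2_diff[OF f(1) f(2)] h] by simp
qed

lemma L2_tendsto_lincomb:
  assumes L: "\<And>n. f n \<in> L2 M" "f' \<in> L2 M" "\<And>n. g n \<in> L2 M" "g' \<in> L2 M"
    and lim: "(\<lambda>n. L2_norm M (\<lambda>x. f n x - f' x)) \<longlonglongrightarrow> 0" "(\<lambda>n. L2_norm M (\<lambda>x. g n x - g' x)) \<longlonglongrightarrow> 0"
  shows "(\<lambda>n. L2_norm M (\<lambda>x. (c * f n x + g n x) - (c * f' x + g' x))) \<longlonglongrightarrow> 0"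
proof (rule Lim_null_comparison)
  show "(\<lambda>n. cmod c * L2_norm M (\<lambda>x. f n x - f' x) + L2_norm M (\<lambda>x. g n x - g' x)) \<longlonglongrightarrow> 0"
    using tendsto_add[OF tendsto_mult_right_zero[OF lim(1), of "cmod c"] lim(2)] by simp
  have "L2_norm M (\<lambda>x. (c * f n x + g n x) - (c * f' x + g' x)) \<le>
     cmod c * L2_norm M (\<lambda>x. f n x - f' x) + L2_norm M (\<lambda>x. g n x - g' x)" for n
  proof -
    have "(\<lambda>x. (c * f n x + g n x) - (c * f' x + g' x)) = (\<lambda>x. c * (f n x - f' x) + (g n x - g' x))"
      by (simp add: algebra_simps)
    then show ?thesis
      using L2_norm_triangle[OF L2_scale[OF L2_diff[OF L(1,2)]] L2_diff[OF L(3,4)], of c n n]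
      by (simp add: L2_norm_scale)
  qed
  then show "\<forall>\<^sub>F n in sequentially. norm (L2_norm M (\<lambda>x. (c * f n x + g n x) - (c * f' x + g' x)))
     \<le> cmod c * L2_norm M (\<lambda>x. f n x - f' x) + L2_norm M (\<lambda>x. g n x - g' x)" by simp
qed

context domain
begin

lemma weakD:
  assumes "has_weak_partial d \<Omega> i f g"
  shows "g \<in> L2 (leb d \<Omega>)"
    and "\<phi> \<in> test_functions d \<Omega> \<Longrightarrow> (LINT x|leb d \<Omega>. f x * partial i \<phi> x) = - (LINT x|leb d \<Omega>. g x * \<phi> x)"
  using assms by (auto simp: has_weak_partial_def)

lemma weak_unique:
  assumes g: "has_weak_partial d \<Omega> i f g" and g': "has_weak_partial d \<Omega> i f g'"
  shows "AE x in leb d \<Omega>. g x = g' x"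
proof -
  have "AE x in leb d \<Omega>. g x - g' x = 0"
  proof (rule fundamental_lemma)
    show "(\<lambda>x. g x - g' x) \<in> L2 (leb d \<Omega>)" by (rule L2_diff[OF weakD(1)[OF g] weakD(1)[OF g']])
    fix a b n assume "closed_box d a b \<subseteq> \<Omega>"
    then have t: "bump d a b n \<in> test_functions d \<Omega>" by (rule bump_test)
    have "(LINT x|leb d \<Omega>. g x * bump d a b n x) = (LINT x|leb d \<Omega>. g' x * bump d a b n x)"
      using weakD(2)[OF g t] weakD(2)[OF g' t] by simp
    then show "(LINT x|leb d \<Omega>. (g x - g' x) * bump d a b n x) = 0"
      using L2_mult_integrable[OF weakD(1)[OF g] test_in_L2[OF t]] L2_mult_integrable[OF weakD(1)[OF g'] test_in_L2[OF t]]
      by (simp add: left_diff_distrib)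
  qed
  then show ?thesis by simp
qed

lemma weak_lincomb:
  assumes f: "f \<in> L2 (leb d \<Omega>)" "f' \<in> L2 (leb d \<Omega>)" and i: "i < d"
    and g: "has_weak_partial d \<Omega> i f g" "has_weak_partial d \<Omega> i f' g'"
  shows "has_weak_partial d \<Omega> i (\<lambda>x. c * f x + f' x) (\<lambda>x. c * g x + g' x)"
  unfolding has_weak_partial_def
proof (intro conjI ballI)
  show "(\<lambda>x. c * g x + g' x) \<in> L2 (leb d \<Omega>)" by (intro L2_add L2_scale g[THEN weakD(1)])
  fix \<phi> assume t: "\<phi> \<in> test_functions d \<Omega>"
  have L: "\<phi> \<in> L2 (leb d \<Omega>)" "partial i \<phi> \<in> L2 (leb d \<Omega>)" using t i by (auto intro: test_in_L2 test_partial)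
  have "(LINT x|leb d \<Omega>. (c * f x + f' x) * partial i \<phi> x) =
    c * (LINT x|leb d \<Omega>. f x * partial i \<phi> x) + (LINT x|leb d \<Omega>. f' x * partial i \<phi> x)"
    using L2_mult_integrable[OF f(1) L(2)] L2_mult_integrable[OF f(2) L(2)] by (simp add: distrib_right mult.assoc)
  moreover have "(LINT x|leb d \<Omega>. (c * g x + g' x) * \<phi> x) =
    c * (LINT x|leb d \<Omega>. g x * \<phi> x) + (LINT x|leb d \<Omega>. g' x * \<phi> x)"
    using L2_mult_integrable[OF g(1)[THEN weakD(1)] L(1)] L2_mult_integrable[OF g(2)[THEN weakD(1)] L(1)]
    by (simp add: distrib_right mult.assoc)
  ultimately show "(LINT x|leb d \<Omega>. (c * f x + f' x) * partial i \<phi> x) = - (LINT x|leb d \<Omega>. (c * g x + g' x) * \<phi> x)"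
    using weakD(2)[OF g(1) t] weakD(2)[OF g(2) t] by simp
qed

lemma weak_cong_AE:
  assumes f: "f \<in> L2 (leb d \<Omega>)" "f' \<in> L2 (leb d \<Omega>)" and AE: "AE x in leb d \<Omega>. f x = f' x" and i: "i < d"
  shows "has_weak_partial d \<Omega> i f = has_weak_partial d \<Omega> i f'"
proof -
  have "(LINT x|leb d \<Omega>. f x * partial i \<phi> x) = (LINT x|leb d \<Omega>. f' x * partial i \<phi> x)"
    if t: "\<phi> \<in> test_functions d \<Omega>" for \<phi>
  proof (rule integral_cong_AE)
    have L: "partial i \<phi> \<in> L2 (leb d \<Omega>)" using t i by (auto intro: test_in_L2 test_partial)
    show "(\<lambda>x. f x * partial i \<phi> x) \<in> borel_measurable (leb d \<Omega>)" "(\<lambda>x. f' x * partial i \<phi> x) \<in> borel_measurable (leb d \<Omega>)"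
      using L2_mult_integrable[OF f(1) L] L2_mult_integrable[OF f(2) L] by (auto dest: borel_measurable_integrable)
    show "AE x in leb d \<Omega>. f x * partial i \<phi> x = f' x * partial i \<phi> x" using AE by eventually_elim simp
  qed
  then show ?thesis unfolding has_weak_partial_def by (intro ext) simp
qed

text \<open>Closedness of the weak derivative: both sides of its defining identity are continuous in
  the \<open>L2\<close> norm. Completeness of the form domains rests on this.\<close>

lemma weak_limit:
  assumes L: "\<And>n. f n \<in> L2 (leb d \<Omega>)" "f' \<in> L2 (leb d \<Omega>)" "g' \<in> L2 (leb d \<Omega>)" and i: "i < d"
    and g: "\<And>n. has_weak_partial d \<Omega> i (f n) (g n)"
    and lim: "(\<lambda>n. L2_norm (leb d \<Omega>) (\<lambda>x. f n x - f' x)) \<longlonglongrightarrow> 0" "(\<lambda>n. L2_norm (leb d \<Omega>) (\<lambda>x. g n x - g' x)) \<longlonglongrightarrow> 0"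
  shows "has_weak_partial d \<Omega> i f' g'"
  unfolding has_weak_partial_def
proof (intro conjI ballI)
  fix \<phi> assume t: "\<phi> \<in> test_functions d \<Omega>"
  have \<phi>: "\<phi> \<in> L2 (leb d \<Omega>)" "partial i \<phi> \<in> L2 (leb d \<Omega>)" using t i by (auto intro: test_in_L2 test_partial)
  have 1: "(\<lambda>n. LINT x|leb d \<Omega>. f n x * partial i \<phi> x) \<longlonglongrightarrow> (LINT x|leb d \<Omega>. f' x * partial i \<phi> x)"
    by (rule L2_integral_tendsto[OF L(1,2) \<phi>(2) lim(1)])
  have "(\<lambda>n. - (LINT x|leb d \<Omega>. g n x * \<phi> x)) \<longlonglongrightarrow> - (LINT x|leb d \<Omega>. g' x * \<phi> x)"
    by (intro tendsto_minus L2_integral_tendsto[OF weakD(1)[OF g] L(3) \<phi>(1) lim(2)])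
  then have "(\<lambda>n. LINT x|leb d \<Omega>. f n x * partial i \<phi> x) \<longlonglongrightarrow> - (LINT x|leb d \<Omega>. g' x * \<phi> x)"
    by (simp add: weakD(2)[OF g t])
  with 1 show "(LINT x|leb d \<Omega>. f' x * partial i \<phi> x) = - (LINT x|leb d \<Omega>. g' x * \<phi> x)"
    by (rule LIMSEQ_unique)
qed (rule L)

lemma H1_L2: "f \<in> H1 d \<Omega> \<Longrightarrow> f \<in> L2 (leb d \<Omega>)"
  by (simp add: H1_def)

lemma H1_weak: "f \<in> H1 d \<Omega> \<Longrightarrow> i < d \<Longrightarrow> has_weak_partial d \<Omega> i f (weak_partial d \<Omega> i f)"
proof -
  assume "f \<in> H1 d \<Omega>" "i < d"
  then have "\<exists>g. has_weak_partial d \<Omega> i f g" by (simp add: H1_def)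
  from someI_ex[OF this] show ?thesis by (simp add: weak_partial_def)
qed

lemma weak_partial_L2: "f \<in> H1 d \<Omega> \<Longrightarrow> i < d \<Longrightarrow> weak_partial d \<Omega> i f \<in> L2 (leb d \<Omega>)"
  by (rule weakD(1)[OF H1_weak])

lemma H1I:
  assumes "f \<in> L2 (leb d \<Omega>)" "\<And>i. i < d \<Longrightarrow> has_weak_partial d \<Omega> i f (g i)"
  shows "f \<in> H1 d \<Omega>"
  using assms by (auto simp: H1_def)

lemma weak_partial_AE:
  assumes "has_weak_partial d \<Omega> i f g"
  shows "AE x in leb d \<Omega>. weak_partial d \<Omega> i f x = g x"
proof -
  have "has_weak_partial d \<Omega> i f (weak_partial d \<Omega> i f)"
    unfolding weak_partial_def by (rule someI[of _ g]) fact
  from weak_unique[OF this assms] show ?thesis .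
qed

lemma H1_lincomb:
  assumes "f \<in> H1 d \<Omega>" "f' \<in> H1 d \<Omega>"
  shows "(\<lambda>x. c * f x + f' x) \<in> H1 d \<Omega>"
    and "i < d \<Longrightarrow> AE x in leb d \<Omega>. weak_partial d \<Omega> i (\<lambda>x. c * f x + f' x) x = c * weak_partial d \<Omega> i f x + weak_partial d \<Omega> i f' x"
proof -
  have w: "has_weak_partial d \<Omega> i (\<lambda>x. c * f x + f' x) (\<lambda>x. c * weak_partial d \<Omega> i f x + weak_partial d \<Omega> i f' x)" if "i < d" for i
    by (rule weak_lincomb[OF assms[THEN H1_L2] that assms[THEN H1_weak, OF that]])
  show "(\<lambda>x. c * f x + f' x) \<in> H1 d \<Omega>"
    by (rule H1I[OF _ w]) (intro L2_add L2_scale assms[THEN H1_L2])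
  show "AE x in leb d \<Omega>. weak_partial d \<Omega> i (\<lambda>x. c * f x + f' x) x = c * weak_partial d \<Omega> i f x + weak_partial d \<Omega> i f' x" if "i < d"
    by (rule weak_partial_AE[OF w[OF that]])
qed

lemma H1_diff:
  assumes "f \<in> H1 d \<Omega>" "f' \<in> H1 d \<Omega>"
  shows "(\<lambda>x. f x - f' x) \<in> H1 d \<Omega>"
    and "i < d \<Longrightarrow> AE x in leb d \<Omega>. weak_partial d \<Omega> i (\<lambda>x. f x - f' x) x = weak_partial d \<Omega> i f x - weak_partial d \<Omega> i f' x"
  using H1_lincomb[OF assms(2,1), where c = "-1"] by simp_all

lemma test_H1: "\<phi> \<in> test_functions d \<Omega> \<Longrightarrow> \<phi> \<in> H1 d \<Omega>"
  by (rule H1I[OF test_in_L2]) (auto intro: test_has_weak_partial)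

definition H1_close :: "(point \<Rightarrow> complex) \<Rightarrow> (point \<Rightarrow> complex) \<Rightarrow> real \<Rightarrow> bool" where
  "H1_close f \<phi> e \<longleftrightarrow> L2_norm (leb d \<Omega>) (\<lambda>x. \<phi> x - f x) < e \<and>
     (\<forall>i<d. L2_norm (leb d \<Omega>) (\<lambda>x. partial i \<phi> x - weak_partial d \<Omega> i f x) < e)"

text \<open>In this form, closedness of the space under limits is a triangle inequality instead of
  the choice of a diagonal sequence.\<close>

lemma H1_0_iff: "f \<in> H1_0 d \<Omega> \<longleftrightarrow> f \<in> H1 d \<Omega> \<and> (\<forall>e>0. \<exists>\<phi>\<in>test_functions d \<Omega>. H1_close f \<phi> e)"
proof
  assume "f \<in> H1_0 d \<Omega>"
  then obtain \<phi> where f: "f \<in> H1 d \<Omega>" and t: "\<And>n. \<phi> n \<in> test_functions d \<Omega>"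
    and 1: "(\<lambda>n. L2_norm (leb d \<Omega>) (\<lambda>x. \<phi> n x - f x)) \<longlonglongrightarrow> 0"
    and 2: "\<And>i. i < d \<Longrightarrow> (\<lambda>n. L2_norm (leb d \<Omega>) (\<lambda>x. partial i (\<phi> n) x - weak_partial d \<Omega> i f x)) \<longlonglongrightarrow> 0"
    by (auto simp: H1_0_def)
  have "\<exists>\<phi>\<in>test_functions d \<Omega>. H1_close f \<phi> e" if e: "e > 0" for e
  proof -
    have "\<forall>\<^sub>F n in sequentially. L2_norm (leb d \<Omega>) (\<lambda>x. \<phi> n x - f x) < e"
      by (rule order_tendstoD(2)[OF 1 e])
    moreover have "\<forall>\<^sub>F n in sequentially. \<forall>i\<in>{..<d}. L2_norm (leb d \<Omega>) (\<lambda>x. partial i (\<phi> n) x - weak_partial d \<Omega> i f x) < e"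
      by (intro eventually_ball_finite finite_lessThan ballI order_tendstoD(2)[OF 2 e]) simp
    ultimately have "\<forall>\<^sub>F n in sequentially. H1_close f (\<phi> n) e"
      by eventually_elim (simp add: H1_close_def)
    then obtain n where "H1_close f (\<phi> n) e" by (auto dest: eventually_happens)
    then show ?thesis using t by blast
  qed
  then show "f \<in> H1 d \<Omega> \<and> (\<forall>e>0. \<exists>\<phi>\<in>test_functions d \<Omega>. H1_close f \<phi> e)" using f by blast
next
  assume a: "f \<in> H1 d \<Omega> \<and> (\<forall>e>0. \<exists>\<phi>\<in>test_functions d \<Omega>. H1_close f \<phi> e)"
  have "\<exists>\<phi>\<in>test_functions d \<Omega>. H1_close f \<phi> (1 / real (Suc n))" for n using a by simp
  then obtain \<phi> where p: "\<And>n. \<phi> n \<in> test_functions d \<Omega>" "\<And>n. H1_close f (\<phi> n) (1 / real (Suc n))" by metis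
  have z: "(\<lambda>n. 1 / real (Suc n)) \<longlonglongrightarrow> 0" by (rule LIMSEQ_Suc[OF lim_1_over_n])
  have "(\<lambda>n. L2_norm (leb d \<Omega>) (\<lambda>x. \<phi> n x - f x)) \<longlonglongrightarrow> 0"
    by (rule Lim_null_comparison[OF _ z]) (use p(2) in \<open>simp add: H1_close_def less_imp_le\<close>)
  moreover have "(\<lambda>n. L2_norm (leb d \<Omega>) (\<lambda>x. partial i (\<phi> n) x - weak_partial d \<Omega> i f x)) \<longlonglongrightarrow> 0" if "i < d" for i
    by (rule Lim_null_comparison[OF _ z]) (use p(2) that in \<open>simp add: H1_close_def less_imp_le\<close>)
  ultimately show "f \<in> H1_0 d \<Omega>" unfolding H1_0_def using a p(1) by blast
qed

lemma H1_0_closed: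
  assumes f: "f \<in> H1 d \<Omega>" and s: "\<And>n. s n \<in> H1_0 d \<Omega>"
    and 1: "(\<lambda>n. L2_norm (leb d \<Omega>) (\<lambda>x. s n x - f x)) \<longlonglongrightarrow> 0"
    and 2: "\<And>i. i < d \<Longrightarrow> (\<lambda>n. L2_norm (leb d \<Omega>) (\<lambda>x. weak_partial d \<Omega> i (s n) x - weak_partial d \<Omega> i f x)) \<longlonglongrightarrow> 0"
  shows "f \<in> H1_0 d \<Omega>"
  unfolding H1_0_iff
proof (intro conjI f allI impI)
  fix e :: real assume "e > 0"
  then have e: "e / 2 > 0" by simp
  have "\<forall>\<^sub>F n in sequentially. L2_norm (leb d \<Omega>) (\<lambda>x. s n x - f x) < e / 2"
    by (rule order_tendstoD(2)[OF 1 e])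
  moreover have "\<forall>\<^sub>F n in sequentially. \<forall>i\<in>{..<d}. L2_norm (leb d \<Omega>) (\<lambda>x. weak_partial d \<Omega> i (s n) x - weak_partial d \<Omega> i f x) < e / 2"
    by (intro eventually_ball_finite finite_lessThan ballI order_tendstoD(2)[OF 2 e]) simp
  ultimately have "\<forall>\<^sub>F n in sequentially. L2_norm (leb d \<Omega>) (\<lambda>x. s n x - f x) < e / 2 \<and>
     (\<forall>i\<in>{..<d}. L2_norm (leb d \<Omega>) (\<lambda>x. weak_partial d \<Omega> i (s n) x - weak_partial d \<Omega> i f x) < e / 2)"
    by eventually_elim simp
  then obtain n where n: "L2_norm (leb d \<Omega>) (\<lambda>x. s n x - f x) < e / 2"
    "\<And>i. i < d \<Longrightarrow> L2_norm (leb d \<Omega>) (\<lambda>x. weak_partial d \<Omega> i (s n) x - weak_partial d \<Omega> i f x) < e / 2"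
    by (auto dest: eventually_happens)
  have sn: "s n \<in> H1 d \<Omega>" "\<exists>\<phi>\<in>test_functions d \<Omega>. H1_close (s n) \<phi> (e / 2)" using s[of n] e unfolding H1_0_iff by auto
  then obtain \<phi> where t: "\<phi> \<in> test_functions d \<Omega>" and c: "H1_close (s n) \<phi> (e / 2)" by blast
  have tri: "L2_norm (leb d \<Omega>) (\<lambda>x. u x - w x) \<le> L2_norm (leb d \<Omega>) (\<lambda>x. u x - v x) + L2_norm (leb d \<Omega>) (\<lambda>x. v x - w x)"
    if "u \<in> L2 (leb d \<Omega>)" "v \<in> L2 (leb d \<Omega>)" "w \<in> L2 (leb d \<Omega>)" for u v w
    using L2.nrm_triangle_diff[OF that] by (simp add: L2_nrm_diff)
  have "L2_norm (leb d \<Omega>) (\<lambda>x. \<phi> x - f x) < e"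
    using tri[OF test_in_L2[OF t] H1_L2[OF sn(1)] H1_L2[OF f]] n(1) c by (simp add: H1_close_def)
  moreover have "L2_norm (leb d \<Omega>) (\<lambda>x. partial i \<phi> x - weak_partial d \<Omega> i f x) < e" if i: "i < d" for i
  proof -
    have "L2_norm (leb d \<Omega>) (\<lambda>x. partial i \<phi> x - weak_partial d \<Omega> i (s n) x) < e / 2" using c i by (simp add: H1_close_def)
    then show ?thesis
      using tri[OF test_in_L2[OF test_partial[OF t i]] weak_partial_L2[OF sn(1) i] weak_partial_L2[OF f i]] n(2)[OF i] by simp
  qed
  ultimately show "\<exists>\<phi>\<in>test_functions d \<Omega>. H1_close f \<phi> e" using t unfolding H1_close_def by blast
qed

lemma test_H1_0: "\<phi> \<in> test_functions d \<Omega> \<Longrightarrow> \<phi> \<in> H1_0 d \<Omega>"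
  unfolding H1_0_iff
proof (intro conjI test_H1 allI impI)
  assume t: "\<phi> \<in> test_functions d \<Omega>"
  fix e :: real assume e: "e > 0"
  have "L2_norm (leb d \<Omega>) (\<lambda>x. partial i \<phi> x - weak_partial d \<Omega> i \<phi> x) = 0" if i: "i < d" for i
  proof -
    have "AE x in leb d \<Omega>. partial i \<phi> x - weak_partial d \<Omega> i \<phi> x = 0"
      using weak_partial_AE[OF test_has_weak_partial[OF t \<Omega>_sets i]] by eventually_elim simp
    then show ?thesis
      using L2_norm_eq_0_iff[OF L2_diff[OF test_in_L2[OF test_partial[OF t i]] weak_partial_L2[OF test_H1[OF t] i]]] by simp
  qed
  then have "H1_close \<phi> \<phi> e" using e by (simp add: H1_close_def L2_norm_def)
  then show "\<exists>\<psi>\<in>test_functions d \<Omega>. H1_close \<phi> \<psi> e" using t by blast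
qed

lemma H1_0_lincomb:
  assumes f: "f \<in> H1_0 d \<Omega>" and f': "f' \<in> H1_0 d \<Omega>"
  shows "(\<lambda>x. c * f x + f' x) \<in> H1_0 d \<Omega>"
proof -
  obtain \<phi> where F: "f \<in> H1 d \<Omega>" and t: "\<And>n. \<phi> n \<in> test_functions d \<Omega>"
    and 1: "(\<lambda>n. L2_norm (leb d \<Omega>) (\<lambda>x. \<phi> n x - f x)) \<longlonglongrightarrow> 0"
    and 2: "\<And>i. i < d \<Longrightarrow> (\<lambda>n. L2_norm (leb d \<Omega>) (\<lambda>x. partial i (\<phi> n) x - weak_partial d \<Omega> i f x)) \<longlonglongrightarrow> 0"
    using f by (auto simp: H1_0_def)
  obtain \<psi> where F': "f' \<in> H1 d \<Omega>" and t': "\<And>n. \<psi> n \<in> test_functions d \<Omega>"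
    and q1: "(\<lambda>n. L2_norm (leb d \<Omega>) (\<lambda>x. \<psi> n x - f' x)) \<longlonglongrightarrow> 0"
    and q2: "\<And>i. i < d \<Longrightarrow> (\<lambda>n. L2_norm (leb d \<Omega>) (\<lambda>x. partial i (\<psi> n) x - weak_partial d \<Omega> i f' x)) \<longlonglongrightarrow> 0"
    using f' by (auto simp: H1_0_def)
  let ?s = "\<lambda>n x. c * \<phi> n x + \<psi> n x"
  have ts: "?s n \<in> test_functions d \<Omega>" for n by (rule test_add[OF test_scale[OF t] t'])
  show ?thesis
  proof (rule H1_0_closed[OF H1_lincomb(1)[OF F F'] test_H1_0[OF ts]])
    show "(\<lambda>n. L2_norm (leb d \<Omega>) (\<lambda>x. (c * \<phi> n x + \<psi> n x) - (c * f x + f' x))) \<longlonglongrightarrow> 0"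
      by (rule L2_tendsto_lincomb[OF test_in_L2[OF t] H1_L2[OF F] test_in_L2[OF t'] H1_L2[OF F'] 1 q1])
    fix i assume i: "i < d"
    have L: "weak_partial d \<Omega> i (?s n) \<in> L2 (leb d \<Omega>)" "weak_partial d \<Omega> i (\<lambda>x. c * f x + f' x) \<in> L2 (leb d \<Omega>)"
      "partial i (\<phi> n) \<in> L2 (leb d \<Omega>)" "partial i (\<psi> n) \<in> L2 (leb d \<Omega>)" "weak_partial d \<Omega> i f \<in> L2 (leb d \<Omega>)"
      "weak_partial d \<Omega> i f' \<in> L2 (leb d \<Omega>)" for n
      by (rule weak_partial_L2[OF test_H1[OF ts] i] weak_partial_L2[OF H1_lincomb(1)[OF F F'] i]
        test_in_L2[OF test_partial[OF t i]] test_in_L2[OF test_partial[OF t' i]] weak_partial_L2[OF F i] weak_partial_L2[OF F' i])+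
    have eq: "L2_norm (leb d \<Omega>) (\<lambda>x. weak_partial d \<Omega> i (?s n) x - weak_partial d \<Omega> i (\<lambda>x. c * f x + f' x) x) =
       L2_norm (leb d \<Omega>) (\<lambda>x. (c * partial i (\<phi> n) x + partial i (\<psi> n) x) - (c * weak_partial d \<Omega> i f x + weak_partial d \<Omega> i f' x))" for n
    proof (rule L2_norm_cong_AE)
      have w: "has_weak_partial d \<Omega> i (?s n) (\<lambda>x. c * partial i (\<phi> n) x + partial i (\<psi> n) x)"
        by (rule weak_lincomb[OF test_in_L2[OF t] test_in_L2[OF t'] i test_has_weak_partial[OF t \<Omega>_sets i] test_has_weak_partial[OF t' \<Omega>_sets i]])
      show "AE x in leb d \<Omega>. weak_partial d \<Omega> i (?s n) x - weak_partial d \<Omega> i (\<lambda>x. c * f x + f' x) x =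
         (c * partial i (\<phi> n) x + partial i (\<psi> n) x) - (c * weak_partial d \<Omega> i f x + weak_partial d \<Omega> i f' x)"
        using weak_partial_AE[OF w] H1_lincomb(2)[OF F F' i, of c] by eventually_elim simp
    qed (intro L2_diff L2_add L2_scale L)+
    show "(\<lambda>n. L2_norm (leb d \<Omega>) (\<lambda>x. weak_partial d \<Omega> i (?s n) x - weak_partial d \<Omega> i (\<lambda>x. c * f x + f' x) x)) \<longlonglongrightarrow> 0"
      unfolding eq by (rule L2_tendsto_lincomb[OF L(3,5,4,6) 2[OF i] q2[OF i]])
  qed
qed

lemma form_domain_H1: "f \<in> form_domain b d \<Omega> \<Longrightarrow> f \<in> H1 d \<Omega>"
  by (cases b) (auto simp: form_domain_def H1_0_def)

lemma form_domain_L2: "f \<in> form_domain b d \<Omega> \<Longrightarrow> f \<in> L2 (leb d \<Omega>)"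
  by (rule H1_L2[OF form_domain_H1])

lemma form_domain_lincomb:
  "f \<in> form_domain b d \<Omega> \<Longrightarrow> f' \<in> form_domain b d \<Omega> \<Longrightarrow> (\<lambda>x. c * f x + f' x) \<in> form_domain b d \<Omega>"
  by (cases b) (auto simp: form_domain_def intro: H1_0_lincomb H1_lincomb(1))

lemma test_form_domain: "\<phi> \<in> test_functions d \<Omega> \<Longrightarrow> \<phi> \<in> form_domain b d \<Omega>"
  by (cases b) (auto simp: form_domain_def intro: test_H1_0 test_H1)

text \<open>Functions that agree almost everywhere satisfy the same predicate
  \<open>has_weak_partial\<close>, so the choice in \<open>weak_partial\<close> returns literally
  the same function.\<close>

lemma form_domain_cong:
  assumes f: "f \<in> form_domain b d \<Omega>" and f': "f' \<in> L2 (leb d \<Omega>)" and AE: "AE x in leb d \<Omega>. f x = f' x"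
  shows "f' \<in> form_domain b d \<Omega>" and "i < d \<Longrightarrow> weak_partial d \<Omega> i f' = weak_partial d \<Omega> i f"
proof -
  have w: "has_weak_partial d \<Omega> i f' = has_weak_partial d \<Omega> i f" if "i < d" for i
    using weak_cong_AE[OF form_domain_L2[OF f] f' AE that] by simp
  show wp: "weak_partial d \<Omega> i f' = weak_partial d \<Omega> i f" if "i < d" for i
    unfolding weak_partial_def w[OF that] ..
  have H: "f' \<in> H1 d \<Omega>" by (rule H1I[OF f', where g = "\<lambda>i. weak_partial d \<Omega> i f"]) (simp add: w H1_weak[OF form_domain_H1[OF f]])
  have n: "L2_norm (leb d \<Omega>) (\<lambda>x. \<phi> x - f' x) = L2_norm (leb d \<Omega>) (\<lambda>x. \<phi> x - f x)" if "\<phi> \<in> L2 (leb d \<Omega>)" for \<phi>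
    by (rule L2_norm_cong_AE) (use that f' form_domain_L2[OF f] AE in \<open>auto intro: L2_diff\<close>)
  show "f' \<in> form_domain b d \<Omega>"
  proof (cases b)
    case Dirichlet
    have "f \<in> H1_0 d \<Omega>" using f Dirichlet by (simp add: form_domain_def)
    then have "\<exists>\<phi>\<in>test_functions d \<Omega>. H1_close f \<phi> e" if "e > 0" for e using that H1_0_iff by blast
    moreover have "H1_close f' \<phi> e \<longleftrightarrow> H1_close f \<phi> e" if "\<phi> \<in> test_functions d \<Omega>" for \<phi> e
      using n[OF test_in_L2[OF that]] wp by (simp add: H1_close_def)
    ultimately have "f' \<in> H1_0 d \<Omega>" unfolding H1_0_iff using H by blast
    then show ?thesis using Dirichlet by (simp add: form_domain_def)
  qed (use H in \<open>simp add: form_domain_def\<close>)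
qed

lemma gradient_form_eq:
  assumes f: "f \<in> H1 d \<Omega>" "h \<in> H1 d \<Omega>"
    and g: "\<And>i. i < d \<Longrightarrow> has_weak_partial d \<Omega> i f (g i)" "\<And>i. i < d \<Longrightarrow> has_weak_partial d \<Omega> i h (k i)"
  shows "gradient_form d \<Omega> f h = (\<Sum>i<d. L2_inner (leb d \<Omega>) (g i) (k i))"
proof -
  have "gradient_form d \<Omega> f h = (\<Sum>i<d. L2_inner (leb d \<Omega>) (weak_partial d \<Omega> i f) (weak_partial d \<Omega> i h))"
    unfolding gradient_form_def L2_inner_def
    by (rule Bochner_Integration.integral_sum) (auto intro!: L2_inner_integrable weak_partial_L2 f)
  also have "\<dots> = (\<Sum>i<d. L2_inner (leb d \<Omega>) (g i) (k i))"
  proof (rule sum.cong[OF refl])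
    fix i assume "i \<in> {..<d}"
    then have i: "i < d" by simp
    show "L2_inner (leb d \<Omega>) (weak_partial d \<Omega> i f) (weak_partial d \<Omega> i h) = L2_inner (leb d \<Omega>) (g i) (k i)"
      by (rule L2_inner_cong_AE[OF weak_partial_L2[OF f(1) i] weak_partial_L2[OF f(2) i] weakD(1)[OF g(1)[OF i]]
        weakD(1)[OF g(2)[OF i]] weak_partial_AE[OF g(1)[OF i]] weak_partial_AE[OF g(2)[OF i]]])
  qed
  finally show ?thesis .
qed

lemmas gradient_form_H1 = gradient_form_eq[OF _ _ H1_weak H1_weak]

end

subsection \<open>The heat semigroups\<close>

context domain
begin

lemma gradient_form_lincomb_left:
  assumes "f \<in> H1 d \<Omega>" "f' \<in> H1 d \<Omega>" "h \<in> H1 d \<Omega>"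
  shows "gradient_form d \<Omega> (\<lambda>x. c * f x + f' x) h = c * gradient_form d \<Omega> f h + gradient_form d \<Omega> f' h"
proof -
  have "gradient_form d \<Omega> (\<lambda>x. c * f x + f' x) h =
    (\<Sum>i<d. L2_inner (leb d \<Omega>) (\<lambda>x. c * weak_partial d \<Omega> i f x + weak_partial d \<Omega> i f' x) (weak_partial d \<Omega> i h))"
    by (rule gradient_form_eq[OF H1_lincomb(1)[OF assms(1,2)] assms(3) weak_lincomb[OF assms(1,2)[THEN H1_L2] _ H1_weak[OF assms(1)] H1_weak[OF assms(2)]] H1_weak[OF assms(3)]])
  also have "\<dots> = (\<Sum>i<d. c * L2_inner (leb d \<Omega>) (weak_partial d \<Omega> i f) (weak_partial d \<Omega> i h) +
      L2_inner (leb d \<Omega>) (weak_partial d \<Omega> i f') (weak_partial d \<Omega> i h))"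
    by (rule sum.cong[OF refl])
      (simp add: L2_inner_add_left L2_inner_scale_left L2_scale weak_partial_L2 assms)
  also have "\<dots> = c * gradient_form d \<Omega> f h + gradient_form d \<Omega> f' h"
    by (simp add: gradient_form_H1 assms sum.distrib sum_distrib_left)
  finally show ?thesis .
qed

lemma gradient_form_cnj:
  "f \<in> H1 d \<Omega> \<Longrightarrow> h \<in> H1 d \<Omega> \<Longrightarrow> gradient_form d \<Omega> h f = cnj (gradient_form d \<Omega> f h)"
  by (simp add: gradient_form_H1 L2_inner_cnj[of _ "weak_partial d \<Omega> _ h"])

lemma gradient_form_self:
  "f \<in> H1 d \<Omega> \<Longrightarrow> Re (gradient_form d \<Omega> f f) = (\<Sum>i<d. (L2_norm (leb d \<Omega>) (weak_partial d \<Omega> i f))\<^sup>2)"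
  by (simp add: gradient_form_H1 rip_self[unfolded rip_def])

lemma H1_zero: "(\<lambda>x. 0) \<in> form_domain b d \<Omega>"
  by (rule test_form_domain[OF test_zero])

lemma form_domain_scale: "f \<in> form_domain b d \<Omega> \<Longrightarrow> (\<lambda>x. c * f x) \<in> form_domain b d \<Omega>"
  using form_domain_lincomb[OF _ H1_zero, of f b c] by simp

lemma gradient_form_scale_left:
  "f \<in> H1 d \<Omega> \<Longrightarrow> h \<in> H1 d \<Omega> \<Longrightarrow> gradient_form d \<Omega> (\<lambda>x. c * f x) h = c * gradient_form d \<Omega> f h"
proof -
  assume f: "f \<in> H1 d \<Omega>" "h \<in> H1 d \<Omega>"
  have z: "(\<lambda>x. 0) \<in> H1 d \<Omega>" by (rule form_domain_H1[OF H1_zero])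
  have "gradient_form d \<Omega> (\<lambda>x. 0) h = 0"
    using gradient_form_lincomb_left[OF z z f(2), of 1] by simp
  then show ?thesis using gradient_form_lincomb_left[OF f(1) z f(2), of c] by simp
qed

definition rform :: "(point \<Rightarrow> complex) \<Rightarrow> (point \<Rightarrow> complex) \<Rightarrow> real" where
  "rform f h = Re (gradient_form d \<Omega> f h)"

text \<open>A Cauchy sequence in the form norm converges in \<open>L2\<close> together with all weak
  derivatives, and these limits fit by closedness. \<open>expand\<close> is needed because the
  chosen derivative of a difference is the difference of the chosen ones only almost
  everywhere.\<close>

lemma form_complete:
  fixes s :: "nat \<Rightarrow> point \<Rightarrow> complex"
  assumes s: "\<And>n. s n \<in> form_domain b d \<Omega>"
    and C: "\<And>e. e > 0 \<Longrightarrow> \<exists>N. \<forall>m\<ge>N. \<forall>n\<ge>N.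
      rip (leb d \<Omega>) (s m - s n) (s m - s n) + rform (s m - s n) (s m - s n) < e"
  shows "\<exists>f\<in>form_domain b d \<Omega>.
    (\<lambda>n. rip (leb d \<Omega>) (s n - f) (s n - f) + rform (s n - f) (s n - f)) \<longlonglongrightarrow> 0"
proof -
  note H = form_domain_H1[OF s]
  have expand: "rip (leb d \<Omega>) (u - v) (u - v) + rform (u - v) (u - v) =
      (L2_norm (leb d \<Omega>) (\<lambda>x. u x - v x))\<^sup>2 +
      (\<Sum>i<d. (L2_norm (leb d \<Omega>) (\<lambda>x. weak_partial d \<Omega> i u x - weak_partial d \<Omega> i v x))\<^sup>2)"
    if u: "u \<in> H1 d \<Omega>" and v: "v \<in> H1 d \<Omega>" for u v
  proof -
    have "L2_norm (leb d \<Omega>) (weak_partial d \<Omega> i (\<lambda>x. u x - v x)) =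
        L2_norm (leb d \<Omega>) (\<lambda>x. weak_partial d \<Omega> i u x - weak_partial d \<Omega> i v x)" if i: "i < d" for i
      by (rule L2_norm_cong_AE[OF weak_partial_L2[OF H1_diff(1)[OF u v] i]
        L2_diff[OF weak_partial_L2[OF u i] weak_partial_L2[OF v i]] H1_diff(2)[OF u v i]])
    then show ?thesis
      using gradient_form_self[OF H1_diff(1)[OF u v]] by (simp add: rip_self rform_def fun_diff_def)
  qed
  have part: "\<exists>N. \<forall>m\<ge>N. \<forall>n\<ge>N. L2.nrm (leb d \<Omega>) (s m - s n) < e \<and>
      (\<forall>i<d. L2.nrm (leb d \<Omega>) (weak_partial d \<Omega> i (s m) - weak_partial d \<Omega> i (s n)) < e)" if e: "e > 0" for e
  proof -
    have "e\<^sup>2 > 0" using e by simp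
    then obtain N where N: "\<forall>m\<ge>N. \<forall>n\<ge>N. rip (leb d \<Omega>) (s m - s n) (s m - s n) + rform (s m - s n) (s m - s n) < e\<^sup>2"
      using C by blast
    have "L2.nrm (leb d \<Omega>) (s m - s n) < e \<and>
      (\<forall>i<d. L2.nrm (leb d \<Omega>) (weak_partial d \<Omega> i (s m) - weak_partial d \<Omega> i (s n)) < e)" if mn: "m \<ge> N" "n \<ge> N" for m n
    proof -
      let ?a = "L2_norm (leb d \<Omega>) (\<lambda>x. s m x - s n x)"
      let ?w = "\<lambda>i. L2_norm (leb d \<Omega>) (\<lambda>x. weak_partial d \<Omega> i (s m) x - weak_partial d \<Omega> i (s n) x)"
      have lt: "?a\<^sup>2 + (\<Sum>i<d. (?w i)\<^sup>2) < e\<^sup>2" using N[rule_format, OF mn] unfolding expand[OF H H] .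
      moreover have "0 \<le> (\<Sum>i<d. (?w i)\<^sup>2)" by (simp add: sum_nonneg)
      ultimately have "?a\<^sup>2 < e\<^sup>2" by linarith
      then have a: "?a < e" using e by (simp add: power2_less_imp_less)
      have "?w i < e" if i: "i < d" for i
      proof -
        have "(?w i)\<^sup>2 \<le> (\<Sum>i<d. (?w i)\<^sup>2)" using i by (intro member_le_sum) auto
        then have "(?w i)\<^sup>2 < e\<^sup>2" using lt zero_le_power2[of ?a] by linarith
        then show ?thesis using e by (simp add: power2_less_imp_less)
      qed
      then show ?thesis using a by (simp add: L2_nrm_diff)
    qed
    then show ?thesis by blast
  qed
  have "\<exists>f\<in>L2 (leb d \<Omega>). (\<lambda>n. L2.nrm (leb d \<Omega>) (s n - f)) \<longlonglongrightarrow> 0"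
  proof (rule L2.complete)
    show "s n \<in> L2 (leb d \<Omega>)" for n by (rule H1_L2[OF H])
    fix e :: real assume "e > 0"
    from part[OF this] show "\<exists>N. \<forall>m\<ge>N. \<forall>n\<ge>N. L2.nrm (leb d \<Omega>) (s m - s n) < e" by blast
  qed
  then obtain f where f: "f \<in> L2 (leb d \<Omega>)" "(\<lambda>n. L2_norm (leb d \<Omega>) (\<lambda>x. s n x - f x)) \<longlonglongrightarrow> 0"
    by (auto simp: L2_nrm_diff)
  have "\<forall>i. \<exists>g. i < d \<longrightarrow> g \<in> L2 (leb d \<Omega>) \<and> (\<lambda>n. L2_norm (leb d \<Omega>) (\<lambda>x. weak_partial d \<Omega> i (s n) x - g x)) \<longlonglongrightarrow> 0"
  proof (intro allI)
    fix i
    show "\<exists>g. i < d \<longrightarrow> g \<in> L2 (leb d \<Omega>) \<and> (\<lambda>n. L2_norm (leb d \<Omega>) (\<lambda>x. weak_partial d \<Omega> i (s n) x - g x)) \<longlonglongrightarrow> 0"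
    proof (cases "i < d")
      case True
      have "\<exists>g\<in>L2 (leb d \<Omega>). (\<lambda>n. L2.nrm (leb d \<Omega>) (weak_partial d \<Omega> i (s n) - g)) \<longlonglongrightarrow> 0"
      proof (rule L2.complete)
        show "weak_partial d \<Omega> i (s n) \<in> L2 (leb d \<Omega>)" for n by (rule weak_partial_L2[OF H True])
        fix e :: real assume "e > 0"
        from part[OF this] obtain N where "\<forall>m\<ge>N. \<forall>n\<ge>N. L2.nrm (leb d \<Omega>) (s m - s n) < e \<and>
          (\<forall>i<d. L2.nrm (leb d \<Omega>) (weak_partial d \<Omega> i (s m) - weak_partial d \<Omega> i (s n)) < e)" by blast
        then show "\<exists>N. \<forall>m\<ge>N. \<forall>n\<ge>N. L2.nrm (leb d \<Omega>) (weak_partial d \<Omega> i (s m) - weak_partial d \<Omega> i (s n)) < e"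
          using True by (intro exI[of _ N]) simp
      qed
      then show ?thesis by (auto simp: L2_nrm_diff)
    qed simp
  qed
  from choice[OF this] obtain g where g0: "\<forall>i. i < d \<longrightarrow> g i \<in> L2 (leb d \<Omega>) \<and>
    (\<lambda>n. L2_norm (leb d \<Omega>) (\<lambda>x. weak_partial d \<Omega> i (s n) x - g i x)) \<longlonglongrightarrow> 0" ..
  have g: "g i \<in> L2 (leb d \<Omega>)" "(\<lambda>n. L2_norm (leb d \<Omega>) (\<lambda>x. weak_partial d \<Omega> i (s n) x - g i x)) \<longlonglongrightarrow> 0"
    if "i < d" for i
    using g0[rule_format, OF that] by (rule conjunct1, rule conjunct2)
  have w: "has_weak_partial d \<Omega> i f (g i)" if i: "i < d" for i
    by (rule weak_limit[OF H1_L2[OF H] f(1) g(1)[OF i] i H1_weak[OF H i] f(2) g(2)[OF i]])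
  have fH: "f \<in> H1 d \<Omega>" by (rule H1I[OF f(1) w])
  have wlim: "(\<lambda>n. L2_norm (leb d \<Omega>) (\<lambda>x. weak_partial d \<Omega> i (s n) x - weak_partial d \<Omega> i f x)) \<longlonglongrightarrow> 0" if i: "i < d" for i
  proof -
    have "L2_norm (leb d \<Omega>) (\<lambda>x. weak_partial d \<Omega> i (s n) x - weak_partial d \<Omega> i f x) =
      L2_norm (leb d \<Omega>) (\<lambda>x. weak_partial d \<Omega> i (s n) x - g i x)" for n
    proof (rule L2_norm_cong_AE)
      show "AE x in leb d \<Omega>. weak_partial d \<Omega> i (s n) x - weak_partial d \<Omega> i f x = weak_partial d \<Omega> i (s n) x - g i x"
        using weak_partial_AE[OF w[OF i]] by eventually_elim simp
    qed (intro L2_diff weak_partial_L2[OF H i] weak_partial_L2[OF fH i] g(1)[OF i])+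
    then show ?thesis using g(2)[OF i] by simp
  qed
  have fV: "f \<in> form_domain b d \<Omega>"
  proof (cases b)
    case Dirichlet
    have "s n \<in> H1_0 d \<Omega>" for n using s[of n] Dirichlet by (simp add: form_domain_def)
    from H1_0_closed[OF fH this f(2) wlim] show ?thesis using Dirichlet by (simp add: form_domain_def)
  qed (use fH in \<open>simp add: form_domain_def\<close>)
  have "(\<lambda>n. (L2_norm (leb d \<Omega>) (\<lambda>x. s n x - f x))\<^sup>2 +
      (\<Sum>i<d. (L2_norm (leb d \<Omega>) (\<lambda>x. weak_partial d \<Omega> i (s n) x - weak_partial d \<Omega> i f x))\<^sup>2)) \<longlonglongrightarrow> 0\<^sup>2 + (\<Sum>i<d. 0\<^sup>2)"
    by (intro tendsto_add tendsto_sum tendsto_power f(2) wlim) simp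
  then have "(\<lambda>n. rip (leb d \<Omega>) (s n - f) (s n - f) + rform (s n - f) (s n - f)) \<longlonglongrightarrow> 0"
    by (simp add: expand[OF H fH])
  then show ?thesis using fV by blast
qed

lemma closed_form: "closed_form (L2 (leb d \<Omega>)) (rip (leb d \<Omega>)) (form_domain b d \<Omega>) rform"
proof
  show "form_domain b d \<Omega> \<subseteq> L2 (leb d \<Omega>)" using form_domain_L2 by blast
  have real: "c *\<^sub>R f = (\<lambda>x. of_real c * f x)" for c and f :: "point \<Rightarrow> complex"
    by (simp add: scaleR_fun_def scaleR_conv_of_real)
  show "subspace (form_domain b d \<Omega>)"
    unfolding subspace_def real plus_fun_def zero_fun_def
  proof (intro conjI ballI allI H1_zero form_domain_scale)
    fix f f' assume "f \<in> form_domain b d \<Omega>" "f' \<in> form_domain b d \<Omega>"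
    from form_domain_lincomb[OF this, of 1] show "(\<lambda>x. f x + f' x) \<in> form_domain b d \<Omega>" by simp
  qed
  fix f g :: "point \<Rightarrow> complex" assume f: "f \<in> form_domain b d \<Omega>"
  note fH = form_domain_H1[OF f]
  show "0 \<le> rform f f" by (simp add: rform_def gradient_form_self[OF fH] sum_nonneg)
  {
    fix f' assume f': "f' \<in> L2 (leb d \<Omega>)" and "L2.nrm (leb d \<Omega>) (f - f') = 0"
    then have AE: "AE x in leb d \<Omega>. f x = f' x" using L2_nrm_eq_iff[OF form_domain_L2[OF f] f'] by simp
    have "rform f' h = rform f h" for h
      unfolding rform_def gradient_form_def
      by (simp add: form_domain_cong(2)[OF f f' AE])
    then show "f' \<in> form_domain b d \<Omega> \<and> (\<forall>h\<in>form_domain b d \<Omega>. rform f' h = rform f h)"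
      using form_domain_cong(1)[OF f f' AE] by blast
  }
  assume g: "g \<in> form_domain b d \<Omega>"
  note gH = form_domain_H1[OF g]
  show "rform f g = rform g f" unfolding rform_def using gradient_form_cnj[OF fH gH] by simp
  show "rform (c *\<^sub>R f) g = c * rform f g" for c
    unfolding rform_def real gradient_form_scale_left[OF fH gH] by simp
  fix h assume h: "h \<in> form_domain b d \<Omega>"
  show "rform (f + g) h = rform f h + rform g h"
    unfolding rform_def plus_fun_def
    using gradient_form_lincomb_left[OF fH gH form_domain_H1[OF h], of 1] by simp
next
  fix s :: "nat \<Rightarrow> point \<Rightarrow> complex"
  assume "\<And>n. s n \<in> form_domain b d \<Omega>" "\<And>e. e > 0 \<Longrightarrow> \<exists>N. \<forall>m\<ge>N. \<forall>n\<ge>N.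
      rip (leb d \<Omega>) (s m - s n) (s m - s n) + rform (s m - s n) (s m - s n) < e"
  then show "\<exists>f\<in>form_domain b d \<Omega>.
    (\<lambda>n. rip (leb d \<Omega>) (s n - f) (s n - f) + rform (s n - f) (s n - f)) \<longlonglongrightarrow> 0" by (rule form_complete)
next
  fix f assume f: "f \<in> L2 (leb d \<Omega>)" and o: "\<And>h. h \<in> form_domain b d \<Omega> \<Longrightarrow> rip (leb d \<Omega>) f h = 0"
  have "AE x in leb d \<Omega>. f x = 0"
  proof (rule fundamental_lemma[OF f])
    fix a a' n assume box: "closed_box d a a' \<subseteq> \<Omega>"
    let ?\<phi> = "bump d a a' n"
    have t: "(\<lambda>x. c * ?\<phi> x) \<in> form_domain b d \<Omega>" for c
      by (rule form_domain_scale[OF test_form_domain[OF bump_test[OF box]]])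
    \<comment> \<open>Orthogonality is known only for the real part; testing with
      \<open>\<i>\<close> times the bump adds the imaginary part.\<close>
    have "Re (L2_inner (leb d \<Omega>) f ?\<phi>) = 0" "Re (cnj \<i> * L2_inner (leb d \<Omega>) f ?\<phi>) = 0"
      using o[OF t[of 1]] o[OF t[of \<i>]] unfolding rip_def L2_inner_scale_right by simp_all
    then have "L2_inner (leb d \<Omega>) f ?\<phi> = 0" by (simp add: complex_eq_iff)
    then show "(LINT x|leb d \<Omega>. f x * ?\<phi> x) = 0" by (simp add: L2_inner_def bump_real)
  qed
  then show "L2.nrm (leb d \<Omega>) f = 0" by (simp add: L2_nrm L2_norm_eq_0_iff[OF f])
qed

lemma laplacian_iff:
  "(f, g) \<in> laplacian b d \<Omega> \<longleftrightarrow> f \<in> form_domain b d \<Omega> \<and> g \<in> L2 (leb d \<Omega>) \<and>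
     (\<forall>h\<in>form_domain b d \<Omega>. gradient_form d \<Omega> f h = - L2_inner (leb d \<Omega>) g h)"
proof -
  have "(\<lambda>x. - g x) \<in> L2 (leb d \<Omega>) \<longleftrightarrow> g \<in> L2 (leb d \<Omega>)"
    using L2_minus[of g] L2_minus[of "\<lambda>x. - g x"] by auto
  moreover have "L2_inner (leb d \<Omega>) (\<lambda>x. - g x) h = - L2_inner (leb d \<Omega>) g h" for h
    using L2_inner_scale_left[of "leb d \<Omega>" "-1" g h] by simp
  ultimately show ?thesis by (simp add: laplacian_def form_operator_def)
qed

text \<open>The abstract graph records only real parts of the form identity. As the form domain is
  closed under multiplication by \<open>\<i>\<close>, the identity at \<open>\<i> h\<close> supplies
  the imaginary part.\<close>

lemma laplacian_eq_form_graph: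
  "laplacian b d \<Omega> = closed_form.form_graph (L2 (leb d \<Omega>)) (rip (leb d \<Omega>)) (form_domain b d \<Omega>) rform"
proof -
  interpret F: closed_form "L2 (leb d \<Omega>)" "rip (leb d \<Omega>)" "form_domain b d \<Omega>" rform by (rule closed_form)
  have "(f, g) \<in> laplacian b d \<Omega> \<longleftrightarrow> (f, g) \<in> F.form_graph" for f g
  proof
    assume "(f, g) \<in> laplacian b d \<Omega>"
    then show "(f, g) \<in> F.form_graph" by (auto simp: laplacian_iff F.form_graph_def rform_def rip_def)
  next
    assume "(f, g) \<in> F.form_graph"
    then have f: "f \<in> form_domain b d \<Omega>" and g: "g \<in> L2 (leb d \<Omega>)"
      and eq: "\<And>h. h \<in> form_domain b d \<Omega> \<Longrightarrow> Re (gradient_form d \<Omega> f h) = - Re (L2_inner (leb d \<Omega>) g h)"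
      by (auto simp: F.form_graph_def rform_def rip_def)
    have "gradient_form d \<Omega> f h = - L2_inner (leb d \<Omega>) g h" if h: "h \<in> form_domain b d \<Omega>" for h
    proof -
      note H = form_domain_H1[OF f] form_domain_H1[OF h] form_domain_H1[OF form_domain_scale[OF h, of \<i>]]
      have "gradient_form d \<Omega> f (\<lambda>x. \<i> * h x) = cnj (gradient_form d \<Omega> (\<lambda>x. \<i> * h x) f)"
        by (rule gradient_form_cnj[OF H(3,1)])
      also have "\<dots> = - \<i> * gradient_form d \<Omega> f h"
        by (simp add: gradient_form_scale_left[OF H(2,1)] gradient_form_cnj[OF H(1,2)])
      finally have "Im (gradient_form d \<Omega> f h) = - Im (L2_inner (leb d \<Omega>) g h)"
        using eq[OF form_domain_scale[OF h, of \<i>]] by (simp add: L2_inner_scale_right)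
      then show ?thesis using eq[OF h] by (simp add: complex_eq_iff)
    qed
    then show "(f, g) \<in> laplacian b d \<Omega>" using f g by (simp add: laplacian_iff)
  qed
  then show ?thesis by auto
qed

theorem laplacian_m_dissipative: "m_dissipative (L2 (leb d \<Omega>)) (rip (leb d \<Omega>)) (laplacian b d \<Omega>)"
  unfolding laplacian_eq_form_graph by (rule closed_form.m_dissipative[OF closed_form])

text \<open>The constructed semigroup is a priori only real-linear. Multiplication by
  \<open>\<i>\<close> maps the Laplacian into itself, so the intertwining theorem, applied to one
  and the same semigroup, gives complex linearity.\<close>

theorem heat_semigroup:
  "C0_semigroup (leb d \<Omega>) (heat_semigroup b d \<Omega>)" "generator (leb d \<Omega>) (heat_semigroup b d \<Omega>) = laplacian b d \<Omega>"
proof -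
  interpret P: m_dissipative "L2 (leb d \<Omega>)" "rip (leb d \<Omega>)" "laplacian b d \<Omega>" by (rule laplacian_m_dissipative)
  interpret I: intertwined "L2 (leb d \<Omega>)" "rip (leb d \<Omega>)" "laplacian b d \<Omega>" "L2 (leb d \<Omega>)" "rip (leb d \<Omega>)" "laplacian b d \<Omega>"
    "\<lambda>f x. \<i> * f x" 1
  proof
    fix f g :: "point \<Rightarrow> complex"
    assume f: "f \<in> L2 (leb d \<Omega>)"
    show "(\<lambda>x. \<i> * f x) \<in> L2 (leb d \<Omega>)" by (rule L2_scale[OF f])
    show "L2.nrm (leb d \<Omega>) (\<lambda>x. \<i> * f x) \<le> 1 * L2.nrm (leb d \<Omega>) f" by (simp add: L2_nrm L2_norm_scale)
    show "(\<lambda>x. \<i> * (c *\<^sub>R f + g) x) = c *\<^sub>R (\<lambda>x. \<i> * f x) + (\<lambda>x. \<i> * g x)" for c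
      by (simp add: fun_eq_iff distrib_left)
  next
    fix f g assume "(f, g) \<in> laplacian b d \<Omega>"
    then have f: "f \<in> form_domain b d \<Omega>" and g: "g \<in> L2 (leb d \<Omega>)"
      and eq: "\<And>h. h \<in> form_domain b d \<Omega> \<Longrightarrow> gradient_form d \<Omega> f h = - L2_inner (leb d \<Omega>) g h"
      by (auto simp: laplacian_iff)
    show "((\<lambda>x. \<i> * f x), (\<lambda>x. \<i> * g x)) \<in> laplacian b d \<Omega>"
      unfolding laplacian_iff
      by (simp add: form_domain_scale[OF f] L2_scale[OF g] gradient_form_scale_left form_domain_H1[OF f] form_domain_H1 eq L2_inner_scale_left)
  qed
  have "AE x in leb d \<Omega>. P.S t (\<lambda>x. \<i> * f x) x = \<i> * P.S t f x" if t: "t \<ge> 0" and f: "f \<in> L2 (leb d \<Omega>)" for t f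
  proof -
    have L: "P.S t f \<in> L2 (leb d \<Omega>)" by (rule P.S_X[OF f t])
    have L': "P.S t (\<lambda>x. \<i> * f x) \<in> L2 (leb d \<Omega>)" by (rule P.S_X[OF L2_scale[OF f] t])
    have "AE x in leb d \<Omega>. \<i> * P.S t f x = P.S t (\<lambda>x. \<i> * f x) x"
      using I.U_semigroup[OF P.c0_S P.gen_S P.c0_S P.gen_S f t] L2_nrm_eq_iff[OF L2_scale[OF L] L'] by simp
    then show ?thesis by eventually_elim simp
  qed
  then have "C0_semigroup (leb d \<Omega>) P.S" by (intro c0_imp_C0_semigroup[OF P.c0_S]) auto
  moreover have "generator (leb d \<Omega>) P.S = laplacian b d \<Omega>" unfolding generator_eq_gen by (rule P.gen_S)
  ultimately have "\<exists>P. C0_semigroup (leb d \<Omega>) P \<and> generator (leb d \<Omega>) P = laplacian b d \<Omega>" by blast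
  from someI_ex[OF this] show "C0_semigroup (leb d \<Omega>) (heat_semigroup b d \<Omega>)"
    "generator (leb d \<Omega>) (heat_semigroup b d \<Omega>) = laplacian b d \<Omega>"
    by (simp_all add: heat_semigroup_def)
qed

end

subsection \<open>Reflection of functions\<close>

lemma reflect_measurable: "d \<ge> 1 \<Longrightarrow> reflect \<in> lborel_Rd d \<rightarrow>\<^sub>M lborel_Rd d"
  unfolding reflect_def
proof (rule measurable_fun_upd)
  assume d: "d \<ge> 1"
  then show "{..<d} = {..<d} \<union> {0}" by auto
  have "(\<lambda>x. x 0) \<in> lborel_Rd d \<rightarrow>\<^sub>M lborel" by (rule measurable_component_singleton) (use d in simp)
  then show "(\<lambda>x. - x 0) \<in> lborel_Rd d \<rightarrow>\<^sub>M lborel" by simp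
qed simp

lemma reflect_distr:
  assumes d: "d \<ge> 1"
  shows "distr (lborel_Rd d) (lborel_Rd d) reflect = lborel_Rd d"
proof (rule lborel_product.PiM_eqI)
  fix A :: "nat \<Rightarrow> real set" assume A: "\<And>i. i \<in> {..<d} \<Longrightarrow> A i \<in> sets lborel"
  let ?B = "A(0 := uminus -` A 0)"
  have A0: "A 0 \<in> sets borel" using A[of 0] d by simp
  have um: "uminus -` A 0 \<in> sets borel"
    by (rule measurable_sets_borel[OF _ A0]) simp
  have eq: "reflect -` (Pi\<^sub>E {..<d} A) \<inter> space (lborel_Rd d) = Pi\<^sub>E {..<d} ?B"
  proof (intro set_eqI iffI)
    fix x assume x: "x \<in> reflect -` (Pi\<^sub>E {..<d} A) \<inter> space (lborel_Rd d)"
    then have r: "reflect x i \<in> A i" if "i < d" for i using that by (auto simp: PiE_iff)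
    have "x i \<in> ?B i" if "i < d" for i using r[OF that] by (cases "i = 0") auto
    then show "x \<in> Pi\<^sub>E {..<d} ?B" using x by (auto simp: PiE_iff Rd_def)
  next
    fix x assume x: "x \<in> Pi\<^sub>E {..<d} ?B"
    then have r: "x i \<in> ?B i" if "i < d" for i using that by (auto simp: PiE_iff)
    have "reflect x i \<in> A i" if "i < d" for i using r[OF that] by (cases "i = 0") auto
    moreover have xR: "x \<in> Rd d" using x by (auto simp: PiE_iff Rd_def)
    moreover have "reflect x \<in> Rd d" using d xR by simp
    ultimately show "x \<in> reflect -` (Pi\<^sub>E {..<d} A) \<inter> space (lborel_Rd d)" by (auto simp: PiE_iff Rd_def)
  qed
  have "emeasure lborel (uminus -` A 0) = emeasure lborel (A 0)"
  proof -
    have "emeasure lborel (A 0) = emeasure (distr lborel borel uminus) (A 0)" by (simp add: lborel_distr_uminus)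
    also have "\<dots> = emeasure lborel (uminus -` A 0)" using A0 by (subst emeasure_distr) auto
    finally show ?thesis by simp
  qed
  then have e: "emeasure lborel (?B i) = emeasure lborel (A i)" for i by simp
  have "emeasure (distr (lborel_Rd d) (lborel_Rd d) reflect) (Pi\<^sub>E {..<d} A) = emeasure (lborel_Rd d) (Pi\<^sub>E {..<d} ?B)"
    using A unfolding eq[symmetric] by (subst emeasure_distr[OF reflect_measurable[OF d]]) (auto intro!: sets_PiM_I_finite)
  also have "\<dots> = (\<Prod>i<d. emeasure lborel (?B i))"
    using A um by (intro lborel_product.emeasure_PiM) auto
  finally show "emeasure (distr (lborel_Rd d) (lborel_Rd d) reflect) (Pi\<^sub>E {..<d} A) = (\<Prod>i<d. emeasure lborel (A i))"
    unfolding e .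
qed simp_all

lemma reflect_lebesgue:
  assumes d: "d \<ge> 1"
  shows "reflect \<in> lebesgue_Rd d \<rightarrow>\<^sub>M lebesgue_Rd d" "distr (lebesgue_Rd d) (lebesgue_Rd d) reflect = lebesgue_Rd d"
proof -
  have m: "reflect \<in> completion (lborel_Rd d) \<rightarrow>\<^sub>M lborel_Rd d" by (rule measurable_completion[OF reflect_measurable[OF d]])
  have eq: "distr (completion (lborel_Rd d)) (lborel_Rd d) reflect = lborel_Rd d"
    by (simp add: distr_completion[OF reflect_measurable[OF d]] reflect_distr[OF d])
  show "reflect \<in> lebesgue_Rd d \<rightarrow>\<^sub>M lebesgue_Rd d"
    unfolding lebesgue_Rd_def by (rule completion.measurable_completion2[OF m]) (simp add: eq)
  show "distr (lebesgue_Rd d) (lebesgue_Rd d) reflect = lebesgue_Rd d"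
    unfolding lebesgue_Rd_def using completion.completion_distr_eq[OF m] by (simp add: eq)
qed

lemma hyperplane_null:
  assumes d: "d \<ge> 1"
  shows "AE x in lebesgue_Rd d. x 0 \<noteq> 0"
proof -
  let ?N = "\<Pi>\<^sub>E i\<in>{..<d}. if i = 0 then {0::real} else UNIV"
  have "emeasure (lborel_Rd d) ?N = (\<Prod>i<d. emeasure lborel (if i = 0 then {0::real} else UNIV))"
    by (rule lborel_product.emeasure_PiM) auto
  also have "\<dots> = 0" using d by (intro prod_zero) auto
  finally have "?N \<in> null_sets (lborel_Rd d)" by (auto intro!: null_setsI sets_PiM_I_finite)
  then have "AE x in lborel_Rd d. x 0 \<noteq> 0"
    by (rule AE_I') (auto simp: Rd_def PiE_iff extensional_def)
  then show ?thesis unfolding lebesgue_Rd_def by (rule AE_completion)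
qed

lemma leb_restrict: "f \<in> borel_measurable (lebesgue_Rd d) \<Longrightarrow> f \<in> borel_measurable (leb d \<Omega>)"
  unfolding leb_def by (rule measurable_restrict_space1)

text \<open>The two open half-spaces exhaust the space up to the null hyperplane, and reflection
  preserves the measure. Integrals over the whole space thereby become integrals over the half-space
  with pointwise comparable integrands.\<close>

lemma integral_fold:
  fixes f :: "point \<Rightarrow> 'b::{banach, second_countable_topology}"
  assumes d: "d \<ge> 1" and f: "integrable (lebesgue_Rd d) f"
  shows "integrable (leb d (half_space d)) (\<lambda>x. f x + f (reflect x))"
    and "(LINT x|lebesgue_Rd d. f x) = (LINT x|leb d (half_space d). f x + f (reflect x))"
proof -
  let ?H = "half_space d"
  have fm: "f \<in> borel_measurable (lebesgue_Rd d)" using f by (rule borel_measurable_integrable)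
  have fr: "integrable (lebesgue_Rd d) (\<lambda>x. f (reflect x))"
    using integrable_distr_eq[OF reflect_lebesgue(1)[OF d] fm] f unfolding reflect_lebesgue(2)[OF d] by simp
  have HR: "{x \<in> Rd d. reflect x \<in> ?H} \<in> sets (lebesgue_Rd d)"
    using measurable_sets[OF reflect_lebesgue(1)[OF d] half_space_sets[OF d]] by (simp add: vimage_def Int_def conj_commute)
  have i1: "integrable (lebesgue_Rd d) (\<lambda>x. indicator ?H x *\<^sub>R f x)"
    by (rule integrable_mult_indicator[OF half_space_sets[OF d] f])
  have i2: "integrable (lebesgue_Rd d) (\<lambda>x. indicator ?H x *\<^sub>R f (reflect x))"
    by (rule integrable_mult_indicator[OF half_space_sets[OF d] fr])
  have i2': "integrable (lebesgue_Rd d) (\<lambda>x. indicator {x \<in> Rd d. reflect x \<in> ?H} x *\<^sub>R f x)"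
    by (rule integrable_mult_indicator[OF HR f])
  show "integrable (leb d ?H) (\<lambda>x. f x + f (reflect x))"
    by (intro integrable_leb Bochner_Integration.integrable_add f fr half_space_sets d)
  have "(LINT x|leb d ?H. f x + f (reflect x)) =
    (LINT x|lebesgue_Rd d. indicator ?H x *\<^sub>R f x + indicator ?H x *\<^sub>R f (reflect x))"
    unfolding integral_leb[OF half_space_sets[OF d]] by (simp add: scaleR_add_right)
  also have "\<dots> = (LINT x|lebesgue_Rd d. indicator ?H x *\<^sub>R f x) + (LINT x|lebesgue_Rd d. indicator ?H x *\<^sub>R f (reflect x))"
    by (rule Bochner_Integration.integral_add[OF i1 i2])
  also have "(LINT x|lebesgue_Rd d. indicator ?H x *\<^sub>R f (reflect x)) =
    (LINT x|lebesgue_Rd d. indicator {x \<in> Rd d. reflect x \<in> ?H} x *\<^sub>R f x)"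
  proof -
    let ?g = "\<lambda>x. indicator {x \<in> Rd d. reflect x \<in> ?H} x *\<^sub>R f x"
    have "(LINT x|lebesgue_Rd d. ?g x) = (LINT x|distr (lebesgue_Rd d) (lebesgue_Rd d) reflect. ?g x)"
      unfolding reflect_lebesgue(2)[OF d] ..
    also have "\<dots> = (LINT x|lebesgue_Rd d. ?g (reflect x))"
      by (rule integral_distr[OF reflect_lebesgue(1)[OF d] borel_measurable_integrable[OF i2']])
    also have "\<dots> = (LINT x|lebesgue_Rd d. indicator ?H x *\<^sub>R f (reflect x))"
      by (rule Bochner_Integration.integral_cong[OF refl]) (use d in \<open>auto simp: indicator_def half_space_def\<close>)
    finally show ?thesis by simp
  qed
  also have "(LINT x|lebesgue_Rd d. indicator ?H x *\<^sub>R f x) +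
    (LINT x|lebesgue_Rd d. indicator {x \<in> Rd d. reflect x \<in> ?H} x *\<^sub>R f x) =
    (LINT x|lebesgue_Rd d. indicator ?H x *\<^sub>R f x + indicator {x \<in> Rd d. reflect x \<in> ?H} x *\<^sub>R f x)"
    by (rule Bochner_Integration.integral_add[OF i1 i2', symmetric])
  also have "\<dots> = (LINT x|lebesgue_Rd d. f x)"
  proof (rule integral_cong_AE)
    show "(\<lambda>x. indicator ?H x *\<^sub>R f x + indicator {x \<in> Rd d. reflect x \<in> ?H} x *\<^sub>R f x) \<in> borel_measurable (lebesgue_Rd d)"
      using i1 i2' by (intro borel_measurable_add borel_measurable_integrable)
    show "AE x in lebesgue_Rd d. indicator ?H x *\<^sub>R f x + indicator {x \<in> Rd d. reflect x \<in> ?H} x *\<^sub>R f x = f x"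
      using hyperplane_null[OF d] AE_space
      by eventually_elim (use d in \<open>auto simp: indicator_def half_space_def\<close>)
  qed (rule fm)
  finally show "(LINT x|lebesgue_Rd d. f x) = (LINT x|leb d ?H. f x + f (reflect x))" by simp
qed

text \<open>Up to normalisation, \<open>sym\<close> with \<open>\<sigma> = 1\<close> (\<open>\<sigma> = -1\<close>) is the even (odd) part.
  Seen as a map from \<open>L\<^sup>2(\<real>\<^sup>d)\<close> to \<open>L\<^sup>2\<close> of the half-space it is the adjoint of the extension \<open>ext\<close>.\<close>

definition sym :: "complex \<Rightarrow> (point \<Rightarrow> complex) \<Rightarrow> point \<Rightarrow> complex" where
  "sym \<sigma> f x = of_real (1 / sqrt 2) * (f x + \<sigma> * f (reflect x))"

definition ext :: "nat \<Rightarrow> complex \<Rightarrow> (point \<Rightarrow> complex) \<Rightarrow> point \<Rightarrow> complex" where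
  "ext d \<sigma> h = sym \<sigma> (\<lambda>x. indicator (half_space d) x * h x)"

lemma sym_linear: "sym \<sigma> (\<lambda>x. c * f x + g x) x = c * sym \<sigma> f x + sym \<sigma> g x"
  by (simp add: sym_def algebra_simps)

lemma sym_diff: "sym \<sigma> (\<lambda>x. f x - g x) x = sym \<sigma> f x - sym \<sigma> g x"
  by (simp add: sym_def algebra_simps)

lemma sqrt2_sq: "complex_of_real (1 / sqrt 2) * of_real (1 / sqrt 2) = 1 / 2"
  by (simp flip: of_real_mult)

lemma ext_half: "x \<in> half_space d \<Longrightarrow> ext d \<sigma> h x = of_real (1 / sqrt 2) * h x"
  by (auto simp: ext_def sym_def half_space_def)

lemma ext_reflect: "x \<in> half_space d \<Longrightarrow> d \<ge> 1 \<Longrightarrow> ext d \<sigma> h (reflect x) = of_real (1 / sqrt 2) * \<sigma> * h x"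
  by (auto simp: ext_def sym_def half_space_def)

text \<open>Restriction is a left inverse of extension, so a control for the extended initial state
  is turned into one for \<open>u0\<close> itself.\<close>

lemma sym_ext: "x \<in> half_space d \<Longrightarrow> d \<ge> 1 \<Longrightarrow> \<sigma>\<^sup>2 = 1 \<Longrightarrow> sym \<sigma> (ext d \<sigma> h) x = h x"
proof -
  assume a: "x \<in> half_space d" "d \<ge> 1" "\<sigma>\<^sup>2 = 1"
  have "sym \<sigma> (ext d \<sigma> h) x = (of_real (1 / sqrt 2) * of_real (1 / sqrt 2)) * ((1 + \<sigma>\<^sup>2) * h x)"
    unfolding sym_def[of \<sigma> "ext d \<sigma> h"] ext_half[OF a(1)] ext_reflect[OF a(1,2)]
    by (simp only: power2_eq_square distrib_right distrib_left mult_1_left mult_ac)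
  then show ?thesis unfolding sqrt2_sq using a(3) by simp
qed

lemma L2_lebesgue_reflect:
  assumes d: "d \<ge> 1" and f: "f \<in> L2 (lebesgue_Rd d)"
  shows "(\<lambda>x. f (reflect x)) \<in> L2 (lebesgue_Rd d)"
proof -
  have "(\<lambda>x. f (reflect x)) \<in> borel_measurable (lebesgue_Rd d)"
    by (rule measurable_compose[OF reflect_lebesgue(1)[OF d] L2D(1)[OF f]])
  moreover have "integrable (lebesgue_Rd d) (\<lambda>x. (cmod (f (reflect x)))\<^sup>2)"
    using integrable_distr_eq[OF reflect_lebesgue(1)[OF d] borel_measurable_integrable[OF L2D(2)[OF f]]] L2D(2)[OF f]
    unfolding reflect_lebesgue(2)[OF d] by simp
  ultimately show ?thesis by (simp add: L2_def)
qed

lemma sym_L2_lebesgue: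
  assumes "d \<ge> 1" "f \<in> L2 (lebesgue_Rd d)"
  shows "sym \<sigma> f \<in> L2 (lebesgue_Rd d)"
  unfolding sym_def[abs_def] by (intro L2_scale L2_add L2_lebesgue_reflect assms)

lemma L2_restrict:
  assumes "f \<in> L2 (lebesgue_Rd d)" "\<Omega> \<in> sets (lebesgue_Rd d)"
  shows "f \<in> L2 (leb d \<Omega>)"
  using assms by (auto simp: L2_def intro: leb_restrict integrable_leb)

lemma L2_extend_zero:
  assumes \<Omega>: "\<Omega> \<in> sets (lebesgue_Rd d)" and h: "h \<in> L2 (leb d \<Omega>)"
  shows "(\<lambda>x. indicator \<Omega> x * h x) \<in> L2 (lebesgue_Rd d)"
proof -
  have sub: "\<Omega> \<inter> space (lebesgue_Rd d) \<in> sets (lebesgue_Rd d)"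
    using sets.Int_space_eq2[OF \<Omega>] \<Omega> by metis
  have "(\<lambda>x. indicator \<Omega> x *\<^sub>R h x) \<in> borel_measurable (lebesgue_Rd d)"
    using L2D(1)[OF h] unfolding leb_def borel_measurable_restrict_space_iff[OF sub] .
  moreover have "integrable (lebesgue_Rd d) (\<lambda>x. indicator \<Omega> x *\<^sub>R (cmod (h x))\<^sup>2)"
    using L2D(2)[OF h] unfolding leb_def integrable_restrict_space[OF sub] .
  moreover have "(\<lambda>x. indicator \<Omega> x *\<^sub>R h x) = (\<lambda>x. indicator \<Omega> x * h x)" by (auto simp: indicator_def)
  moreover have "(\<lambda>x. indicator \<Omega> x *\<^sub>R (cmod (h x))\<^sup>2) = (\<lambda>x. (cmod (indicator \<Omega> x * h x))\<^sup>2)" by (auto simp: indicator_def)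
  ultimately show ?thesis by (simp add: L2_def)
qed

lemma sym_L2: "d \<ge> 1 \<Longrightarrow> f \<in> L2 (lebesgue_Rd d) \<Longrightarrow> sym \<sigma> f \<in> L2 (leb d (half_space d))"
  by (intro L2_restrict sym_L2_lebesgue half_space_sets)

lemma ext_L2: "d \<ge> 1 \<Longrightarrow> h \<in> L2 (leb d (half_space d)) \<Longrightarrow> ext d \<sigma> h \<in> L2 (lebesgue_Rd d)"
  unfolding ext_def by (intro sym_L2_lebesgue L2_extend_zero half_space_sets)

lemma space_leb_half: "d \<ge> 1 \<Longrightarrow> x \<in> space (leb d (half_space d)) \<Longrightarrow> x \<in> half_space d"
  by (simp add: leb_def space_restrict_space)

lemma sym_ext_adjoint:
  assumes d: "d \<ge> 1" and f: "f \<in> L2 (lebesgue_Rd d)" and h: "h \<in> L2 (leb d (half_space d))"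
  shows "(LINT x|leb d (half_space d). sym \<sigma> f x * h x) = (LINT x|lebesgue_Rd d. f x * ext d \<sigma> h x)"
  unfolding integral_fold(2)[OF d L2_mult_integrable[OF f ext_L2[OF d h]]]
proof (rule Bochner_Integration.integral_cong[OF refl])
  fix x assume "x \<in> space (leb d (half_space d))"
  then have x: "x \<in> half_space d" by (rule space_leb_half[OF d])
  show "sym \<sigma> f x * h x = f x * ext d \<sigma> h x + f (reflect x) * ext d \<sigma> h (reflect x)"
    unfolding ext_half[OF x] ext_reflect[OF x d] sym_def by (simp add: algebra_simps)
qed

lemma sym_ext_inner:
  assumes d: "d \<ge> 1" and f: "f \<in> L2 (lebesgue_Rd d)" and h: "h \<in> L2 (leb d (half_space d))" and s: "cnj \<sigma> = \<sigma>"
  shows "L2_inner (leb d (half_space d)) (sym \<sigma> f) h = L2_inner (lebesgue_Rd d) f (ext d \<sigma> h)"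
proof -
  have "(\<lambda>x. cnj (ext d \<sigma> h x)) = ext d \<sigma> (\<lambda>x. cnj (h x))"
    by (simp add: ext_def sym_def s fun_eq_iff indicator_def)
  then show ?thesis
    using sym_ext_adjoint[OF d f L2_cnj[OF h], of \<sigma>] unfolding L2_inner_def by metis
qed

lemma cmod_sym_le:
  assumes "cmod \<sigma> = 1"
  shows "(cmod (sym \<sigma> f x))\<^sup>2 \<le> (cmod (f x))\<^sup>2 + (cmod (f (reflect x)))\<^sup>2"
proof -
  have "cmod (f x + \<sigma> * f (reflect x)) \<le> cmod (f x) + cmod (f (reflect x))"
    using norm_triangle_ineq[of "f x" "\<sigma> * f (reflect x)"] assms by (simp add: norm_mult)
  then have "(cmod (f x + \<sigma> * f (reflect x)))\<^sup>2 \<le> (cmod (f x) + cmod (f (reflect x)))\<^sup>2" by (intro power_mono) auto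
  also have "\<dots> \<le> 2 * ((cmod (f x))\<^sup>2 + (cmod (f (reflect x)))\<^sup>2)"
    using sum_squares_bound[of "cmod (f x)" "cmod (f (reflect x))"] by (simp add: power2_sum)
  finally show ?thesis by (simp add: sym_def norm_mult norm_divide power_divide)
qed

lemma sym_norm_le:
  assumes d: "d \<ge> 1" and f: "f \<in> L2 (lebesgue_Rd d)" and s: "cmod \<sigma> = 1"
  shows "L2_norm (leb d (half_space d)) (sym \<sigma> f) \<le> L2_norm (lebesgue_Rd d) f"
  unfolding L2_norm_def integral_fold(2)[OF d L2D(2)[OF f]]
  by (intro real_sqrt_le_mono integral_mono L2D(2)[OF sym_L2[OF d f]] integral_fold(1)[OF d L2D(2)[OF f]] cmod_sym_le s)

lemma ext_norm:
  assumes d: "d \<ge> 1" and h: "h \<in> L2 (leb d (half_space d))" and s: "cmod \<sigma> = 1"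
  shows "L2_norm (lebesgue_Rd d) (ext d \<sigma> h) = L2_norm (leb d (half_space d)) h"
proof -
  have "(LINT x|leb d (half_space d). (cmod (ext d \<sigma> h x))\<^sup>2 + (cmod (ext d \<sigma> h (reflect x)))\<^sup>2) =
    (LINT x|leb d (half_space d). (cmod (h x))\<^sup>2)"
  proof (rule Bochner_Integration.integral_cong[OF refl])
    fix x assume "x \<in> space (leb d (half_space d))"
    then have x: "x \<in> half_space d" by (rule space_leb_half[OF d])
    show "(cmod (ext d \<sigma> h x))\<^sup>2 + (cmod (ext d \<sigma> h (reflect x)))\<^sup>2 = (cmod (h x))\<^sup>2"
      unfolding ext_half[OF x] ext_reflect[OF x d] using s
      by (simp add: norm_mult norm_divide power_mult_distrib power_divide)
  qed
  then show ?thesis unfolding L2_norm_def integral_fold(2)[OF d L2D(2)[OF ext_L2[OF d h]]] by simp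
qed

lemma ext_diff: "ext d \<sigma> (\<lambda>x. f x - g x) x = ext d \<sigma> f x - ext d \<sigma> g x"
  by (simp add: ext_def sym_def algebra_simps)

subsection \<open>Cutting off near the boundary of the half-space\<close>

lemma L2_norm_dominated:
  assumes f: "\<And>n. f n \<in> borel_measurable M" and w: "integrable M (\<lambda>x. (w x)\<^sup>2)"
    and le: "\<And>n x. x \<in> space M \<Longrightarrow> cmod (f n x) \<le> w x"
    and lim: "\<And>x. x \<in> space M \<Longrightarrow> (\<lambda>n. f n x) \<longlonglongrightarrow> 0"
  shows "(\<lambda>n. L2_norm M (f n)) \<longlonglongrightarrow> 0"
proof -
  have "(\<lambda>n. LINT x|M. (cmod (f n x))\<^sup>2) \<longlonglongrightarrow> (LINT x|M. 0)"
  proof (rule integral_dominated_convergence[OF _ _ w])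
    show "(\<lambda>x. (cmod (f n x))\<^sup>2) \<in> borel_measurable M" for n using f[of n] by measurable
    show "AE x in M. (\<lambda>n. (cmod (f n x))\<^sup>2) \<longlonglongrightarrow> 0"
    proof (rule AE_I2)
      fix x assume "x \<in> space M"
      from tendsto_power[OF tendsto_norm[OF lim[OF this]], of 2] show "(\<lambda>n. (cmod (f n x))\<^sup>2) \<longlonglongrightarrow> 0" by simp
    qed
    show "AE x in M. norm ((cmod (f n x))\<^sup>2) \<le> (w x)\<^sup>2" for n
      by (rule AE_I2) (simp add: power_mono le)
  qed simp
  from tendsto_real_sqrt[OF this] show ?thesis by (simp add: L2_norm_def)
qed

text \<open>The derivative of \<open>eta 1\<close>.\<close>

definition eta' :: "real \<Rightarrow> real" where
  "eta' = eta ([:0, 0, 1:] * (1 - pderiv 1))"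

lemma eta'_eq: "t > 0 \<Longrightarrow> eta' t = (1 / t)\<^sup>2 * exp (- (1 / t))" and eta'_nonpos: "t \<le> 0 \<Longrightarrow> eta' t = 0"
  by (auto simp: eta'_def eta_def pderiv_1 power2_eq_square)

text \<open>With \<open>u = 1 / y\<close> the weighted derivative is
  \<open>(u + u\<^sup>2) * exp (- u)\<close>. The bound 2, from the quadratic Taylor bound of
  \<open>exp u\<close>, serves as majorant; the second bound gives the pointwise limit 0 for large
  \<open>y\<close>.\<close>

lemma eta'_weighted:
  assumes y: "y > 0"
  shows "(y + 1) * eta' y \<le> 2" "(y + 1) * eta' y \<le> (1 / y)\<^sup>2 + 1 / y" "0 \<le> (y + 1) * eta' y"
proof -
  define u where "u = 1 / y"
  have u: "u > 0" using y by (simp add: u_def)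
  have eq: "(y + 1) * eta' y = (u + u\<^sup>2) * exp (- u)"
    using y by (simp add: eta'_eq u_def power2_eq_square field_simps)
  have "1 + u + u\<^sup>2 / 2 \<le> exp u" using exp_lower_Taylor_quadratic[of u] u by simp
  then have "u + u\<^sup>2 \<le> 2 * exp u" using u by (simp add: field_simps)
  then have "(u + u\<^sup>2) * exp (- u) \<le> 2 * exp u * exp (- u)" by (intro mult_right_mono) auto
  also have "\<dots> = 2" by (simp add: exp_minus)
  finally show "(y + 1) * eta' y \<le> 2" unfolding eq .
  have "(u + u\<^sup>2) * exp (- u) \<le> (u + u\<^sup>2) * 1" using u by (intro mult_left_mono) auto
  then show "(y + 1) * eta' y \<le> (1 / y)\<^sup>2 + 1 / y" unfolding eq by (simp add: u_def)
  show "0 \<le> (y + 1) * eta' y" unfolding eq using u by simp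
qed

text \<open>Vanishes for \<open>x 0 \<le> 1 / Suc k\<close>. It never becomes identically 1, but
  tends to 1 at each point of the half-space, as \<open>eta 1\<close> tends to 1 at
  infinity.\<close>

definition cutoff :: "nat \<Rightarrow> point \<Rightarrow> complex" where
  "cutoff k x = of_real (eta 1 (real (Suc k) * x 0 + - 1))"

lemma smooth_cutoff: "smooth d (cutoff k)"
  unfolding cutoff_def[abs_def] by (rule smooth_eta)

lemma cutoff_bounds: "cmod (cutoff k x) \<le> 1" "cmod (cutoff k x - 1) \<le> 1"
proof -
  define e where "e = eta 1 (real (Suc k) * x 0 + - 1)"
  have e: "0 \<le> e" "e \<le> 1" unfolding e_def by (rule eta_1_bounds)+
  have "cutoff k x = of_real e" by (simp add: cutoff_def e_def)
  moreover from this have "cutoff k x - 1 = of_real (e - 1)" by simp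
  ultimately show "cmod (cutoff k x) \<le> 1" "cmod (cutoff k x - 1) \<le> 1"
    using e by (simp_all only: norm_of_real)
qed

lemma cutoff_arg_filterlim:
  assumes "x > 0"
  shows "filterlim (\<lambda>k. real (Suc k) * x + - 1) at_top sequentially"
proof -
  have "filterlim (\<lambda>k. x * real (Suc k)) at_top sequentially"
    by (rule filterlim_tendsto_pos_mult_at_top[OF tendsto_const assms])
      (rule filterlim_compose[OF filterlim_real_sequentially filterlim_Suc])
  from filterlim_tendsto_add_at_top[OF tendsto_const this, of "-1"] show ?thesis
    by (simp add: mult.commute add.commute)
qed

lemma cutoff_tendsto: "x 0 > 0 \<Longrightarrow> (\<lambda>k. cutoff k x) \<longlonglongrightarrow> 1"
proof -
  assume x: "x 0 > 0"
  have "((\<lambda>y. exp (- inverse y)) \<longlongrightarrow> exp (- 0)) (at_top :: real filter)"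
    by (intro tendsto_intros tendsto_inverse_0_at_top filterlim_ident)
  then have "((\<lambda>y. exp (- inverse y)) \<longlongrightarrow> 1) (at_top :: real filter)" by simp
  moreover have "\<forall>\<^sub>F y in at_top. exp (- inverse y) = eta 1 y"
    using eventually_gt_at_top[of 0] by eventually_elim (simp add: eta_def inverse_eq_divide)
  ultimately have "(eta 1 \<longlongrightarrow> 1) at_top" by (rule Lim_transform_eventually)
  from filterlim_compose[OF this cutoff_arg_filterlim[OF x]]
  show ?thesis unfolding cutoff_def using tendsto_of_real[of _ 1, where 'a = complex] by fastforce
qed

lemma partial_cutoff:
  "i < d \<Longrightarrow> x \<in> Rd d \<Longrightarrow> partial i (cutoff k) x = of_real (if i = 0 then real (Suc k) * eta' (real (Suc k) * x 0 + - 1) else 0)"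
  unfolding cutoff_def[abs_def] eta'_def by (rule partial_eta)

lemma cutoff_test:
  assumes t: "\<psi> \<in> test_functions d (Rd d)"
  shows "(\<lambda>x. cutoff k x * \<psi> x) \<in> test_functions d (half_space d)"
proof -
  obtain C where C: "compact C" "C \<subseteq> Rd d" "\<And>x. x \<in> Rd d - C \<Longrightarrow> \<psi> x = 0"
    using t by (auto simp: test_functions_def)
  let ?D = "C \<inter> {x. 1 / real (Suc k) \<le> x 0}"
  show ?thesis
  proof (rule test_functionsI[OF smooth_mult[OF smooth_cutoff test_smooth[OF t]]])
    show "compact ?D"
      by (intro compact_Int_closed C(1) closed_Collect_le continuous_on_const continuous_on_product_coordinates)
    show "?D \<subseteq> half_space d"
    proof
      fix x assume x: "x \<in> ?D"
      have "0 < 1 / real (Suc k)" by simp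
      also have "\<dots> \<le> x 0" using x by simp
      finally show "x \<in> half_space d" using x C(2) by (auto simp: half_space_def)
    qed
    fix x assume x: "x \<in> Rd d" "x \<notin> ?D"
    show "cutoff k x * \<psi> x = 0"
    proof (cases "x \<in> C")
      case True
      then have "real (Suc k) * x 0 \<le> 1" using x(2) by (simp add: field_simps not_le less_imp_le)
      then have "cutoff k x = 0" using eta_1_bounds(3) by (simp add: cutoff_def)
      then show ?thesis by simp
    qed (use C(3) x(1) in simp)
  qed
qed

text \<open>Mean value inequality on the segment from the hyperplane to \<open>x\<close> in
  direction 0, where the partial derivative is bounded.\<close>

lemma test_vanishing_linear_bound:
  assumes t: "\<psi> \<in> test_functions d (Rd d)" and d: "d \<ge> 1" and v: "\<And>x. x \<in> Rd d \<Longrightarrow> x 0 = 0 \<Longrightarrow> \<psi> x = 0"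
  shows "\<exists>C\<ge>0. \<forall>x\<in>half_space d. cmod (\<psi> x) \<le> C * x 0"
proof -
  have d0: "0 < d" using d by simp
  obtain C where C: "\<forall>x\<in>Rd d. cmod (partial 0 \<psi> x) \<le> C" using test_bounded[OF test_partial[OF t d0] order_refl] ..
  have "cmod (\<psi> x) \<le> \<bar>C\<bar> * x 0" if x: "x \<in> half_space d" for x
  proof -
    have xR: "x \<in> Rd d" "x 0 > 0" using x by (auto simp: half_space_def)
    let ?f = "\<lambda>s. \<psi> (x(0 := s))"
    have "norm (?f (x 0) - ?f 0) \<le> \<bar>C\<bar> * norm (x 0 - 0)"
    proof (rule differentiable_bound[where f' = "\<lambda>s h. h *\<^sub>R partial 0 \<psi> (x(0 := s))"])
      show "convex {0 .. x 0}" by simp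
      fix s assume "s \<in> {0 .. x 0}"
      show "(?f has_derivative (\<lambda>h. h *\<^sub>R partial 0 \<psi> (x(0 := s)))) (at s within {0 .. x 0})"
        using coord_diffD'[OF smooth_coord_diff[OF test_smooth[OF t]] d0 xR(1), of s]
        by (auto simp: has_vector_derivative_def intro: has_derivative_at_withinI)
      have "cmod (partial 0 \<psi> (x(0 := s))) \<le> \<bar>C\<bar>"
        using C Rd_upd[OF xR(1) d0, of s] by (meson abs_ge_self order_trans)
      then show "onorm (\<lambda>h. h *\<^sub>R partial 0 \<psi> (x(0 := s))) \<le> \<bar>C\<bar>"
        by (intro onorm_bound) (auto simp: mult.commute[of "\<bar>C\<bar>"] intro!: mult_left_mono)
    qed (use xR in auto)
    moreover have "?f 0 = 0" using v[of "x(0 := 0)"] xR(1) d0 by simp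
    ultimately show ?thesis using xR(2) by simp
  qed
  then show ?thesis by (intro exI[of _ "\<bar>C\<bar>"]) auto
qed

lemma cutoff_limit:
  assumes t: "\<psi> \<in> test_functions d (Rd d)" and d: "d \<ge> 1"
  shows "(\<lambda>k. L2_norm (leb d (half_space d)) (\<lambda>x. cutoff k x * \<psi> x - \<psi> x)) \<longlonglongrightarrow> 0"
proof (rule L2_norm_dominated)
  show "(\<lambda>x. cutoff k x * \<psi> x - \<psi> x) \<in> borel_measurable (leb d (half_space d))" for k
    by (intro borel_measurable_diff borel_measurable_times leb_measurable borel_measurable_lborel_Rd smooth_continuous smooth_cutoff test_smooth[OF t])
  show "integrable (leb d (half_space d)) (\<lambda>x. (cmod (\<psi> x))\<^sup>2)"
    by (rule L2D(2)[OF test_L2[OF t order_refl half_space_sets[OF d]]])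
  fix x assume "x \<in> space (leb d (half_space d))"
  from space_leb_half[OF d this] have x: "x 0 > 0" by (simp add: half_space_def)
  show "cmod (cutoff k x * \<psi> x - \<psi> x) \<le> cmod (\<psi> x)" for k
  proof -
    have "cmod (cutoff k x * \<psi> x - \<psi> x) = cmod (cutoff k x - 1) * cmod (\<psi> x)"
      by (simp add: left_diff_distrib flip: norm_mult)
    also have "\<dots> \<le> 1 * cmod (\<psi> x)" by (intro mult_right_mono cutoff_bounds) auto
    finally show ?thesis by simp
  qed
  have "(\<lambda>k. cutoff k x * \<psi> x - \<psi> x) \<longlonglongrightarrow> 1 * \<psi> x - \<psi> x"
    by (intro tendsto_intros cutoff_tendsto x)
  then show "(\<lambda>k. cutoff k x * \<psi> x - \<psi> x) \<longlonglongrightarrow> 0" by simp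
qed

text \<open>If \<open>\<psi>\<close> vanishes on the boundary then \<open>\<bar>\<psi>\<bar> \<le> C x\<^sub>0\<close>, which compensates the factor \<open>k\<close>
  in the normal derivative of the cutoff.\<close>

lemma cutoff_partial_limit:
  assumes t: "\<psi> \<in> test_functions d (Rd d)" and d: "d \<ge> 1" and i: "i < d"
    and v: "i = 0 \<Longrightarrow> (\<And>x. x \<in> Rd d \<Longrightarrow> x 0 = 0 \<Longrightarrow> \<psi> x = 0)"
  shows "(\<lambda>k. L2_norm (leb d (half_space d)) (\<lambda>x. partial i (\<lambda>x. cutoff k x * \<psi> x) x - partial i \<psi> x)) \<longlonglongrightarrow> 0"
proof -
  let ?H = "leb d (half_space d)"
  have p: "partial i (\<lambda>x. cutoff k x * \<psi> x) x = cutoff k x * partial i \<psi> x + partial i (cutoff k) x * \<psi> x"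
    if "x \<in> Rd d" for x k
    by (rule partialI) (rule partial_mult[OF smooth_coord_diff[OF smooth_cutoff] smooth_coord_diff[OF test_smooth[OF t]] i that])
  have ti: "partial i \<psi> \<in> test_functions d (Rd d)" by (rule test_partial[OF t i])
  have xH: "x \<in> Rd d" "x 0 > 0" if "x \<in> space ?H" for x
    using space_leb_half[OF d that] by (simp_all add: half_space_def)
  define r where "r k x = partial i (cutoff k) x * \<psi> x" for k x
  have rL: "r k \<in> L2 ?H" for k
  proof -
    have "(\<lambda>x. partial i (cutoff k) x * \<psi> x) \<in> test_functions d (Rd d)"
      by (rule test_mult[OF t smooth_partial[OF smooth_cutoff i]])
    then show ?thesis unfolding r_def by (rule test_L2[OF _ order_refl half_space_sets[OF d]])
  qed
  have cL: "(\<lambda>x. cutoff k x * partial i \<psi> x - partial i \<psi> x) \<in> L2 ?H" for k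
    by (rule L2_diff[OF test_L2[OF test_mult[OF ti smooth_cutoff] order_refl half_space_sets[OF d]]
      test_L2[OF ti order_refl half_space_sets[OF d]]])
  have r_lim: "(\<lambda>k. L2_norm ?H (r k)) \<longlonglongrightarrow> 0"
  proof (cases "i = 0")
    case False
    have "L2_norm ?H (r k) = 0" for k
      unfolding L2_norm_eq_0_iff[OF rL] by (rule AE_I2) (simp add: r_def partial_cutoff[OF i xH(1)] False)
    then show ?thesis by simp
  next
    case True
    obtain C where C: "C \<ge> 0" "\<forall>x\<in>half_space d. cmod (\<psi> x) \<le> C * x 0"
      using test_vanishing_linear_bound[OF t d v[OF True]] by blast
    obtain B where B: "\<forall>x\<in>Rd d. \<psi> x \<noteq> 0 \<longrightarrow> (\<forall>i<d. \<bar>x i\<bar> < B)" using test_support_bounded[OF t] by blast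
    \<comment> \<open>Since \<open>y + 1\<close> is \<open>real (Suc k) * x 0\<close>, the linear
      bound on \<open>\<psi>\<close> turns the large factor \<open>Suc k\<close> into the weight of
      \<open>eta'_weighted\<close>.\<close>
    have key: "cmod (r k x) \<le> C * ((y + 1) * eta' y) \<and> (y \<le> 0 \<longrightarrow> r k x = 0)"
      if x: "x \<in> half_space d" and y: "y = real (Suc k) * x 0 + - 1" for k x y
    proof -
      have xR: "x \<in> Rd d" using x by (simp add: half_space_def)
      have eq: "r k x = of_real (real (Suc k) * eta' y) * \<psi> x"
        unfolding r_def partial_cutoff[OF i xR] y using True by simp
      have e0: "eta' y \<ge> 0" using eta'_eq[of y] eta'_nonpos[of y] by (cases "y > 0") auto
      have "cmod (r k x) = real (Suc k) * eta' y * cmod (\<psi> x)" unfolding eq norm_mult[of _ "\<psi> x"] norm_of_real using e0 by (simp add: abs_mult)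
      also have "\<dots> \<le> real (Suc k) * eta' y * (C * x 0)" using C(2) x e0 by (intro mult_left_mono) auto
      also have "\<dots> = C * ((y + 1) * eta' y)" unfolding y by (simp add: algebra_simps)
      finally show ?thesis unfolding eq using eta'_nonpos[of y] by simp
    qed
    show ?thesis
    proof (rule L2_norm_dominated)
      show "r k \<in> borel_measurable ?H" for k by (rule L2D(1)[OF rL])
      have "integrable (lborel_Rd d) (\<lambda>x. (C * 2 * indicator (cube d B) x)\<^sup>2 :: real)"
      proof -
        have "(C * 2 * indicator (cube d B) x)\<^sup>2 = (C * 2)\<^sup>2 * indicator (cube d B) x" for x
          by (simp add: indicator_def)
        moreover have "integrable (lborel_Rd d) (\<lambda>x. (C * 2)\<^sup>2 * indicator (cube d B) x :: real)"
          using cube_emeasure[of d B] cube_sets[of d B] by (intro integrable_mult_right integrable_real_indicator) auto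
        ultimately show ?thesis by simp
      qed
      then have "integrable (lebesgue_Rd d) (\<lambda>x. (C * 2 * indicator (cube d B) x)\<^sup>2 :: real)"
        unfolding lebesgue_Rd_def by (subst integrable_completion) auto
      then show "integrable ?H (\<lambda>x. (C * 2 * indicator (cube d B) x)\<^sup>2 :: real)"
        by (rule integrable_leb[OF _ half_space_sets[OF d]])
      fix x assume x: "x \<in> space ?H"
      have xh: "x \<in> half_space d" by (rule space_leb_half[OF d x])
      show "cmod (r k x) \<le> C * 2 * indicator (cube d B) x" for k
      proof (cases "\<psi> x = 0")
        case False
        then have "\<forall>i<d. \<bar>x i\<bar> < B" using B xH(1)[OF x] by blast
        then have c: "x \<in> cube d B" using xH(1)[OF x]
          by (auto simp: cube_def Rd_def PiE_iff abs_less_iff less_imp_le minus_le_iff)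
        define y where "y = real (Suc k) * x 0 + - 1"
        have "cmod (r k x) \<le> C * 2"
        proof (cases "y > 0")
          case True
          have "C * ((y + 1) * eta' y) \<le> C * 2" using eta'_weighted(1)[OF True] C(1) by (rule mult_left_mono)
          then show ?thesis using key[OF xh y_def] by linarith
        next
          case False
          then show ?thesis using key[OF xh y_def] C(1) by simp
        qed
        then show ?thesis using c by simp
      qed (simp add: r_def C)
      show "(\<lambda>k. r k x) \<longlonglongrightarrow> 0"
      proof (rule Lim_null_comparison)
        let ?y = "\<lambda>k. real (Suc k) * x 0 + - 1"
        have lim: "filterlim ?y at_top sequentially" by (rule cutoff_arg_filterlim[OF xH(2)[OF x]])
        have inv: "(\<lambda>k. 1 / ?y k) \<longlonglongrightarrow> 0"
          using filterlim_compose[OF tendsto_inverse_0_at_top[OF filterlim_ident] lim] by (simp add: inverse_eq_divide)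
        have "(\<lambda>k. C * ((1 / ?y k)\<^sup>2 + 1 / ?y k)) \<longlonglongrightarrow> C * (0\<^sup>2 + 0)"
          by (intro tendsto_intros inv)
        then show "(\<lambda>k. C * ((1 / ?y k)\<^sup>2 + 1 / ?y k)) \<longlonglongrightarrow> 0" by simp
        have "\<forall>\<^sub>F k in sequentially. ?y k > 0"
          using lim unfolding filterlim_at_top_dense by blast
        then show "\<forall>\<^sub>F k in sequentially. norm (r k x) \<le> C * ((1 / ?y k)\<^sup>2 + 1 / ?y k)"
        proof eventually_elim
          case (elim k)
          have "C * ((?y k + 1) * eta' (?y k)) \<le> C * ((1 / ?y k)\<^sup>2 + 1 / ?y k)"
            using eta'_weighted(2)[OF elim] C(1) by (rule mult_left_mono)
          then show ?case using key[OF xh refl, of k] by linarith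
        qed
      qed
    qed
  qed
  have "L2_norm ?H (\<lambda>x. partial i (\<lambda>x. cutoff k x * \<psi> x) x - partial i \<psi> x) \<le>
      L2_norm ?H (\<lambda>x. cutoff k x * partial i \<psi> x - partial i \<psi> x) + L2_norm ?H (r k)" for k
  proof -
    have "L2_norm ?H (\<lambda>x. partial i (\<lambda>x. cutoff k x * \<psi> x) x - partial i \<psi> x) =
      L2_norm ?H (\<lambda>x. (cutoff k x * partial i \<psi> x - partial i \<psi> x) + r k x)"
      unfolding L2_norm_def
      by (intro arg_cong[where f = sqrt] Bochner_Integration.integral_cong refl) (simp add: p xH(1) r_def diff_add_eq)
    then show ?thesis using L2_norm_triangle[OF cL rL, of k k] by simp
  qed
  then have le: "norm (L2_norm ?H (\<lambda>x. partial i (\<lambda>x. cutoff k x * \<psi> x) x - partial i \<psi> x)) \<le>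
      L2_norm ?H (\<lambda>x. cutoff k x * partial i \<psi> x - partial i \<psi> x) + L2_norm ?H (r k)" for k
    by simp
  show ?thesis
    by (rule Lim_null_comparison[OF always_eventually[OF allI[OF le]]])
      (use tendsto_add[OF cutoff_limit[OF ti d] r_lim] in simp)
qed

subsection \<open>Laplacians and reflection\<close>

definition parity :: "boundary_condition \<Rightarrow> complex" where
  "parity b = (case b of Dirichlet \<Rightarrow> - 1 | Neumann \<Rightarrow> 1)"

lemma parity [simp]: "(parity b)\<^sup>2 = 1" "cmod (parity b) = 1" "cnj (parity b) = parity b"
  by (cases b; simp add: parity_def)+

text \<open>The partial derivative in direction 0 exchanges even and odd functions; the tangential
  ones preserve parity.\<close>

definition flip :: "nat \<Rightarrow> complex \<Rightarrow> complex" where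
  "flip i \<sigma> = (if i = 0 then - \<sigma> else \<sigma>)"

lemma flip_parity [simp]: "(flip i (parity b))\<^sup>2 = 1" "cmod (flip i (parity b)) = 1" "cnj (flip i (parity b)) = flip i (parity b)"
  by (auto simp: flip_def)

lemma flip_flip [simp]: "flip i (flip i \<sigma>) = \<sigma>"
  by (simp add: flip_def)

context
  fixes d :: nat assumes d: "d \<ge> 1"
begin

interpretation R: domain d "Rd d" by (rule domain_Rd[OF d])
interpretation H: domain d "half_space d" by (rule domain_half_space[OF d])

lemma half_Rd: "half_space d \<subseteq> Rd d"
  by (auto simp: half_space_def)

lemma reflect_image_Rd: "reflect ` Rd d = Rd d"
proof (intro set_eqI iffI)
  fix x assume "x \<in> Rd d"
  then have "reflect x \<in> Rd d" using d by simp
  then have "reflect (reflect x) \<in> reflect ` Rd d" by (rule imageI)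
  then show "x \<in> reflect ` Rd d" by simp
qed (use d in auto)

lemma sym_test:
  assumes t: "\<phi> \<in> test_functions d (Rd d)"
  shows "sym \<sigma> \<phi> \<in> test_functions d (Rd d)"
proof -
  have "(\<lambda>x. \<phi> (reflect x)) \<in> test_functions d (Rd d)" using test_reflect[OF t d] by (simp add: reflect_image_Rd)
  from test_scale[OF test_add[OF t test_scale[OF this, of \<sigma>]], of "of_real (1 / sqrt 2)"]
  show ?thesis by (simp add: sym_def[abs_def])
qed

lemma partial_sym:
  assumes t: "\<phi> \<in> test_functions d (Rd d)" and i: "i < d" and x: "x \<in> Rd d"
  shows "partial i (sym \<sigma> \<phi>) x = sym (flip i \<sigma>) (partial i \<phi>) x"
proof (rule partialI)
  have cd: "coord_diff d \<phi>" by (rule smooth_coord_diff[OF test_smooth[OF t]])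
  let ?e = "(if i = 0 then - 1 else 1) :: complex"
  have "((\<lambda>t. of_real (1 / sqrt 2) * (\<phi> (x(i := t)) + \<sigma> * \<phi> (reflect (x(i := t))))) has_vector_derivative
    of_real (1 / sqrt 2) * (partial i \<phi> x + \<sigma> * (?e * partial i \<phi> (reflect x)))) (at (x i))"
    by (intro has_vector_derivative_mult_right has_vector_derivative_add coord_diffD[OF cd i x] reflect_coord_deriv[OF cd d i x])
  moreover have "of_real (1 / sqrt 2) * (partial i \<phi> x + \<sigma> * (?e * partial i \<phi> (reflect x))) = sym (flip i \<sigma>) (partial i \<phi>) x"
    by (simp add: sym_def flip_def)
  ultimately have "((\<lambda>t. of_real (1 / sqrt 2) * (\<phi> (x(i := t)) + \<sigma> * \<phi> (reflect (x(i := t))))) has_vector_derivative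
    sym (flip i \<sigma>) (partial i \<phi>) x) (at (x i))" by (simp only:)
  then show "((\<lambda>t. sym \<sigma> \<phi> (x(i := t))) has_vector_derivative sym (flip i \<sigma>) (partial i \<phi>) x) (at (x i))"
    by (simp only: sym_def)
qed

lemma ext_test_eq:
  assumes t: "\<phi> \<in> test_functions d (half_space d)" and x: "x \<in> Rd d"
  shows "ext d \<sigma> \<phi> x = sym \<sigma> \<phi> x"
  using test_outside[OF t x] test_outside[OF t, of "reflect x"] x d
  by (auto simp: ext_def sym_def indicator_def)

lemma test_half_Rd: "\<phi> \<in> test_functions d (half_space d) \<Longrightarrow> \<phi> \<in> test_functions d (Rd d)"
  by (rule test_mono[OF half_Rd])

lemma L2_Rd: "L2 (leb d (Rd d)) = L2 (lebesgue_Rd d)"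
  by (simp add: leb_Rd)

text \<open>By adjointness \<open>sym\<close> moves onto the test function. A test function of the
  half-space stays away from the hyperplane, so its reflected extension is a test function on the
  whole space, for either parity.\<close>

lemma sym_weak_partial:
  assumes F: "F \<in> L2 (lebesgue_Rd d)" and G: "has_weak_partial d (Rd d) i F G" and i: "i < d"
  shows "has_weak_partial d (half_space d) i (sym \<sigma> F) (sym (flip i \<sigma>) G)"
  unfolding has_weak_partial_def
proof (intro conjI ballI)
  have GL: "G \<in> L2 (lebesgue_Rd d)" using R.weakD(1)[OF G] by (simp add: L2_Rd)
  show "sym (flip i \<sigma>) G \<in> L2 (leb d (half_space d))" by (rule sym_L2[OF d GL])
  fix \<phi> assume t: "\<phi> \<in> test_functions d (half_space d)"
  have tR: "\<phi> \<in> test_functions d (Rd d)" by (rule test_half_Rd[OF t])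
  have "(LINT x|leb d (half_space d). sym \<sigma> F x * partial i \<phi> x) = (LINT x|lebesgue_Rd d. F x * ext d \<sigma> (partial i \<phi>) x)"
    by (rule sym_ext_adjoint[OF d F H.test_in_L2[OF test_partial[OF t i]]])
  also have "\<dots> = (LINT x|lebesgue_Rd d. F x * partial i (sym (flip i \<sigma>) \<phi>) x)"
    by (rule Bochner_Integration.integral_cong[OF refl])
      (simp add: ext_test_eq[OF test_partial[OF t i]] partial_sym[OF tR i])
  also have "\<dots> = - (LINT x|lebesgue_Rd d. G x * sym (flip i \<sigma>) \<phi> x)"
    using R.weakD(2)[OF G sym_test[OF tR]] by (simp add: leb_Rd)
  also have "(LINT x|lebesgue_Rd d. G x * sym (flip i \<sigma>) \<phi> x) = (LINT x|lebesgue_Rd d. G x * ext d (flip i \<sigma>) \<phi> x)"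
    by (rule Bochner_Integration.integral_cong[OF refl]) (simp add: ext_test_eq[OF t])
  also have "\<dots> = (LINT x|leb d (half_space d). sym (flip i \<sigma>) G x * \<phi> x)"
    by (rule sym_ext_adjoint[OF d GL H.test_in_L2[OF t], symmetric])
  finally show "(LINT x|leb d (half_space d). sym \<sigma> F x * partial i \<phi> x) =
    - (LINT x|leb d (half_space d). sym (flip i \<sigma>) G x * \<phi> x)" .
qed

lemma sym_H1:
  assumes F: "F \<in> H1 d (Rd d)"
  shows "sym \<sigma> F \<in> H1 d (half_space d)"
    and "i < d \<Longrightarrow> has_weak_partial d (half_space d) i (sym \<sigma> F) (sym (flip i \<sigma>) (weak_partial d (Rd d) i F))"
proof -
  have L: "F \<in> L2 (lebesgue_Rd d)" using R.H1_L2[OF F] by (simp add: L2_Rd)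
  show w: "has_weak_partial d (half_space d) i (sym \<sigma> F) (sym (flip i \<sigma>) (weak_partial d (Rd d) i F))" if "i < d" for i
    by (rule sym_weak_partial[OF L R.H1_weak[OF F that] that])
  show "sym \<sigma> F \<in> H1 d (half_space d)" by (rule H.H1I[OF sym_L2[OF d L] w])
qed

lemma restrict_test:
  assumes t: "\<psi> \<in> test_functions d (Rd d)" and i: "i < d"
  shows "\<psi> \<in> L2 (leb d (half_space d))" "has_weak_partial d (half_space d) i \<psi> (partial i \<psi>)"
proof -
  have LR: "\<psi> \<in> L2 (leb d (half_space d))" if "\<psi> \<in> test_functions d (Rd d)" for \<psi>
    by (rule test_L2[OF that order_refl half_space_sets[OF d]])
  show "\<psi> \<in> L2 (leb d (half_space d))" by (rule LR[OF t])
  have w: "has_weak_partial d (Rd d) i \<psi> (partial i \<psi>)" by (rule test_has_weak_partial[OF t Rd_sets i])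
  show "has_weak_partial d (half_space d) i \<psi> (partial i \<psi>)"
    unfolding has_weak_partial_def
  proof (intro conjI ballI LR test_partial t i)
    fix \<phi> assume p: "\<phi> \<in> test_functions d (half_space d)"
    show "(LINT x|leb d (half_space d). \<psi> x * partial i \<phi> x) = - (LINT x|leb d (half_space d). partial i \<psi> x * \<phi> x)"
      using R.weakD(2)[OF w test_half_Rd[OF p]] unfolding leb_Rd
        integral_test_leb[OF test_partial[OF p i] half_space_sets[OF d]] integral_test_leb[OF p half_space_sets[OF d]] .
  qed
qed

text \<open>The products with the cutoffs are admissible test functions and converge in the Sobolev
  norm because \<open>\<psi>\<close> vanishes on the hyperplane.\<close>

lemma odd_test_H1_0:
  assumes t: "\<psi> \<in> test_functions d (Rd d)" and v: "\<And>x. x \<in> Rd d \<Longrightarrow> x 0 = 0 \<Longrightarrow> \<psi> x = 0"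
  shows "\<psi> \<in> H1_0 d (half_space d)"
proof (rule H.H1_0_closed)
  have d0: "0 < d" using d by simp
  show H1: "\<psi> \<in> H1 d (half_space d)"
    by (rule H.H1I[OF restrict_test(1)[OF t d0] restrict_test(2)[OF t]])
  show "(\<lambda>x. cutoff k x * \<psi> x) \<in> H1_0 d (half_space d)" for k
    by (rule H.test_H1_0[OF cutoff_test[OF t]])
  show "(\<lambda>k. L2_norm (leb d (half_space d)) (\<lambda>x. cutoff k x * \<psi> x - \<psi> x)) \<longlonglongrightarrow> 0" by (rule cutoff_limit[OF t d])
  fix i assume i: "i < d"
  have "L2_norm (leb d (half_space d)) (\<lambda>x. weak_partial d (half_space d) i (\<lambda>x. cutoff k x * \<psi> x) x - weak_partial d (half_space d) i \<psi> x) =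
    L2_norm (leb d (half_space d)) (\<lambda>x. partial i (\<lambda>x. cutoff k x * \<psi> x) x - partial i \<psi> x)" for k
  proof (rule L2_norm_cong_AE)
    note c = cutoff_test[OF t, of k]
    show "AE x in leb d (half_space d). weak_partial d (half_space d) i (\<lambda>x. cutoff k x * \<psi> x) x - weak_partial d (half_space d) i \<psi> x =
        partial i (\<lambda>x. cutoff k x * \<psi> x) x - partial i \<psi> x"
      using H.weak_partial_AE[OF test_has_weak_partial[OF c half_space_sets[OF d] i]] H.weak_partial_AE[OF restrict_test(2)[OF t i]]
      by eventually_elim simp
    show "(\<lambda>x. weak_partial d (half_space d) i (\<lambda>x. cutoff k x * \<psi> x) x - weak_partial d (half_space d) i \<psi> x) \<in> L2 (leb d (half_space d))"
      by (rule L2_diff[OF H.weak_partial_L2[OF H.test_H1[OF c] i] H.weak_partial_L2[OF H1 i]])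
    show "(\<lambda>x. partial i (\<lambda>x. cutoff k x * \<psi> x) x - partial i \<psi> x) \<in> L2 (leb d (half_space d))"
      by (rule L2_diff[OF H.test_in_L2[OF test_partial[OF c i]] restrict_test(1)[OF test_partial[OF t i] i]])
  qed
  then show "(\<lambda>k. L2_norm (leb d (half_space d)) (\<lambda>x. weak_partial d (half_space d) i (\<lambda>x. cutoff k x * \<psi> x) x - weak_partial d (half_space d) i \<psi> x)) \<longlonglongrightarrow> 0"
    using cutoff_partial_limit[OF t d i v] by simp
qed

text \<open>For Neumann conditions only weak derivatives matter. For Dirichlet conditions the
  approximating test functions become odd, hence lie in \<open>H1_0\<close> of the half-space, and
  \<open>sym\<close> is a contraction for the functions and all their derivatives.\<close>

lemma sym_form_domain:
  assumes F: "F \<in> form_domain b d (Rd d)"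
  shows "sym (parity b) F \<in> form_domain b d (half_space d)"
proof (cases b)
  case Neumann
  then show ?thesis using F sym_H1(1) by (simp add: form_domain_def)
next
  case Dirichlet
  let ?\<sigma> = "parity b"
  have \<sigma>: "?\<sigma> = - 1" using Dirichlet by (simp add: parity_def)
  have "F \<in> H1_0 d (Rd d)" using F Dirichlet by (simp add: form_domain_def)
  then obtain \<phi> where FH: "F \<in> H1 d (Rd d)" and t: "\<And>n. \<phi> n \<in> test_functions d (Rd d)"
    and l1: "(\<lambda>n. L2_norm (leb d (Rd d)) (\<lambda>x. \<phi> n x - F x)) \<longlonglongrightarrow> 0"
    and l2: "\<And>i. i < d \<Longrightarrow> (\<lambda>n. L2_norm (leb d (Rd d)) (\<lambda>x. partial i (\<phi> n) x - weak_partial d (Rd d) i F x)) \<longlonglongrightarrow> 0"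
    by (auto simp: H1_0_def)
  have FL: "F \<in> L2 (lebesgue_Rd d)" using R.H1_L2[OF FH] by (simp add: L2_Rd)
  have tL: "\<phi> n \<in> L2 (lebesgue_Rd d)" for n using R.test_in_L2[OF t] by (simp add: L2_Rd)
  have le: "L2_norm (leb d (half_space d)) (\<lambda>x. sym \<sigma> u x - sym \<sigma> v x) \<le> L2_norm (leb d (Rd d)) (\<lambda>x. u x - v x)"
    if "u \<in> L2 (lebesgue_Rd d)" "v \<in> L2 (lebesgue_Rd d)" "cmod \<sigma> = 1" for u v \<sigma>
    using sym_norm_le[OF d L2_diff[OF that(1,2)] that(3)] by (simp add: sym_diff[abs_def] leb_Rd)
  have "sym ?\<sigma> F \<in> H1_0 d (half_space d)"
  proof (rule H.H1_0_closed[OF sym_H1(1)[OF FH]])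
    show "sym ?\<sigma> (\<phi> n) \<in> H1_0 d (half_space d)" for n
    proof (rule odd_test_H1_0[OF sym_test[OF t]])
      fix x :: point assume "x 0 = 0"
      then have "reflect x = x" by (auto simp: reflect_def)
      then show "sym ?\<sigma> (\<phi> n) x = 0" by (simp add: sym_def \<sigma>)
    qed
    show "(\<lambda>n. L2_norm (leb d (half_space d)) (\<lambda>x. sym ?\<sigma> (\<phi> n) x - sym ?\<sigma> F x)) \<longlonglongrightarrow> 0"
      by (rule Lim_null_comparison[OF _ l1]) (simp add: le[OF tL FL])
    fix i assume i: "i < d"
    let ?\<tau> = "flip i ?\<sigma>"
    have pL: "partial i (\<phi> n) \<in> L2 (lebesgue_Rd d)" for n using R.test_in_L2[OF test_partial[OF t i]] by (simp add: L2_Rd)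
    have wL: "weak_partial d (Rd d) i F \<in> L2 (lebesgue_Rd d)" using R.weak_partial_L2[OF FH i] by (simp add: L2_Rd)
    have "L2_norm (leb d (half_space d)) (\<lambda>x. weak_partial d (half_space d) i (sym ?\<sigma> (\<phi> n)) x - weak_partial d (half_space d) i (sym ?\<sigma> F) x) =
      L2_norm (leb d (half_space d)) (\<lambda>x. sym ?\<tau> (partial i (\<phi> n)) x - sym ?\<tau> (weak_partial d (Rd d) i F) x)" for n
    proof (rule L2_norm_cong_AE)
      note w = sym_weak_partial[OF tL test_has_weak_partial[OF t Rd_sets i] i, of ?\<sigma> n]
      show "AE x in leb d (half_space d). weak_partial d (half_space d) i (sym ?\<sigma> (\<phi> n)) x - weak_partial d (half_space d) i (sym ?\<sigma> F) x =
          sym ?\<tau> (partial i (\<phi> n)) x - sym ?\<tau> (weak_partial d (Rd d) i F) x"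
        using H.weak_partial_AE[OF w] H.weak_partial_AE[OF sym_H1(2)[OF FH i, of ?\<sigma>]] by eventually_elim simp
      show "(\<lambda>x. weak_partial d (half_space d) i (sym ?\<sigma> (\<phi> n)) x - weak_partial d (half_space d) i (sym ?\<sigma> F) x) \<in> L2 (leb d (half_space d))"
        by (rule L2_diff[OF H.weak_partial_L2[OF sym_H1(1)[OF R.test_H1[OF t]] i] H.weak_partial_L2[OF sym_H1(1)[OF FH] i]])
      show "(\<lambda>x. sym ?\<tau> (partial i (\<phi> n)) x - sym ?\<tau> (weak_partial d (Rd d) i F) x) \<in> L2 (leb d (half_space d))"
        by (rule L2_diff[OF sym_L2[OF d pL] sym_L2[OF d wL]])
    qed
    then show "(\<lambda>n. L2_norm (leb d (half_space d)) (\<lambda>x. weak_partial d (half_space d) i (sym ?\<sigma> (\<phi> n)) x - weak_partial d (half_space d) i (sym ?\<sigma> F) x)) \<longlonglongrightarrow> 0"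
      by (intro Lim_null_comparison[OF _ l2[OF i]]) (simp add: le[OF pL wL])
  qed
  then show ?thesis using Dirichlet by (simp add: form_domain_def)
qed

text \<open>Neumann: a test function of the whole space does not restrict to one of the half-space,
  so the weak derivative is tested with a cut-off symmetrised function and the cutoff is removed in
  the limit. Dirichlet: the approximants are extended along with \<open>h\<close>, and
  \<open>ext\<close> is isometric on them and on their derivatives.\<close>

lemma ext_H1:
  assumes h: "h \<in> form_domain b d (half_space d)"
  shows "ext d (parity b) h \<in> form_domain b d (Rd d)"
    and "i < d \<Longrightarrow> has_weak_partial d (Rd d) i (ext d (parity b) h) (ext d (flip i (parity b)) (weak_partial d (half_space d) i h))"
proof -
  let ?\<sigma> = "parity b"
  have hH: "h \<in> H1 d (half_space d)" by (rule H.form_domain_H1[OF h])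
  have hL: "h \<in> L2 (leb d (half_space d))" by (rule H.H1_L2[OF hH])
  have wL: "weak_partial d (half_space d) i h \<in> L2 (leb d (half_space d))" if "i < d" for i by (rule H.weak_partial_L2[OF hH that])
  have eL: "ext d ?\<sigma> h \<in> L2 (leb d (Rd d))" using ext_L2[OF d hL] by (simp add: L2_Rd)
  have both: "ext d ?\<sigma> h \<in> form_domain b d (Rd d) \<and>
    (\<forall>i<d. has_weak_partial d (Rd d) i (ext d ?\<sigma> h) (ext d (flip i ?\<sigma>) (weak_partial d (half_space d) i h)))"
  proof (cases b)
    case Neumann
    have \<sigma>: "?\<sigma> = 1" using Neumann by (simp add: parity_def)
    have w: "has_weak_partial d (Rd d) i (ext d ?\<sigma> h) (ext d (flip i ?\<sigma>) (weak_partial d (half_space d) i h))" if i: "i < d" for i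
      unfolding has_weak_partial_def
    proof (intro conjI ballI)
      let ?g = "weak_partial d (half_space d) i h" and ?\<tau> = "flip i ?\<sigma>"
      show "ext d ?\<tau> ?g \<in> L2 (leb d (Rd d))" using ext_L2[OF d wL[OF i]] by (simp add: L2_Rd)
      fix \<phi> assume t: "\<phi> \<in> test_functions d (Rd d)"
      have tL: "\<phi> \<in> L2 (lebesgue_Rd d)" "partial i \<phi> \<in> L2 (lebesgue_Rd d)"
        using R.test_in_L2[OF t] R.test_in_L2[OF test_partial[OF t i]] by (simp_all add: L2_Rd)
      let ?\<psi> = "sym ?\<tau> \<phi>"
      have p: "?\<psi> \<in> test_functions d (Rd d)" by (rule sym_test[OF t])
      \<comment> \<open>In direction 0 the parity \<open>?\<tau>\<close> is odd, so
        \<open>?\<psi>\<close> vanishes on the hyperplane as the cutoff limit for the normal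
        derivative demands. In the other directions \<open>?\<psi>\<close> is even and the cutoff
        has no derivative.\<close>
      have v: "?\<psi> x = 0" if "i = 0" "x \<in> Rd d" "x 0 = 0" for x
      proof -
        have "reflect x = x" using that by (auto simp: reflect_def)
        then show ?thesis using that by (simp add: sym_def \<sigma> flip_def)
      qed
      have lim1: "(\<lambda>k. LINT x|leb d (half_space d). partial i (\<lambda>x. cutoff k x * ?\<psi> x) x * h x) \<longlonglongrightarrow>
          (LINT x|leb d (half_space d). partial i ?\<psi> x * h x)"
        by (rule L2_integral_tendsto[OF H.test_in_L2[OF test_partial[OF cutoff_test[OF p] i]]
          restrict_test(1)[OF test_partial[OF p i] i] hL cutoff_partial_limit[OF p d i v]])
      have lim2: "(\<lambda>k. - (LINT x|leb d (half_space d). (cutoff k x * ?\<psi> x) * ?g x)) \<longlonglongrightarrow>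
          - (LINT x|leb d (half_space d). ?\<psi> x * ?g x)"
        by (intro tendsto_minus L2_integral_tendsto[OF H.test_in_L2[OF cutoff_test[OF p]] restrict_test(1)[OF p i] wL[OF i] cutoff_limit[OF p d]])
      have "(LINT x|leb d (half_space d). partial i (\<lambda>x. cutoff k x * ?\<psi> x) x * h x) =
          - (LINT x|leb d (half_space d). (cutoff k x * ?\<psi> x) * ?g x)" for k
        using H.weakD(2)[OF H.H1_weak[OF hH i] cutoff_test[OF p, of k]] by (simp add: mult.commute)
      with lim1 have "(\<lambda>k. - (LINT x|leb d (half_space d). (cutoff k x * ?\<psi> x) * ?g x)) \<longlonglongrightarrow>
          (LINT x|leb d (half_space d). partial i ?\<psi> x * h x)" by simp
      from LIMSEQ_unique[OF this lim2]
      have main: "(LINT x|leb d (half_space d). partial i ?\<psi> x * h x) = - (LINT x|leb d (half_space d). ?\<psi> x * ?g x)" .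
      have "(LINT x|lebesgue_Rd d. ext d ?\<sigma> h x * partial i \<phi> x) = (LINT x|leb d (half_space d). sym ?\<sigma> (partial i \<phi>) x * h x)"
        using sym_ext_adjoint[OF d tL(2) hL, of ?\<sigma>] by (simp add: mult.commute)
      also have "\<dots> = (LINT x|leb d (half_space d). partial i ?\<psi> x * h x)"
      proof (rule Bochner_Integration.integral_cong[OF refl])
        fix x assume "x \<in> space (leb d (half_space d))"
        then have "x \<in> Rd d" using space_leb_half[OF d] half_Rd by blast
        from partial_sym[OF t i this, of ?\<tau>]
        show "sym ?\<sigma> (partial i \<phi>) x * h x = partial i ?\<psi> x * h x" by simp
      qed
      also note main
      also have "(LINT x|leb d (half_space d). ?\<psi> x * ?g x) = (LINT x|lebesgue_Rd d. ext d ?\<tau> ?g x * \<phi> x)"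
        using sym_ext_adjoint[OF d tL(1) wL[OF i], of ?\<tau>] by (simp add: mult.commute)
      finally show "(LINT x|leb d (Rd d). ext d ?\<sigma> h x * partial i \<phi> x) = - (LINT x|leb d (Rd d). ext d ?\<tau> ?g x * \<phi> x)"
        by (simp add: leb_Rd)
    qed
    then have "ext d ?\<sigma> h \<in> H1 d (Rd d)" by (intro R.H1I[OF eL]) auto
    then show ?thesis using w Neumann by (simp add: form_domain_def)
  next
    case Dirichlet
    have "h \<in> H1_0 d (half_space d)" using h Dirichlet by (simp add: form_domain_def)
    then obtain \<phi> where t: "\<And>n. \<phi> n \<in> test_functions d (half_space d)"
      and l1: "(\<lambda>n. L2_norm (leb d (half_space d)) (\<lambda>x. \<phi> n x - h x)) \<longlonglongrightarrow> 0"
      and l2: "\<And>i. i < d \<Longrightarrow> (\<lambda>n. L2_norm (leb d (half_space d)) (\<lambda>x. partial i (\<phi> n) x - weak_partial d (half_space d) i h x)) \<longlonglongrightarrow> 0"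
      by (auto simp: H1_0_def)
    have tR: "\<phi> n \<in> test_functions d (Rd d)" for n by (rule test_half_Rd[OF t])
    have tL: "\<phi> n \<in> L2 (leb d (half_space d))" for n by (rule H.test_in_L2[OF t])
    let ?\<Phi> = "\<lambda>n. sym ?\<sigma> (\<phi> n)"
    have p: "?\<Phi> n \<in> test_functions d (Rd d)" for n by (rule sym_test[OF tR])
    have le: "L2_norm (leb d (Rd d)) (\<lambda>x. U x - ext d \<sigma> v x) = L2_norm (leb d (half_space d)) (\<lambda>x. u x - v x)"
      if "u \<in> L2 (leb d (half_space d))" "v \<in> L2 (leb d (half_space d))" "cmod \<sigma> = 1" "\<And>x. x \<in> Rd d \<Longrightarrow> U x = ext d \<sigma> u x" for u v U \<sigma>
    proof -
      have "L2_norm (leb d (Rd d)) (\<lambda>x. U x - ext d \<sigma> v x) = L2_norm (lebesgue_Rd d) (ext d \<sigma> (\<lambda>x. u x - v x))"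
        unfolding L2_norm_def leb_Rd
        by (intro arg_cong[where f = sqrt] Bochner_Integration.integral_cong refl) (simp add: that(4) ext_diff)
      then show ?thesis using ext_norm[OF d L2_diff[OF that(1,2)] that(3)] by simp
    qed
    have lim1: "(\<lambda>n. L2_norm (leb d (Rd d)) (\<lambda>x. ?\<Phi> n x - ext d ?\<sigma> h x)) \<longlonglongrightarrow> 0"
      using l1 le[OF tL hL, of ?\<sigma>] ext_test_eq[OF t] by simp
    have lim2: "(\<lambda>n. L2_norm (leb d (Rd d)) (\<lambda>x. partial i (?\<Phi> n) x - ext d (flip i ?\<sigma>) (weak_partial d (half_space d) i h) x)) \<longlonglongrightarrow> 0"
      if i: "i < d" for i
    proof -
      have "L2_norm (leb d (Rd d)) (\<lambda>x. partial i (?\<Phi> n) x - ext d (flip i ?\<sigma>) (weak_partial d (half_space d) i h) x) =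
        L2_norm (leb d (half_space d)) (\<lambda>x. partial i (\<phi> n) x - weak_partial d (half_space d) i h x)" for n
        by (rule le[OF H.test_in_L2[OF test_partial[OF t i]] wL[OF i]])
          (simp_all add: partial_sym[OF tR i] ext_test_eq[OF test_partial[OF t i]])
      then show ?thesis using l2[OF i] by simp
    qed
    have eL': "ext d (flip i ?\<sigma>) (weak_partial d (half_space d) i h) \<in> L2 (leb d (Rd d))" if "i < d" for i
      using ext_L2[OF d wL[OF that]] by (simp add: L2_Rd)
    have w: "has_weak_partial d (Rd d) i (ext d ?\<sigma> h) (ext d (flip i ?\<sigma>) (weak_partial d (half_space d) i h))" if i: "i < d" for i
      by (rule R.weak_limit[OF R.test_in_L2[OF p] eL eL'[OF i] i test_has_weak_partial[OF p Rd_sets i] lim1 lim2[OF i]])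
    have e1: "ext d ?\<sigma> h \<in> H1 d (Rd d)" by (rule R.H1I[OF eL w])
    have "ext d ?\<sigma> h \<in> H1_0 d (Rd d)"
      unfolding H1_0_def
    proof (intro CollectI conjI e1 exI[of _ ?\<Phi>] allI impI p lim1)
      fix i assume i: "i < d"
      have "L2_norm (leb d (Rd d)) (\<lambda>x. partial i (?\<Phi> n) x - weak_partial d (Rd d) i (ext d ?\<sigma> h) x) =
        L2_norm (leb d (Rd d)) (\<lambda>x. partial i (?\<Phi> n) x - ext d (flip i ?\<sigma>) (weak_partial d (half_space d) i h) x)" for n
      proof (rule L2_norm_cong_AE)
        show "AE x in leb d (Rd d). partial i (?\<Phi> n) x - weak_partial d (Rd d) i (ext d ?\<sigma> h) x =
          partial i (?\<Phi> n) x - ext d (flip i ?\<sigma>) (weak_partial d (half_space d) i h) x"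
          using R.weak_partial_AE[OF w[OF i]] by eventually_elim simp
      qed (intro L2_diff R.test_in_L2[OF test_partial[OF p i]] R.weak_partial_L2[OF e1 i] eL'[OF i])+
      then show "(\<lambda>n. L2_norm (leb d (Rd d)) (\<lambda>x. partial i (?\<Phi> n) x - weak_partial d (Rd d) i (ext d ?\<sigma> h) x)) \<longlonglongrightarrow> 0"
        using lim2[OF i] by simp
    qed
    then show ?thesis using w Dirichlet by (simp add: form_domain_def)
  qed
  then show "ext d ?\<sigma> h \<in> form_domain b d (Rd d)"
    "i < d \<Longrightarrow> has_weak_partial d (Rd d) i (ext d ?\<sigma> h) (ext d (flip i ?\<sigma>) (weak_partial d (half_space d) i h))" by auto
qed

text \<open>Each \<open>h\<close> in the form domain of the half-space is tested through its
  extension on the whole space: adjointness of \<open>sym\<close> and \<open>ext\<close>, with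
  flipped parity for the derivatives, identifies both the forms and the inner products.\<close>

theorem sym_laplacian:
  assumes FG: "(F, G) \<in> laplacian b d (Rd d)"
  shows "(sym (parity b) F, sym (parity b) G) \<in> laplacian b d (half_space d)"
proof -
  let ?\<sigma> = "parity b"
  have F: "F \<in> form_domain b d (Rd d)" and G: "G \<in> L2 (leb d (Rd d))"
    and eq: "\<And>h. h \<in> form_domain b d (Rd d) \<Longrightarrow> gradient_form d (Rd d) F h = - L2_inner (leb d (Rd d)) G h"
    using FG unfolding R.laplacian_iff by auto
  have GL: "G \<in> L2 (lebesgue_Rd d)" using G by (simp add: L2_Rd)
  note FH = R.form_domain_H1[OF F]
  have "gradient_form d (half_space d) (sym ?\<sigma> F) h = - L2_inner (leb d (half_space d)) (sym ?\<sigma> G) h"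
    if h: "h \<in> form_domain b d (half_space d)" for h
  proof -
    note hH = H.form_domain_H1[OF h]
    have "gradient_form d (half_space d) (sym ?\<sigma> F) h =
      (\<Sum>i<d. L2_inner (leb d (half_space d)) (sym (flip i ?\<sigma>) (weak_partial d (Rd d) i F)) (weak_partial d (half_space d) i h))"
      by (rule H.gradient_form_eq[OF sym_H1(1)[OF FH] hH sym_H1(2)[OF FH] H.H1_weak[OF hH]])
    also have "\<dots> = (\<Sum>i<d. L2_inner (leb d (Rd d)) (weak_partial d (Rd d) i F) (ext d (flip i ?\<sigma>) (weak_partial d (half_space d) i h)))"
    proof (rule sum.cong[OF refl])
      fix i assume "i \<in> {..<d}"
      then have i: "i < d" by simp
      have "weak_partial d (Rd d) i F \<in> L2 (lebesgue_Rd d)" using R.weak_partial_L2[OF FH i] by (simp add: L2_Rd)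
      from sym_ext_inner[OF d this H.weak_partial_L2[OF hH i] flip_parity(3)]
      show "L2_inner (leb d (half_space d)) (sym (flip i ?\<sigma>) (weak_partial d (Rd d) i F)) (weak_partial d (half_space d) i h) =
        L2_inner (leb d (Rd d)) (weak_partial d (Rd d) i F) (ext d (flip i ?\<sigma>) (weak_partial d (half_space d) i h))"
        by (simp add: leb_Rd)
    qed
    also have "\<dots> = gradient_form d (Rd d) F (ext d ?\<sigma> h)"
      by (rule R.gradient_form_eq[OF FH R.form_domain_H1[OF ext_H1(1)[OF h]] R.H1_weak[OF FH] ext_H1(2)[OF h], symmetric])
    also have "\<dots> = - L2_inner (leb d (Rd d)) G (ext d ?\<sigma> h)" by (rule eq[OF ext_H1(1)[OF h]])
    also have "L2_inner (leb d (Rd d)) G (ext d ?\<sigma> h) = L2_inner (leb d (half_space d)) (sym ?\<sigma> G) h"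
      using sym_ext_inner[OF d GL H.H1_L2[OF hH] parity(3)] by (simp add: leb_Rd)
    finally show ?thesis .
  qed
  then show ?thesis unfolding H.laplacian_iff using sym_form_domain[OF F] sym_L2[OF d GL] by blast
qed

theorem sym_heat_semigroup:
  assumes f: "f \<in> L2 (leb d (Rd d))" and t: "t \<ge> 0"
  shows "AE x in leb d (half_space d). sym (parity b) (heat_semigroup b d (Rd d) t f) x =
    heat_semigroup b d (half_space d) t (sym (parity b) f) x"
proof -
  let ?\<sigma> = "parity b"
  interpret P: m_dissipative "L2 (leb d (Rd d))" "rip (leb d (Rd d))" "laplacian b d (Rd d)" by (rule R.laplacian_m_dissipative)
  interpret Q: m_dissipative "L2 (leb d (half_space d))" "rip (leb d (half_space d))" "laplacian b d (half_space d)" by (rule H.laplacian_m_dissipative)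
  interpret I: intertwined "L2 (leb d (Rd d))" "rip (leb d (Rd d))" "laplacian b d (Rd d)"
    "L2 (leb d (half_space d))" "rip (leb d (half_space d))" "laplacian b d (half_space d)" "sym ?\<sigma>" 1
  proof
    fix f g assume f: "f \<in> L2 (leb d (Rd d))"
    then have fL: "f \<in> L2 (lebesgue_Rd d)" by (simp add: L2_Rd)
    show "sym ?\<sigma> f \<in> L2 (leb d (half_space d))" by (rule sym_L2[OF d fL])
    show "L2.nrm (leb d (half_space d)) (sym ?\<sigma> f) \<le> 1 * L2.nrm (leb d (Rd d)) f"
      using sym_norm_le[OF d fL parity(2)] by (simp add: L2_nrm leb_Rd)
    show "sym ?\<sigma> (c *\<^sub>R f + g) = c *\<^sub>R sym ?\<sigma> f + sym ?\<sigma> g" for c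
      by (simp add: fun_eq_iff sym_def scaleR_conv_of_real algebra_simps)
  next
    show "(sym ?\<sigma> f, sym ?\<sigma> g) \<in> laplacian b d (half_space d)" if "(f, g) \<in> laplacian b d (Rd d)" for f g
      by (rule sym_laplacian[OF that])
  qed
  note P = C0_semigroup_imp_c0[OF R.heat_semigroup(1)] R.heat_semigroup(2)[unfolded generator_eq_gen]
  note Q = C0_semigroup_imp_c0[OF H.heat_semigroup(1)] H.heat_semigroup(2)[unfolded generator_eq_gen]
  have "L2.nrm (leb d (half_space d)) (sym ?\<sigma> (heat_semigroup b d (Rd d) t f) - heat_semigroup b d (half_space d) t (sym ?\<sigma> f)) = 0"
    by (rule I.U_semigroup[OF P Q f t])
  then show ?thesis
    by (subst (asm) L2_nrm_eq_iff) (rule I.U_Y[OF L2.c0D(1)[OF P(1) t f]] L2.c0D(1)[OF Q(1) t I.U_Y[OF f]])+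
qed

end

subsection \<open>Contractions and square-integrable controls\<close>

text \<open>Linearity is an equality of functions, for arbitrary functions: simple integrals are
  pointwise finite sums of representatives, and \<open>U\<close> has to pass through them.\<close>

locale pointwise_contraction =
  fixes M :: "'a measure" and M' :: "'b measure" and U :: "('a \<Rightarrow> complex) \<Rightarrow> 'b \<Rightarrow> complex"
  assumes U_L2: "f \<in> L2 M \<Longrightarrow> U f \<in> L2 M'"
    and U_lincomb: "U (\<lambda>x. c * f x + g x) = (\<lambda>x. c * U f x + U g x)"
    and U_norm: "f \<in> L2 M \<Longrightarrow> L2_norm M' (U f) \<le> L2_norm M f"
begin

lemma U_0: "U (\<lambda>x. 0) = (\<lambda>x. 0)"
  using U_lincomb[of "-1" "\<lambda>x. 0" "\<lambda>x. 0"] by simp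

lemma U_diff: "U (\<lambda>x. f x - g x) = (\<lambda>x. U f x - U g x)"
  using U_lincomb[of "-1" g f] by simp

lemma U_sum: "finite A \<Longrightarrow> U (\<lambda>x. \<Sum>y\<in>A. c y * F y x) = (\<lambda>x. \<Sum>y\<in>A. c y * U (F y) x)"
  by (induction A rule: finite_induct) (simp_all add: U_0 U_lincomb)

lemma U_norm_diff:
  assumes "f \<in> L2 M" "g \<in> L2 M"
  shows "L2_norm M' (\<lambda>x. U f x - U g x) \<le> L2_norm M (\<lambda>x. f x - g x)"
  using U_norm[OF L2_diff[OF assms]] by (simp add: U_diff)

lemma U_simple: "L2_simple N M s \<Longrightarrow> L2_simple N M' (\<lambda>t. U (s t))"
  unfolding L2_simple_def using U_L2 simple_function_compose1[of N s U] by auto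

lemma U_strongly_measurable:
  assumes v: "L2_strongly_measurable N M v"
  shows "L2_strongly_measurable N M' (\<lambda>t. U (v t))"
proof -
  obtain s where vL: "v \<in> space N \<rightarrow> L2 M" and s: "\<And>n. L2_simple N M (s n)"
    and lim: "AE t in N. (\<lambda>n. L2_norm M (\<lambda>x. v t x - s n t x)) \<longlonglongrightarrow> 0"
    using v unfolding L2_strongly_measurable_def by blast
  have "AE t in N. (\<lambda>n. L2_norm M' (\<lambda>x. U (v t) x - U (s n t) x)) \<longlonglongrightarrow> 0"
    using lim AE_space
  proof eventually_elim
    case (elim t)
    have "v t \<in> L2 M" "s n t \<in> L2 M" for n using vL s[of n] elim(2) by (auto simp: L2_simple_def)
    then show ?case by (intro Lim_null_comparison[OF _ elim(1)]) (simp add: U_norm_diff)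
  qed
  moreover have "(\<lambda>t. U (v t)) \<in> space N \<rightarrow> L2 M'" using vL U_L2 by auto
  ultimately show ?thesis unfolding L2_strongly_measurable_def
    by (intro conjI exI[of _ "\<lambda>n t. U (s n t)"]) (simp_all add: U_simple[OF s])
qed

text \<open>\<open>U\<close> may identify different values of \<open>s\<close>. The level set of
  \<open>U\<close> composed with \<open>s\<close> at \<open>z\<close> is the disjoint union of the
  level sets of \<open>s\<close> over the fibre of \<open>z\<close>, and the sum is regrouped
  accordingly.\<close>

lemma U_simple_integral:
  assumes N: "finite_measure N" and s: "L2_simple N M s"
  shows "L2_simple_integral N (\<lambda>t. U (s t)) = U (L2_simple_integral N s)"
proof
  fix x
  interpret finite_measure N by (rule N)
  let ?A = "s ` space N"
  let ?m = "\<lambda>y. measure N (s -` {y} \<inter> space N)"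
  have sf: "simple_function N s" using s by (simp add: L2_simple_def)
  have fin: "finite ?A" using sf by (simp add: simple_function_def)
  have meas: "measure N ((\<lambda>t. U (s t)) -` {z} \<inter> space N) = (\<Sum>y\<in>{y\<in>?A. U y = z}. ?m y)" for z
  proof -
    have "(\<lambda>t. U (s t)) -` {z} \<inter> space N = (\<Union>y\<in>{y\<in>?A. U y = z}. s -` {y} \<inter> space N)" by auto
    also have "measure N \<dots> = (\<Sum>y\<in>{y\<in>?A. U y = z}. ?m y)"
    proof (rule finite_measure_finite_Union)
      show "(\<lambda>y. s -` {y} \<inter> space N) ` {y\<in>?A. U y = z} \<subseteq> sets N"
        using sf by (auto simp: simple_function_def)
    qed (use fin in \<open>auto simp: disjoint_family_on_def\<close>)
    finally show ?thesis .
  qed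
  have "L2_simple_integral N (\<lambda>t. U (s t)) x =
    (\<Sum>z\<in>U ` ?A. of_real (\<Sum>y\<in>{y\<in>?A. U y = z}. ?m y) * z x)"
    by (simp add: L2_simple_integral_def image_image meas)
  also have "\<dots> = (\<Sum>z\<in>U ` ?A. \<Sum>y\<in>{y\<in>?A. U y = z}. of_real (?m y) * U y x)"
    by (rule sum.cong[OF refl]) (simp add: sum_distrib_right)
  also have "\<dots> = (\<Sum>y\<in>?A. of_real (?m y) * U y x)" by (rule sum.image_gen[OF fin, symmetric])
  also have "\<dots> = U (L2_simple_integral N s) x"
    unfolding L2_simple_integral_def[abs_def] using U_sum[OF fin, of "\<lambda>y. of_real (?m y)" "\<lambda>y. y"] by simp
  finally show "L2_simple_integral N (\<lambda>t. U (s t)) x = U (L2_simple_integral N s) x" .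
qed

lemma L2_simple_integral_L2: "L2_simple N M s \<Longrightarrow> L2_simple_integral N s \<in> L2 M"
  unfolding L2_simple_integral_def[abs_def] by (intro L2_sum L2_scale) (auto simp: L2_simple_def)

lemma U_has_integral:
  assumes N: "finite_measure N" and w: "has_L2_integral N M w I"
  shows "has_L2_integral N M' (\<lambda>t. U (w t)) (U I)"
proof -
  have wm: "L2_strongly_measurable N M w" and I: "I \<in> L2 M" using w by (auto simp: has_L2_integral_def)
  obtain s where s: "\<And>n. L2_simple N M (s n)"
    and l1: "(\<lambda>n. \<integral>\<^sup>+ t. ennreal (L2_norm M (\<lambda>x. w t x - s n t x)) \<partial>N) \<longlonglongrightarrow> 0"
    and l2: "(\<lambda>n. L2_norm M (\<lambda>x. L2_simple_integral N (s n) x - I x)) \<longlonglongrightarrow> 0"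
    using w by (auto simp: has_L2_integral_def)
  have L: "w t \<in> L2 M" "s n t \<in> L2 M" if "t \<in> space N" for t n
    using wm s[of n] that by (auto simp: L2_strongly_measurable_def L2_simple_def)
  have "(\<lambda>n. \<integral>\<^sup>+ t. ennreal (L2_norm M' (\<lambda>x. U (w t) x - U (s n t) x)) \<partial>N) \<longlonglongrightarrow> 0"
  proof (rule tendsto_sandwich[OF _ _ tendsto_const l1])
    show "\<forall>\<^sub>F n in sequentially. (\<integral>\<^sup>+ t. ennreal (L2_norm M' (\<lambda>x. U (w t) x - U (s n t) x)) \<partial>N)
      \<le> (\<integral>\<^sup>+ t. ennreal (L2_norm M (\<lambda>x. w t x - s n t x)) \<partial>N)"
      by (intro always_eventually allI nn_integral_mono ennreal_leI U_norm_diff L)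
  qed simp
  moreover have "(\<lambda>n. L2_norm M' (\<lambda>x. L2_simple_integral N (\<lambda>t. U (s n t)) x - U I x)) \<longlonglongrightarrow> 0"
    unfolding U_simple_integral[OF N s]
    by (rule Lim_null_comparison[OF _ l2]) (simp add: U_norm_diff[OF L2_simple_integral_L2[OF s] I])
  ultimately show ?thesis
    unfolding has_L2_integral_def using U_strongly_measurable[OF wm] U_L2[OF I]
    by (intro conjI exI[of _ "\<lambda>n t. U (s n t)"]) (simp_all add: U_simple[OF s])
qed

end

lemma strongly_measurable_cong:
  assumes v: "L2_strongly_measurable N M v"
    and eq: "\<And>t. t \<in> space N \<Longrightarrow> v' t \<in> L2 M \<and> (AE x in M. v t x = v' t x)"
  shows "L2_strongly_measurable N M v'"
proof -
  obtain s where vL: "v \<in> space N \<rightarrow> L2 M" and s: "\<And>n. L2_simple N M (s n)"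
    and lim: "AE t in N. (\<lambda>n. L2_norm M (\<lambda>x. v t x - s n t x)) \<longlonglongrightarrow> 0"
    using v unfolding L2_strongly_measurable_def by blast
  have "AE t in N. (\<lambda>n. L2_norm M (\<lambda>x. v' t x - s n t x)) \<longlonglongrightarrow> 0"
    using lim AE_space
  proof eventually_elim
    case (elim t)
    have "L2_norm M (\<lambda>x. v' t x - s n t x) = L2_norm M (\<lambda>x. v t x - s n t x)" for n
    proof (rule L2_norm_cong_AE)
      show "(\<lambda>x. v' t x - s n t x) \<in> L2 M" "(\<lambda>x. v t x - s n t x) \<in> L2 M"
        using eq[OF elim(2)] vL s[of n] elim(2) by (auto simp: L2_simple_def intro!: L2_diff)
      show "AE x in M. v' t x - s n t x = v t x - s n t x"
        using conjunct2[OF eq[OF elim(2)]] by eventually_elim simp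
    qed
    then show ?case using elim(1) by simp
  qed
  moreover have "v' \<in> space N \<rightarrow> L2 M" using eq by auto
  ultimately show ?thesis unfolding L2_strongly_measurable_def using s by blast
qed

lemma has_L2_integral_cong:
  assumes w: "has_L2_integral N M w I"
    and eq: "\<And>t. t \<in> space N \<Longrightarrow> w' t \<in> L2 M \<and> (AE x in M. w t x = w' t x)"
  shows "has_L2_integral N M w' I"
proof -
  have wm: "L2_strongly_measurable N M w" and I: "I \<in> L2 M" using w by (auto simp: has_L2_integral_def)
  obtain s where s: "\<And>n. L2_simple N M (s n)"
    and l1: "(\<lambda>n. \<integral>\<^sup>+ t. ennreal (L2_norm M (\<lambda>x. w t x - s n t x)) \<partial>N) \<longlonglongrightarrow> 0"
    and l2: "(\<lambda>n. L2_norm M (\<lambda>x. L2_simple_integral N (s n) x - I x)) \<longlonglongrightarrow> 0"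
    using w by (auto simp: has_L2_integral_def)
  have "(\<integral>\<^sup>+ t. ennreal (L2_norm M (\<lambda>x. w' t x - s n t x)) \<partial>N) =
    (\<integral>\<^sup>+ t. ennreal (L2_norm M (\<lambda>x. w t x - s n t x)) \<partial>N)" for n
  proof (rule nn_integral_cong)
    fix t assume t: "t \<in> space N"
    have "L2_norm M (\<lambda>x. w' t x - s n t x) = L2_norm M (\<lambda>x. w t x - s n t x)"
    proof (rule L2_norm_cong_AE)
      show "(\<lambda>x. w' t x - s n t x) \<in> L2 M" "(\<lambda>x. w t x - s n t x) \<in> L2 M"
        using eq[OF t] wm s[of n] t by (auto simp: L2_strongly_measurable_def L2_simple_def intro!: L2_diff)
      show "AE x in M. w' t x - s n t x = w t x - s n t x"
        using conjunct2[OF eq[OF t]] by eventually_elim simp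
    qed
    then show "ennreal (L2_norm M (\<lambda>x. w' t x - s n t x)) = ennreal (L2_norm M (\<lambda>x. w t x - s n t x))" by simp
  qed
  then show ?thesis
    unfolding has_L2_integral_def using strongly_measurable_cong[OF wm eq] I
    by (intro conjI exI[of _ s]) (simp_all add: s l1 l2)
qed

text \<open>Almost everywhere the norm is the limit of the norms of the simple approximants.
  Completeness of Lebesgue measure removes the exceptional null set, which is why the function is
  extended by 0 to the whole line.\<close>

lemma strongly_measurable_norm:
  fixes S :: "real set"
  assumes S: "S \<in> sets lebesgue" and v: "L2_strongly_measurable (lebesgue_on S) M v"
  shows "(\<lambda>t. L2_norm M (v t)) \<in> borel_measurable (lebesgue_on S)"
proof -
  let ?N = "lebesgue_on S"
  obtain s where vL: "v \<in> space ?N \<rightarrow> L2 M" and s: "\<And>n. L2_simple ?N M (s n)"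
    and lim: "AE t in ?N. (\<lambda>n. L2_norm M (\<lambda>x. v t x - s n t x)) \<longlonglongrightarrow> 0"
    using v unfolding L2_strongly_measurable_def by blast
  have sm: "(\<lambda>t. L2_norm M (s n t)) \<in> borel_measurable ?N" for n
    using s[of n] unfolding L2_simple_def
    by (intro borel_measurable_simple_function simple_function_compose1[where g = "L2_norm M"]) auto
  let ?g = "\<lambda>t. lim (\<lambda>n. L2_norm M (s n t))"
  have gm: "?g \<in> borel_measurable ?N" using sm by (rule borel_measurable_lim_metric)
  have AE: "AE t in ?N. ?g t = L2_norm M (v t)"
    using lim AE_space
  proof eventually_elim
    case (elim t)
    have L: "v t \<in> L2 M" "s n t \<in> L2 M" for n using vL s[of n] elim(2) by (auto simp: L2_simple_def)
    have "(\<lambda>n. L2_norm M (s n t)) \<longlonglongrightarrow> L2_norm M (v t)"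
    proof (rule LIM_zero_cancel, rule Lim_null_comparison[OF _ elim(1)])
      have "\<bar>L2_norm M (s n t) - L2_norm M (v t)\<bar> \<le> L2_norm M (\<lambda>x. v t x - s n t x)" for n
        using L2.nrm_le_add_diff[OF L(1) L(2)[of n]] L2.nrm_le_add_diff[OF L(2)[of n] L(1)]
          L2.nrm_commute[OF L(1) L(2)[of n]] by (simp add: L2_nrm fun_diff_def)
      then show "\<forall>\<^sub>F n in sequentially. norm (L2_norm M (s n t) - L2_norm M (v t)) \<le> L2_norm M (\<lambda>x. v t x - s n t x)"
        by simp
    qed
    then show ?case by (rule limI)
  qed
  have "(\<lambda>t. if t \<in> S then ?g t else 0) \<in> borel_measurable lebesgue"
    using gm unfolding borel_measurable_if[OF S] .
  moreover have "AE t in lebesgue. (if t \<in> S then ?g t else 0) = (if t \<in> S then L2_norm M (v t) else 0)"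
  proof -
    have "AE t in lebesgue. t \<in> S \<longrightarrow> ?g t = L2_norm M (v t)"
      using AE S by (subst (asm) AE_restrict_space_iff) auto
    then show ?thesis by eventually_elim simp
  qed
  ultimately have "(\<lambda>t. if t \<in> S then L2_norm M (v t) else 0) \<in> borel_measurable lebesgue"
    by (rule borel_measurable_AE)
  then show ?thesis unfolding borel_measurable_if[OF S] .
qed

lemma (in pointwise_contraction) U_L2_L2:
  fixes S :: "real set"
  assumes S: "S \<in> sets lebesgue" and v: "v \<in> L2_L2 (lebesgue_on S) M"
  shows "(\<lambda>t. U (v t)) \<in> L2_L2 (lebesgue_on S) M'"
proof -
  have sm: "L2_strongly_measurable (lebesgue_on S) M v" and int: "integrable (lebesgue_on S) (\<lambda>t. (L2_norm M (v t))\<^sup>2)"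
    using v by (auto simp: L2_L2_def)
  note smU = U_strongly_measurable[OF sm]
  have "integrable (lebesgue_on S) (\<lambda>t. (L2_norm M' (U (v t)))\<^sup>2)"
  proof (rule Bochner_Integration.integrable_bound[OF int])
    show "(\<lambda>t. (L2_norm M' (U (v t)))\<^sup>2) \<in> borel_measurable (lebesgue_on S)"
      using strongly_measurable_norm[OF S smU] by measurable
    show "AE t in lebesgue_on S. norm ((L2_norm M' (U (v t)))\<^sup>2) \<le> norm ((L2_norm M (v t))\<^sup>2)"
    proof (rule AE_I2)
      fix t assume "t \<in> space (lebesgue_on S)"
      then have "v t \<in> L2 M" using sm by (auto simp: L2_strongly_measurable_def)
      from U_norm[OF this] show "norm ((L2_norm M' (U (v t)))\<^sup>2) \<le> norm ((L2_norm M (v t))\<^sup>2)"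
        by (simp add: power_mono)
    qed
  qed
  then show ?thesis using smU by (simp add: L2_L2_def)
qed

subsection \<open>Symmetrised sets\<close>

definition symmetrized :: "nat \<Rightarrow> point set \<Rightarrow> point set" where
  "symmetrized d A = {x \<in> Rd d. x \<in> A \<or> reflect x \<in> A}"

lemma symmetrized_sets:
  assumes d: "d \<ge> 1" and A: "A \<in> sets (lebesgue_Rd d)"
  shows "symmetrized d A \<in> sets (lebesgue_Rd d)"
proof -
  have "A \<subseteq> Rd d" using sets.sets_into_space[OF A] by simp
  then have "symmetrized d A = A \<union> (reflect -` A \<inter> space (lebesgue_Rd d))"
    by (auto simp: symmetrized_def)
  then show ?thesis using measurable_sets[OF reflect_lebesgue(1)[OF d] A] A by auto
qed

text \<open>If \<open>- a 0 \<le> x 0\<close>, the right half of the doubled box lies in the closed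
  half-space; otherwise the reflection of its left half lies in the open half-space. Either is a box
  of size \<open>a\<close>, of which \<open>S\<close> fills at least
  \<open>\<gamma> * (\<Prod>j<d. a j)\<close>, and the doubled box has twice that volume.\<close>

lemma thick_symmetrized:
  assumes d: "d \<ge> 1" and S: "thick d \<gamma> a S"
  shows "thick d (\<gamma> / 2) (\<lambda>j. if j = 0 then 2 * a 0 else a j) (symmetrized d (half_space d \<inter> S))"
proof -
  let ?M = "lebesgue_Rd d" and ?a' = "\<lambda>j. if j = 0 then 2 * a 0 else a j"
  let ?S' = "symmetrized d (half_space d \<inter> S)"
  define box where "box = (\<lambda>(x::point) a. (\<Pi>\<^sub>E j\<in>{..<d}. {x j..x j + a j}))"
  have g: "0 < \<gamma>" "\<gamma> \<le> 1" and a: "\<And>j. j < d \<Longrightarrow> 0 < a j" and Ss: "S \<in> sets ?M"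
    and le: "\<And>y. y \<in> Rd d \<Longrightarrow> \<gamma> * (\<Prod>j<d. a j) \<le> measure ?M (S \<inter> box y a)"
    using S unfolding thick_def box_def by simp_all
  have S's: "?S' \<in> sets ?M" by (rule symmetrized_sets[OF d sets.Int[OF half_space_sets[OF d] Ss]])
  have a0: "a 0 > 0" using a[of 0] d by simp
  have box_sets: "box x c \<in> sets ?M" for x c
    unfolding box_def by (rule sets_lebesgue_RdI, rule sets_PiM_I_finite) auto
  have box_fin: "emeasure ?M (box x c) < \<infinity>" for x c
  proof -
    have "box x c \<in> sets (lborel_Rd d)" unfolding box_def by (rule sets_PiM_I_finite) auto
    then have "emeasure ?M (box x c) = emeasure (lborel_Rd d) (box x c)"
      unfolding lebesgue_Rd_def by simp
    also have "\<dots> = (\<Prod>j<d. emeasure lborel {x j..x j + c j})"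
      unfolding box_def by (subst lborel_product.emeasure_PiM) auto
    also have "\<dots> = (\<Prod>j<d. ennreal (max 0 (c j)))" by (intro prod.cong refl) (simp add: emeasure_lborel_Icc_eq)
    also have "\<dots> < \<infinity>" by (subst prod_ennreal) auto
    finally show ?thesis .
  qed
  have mono: "measure ?M A \<le> measure ?M (?S' \<inter> box x ?a')" if "emeasure ?M A \<le> emeasure ?M (?S' \<inter> box x ?a')" for A x
  proof -
    have "emeasure ?M (?S' \<inter> box x ?a') \<le> emeasure ?M (box x ?a')" by (rule emeasure_mono) (auto intro: box_sets)
    then show ?thesis unfolding measure_def using box_fin[of x ?a'] that by (intro enn2real_mono) auto
  qed
  have upd: "x(0 := r) \<in> Rd d" if "x \<in> Rd d" for x r using that d by (auto simp: Rd_def PiE_iff extensional_def)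
  have boxD: "z \<in> Rd d \<and> (\<forall>j<d. y j \<le> z j \<and> z j \<le> y j + c j)" if "z \<in> box y c" for z y c
    using that by (auto simp: box_def Rd_def PiE_iff)
  have boxI: "z \<in> box y c" if "z \<in> Rd d" "\<And>j. j < d \<Longrightarrow> y j \<le> z j \<and> z j \<le> y j + c j" for z y c
    using that by (auto simp: box_def Rd_def PiE_iff)
  have "\<gamma> * (\<Prod>j<d. a j) \<le> measure ?M (?S' \<inter> box x ?a')" if x: "x \<in> Rd d" for x
  proof (cases "- a 0 \<le> x 0")
    case True
    define y where "y = x(0 := x 0 + a 0)"
    have "emeasure ?M (S \<inter> box y a) \<le> emeasure ?M (?S' \<inter> box x ?a')"
    proof (rule emeasure_mono_AE)
      show "?S' \<inter> box x ?a' \<in> sets ?M" using S's box_sets by blast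
      \<comment> \<open>The shifted box may touch the hyperplane, whose points are excluded from the
        open half-space.\<close>
      show "AE z in ?M. z \<in> S \<inter> box y a \<longrightarrow> z \<in> ?S' \<inter> box x ?a'"
        using hyperplane_null[OF d]
      proof eventually_elim
        case (elim z)
        show ?case
        proof
          assume z: "z \<in> S \<inter> box y a"
          then have zR: "z \<in> Rd d" and zj: "\<And>j. j < d \<Longrightarrow> y j \<le> z j \<and> z j \<le> y j + a j" using boxD[of z y a] by auto
          have "z 0 > 0" using zj[of 0] d True elim by (simp add: y_def)
          moreover have "z \<in> box x ?a'"
          proof (rule boxI[OF zR])
            fix j assume "j < d"
            from zj[OF this] a0 show "x j \<le> z j \<and> z j \<le> x j + ?a' j" by (auto simp: y_def split: if_splits)
          qed
          ultimately show "z \<in> ?S' \<inter> box x ?a'" using z zR by (simp add: symmetrized_def half_space_def)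
        qed
      qed
    qed
    then show ?thesis using mono le[OF upd[OF x]] unfolding y_def by (meson order_trans)
  next
    case False
    define y where "y = x(0 := - x 0 - a 0)"
    have s: "?S' \<inter> box x ?a' \<in> sets ?M" using S's box_sets by blast
    have "S \<inter> box y a \<subseteq> reflect -` (?S' \<inter> box x ?a') \<inter> space ?M"
    proof
      fix z assume z: "z \<in> S \<inter> box y a"
      then have zR: "z \<in> Rd d" and zj: "\<And>j. j < d \<Longrightarrow> y j \<le> z j \<and> z j \<le> y j + a j" using boxD[of z y a] by auto
      have rR: "reflect z \<in> Rd d" using zR d by simp
      have "z 0 > 0" using zj[of 0] d False by (simp add: y_def)
      moreover have "reflect z \<in> box x ?a'"
      proof (rule boxI[OF rR])
        fix j assume "j < d"
        from zj[OF this] a0 show "x j \<le> reflect z j \<and> reflect z j \<le> x j + ?a' j"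
          by (cases "j = 0") (auto simp: y_def)
      qed
      ultimately show "z \<in> reflect -` (?S' \<inter> box x ?a') \<inter> space ?M"
        using z zR rR by (simp add: symmetrized_def half_space_def)
    qed
    then have "emeasure ?M (S \<inter> box y a) \<le> emeasure ?M (reflect -` (?S' \<inter> box x ?a') \<inter> space ?M)"
      by (rule emeasure_mono) (rule measurable_sets[OF reflect_lebesgue(1)[OF d] s])
    also have "\<dots> = emeasure (distr ?M ?M reflect) (?S' \<inter> box x ?a')"
      by (rule emeasure_distr[OF reflect_lebesgue(1)[OF d] s, symmetric])
    also have "\<dots> = emeasure ?M (?S' \<inter> box x ?a')" by (simp only: reflect_lebesgue(2)[OF d])
    finally show ?thesis using mono le[OF upd[OF x]] unfolding y_def by (meson order_trans)
  qed
  moreover have "(\<Prod>j<d. ?a' j) = 2 * (\<Prod>j<d. a j)"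
  proof -
    have "{..<d} = insert 0 {1..<d}" using d by auto
    then show ?thesis by simp
  qed
  ultimately show ?thesis
    using g a0 a S's unfolding thick_def box_def by auto
qed

text \<open>\<open>P t\<close> acts on representatives; boundedness applied to the difference shows
  that it respects equality almost everywhere.\<close>

lemma C0_semigroup_cong:
  assumes P: "C0_semigroup M P" and t: "t \<ge> 0" and f: "f \<in> L2 M" and g: "g \<in> L2 M" and eq: "AE x in M. f x = g x"
  shows "AE x in M. P t f x = P t g x"
proof -
  let ?h = "\<lambda>x. - 1 * g x + f x"
  have h: "?h \<in> L2 M" by (intro L2_add L2_scale f g)
  obtain B where B: "\<And>f. f \<in> L2 M \<Longrightarrow> L2_norm M (P t f) \<le> B * L2_norm M f"
    using P t unfolding C0_semigroup_def by metis
  have "AE x in M. ?h x = 0" using eq by eventually_elim simp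
  then have "L2_norm M ?h = 0" using L2_norm_eq_0_iff[OF h] by simp
  then have "L2_norm M (P t ?h) \<le> 0" using B[OF h] by simp
  then have "L2_norm M (P t ?h) = 0" using L2_norm_nonneg by (rule order_antisym)
  moreover have "P t ?h \<in> L2 M" using P t h unfolding C0_semigroup_def by blast
  ultimately have "AE x in M. P t ?h x = 0" using L2_norm_eq_0_iff by blast
  moreover have "AE x in M. P t ?h x = - 1 * P t g x + P t f x"
    using P t f g unfolding C0_semigroup_def by blast
  ultimately show ?thesis by eventually_elim simp
qed

subsection \<open>Controls on the half-space\<close>

lemma L2_indicator:
  assumes A: "A \<in> sets (lebesgue_Rd d)" and f: "f \<in> L2 (leb d \<Omega>)"
  shows "(\<lambda>x. indicator A x * f x) \<in> L2 (leb d \<Omega>)"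
proof -
  have m: "(\<lambda>x. indicator A x * f x) \<in> borel_measurable (leb d \<Omega>)"
    by (intro borel_measurable_times leb_restrict borel_measurable_indicator A L2D(1)[OF f])
  moreover have "integrable (leb d \<Omega>) (\<lambda>x. (cmod (indicator A x * f x))\<^sup>2)"
    by (rule Bochner_Integration.integrable_bound[OF L2D(2)[OF f]])
      (use m in \<open>auto simp: indicator_def\<close>)
  ultimately show ?thesis by (simp add: L2_def)
qed

lemma restriction_contraction:
  assumes A: "A \<in> sets (lebesgue_Rd d)"
  shows "pointwise_contraction (leb d (Rd d)) (leb d A) (\<lambda>f. f)"
proof
  fix f assume "f \<in> L2 (leb d (Rd d))"
  then have f: "f \<in> L2 (lebesgue_Rd d)" by (simp add: leb_Rd)
  then show "f \<in> L2 (leb d A)" by (rule L2_restrict[OF _ A])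
  have "(LINT x|leb d A. (cmod (f x))\<^sup>2) = (LINT x|lebesgue_Rd d. indicator A x *\<^sub>R (cmod (f x))\<^sup>2)"
    by (rule integral_leb[OF A])
  also have "\<dots> \<le> (LINT x|lebesgue_Rd d. (cmod (f x))\<^sup>2)"
    by (rule integral_mono'[OF L2D(2)[OF f]]) (auto simp: indicator_def)
  finally show "L2_norm (leb d A) f \<le> L2_norm (leb d (Rd d)) f"
    by (simp add: L2_norm_def leb_Rd)
qed simp

lemma sym_contraction:
  assumes d: "d \<ge> 1" and s: "cmod \<sigma> = 1"
  shows "pointwise_contraction (leb d (Rd d)) (leb d (half_space d)) (sym \<sigma>)"
  by standard (simp_all add: leb_Rd sym_L2[OF d] sym_norm_le[OF d _ s] sym_linear fun_eq_iff)

text \<open>The cost integrates over the control set only. Folding the integral over the symmetrised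
  set gives at \<open>x\<close> in \<open>A\<close> both \<open>f x\<close> and
  \<open>f (reflect x)\<close>, which dominate the restriction.\<close>

lemma sym_norm_localized:
  assumes d: "d \<ge> 1" and s: "cmod \<sigma> = 1" and f: "f \<in> L2 (lebesgue_Rd d)"
    and A: "A \<in> sets (lebesgue_Rd d)" "A \<subseteq> half_space d"
  shows "L2_norm (leb d A) (sym \<sigma> f) \<le> L2_norm (leb d (symmetrized d A)) f"
proof -
  let ?B = "symmetrized d A"
  have B: "?B \<in> sets (lebesgue_Rd d)" by (rule symmetrized_sets[OF d A(1)])
  define g where "g = (\<lambda>x. indicator ?B x *\<^sub>R (cmod (f x))\<^sup>2)"
  have g: "integrable (lebesgue_Rd d) g"
    unfolding g_def by (rule integrable_mult_indicator[OF B L2D(2)[OF f]])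
  have "(LINT x|leb d A. (cmod (sym \<sigma> f x))\<^sup>2) =
    (LINT x|leb d (half_space d). indicator A x *\<^sub>R (cmod (sym \<sigma> f x))\<^sup>2)"
    unfolding integral_leb[OF A(1)] integral_leb[OF half_space_sets[OF d]]
    by (rule Bochner_Integration.integral_cong[OF refl]) (use A(2) in \<open>auto simp: indicator_def\<close>)
  also have "\<dots> \<le> (LINT x|leb d (half_space d). g x + g (reflect x))"
  proof (rule integral_mono'[OF integral_fold(1)[OF d g]])
    fix x
    show "0 \<le> g x + g (reflect x)" by (simp add: g_def)
    show "indicator A x *\<^sub>R (cmod (sym \<sigma> f x))\<^sup>2 \<le> g x + g (reflect x)"
    proof (cases "x \<in> A")
      case True
      then have "x \<in> Rd d" using A(2) by (auto simp: half_space_def)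
      then have "x \<in> ?B" "reflect x \<in> ?B" using True d by (auto simp: symmetrized_def)
      then show ?thesis using cmod_sym_le[OF s, of f x] True by (simp add: g_def)
    qed (simp add: g_def)
  qed
  also have "\<dots> = (LINT x|lebesgue_Rd d. g x)" by (rule integral_fold(2)[OF d g, symmetric])
  also have "\<dots> = (LINT x|leb d ?B. (cmod (f x))\<^sup>2)" unfolding g_def by (rule integral_leb[OF B, symmetric])
  finally show ?thesis by (simp add: L2_norm_def)
qed

lemma sym_indicator:
  assumes d: "d \<ge> 1" and A: "A \<subseteq> half_space d" and x: "x \<in> half_space d"
  shows "sym \<sigma> (\<lambda>x. indicator (symmetrized d A) x * f x) x = indicator A x * sym \<sigma> f x"
proof -
  have "x \<in> Rd d" "reflect x \<in> Rd d" "reflect x \<notin> A" using A x d by (auto simp: half_space_def)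
  then have "x \<in> symmetrized d A \<longleftrightarrow> x \<in> A" "reflect x \<in> symmetrized d A \<longleftrightarrow> x \<in> A"
    by (auto simp: symmetrized_def)
  then show ?thesis by (simp add: sym_def indicator_def)
qed

lemma L2_L2_norm_sym_le:
  fixes T :: real
  assumes d: "d \<ge> 1" and s: "cmod \<sigma> = 1" and A: "A \<in> sets (lebesgue_Rd d)" "A \<subseteq> half_space d"
    and v: "v \<in> L2_L2 (lebesgue_on {0<..<T}) (leb d (Rd d))"
  shows "L2_L2_norm (lebesgue_on {0<..<T}) (leb d A) (\<lambda>t. sym \<sigma> (v t)) \<le>
    L2_L2_norm (lebesgue_on {0<..<T}) (leb d (symmetrized d A)) v"
  unfolding L2_L2_norm_def
proof (rule real_sqrt_le_mono, rule integral_mono')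
  have "{0<..<T} \<in> sets lebesgue" by simp
  from pointwise_contraction.U_L2_L2[OF restriction_contraction[OF symmetrized_sets[OF d A(1)]] this v]
  show "integrable (lebesgue_on {0<..<T}) (\<lambda>t. (L2_norm (leb d (symmetrized d A)) (v t))\<^sup>2)"
    by (simp add: L2_L2_def)
  fix t assume "t \<in> space (lebesgue_on {0<..<T})"
  then have "v t \<in> L2 (lebesgue_Rd d)"
    using v by (auto simp: L2_L2_def L2_strongly_measurable_def leb_Rd)
  from sym_norm_localized[OF d s this A]
  show "(L2_norm (leb d A) (sym \<sigma> (v t)))\<^sup>2 \<le> (L2_norm (leb d (symmetrized d A)) (v t))\<^sup>2"
    by (simp add: power_mono)
qed simp

text \<open>Applying \<open>sym\<close> to the null condition on the whole space commutes with the
  Bochner integral, the semigroups and the indicator of the symmetrised set, and takes the extended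
  initial state back to \<open>u0\<close>.\<close>

lemma sym_null_controls:
  assumes d: "d \<ge> 1" and A: "A \<in> sets (lebesgue_Rd d)" "A \<subseteq> half_space d" and T: "T > 0"
    and u0: "u0 \<in> L2 (leb d (half_space d))"
    and v: "v \<in> null_controls b d (Rd d) (symmetrized d A) T (ext d (parity b) u0)"
  shows "(\<lambda>t. sym (parity b) (v t)) \<in> null_controls b d (half_space d) A T u0"
proof -
  let ?\<sigma> = "parity b" and ?N = "lebesgue_on {0<..<T}" and ?B = "symmetrized d A"
  let ?P = "heat_semigroup b d (Rd d)" and ?Q = "heat_semigroup b d (half_space d)"
  interpret C: pointwise_contraction "leb d (Rd d)" "leb d (half_space d)" "sym ?\<sigma>"
    by (rule sym_contraction[OF d parity(2)])
  note P = domain.heat_semigroup(1)[OF domain_Rd[OF d], of b]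
  note Q = domain.heat_semigroup(1)[OF domain_half_space[OF d], of b]
  have PL: "?P t f \<in> L2 (leb d (Rd d))" if "t \<ge> 0" "f \<in> L2 (leb d (Rd d))" for t f
    using P that unfolding C0_semigroup_def by blast
  have QL: "?Q t f \<in> L2 (leb d (half_space d))" if "t \<ge> 0" "f \<in> L2 (leb d (half_space d))" for t f
    using Q that unfolding C0_semigroup_def by blast
  have B: "?B \<in> sets (lebesgue_Rd d)" by (rule symmetrized_sets[OF d A(1)])
  have TL: "{0<..<T} \<in> sets lebesgue" by simp
  have fin: "finite_measure ?N" by (rule finite_measure_lebesgue_on) simp
  obtain I where vL: "v \<in> L2_L2 ?N (leb d (Rd d))"
    and int: "has_L2_integral ?N (leb d (Rd d)) (\<lambda>s. ?P (T - s) (\<lambda>x. indicator ?B x * v s x)) I"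
    and null: "AE x in leb d (Rd d). ?P T (ext d ?\<sigma> u0) x + I x = 0"
    using v unfolding null_controls_def by blast
  have "has_L2_integral ?N (leb d (half_space d)) (\<lambda>s. ?Q (T - s) (\<lambda>x. indicator A x * sym ?\<sigma> (v s) x)) (sym ?\<sigma> I)"
  proof (rule has_L2_integral_cong[OF C.U_has_integral[OF fin int]], intro conjI)
    fix s assume s: "s \<in> space ?N"
    then have t: "T - s \<ge> 0" by simp
    have vs: "v s \<in> L2 (leb d (Rd d))" using vL s by (auto simp: L2_L2_def L2_strongly_measurable_def)
    let ?f = "\<lambda>x. indicator ?B x * v s x" and ?h = "\<lambda>x. indicator A x * sym ?\<sigma> (v s) x"
    have f: "?f \<in> L2 (leb d (Rd d))" by (rule L2_indicator[OF B vs])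
    have h: "?h \<in> L2 (leb d (half_space d))" by (rule L2_indicator[OF A(1) C.U_L2[OF vs]])
    show "?Q (T - s) ?h \<in> L2 (leb d (half_space d))" by (rule QL[OF t h])
    have "AE x in leb d (half_space d). sym ?\<sigma> ?f x = ?h x"
      by (rule AE_I2) (rule sym_indicator[OF d A(2) space_leb_half[OF d]])
    from C0_semigroup_cong[OF Q t C.U_L2[OF f] h this]
    show "AE x in leb d (half_space d). sym ?\<sigma> (?P (T - s) ?f) x = ?Q (T - s) ?h x"
      using sym_heat_semigroup[OF d f t, of b] by eventually_elim simp
  qed
  moreover have "AE x in leb d (half_space d). ?Q T u0 x + sym ?\<sigma> I x = 0"
  proof -
    let ?U = "ext d ?\<sigma> u0"
    have U: "?U \<in> L2 (leb d (Rd d))" using ext_L2[OF d u0] by (simp add: leb_Rd)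
    have T0: "T \<ge> 0" using T by simp
    have I: "I \<in> L2 (leb d (Rd d))" using int by (simp add: has_L2_integral_def)
    \<comment> \<open>The factor 1 puts the sum into the shape of \<open>U_lincomb\<close>.\<close>
    let ?w = "\<lambda>x. 1 * ?P T ?U x + I x"
    have w: "?w \<in> L2 (leb d (Rd d))" by (intro L2_add L2_scale PL T0 U I)
    have "AE x in leb d (Rd d). ?w x = 0" using null by simp
    then have "L2_norm (leb d (Rd d)) ?w = 0" using L2_norm_eq_0_iff[OF w] by blast
    then have "L2_norm (leb d (half_space d)) (sym ?\<sigma> ?w) \<le> 0" using C.U_norm[OF w] by simp
    then have "L2_norm (leb d (half_space d)) (sym ?\<sigma> ?w) = 0" using L2_norm_nonneg by (rule order_antisym)
    then have "AE x in leb d (half_space d). sym ?\<sigma> ?w x = 0" using L2_norm_eq_0_iff[OF C.U_L2[OF w]] by blast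
    moreover have "AE x in leb d (half_space d). sym ?\<sigma> ?U x = u0 x"
      by (rule AE_I2) (rule sym_ext[OF space_leb_half[OF d] d parity(1)])
    from C0_semigroup_cong[OF Q T0 C.U_L2[OF U] u0 this]
    have "AE x in leb d (half_space d). ?Q T (sym ?\<sigma> ?U) x = ?Q T u0 x" .
    ultimately show ?thesis
      using sym_heat_semigroup[OF d U T0, of b] unfolding C.U_lincomb by eventually_elim simp
  qed
  ultimately show ?thesis unfolding null_controls_def using C.U_L2_L2[OF TL vL] by blast
qed

theorem proposition2p4:
  fixes K \<gamma> T :: real and d :: nat and a :: "nat \<Rightarrow> real"
    and b :: boundary_condition and \<Omega> \<omega> S :: "point set"
  assumes "universal_cost_constant K"
    and "d \<ge> 1"
    and "\<Omega> = half_space d"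
    and "thick d \<gamma> a S"
    and "\<omega> = \<Omega> \<inter> S"
    and "T > 0"
  shows "null_controllable b d \<Omega> \<omega> T \<and>
    control_cost b d \<Omega> \<omega> T \<le>
      ennreal (1 / sqrt T * (2 * K ^ d / \<gamma>) powr (K * real d / 2) *
        exp (K * (2 * a 0 + (\<Sum>j=1..<d. a j))\<^sup>2 * (ln (2 * K ^ d / \<gamma>))\<^sup>2 / (2 * T)))"
proof -
  note d = \<open>d \<ge> 1\<close> and T = \<open>T > 0\<close>
  let ?\<sigma> = "parity b" and ?N = "lebesgue_on {0<..<T}" and ?B = "symmetrized d \<omega>"
  let ?a = "\<lambda>j. if j = 0 then 2 * a 0 else a j"
  let ?C = "ennreal (1 / sqrt T * (2 * K ^ d / \<gamma>) powr (K * real d / 2) *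
        exp (K * (2 * a 0 + (\<Sum>j=1..<d. a j))\<^sup>2 * (ln (2 * K ^ d / \<gamma>))\<^sup>2 / (2 * T)))"
  have "S \<in> sets (lebesgue_Rd d)" using assms(4) by (simp add: thick_def)
  then have A: "\<omega> \<in> sets (lebesgue_Rd d)" "\<omega> \<subseteq> half_space d"
    using assms(3,5) half_space_sets[OF d] by auto
  have thick: "thick d (\<gamma> / 2) ?a ?B"
    using thick_symmetrized[OF d assms(4)] assms(3,5) by simp
  \<comment> \<open>The property of \<open>K\<close> is used with the side length 1 and the domain
    \<open>Rd d\<close>. Since that is not the cube, the restriction on \<open>a\<close> relative to
    the side length is vacuous.\<close>
  have "restrict (\<lambda>_. 0) {..<d} \<in> Rd d" by (simp add: Rd_def)
  moreover have "restrict (\<lambda>_. 0) {..<d} \<notin> open_cube d 1" using d by (auto simp: open_cube_def PiE_iff intro!: exI[of _ 0])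
  ultimately have "Rd d \<noteq> open_cube d 1" by blast
  moreover have "Rd d \<inter> ?B = ?B" by (auto simp: symmetrized_def)
  moreover have "(\<Sum>j<d. ?a j) = 2 * a 0 + (\<Sum>j=1..<d. a j)"
  proof -
    have "{..<d} = insert 0 {1..<d}" using d by auto
    then show ?thesis by simp
  qed
  moreover have "K ^ d / (\<gamma> / 2) = 2 * K ^ d / \<gamma>" by simp
  moreover have "null_controllable b d (Rd d) (Rd d \<inter> ?B) T \<and>
    control_cost b d (Rd d) (Rd d \<inter> ?B) T \<le>
      ennreal (1 / sqrt T * (K ^ d / (\<gamma> / 2)) powr (K * real d / 2) *
        exp (K * (\<Sum>j<d. ?a j)\<^sup>2 * (ln (K ^ d / (\<gamma> / 2)))\<^sup>2 / (2 * T)))"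
    if "Rd d \<noteq> open_cube d 1"
    using assms(1)[unfolded universal_cost_constant_def, THEN conjunct2, rule_format, OF d zero_less_one insertI1 thick _ T, of b]
      that by blast
  ultimately have ctrl: "null_controllable b d (Rd d) ?B T" and cost: "control_cost b d (Rd d) ?B T \<le> ?C"
    by (simp_all add: mult.commute)
  have extL: "ext d ?\<sigma> u0 \<in> L2 (leb d (Rd d))" if "u0 \<in> L2 (leb d (half_space d))" for u0
    using ext_L2[OF d that] by (simp add: leb_Rd)
  have "null_controllable b d \<Omega> \<omega> T"
    unfolding null_controllable_def assms(3)
  proof
    fix u0 assume u0: "u0 \<in> L2 (leb d (half_space d))"
    obtain v where "v \<in> null_controls b d (Rd d) ?B T (ext d ?\<sigma> u0)"
      using ctrl extL[OF u0] unfolding null_controllable_def by blast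
    from sym_null_controls[OF d A T u0 this]
    show "null_controls b d (half_space d) \<omega> T u0 \<noteq> {}" by blast
  qed
  moreover have "control_cost b d \<Omega> \<omega> T \<le> ?C"
    unfolding control_cost_def assms(3)
  proof (rule SUP_least)
    fix u0 assume "u0 \<in> {u0 \<in> L2 (leb d (half_space d)). L2_norm (leb d (half_space d)) u0 = 1}"
    then have u0: "u0 \<in> L2 (leb d (half_space d))" and n: "L2_norm (leb d (half_space d)) u0 = 1" by auto
    have n': "L2_norm (leb d (Rd d)) (ext d ?\<sigma> u0) = 1" using ext_norm[OF d u0 parity(2)] n by (simp add: leb_Rd)
    \<comment> \<open>Every control on the whole space is mapped to one on the half-space of no
      larger cost, so the infimum can only drop.\<close>
    have "(INF v\<in>null_controls b d (half_space d) \<omega> T u0. ennreal (L2_L2_norm ?N (leb d \<omega>) v)) \<le>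
      (INF v\<in>null_controls b d (Rd d) ?B T (ext d ?\<sigma> u0). ennreal (L2_L2_norm ?N (leb d ?B) v))"
    proof (rule INF_mono)
      fix v assume v: "v \<in> null_controls b d (Rd d) ?B T (ext d ?\<sigma> u0)"
      then have vL: "v \<in> L2_L2 ?N (leb d (Rd d))" by (simp add: null_controls_def)
      show "\<exists>v'\<in>null_controls b d (half_space d) \<omega> T u0.
        ennreal (L2_L2_norm ?N (leb d \<omega>) v') \<le> ennreal (L2_L2_norm ?N (leb d ?B) v)"
        by (rule bexI[where x = "\<lambda>t. sym ?\<sigma> (v t)"])
          (rule ennreal_leI[OF L2_L2_norm_sym_le[OF d parity(2) A vL]] sym_null_controls[OF d A T u0 v])+
    qed
    also have "\<dots> \<le> control_cost b d (Rd d) ?B T"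
      unfolding control_cost_def by (rule SUP_upper) (use extL[OF u0] n' in simp)
    also note cost
    finally show "(INF v\<in>null_controls b d (half_space d) \<omega> T u0. ennreal (L2_L2_norm ?N (leb d \<omega>) v)) \<le> ?C" .
  qed
  ultimately show ?thesis ..
qed

end
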